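(* Let $\Omega\subset\mathbb{R}^n$ be open and let $L=\sum_{|\alpha|\le k}c_\alpha(x)D^\alpha$ be a linear differential operator of order $k$ with smooth complex coefficients on $\Omega$, where $D^\alpha=\left(\frac{\partial}{2\pi i\,\partial x_1}\right)^{\alpha_1}\cdots\left(\frac{\partial}{2\pi i\,\partial x_n}\right)^{\alpha_n}$. Let $p_k(x,\xi)=\sum_{|\alpha|=k}c_\alpha(x)\xi^\alpha$ be its principal symbol, and let $(x_0,\xi_0)\in\Omega\times(\mathbb{R}^n\setminus\{0\})$ be a point with $dp_k(x_0,\xi_0)=0$ (a double characteristic). Let $\mathcal{H}:=D^2p_k(x_0,\xi_0)$ be the Hessian matrix of $p_k$ with respect to $(x,\xi)\in\mathbb{R}^{2n}$, and write $\mathcal{H}=A+iB$ with $A,B\in\operatorname{Sym}(2n,\mathbb{R})$. Define $C\in\operatorname{Sym}(2n,\mathbb{R})$ by $Q_C:=\{Q_A,Q_B\}$ (canonical Poisson bracket on $\mathbb{R}^{2n}$). Assume: (a) $A,B$ form a non-dissipative pair (equivalently, there is no $\theta\in\mathbb{R}$ with $\operatorname{Re}(e^{i\theta}Q_{\mathcal{H}})\ge 0$); (b) $A$, $B$, $C$ are linearly independent over $\mathbb{R}$; (c) either (i) $\operatorname{minrank}\{A,B\}\ge 3$ and $\operatorname{maxrank}\{A,B\}\ge 17$, or (ii) $\operatorname{minrank}\{A,B\}=2$, $\operatorname{maxrank}\{A,B\}\ge 9$, and $\ker A\cap\ker B$ is either $\{0\}$ or a symplectic subspace of $\mathbb{R}^{2n}$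 with respect to the canonical symplectic form $\sigma$. Then $L$ is not locally solvable at $x_0$.
   Context: For a real symmetric matrix $M$, $Q_M(z):={}^tzMz$; for complex symmetric $\mathcal{H}$, $Q_{\mathcal{H}}(z)={}^tz\mathcal{H}z$. On $\mathbb{R}^{2n}$ with coordinates $(x,\xi)$ the canonical symplectic form is $\sigma=\sum_j d\xi_j\wedge dx_j$ and the Poisson bracket is $\{a,b\}=\sum_{j=1}^n\left(\frac{\partial a}{\partial\xi_j}\frac{\partial b}{\partial x_j}-\frac{\partial a}{\partial x_j}\frac{\partial b}{\partial\xi_j}\right)$; the bracket of two quadratic forms is again a quadratic form. $A,B\in\operatorname{Sym}(m,\mathbb{R})$ form a non-dissipative pair if $0$ is the only positive semidefinite element of $\operatorname{span}_{\mathbb{R}}\{A,B\}$. $\operatorname{maxrank}\{A,B\}:=\max\{\operatorname{rank}F: F\in\operatorname{span}_{\mathbb{R}}\{A,B\}\}$ and $\operatorname{minrank}\{A,B\}:=\min\{\operatorname{rank}F: F\in\operatorname{span}_{\mathbb{R}}\{A,B\}, F\ne0\}$. $L$ is locally solvable at $x_0$ if there is an open neighborhood $U$ of $x_0$ such that for every $f\in C_0^\infty(U)$ the equation $Lu=f$ has a distributional solution $u\in\mathcal{D}'(U)$. *)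

theory Defs
  imports "HOL-Analysis.Analysis"
begin

definition partial :: "'n::finite \<Rightarrow> (real^'n \<Rightarrow> 'b::real_normed_vector) \<Rightarrow> real^'n \<Rightarrow> 'b" where
  "partial i f x = vector_derivative (\<lambda>t. f (x + t *\<^sub>R axis i 1)) (at 0)"

definition has_partial :: "'n::finite \<Rightarrow> (real^'n \<Rightarrow> 'b::real_normed_vector) \<Rightarrow> real^'n \<Rightarrow> bool" where
  "has_partial i f x \<longleftrightarrow> (\<lambda>t. f (x + t *\<^sub>R axis i 1)) differentiable (at 0)"

fun partials :: "'n::finite list \<Rightarrow> (real^'n \<Rightarrow> 'b::real_normed_vector) \<Rightarrow> real^'n \<Rightarrow> 'b" where
  "partials [] f = f"
| "partials (i # is) f = partial i (partials is f)"

definition smooth_on :: "(real^'n::finite) set \<Rightarrow> (real^'n \<Rightarrow> 'b::real_normed_vector) \<Rightarrow> bool" where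
  "smooth_on U f \<longleftrightarrow>
     (\<forall>is. continuous_on U (partials is f) \<and> (\<forall>i. \<forall>x\<in>U. has_partial i (partials is f) x))"

definition mi_abs :: "('n::finite \<Rightarrow> nat) \<Rightarrow> nat" where
  "mi_abs \<alpha> = (\<Sum>i\<in>UNIV. \<alpha> i)"

definition mi_list :: "('n::finite \<Rightarrow> nat) \<Rightarrow> 'n list" where
  "mi_list \<alpha> = (SOME xs. \<forall>i. count_list xs i = \<alpha> i)"

text \<open>partial^alpha (order of differentiation irrelevant for smooth functions).\<close>
definition dpart :: "('n::finite \<Rightarrow> nat) \<Rightarrow> (real^'n \<Rightarrow> 'b::real_normed_vector) \<Rightarrow> real^'n \<Rightarrow> 'b" where
  "dpart \<alpha> f = partials (mi_list \<alpha>) f"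

definition Dop :: "('n::finite \<Rightarrow> nat) \<Rightarrow> (real^'n \<Rightarrow> complex) \<Rightarrow> real^'n \<Rightarrow> complex" where
  "Dop \<alpha> f x = (1 / (2 * of_real pi * \<i>)) ^ mi_abs \<alpha> * dpart \<alpha> f x"

definition mono_pow :: "real^'n::finite \<Rightarrow> ('n \<Rightarrow> nat) \<Rightarrow> complex" where
  "mono_pow \<xi> \<alpha> = (\<Prod>i\<in>UNIV. complex_of_real (\<xi>$i) ^ \<alpha> i)"

definition tsupport :: "(real^'n::finite \<Rightarrow> complex) \<Rightarrow> (real^'n) set" where
  "tsupport \<phi> = closure {x. \<phi> x \<noteq> 0}"

definition test_fun :: "(real^'n::finite) set \<Rightarrow> (real^'n \<Rightarrow> complex) \<Rightarrow> bool" where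
  "test_fun U \<phi> \<longleftrightarrow> smooth_on UNIV \<phi> \<and> compact (tsupport \<phi>) \<and> tsupport \<phi> \<subseteq> U"

definition distribution :: "(real^'n::finite) set \<Rightarrow> ((real^'n \<Rightarrow> complex) \<Rightarrow> complex) \<Rightarrow> bool" where
  "distribution U u \<longleftrightarrow>
     (\<forall>\<phi> \<psi> a b. test_fun U \<phi> \<longrightarrow> test_fun U \<psi> \<longrightarrow>
         u (\<lambda>x. a * \<phi> x + b * \<psi> x) = a * u \<phi> + b * u \<psi>) \<and>
     (\<forall>K. compact K \<and> K \<subseteq> U \<longrightarrow>
        (\<exists>C N. \<forall>\<phi>. test_fun U \<phi> \<and> tsupport \<phi> \<subseteq> K \<longrightarrow>
           norm (u \<phi>) \<le> C * (\<Sum>\<alpha>\<in>{\<alpha>::'n\<Rightarrow>nat. mi_abs \<alpha> \<le> N}.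
                                 Sup ((\<lambda>x. norm (dpart \<alpha> \<phi> x)) ` UNIV))))"

definition transpose_op :: "nat \<Rightarrow> (('n::finite \<Rightarrow> nat) \<Rightarrow> real^'n \<Rightarrow> complex)
      \<Rightarrow> (real^'n \<Rightarrow> complex) \<Rightarrow> real^'n \<Rightarrow> complex" where
  "transpose_op k c \<phi> x =
     (\<Sum>\<alpha>\<in>{\<alpha>. mi_abs \<alpha> \<le> k}. (-1) ^ mi_abs \<alpha> * Dop \<alpha> (\<lambda>y. c \<alpha> y * \<phi> y) x)"

text \<open>L u = f in D'(U): <u, tL phi> = integral f phi for all phi in C_0^infinity(U).\<close>
definition locally_solvable_at :: "(real^'n::finite) set \<Rightarrow> nat \<Rightarrow> (('n \<Rightarrow> nat) \<Rightarrow> real^'n \<Rightarrow> complex)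
      \<Rightarrow> real^'n \<Rightarrow> bool" where
  "locally_solvable_at \<Omega> k c x0 \<longleftrightarrow>
     (\<exists>U. open U \<and> x0 \<in> U \<and> U \<subseteq> \<Omega> \<and>
        (\<forall>f. test_fun U f \<longrightarrow>
           (\<exists>u. distribution U u \<and>
              (\<forall>\<phi>. test_fun U \<phi> \<longrightarrow>
                  u (transpose_op k c \<phi>) = integral UNIV (\<lambda>x. f x * \<phi> x)))))"

definition xpart :: "real^('n::finite + 'n) \<Rightarrow> real^'n" where
  "xpart z = (\<chi> i. z $ Inl i)"

definition xipart :: "real^('n::finite + 'n) \<Rightarrow> real^'n" where
  "xipart z = (\<chi> i. z $ Inr i)"

definition pairvec :: "real^'n::finite \<Rightarrow> real^'n \<Rightarrow> real^('n + 'n)" where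
  "pairvec x \<xi> = (\<chi> j. case j of Inl i \<Rightarrow> x $ i | Inr i \<Rightarrow> \<xi> $ i)"

definition principal_symbol :: "nat \<Rightarrow> (('n::finite \<Rightarrow> nat) \<Rightarrow> real^'n \<Rightarrow> complex)
      \<Rightarrow> real^('n + 'n) \<Rightarrow> complex" where
  "principal_symbol k c z = (\<Sum>\<alpha>\<in>{\<alpha>. mi_abs \<alpha> = k}. c \<alpha> (xpart z) * mono_pow (xipart z) \<alpha>)"

definition hessian :: "(real^'m::finite \<Rightarrow> complex) \<Rightarrow> real^'m \<Rightarrow> complex^'m^'m" where
  "hessian p z = (\<chi> a b. partial a (partial b p) z)"

definition qform :: "real^'m::finite^'m \<Rightarrow> real^'m \<Rightarrow> real" where
  "qform M z = z \<bullet> (M *v z)"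

definition poisson :: "(real^('n::finite + 'n) \<Rightarrow> real) \<Rightarrow> (real^('n + 'n) \<Rightarrow> real) \<Rightarrow> real^('n + 'n) \<Rightarrow> real" where
  "poisson a b z = (\<Sum>j\<in>UNIV. partial (Inr j) a z * partial (Inl j) b z
                            - partial (Inl j) a z * partial (Inr j) b z)"

definition symp :: "real^('n::finite + 'n) \<Rightarrow> real^('n + 'n) \<Rightarrow> real" where
  "symp u v = (\<Sum>j\<in>UNIV. u $ Inr j * v $ Inl j - v $ Inr j * u $ Inl j)"

definition symplectic_subspace :: "(real^('n::finite + 'n)) set \<Rightarrow> bool" where
  "symplectic_subspace W \<longleftrightarrow> subspace W \<and> (\<forall>w\<in>W. (\<forall>v\<in>W. symp w v = 0) \<longrightarrow> w = 0)"

definition sym_mat :: "real^'m::finite^'m \<Rightarrow> bool" where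
  "sym_mat M \<longleftrightarrow> transpose M = M"

definition psd :: "real^'m::finite^'m \<Rightarrow> bool" where
  "psd M \<longleftrightarrow> sym_mat M \<and> (\<forall>z. qform M z \<ge> 0)"

definition pencil :: "real^'m::finite^'m \<Rightarrow> real^'m^'m \<Rightarrow> (real^'m^'m) set" where
  "pencil A B = {s *\<^sub>R A + t *\<^sub>R B | s t. True}"

definition non_dissipative :: "real^'m::finite^'m \<Rightarrow> real^'m^'m \<Rightarrow> bool" where
  "non_dissipative A B \<longleftrightarrow> (\<forall>F\<in>pencil A B. psd F \<longrightarrow> F = 0)"

definition maxrank :: "real^'m::finite^'m \<Rightarrow> real^'m^'m \<Rightarrow> nat" where
  "maxrank A B = Max (rank ` pencil A B)"

definition minrank :: "real^'m::finite^'m \<Rightarrow> real^'m^'m \<Rightarrow> nat" where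
  "minrank A B = Min (rank ` (pencil A B - {0}))"

end

theory Submission
  imports Defs
begin

text \<open>
  Algebra: there is a common zero \<open>z\<close> of \<open>Q\<^sub>A\<close> and \<open>Q\<^sub>B\<close> at which \<open>Q\<^sub>C\<close> does not vanish. Suppose not.
  At a common zero \<open>z\<close> where \<open>A z\<close>, \<open>B z\<close> are independent, second order perturbation along the zero set gives
  a combination \<open>F = C - l A - m B\<close> that vanishes on the space where \<open>A z\<close> and \<open>B z\<close> vanish, hence has rank at most 4.
  Comparing two such points either makes \<open>l\<close>, \<open>m\<close> constant, whence \<open>F = 0\<close>, or produces a form of the pencil
  and a form \<open>C - m B\<close> with a large common kernel, on which nondissipativity forces \<open>C\<close> into the span of \<open>A\<close>, \<open>B\<close>.
  If the pencil contains a product \<open>a b\<close> of two linear forms, then either the second form is indefinite on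
  \<open>a = 0\<close> and on \<open>b = 0\<close>, so that \<open>C\<close> is a multiple of it on both hyperplanes and again in the span, or the Hamilton
  vector of \<open>a\<close> or \<open>b\<close> yields a positive semidefinite form in the pencil or lies in the radical of \<open>ker A \<inter> ker B\<close>.

  Analysis: blowing up at the double characteristic, Brouwer's theorem turns \<open>z\<close> into a true zero of \<open>p\<close>, arbitrarily
  close to \<open>(x0, \<xi>0)\<close>, with \<open>{Re p, Im p} \<noteq> 0\<close>. Hoermander's necessary condition excludes solvability: a quadratic
  phase with \<open>Re \<phi> \<le> - c |x - y|\<^sup>2\<close> gives functions \<open>exp (\<rho>\<^sup>2 \<phi>) v\<close> that the transpose of \<open>L\<close> makes small
  to any order in \<open>\<rho>\<close>, and a gliding hump builds a right hand side \<open>f\<close> that pairs with infinitely many of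
  them too strongly for any distribution \<open>u\<close> with \<open>L u = f\<close>.
\<close>

section \<open>Smooth functions\<close>

text \<open>The coefficients are only smooth and the phase is complex, so the eikonal equation is
  solved only to first order at \<open>y\<close>. On the Gaussian scale this is enough:
  \<open>x - y\<close> counts as \<open>1/\<rho>\<close>, so a quadratic error in the symbol gains
  two orders, while the transport term sits only one order below the leading term. For the same
  reason the transport field may be frozen at \<open>y\<close>. Its constant coefficients are
  complex, so there are no real integral curves to integrate along; on polynomials, however, the
  field is nilpotent and can be inverted explicitly. This is why every family is carried together
  with polynomial approximations. The frequency is \<open>\<rho>\<^sup>2\<close> rather than
  \<open>\<rho>\<close> so that derivatives and factors \<open>x - y\<close> have integer weights.
  The algebra rests on one estimate: a form that vanishes on a subspace of codimension
  \<open>k\<close> has rank at most \<open>2 * k\<close>. Tangent spaces have codimension 2, whence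
  the rank 4; two kernels of codimension 4 meet in codimension 8, whence the bound 17 = 2 * 8 +
  1.\<close>

lemma has_vector_derivative_partial:
  assumes "has_partial i f x"
  shows "((\<lambda>t. f (x + t *\<^sub>R axis i 1)) has_vector_derivative partial i f x) (at 0)"
  using assms unfolding has_partial_def partial_def by (simp add: vector_derivative_works)

lemma partialI:
  assumes "((\<lambda>t. f (x + t *\<^sub>R axis i 1)) has_vector_derivative d) (at 0)"
  shows "has_partial i f x" "partial i f x = d"
  using assms unfolding has_partial_def partial_def
  by (auto simp: differentiableI_vector vector_derivative_at)

lemma has_vector_derivative_line:
  assumes "has_partial i f (x + t *\<^sub>R axis i 1)"
  shows "((\<lambda>t. f (x + t *\<^sub>R axis i 1)) has_vector_derivative partial i f (x + t *\<^sub>R axis i 1)) (at t within S)"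
proof -
  have "((\<lambda>s. f (x + t *\<^sub>R axis i 1 + s *\<^sub>R axis i 1)) has_vector_derivative
     partial i f (x + t *\<^sub>R axis i 1)) (at 0)"
    using has_vector_derivative_partial[OF assms] .
  then have "((\<lambda>s. f (x + (t + s) *\<^sub>R axis i 1)) has_vector_derivative
     partial i f (x + t *\<^sub>R axis i 1)) (at 0)"
    by (simp add: algebra_simps)
  then have "(((\<lambda>u. f (x + u *\<^sub>R axis i 1)) \<circ> (\<lambda>s. t + s)) has_vector_derivative
     partial i f (x + t *\<^sub>R axis i 1)) (at 0)"
    by (simp add: o_def)
  then have "((\<lambda>u. f (x + u *\<^sub>R axis i 1)) has_vector_derivative
     partial i f (x + t *\<^sub>R axis i 1)) (at t)"
    unfolding has_vector_derivative_def has_derivative_at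
    by (simp add: o_def add_ac)
  then show ?thesis by (rule has_vector_derivative_at_within)
qed

lemma partial_cong:
  assumes "open U" "x \<in> U" "\<And>y. y \<in> U \<Longrightarrow> f y = g y"
  shows "partial i f x = partial i g x" "has_partial i f x \<longleftrightarrow> has_partial i g x"
proof -
  have lim: "((\<lambda>t. x + t *\<^sub>R axis i 1) \<longlongrightarrow> x + 0 *\<^sub>R axis i (1::real)) (nhds 0)"
    by (intro tendsto_intros filterlim_ident)
  have "\<forall>\<^sub>F t in nhds 0. x + t *\<^sub>R axis i 1 \<in> U"
    by (rule topological_tendstoD[OF lim]) (use assms in auto)
  then have ev: "\<forall>\<^sub>F t in nhds 0. f (x + t *\<^sub>R axis i 1) = g (x + t *\<^sub>R axis i 1)"
    by (rule eventually_mono) (use assms in auto)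
  have *: "((\<lambda>t. f (x + t *\<^sub>R axis i 1)) has_vector_derivative d) (at 0) \<longleftrightarrow>
    ((\<lambda>t. g (x + t *\<^sub>R axis i 1)) has_vector_derivative d) (at 0)" for d
    by (rule has_vector_derivative_cong_ev) (use ev eventually_nhds_x_imp_x[OF ev] in \<open>auto elim: eventually_mono\<close>)
  show "partial i f x = partial i g x"
    unfolding partial_def vector_derivative_def using * by auto
  show "has_partial i f x \<longleftrightarrow> has_partial i g x"
    using * partialI(1) has_vector_derivative_partial by metis
qed

lemma partials_append: "partials (is @ js) f = partials is (partials js f)"
  by (induction "is") auto

lemma partials_cong:
  assumes "open U" "\<And>y. y \<in> U \<Longrightarrow> f y = g y"
  shows "x \<in> U \<Longrightarrow> partials is f x = partials is g x"
proof (induction "is" arbitrary: x)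
  case (Cons i "is")
  then show ?case using partial_cong(1)[OF assms(1) Cons.prems, of "partials is f" "partials is g"] by simp
qed (use assms in auto)

text \<open>\<open>smooth_on\<close> speaks of all iterated partials at once, which does not suit
  induction. Here the derivative applied first is split off, so closure under products, inverses and
  \<open>exp\<close> follows by induction on the order with \<open>f\<close> generalized.\<close>

fun ck :: "(real^'n::finite) set \<Rightarrow> nat \<Rightarrow> (real^'n \<Rightarrow> 'b::real_normed_vector) \<Rightarrow> bool" where
  "ck U 0 f = continuous_on U f"
| "ck U (Suc n) f = (continuous_on U f \<and> (\<forall>i. \<forall>x\<in>U. has_partial i f x) \<and> (\<forall>i. ck U n (partial i f)))"

lemma ck_continuous: "ck U n f \<Longrightarrow> continuous_on U f"
  by (cases n) auto

lemma ck_Suc_le: "ck U (Suc n) f \<Longrightarrow> ck U n f"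
  by (induction n arbitrary: f) (auto simp: ck_continuous)

lemma smooth_on_partial: "smooth_on U f \<Longrightarrow> smooth_on U (partial i f)"
  unfolding smooth_on_def
proof (intro allI)
  fix "is" assume "\<forall>is. continuous_on U (partials is f) \<and> (\<forall>i. \<forall>x\<in>U. has_partial i (partials is f) x)"
  then show "continuous_on U (partials is (partial i f)) \<and> (\<forall>ia. \<forall>x\<in>U. has_partial ia (partials is (partial i f)) x)"
    by (metis partials_append partials.simps)
qed

lemma smooth_on_partials: "smooth_on U f \<Longrightarrow> smooth_on U (partials is f)"
  by (induction "is" arbitrary: f) (auto simp: smooth_on_partial)

lemma smooth_on_continuous: "smooth_on U f \<Longrightarrow> continuous_on U f"
  unfolding smooth_on_def by (metis partials.simps(1))

lemma smooth_on_has_partial: "smooth_on U f \<Longrightarrow> x \<in> U \<Longrightarrow> has_partial i f x"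
  unfolding smooth_on_def by (metis partials.simps(1))

lemma smooth_on_ck_iff: "smooth_on U f \<longleftrightarrow> (\<forall>n. ck U n f)"
proof
  assume "smooth_on U f"
  then have "ck U n f" for n
    by (induction n arbitrary: f)
       (auto simp: smooth_on_continuous smooth_on_has_partial smooth_on_partial)
  then show "\<forall>n. ck U n f" by blast
next
  assume a: "\<forall>n. ck U n f"
  have "ck U (Suc (length is)) f \<Longrightarrow> continuous_on U (partials is f) \<and> (\<forall>i. \<forall>x\<in>U. has_partial i (partials is f) x)"
    for "is" and f :: "real^'a \<Rightarrow> 'b"
  \<comment> \<open>\<open>ck\<close> strips the derivative applied first, which is the last entry
    of the list; hence the induction from the right.\<close>
  proof (induction "is" arbitrary: f rule: rev_induct)
    case (snoc j js)
    then have "ck U (Suc (length js)) (partial j f)" by simp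
    from snoc.IH[OF this] show ?case by (simp add: partials_append)
  qed auto
  with a show "smooth_on U f" unfolding smooth_on_def by blast
qed

lemma ck_cong:
  assumes "open U" "\<And>y. y \<in> U \<Longrightarrow> f y = g y" "ck U n f"
  shows "ck U n g"
  using assms(2,3)
proof (induction n arbitrary: f g)
  case 0
  then show ?case by (simp cong: continuous_on_cong)
next
  case (Suc n)
  have "continuous_on U g" using Suc.prems by (simp cong: continuous_on_cong)
  moreover have "has_partial i g x" if "x \<in> U" for i x
    using Suc.prems partial_cong(2)[OF assms(1) that, of f g] that by auto
  moreover have "ck U n (partial i g)" for i
    by (rule Suc.IH[of "partial i f"]) (use Suc.prems partial_cong(1)[OF assms(1) _ Suc.prems(1)] in auto)
  ultimately show ?case by simp
qed

lemma ck_Un: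
  assumes "open U" "open V" "ck U n f" "ck V n f"
  shows "ck (U \<union> V) n f"
  using assms(3,4)
  by (induction n arbitrary: f) (auto intro: continuous_on_open_Un assms)

lemma ck_subset: "ck U n f \<Longrightarrow> V \<subseteq> U \<Longrightarrow> ck V n f"
  by (induction n arbitrary: f) (auto intro: continuous_on_subset)

lemma partial_const: "partial i (\<lambda>x. a) x = 0" "has_partial i (\<lambda>x. a) x"
  by (intro partialI(2)[OF has_vector_derivative_const[where c=a]] partialI(1)[OF has_vector_derivative_const[where c=a]])+

lemma ck_const: "ck U n (\<lambda>x. a)"
proof (induction n arbitrary: a)
  case (Suc n)
  have "partial i (\<lambda>x::real^'a. a) = (\<lambda>x. 0)" for i by (rule ext) (rule partial_const)
  with Suc show ?case by (simp add: partial_const)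
qed simp

lemma partial_add:
  assumes "has_partial i f x" "has_partial i g x"
  shows "partial i (\<lambda>x. f x + g x) x = partial i f x + partial i g x"
    "has_partial i (\<lambda>x. f x + g x) x"
  by (rule partialI, rule has_vector_derivative_add; rule has_vector_derivative_partial; rule assms)+

lemma ck_add:
  assumes "open U"
  shows "ck U n f \<Longrightarrow> ck U n g \<Longrightarrow> ck U n (\<lambda>x. f x + g x)"
proof (induction n arbitrary: f g)
  case (Suc n)
  have "ck U n (partial i (\<lambda>x. f x + g x))" for i
    by (rule ck_cong[OF assms, of "\<lambda>x. partial i f x + partial i g x"])
      (use Suc in \<open>auto simp: partial_add\<close>)
  with Suc show ?case by (auto simp: partial_add intro: continuous_intros)
qed (auto intro: continuous_intros)

lemma partial_bounded_linear:
  assumes "bounded_linear h" "has_partial i f x"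
  shows "partial i (\<lambda>x. h (f x)) x = h (partial i f x)"
    "has_partial i (\<lambda>x. h (f x)) x"
  by (rule partialI, rule bounded_linear.has_vector_derivative[OF assms(1)],
     rule has_vector_derivative_partial, rule assms)+

lemma ck_bounded_linear:
  assumes "open U" "bounded_linear h"
  shows "ck U n f \<Longrightarrow> ck U n (\<lambda>x. h (f x))"
proof (induction n arbitrary: f)
  case 0
  then show ?case by (auto intro: bounded_linear.continuous_on[OF assms(2)])
next
  case (Suc n)
  have "ck U n (partial i (\<lambda>x. h (f x)))" for i
    by (rule ck_cong[OF assms(1), of "\<lambda>x. h (partial i f x)"])
      (use Suc in \<open>auto simp: partial_bounded_linear[OF assms(2)]\<close>)
  with Suc show ?case
    by (auto simp: partial_bounded_linear[OF assms(2)] intro: bounded_linear.continuous_on[OF assms(2)])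
qed

lemma partial_mult:
  fixes f g :: "real^'n::finite \<Rightarrow> 'b::real_normed_algebra"
  assumes "has_partial i f x" "has_partial i g x"
  shows "partial i (\<lambda>x. f x * g x) x = f x * partial i g x + partial i f x * g x"
    "has_partial i (\<lambda>x. f x * g x) x"
  using has_vector_derivative_mult[OF has_vector_derivative_partial[OF assms(1)]
     has_vector_derivative_partial[OF assms(2)]]
  by (auto dest: partialI)

lemma ck_mult:
  fixes f g :: "real^'n::finite \<Rightarrow> 'b::real_normed_algebra"
  assumes "open U"
  shows "ck U n f \<Longrightarrow> ck U n g \<Longrightarrow> ck U n (\<lambda>x. f x * g x)"
proof (induction n arbitrary: f g)
  case (Suc n)
  have "ck U n f" "ck U n g" using Suc.prems(1,2)[THEN ck_Suc_le] .
  then have "ck U n (\<lambda>x. f x * partial i g x + partial i f x * g x)" for i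
    using Suc.prems by (auto intro!: ck_add assms Suc.IH)
  then have "ck U n (partial i (\<lambda>x. f x * g x))" for i
    by (rule ck_cong[OF assms, rotated]) (use Suc.prems in \<open>auto simp: partial_mult\<close>)
  with Suc show ?case by (auto simp: partial_mult intro: continuous_intros)
qed (auto intro: continuous_intros)

lemma partial_inverse:
  fixes f :: "real^'n::finite \<Rightarrow> real"
  assumes "has_partial i f x" "f x \<noteq> 0"
  shows "partial i (\<lambda>x. inverse (f x)) x = - (inverse (f x) * partial i f x * inverse (f x))"
    "has_partial i (\<lambda>x. inverse (f x)) x"
proof -
  have "((\<lambda>t. f (x + t *\<^sub>R axis i 1)) has_real_derivative partial i f x) (at 0)"
    using has_vector_derivative_partial[OF assms(1)]
    by (simp add: has_real_derivative_iff_has_vector_derivative)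
  from DERIV_inverse'[OF this] assms(2)
  have "((\<lambda>t. inverse (f (x + t *\<^sub>R axis i 1))) has_vector_derivative
     - (inverse (f x) * partial i f x * inverse (f x))) (at 0)"
    by (simp add: has_real_derivative_iff_has_vector_derivative)
  from partialI[OF this]
  show "partial i (\<lambda>x. inverse (f x)) x = - (inverse (f x) * partial i f x * inverse (f x))"
    "has_partial i (\<lambda>x. inverse (f x)) x" by auto
qed

lemma ck_inverse:
  fixes f :: "real^'n::finite \<Rightarrow> real"
  assumes "open U" "\<And>x. x \<in> U \<Longrightarrow> f x \<noteq> 0"
  shows "ck U n f \<Longrightarrow> ck U n (\<lambda>x. inverse (f x))"
proof (induction n)
  case 0
  then show ?case using assms by (auto intro: continuous_intros)
next
  case (Suc n)
  have *: "ck U n f" using Suc.prems ck_Suc_le by blast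
  have "ck U n (\<lambda>x. - 1 * (inverse (f x) * partial i f x * inverse (f x)))" for i
    by (intro ck_mult assms ck_const Suc.IH *) (use Suc.prems in auto)
  then have "ck U n (partial i (\<lambda>x. inverse (f x)))" for i
    by (rule ck_cong[OF assms(1), rotated]) (use assms Suc.prems in \<open>auto simp: partial_inverse\<close>)
  with Suc assms show ?case by (auto simp: partial_inverse intro: continuous_intros)
qed

lemma partial_exp:
  fixes f :: "real^'n::finite \<Rightarrow> complex"
  assumes "has_partial i f x"
  shows "partial i (\<lambda>x. exp (f x)) x = partial i f x * exp (f x)"
    "has_partial i (\<lambda>x. exp (f x)) x"
proof -
  have "((exp \<circ> (\<lambda>t. f (x + t *\<^sub>R axis i 1))) has_vector_derivative partial i f x * exp (f (x + 0 *\<^sub>R axis i 1))) (at 0)"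
    by (rule field_vector_diff_chain_at[OF has_vector_derivative_partial[OF assms]]) simp
  then have "((\<lambda>t. exp (f (x + t *\<^sub>R axis i 1))) has_vector_derivative partial i f x * exp (f x)) (at 0)"
    by (simp add: o_def)
  from partialI[OF this]
  show "partial i (\<lambda>x. exp (f x)) x = partial i f x * exp (f x)"
    "has_partial i (\<lambda>x. exp (f x)) x" by auto
qed

lemma ck_exp:
  fixes f :: "real^'n::finite \<Rightarrow> complex"
  assumes "open U"
  shows "ck U n f \<Longrightarrow> ck U n (\<lambda>x. exp (f x))"
proof (induction n)
  case 0
  then show ?case using assms by (auto intro: continuous_intros)
next
  case (Suc n)
  have "ck U n f" using Suc.prems ck_Suc_le by blast
  then have "ck U n (\<lambda>x. partial i f x * exp (f x))" for i
    by (intro ck_mult assms Suc.IH) (use Suc.prems in auto)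
  then have "ck U n (partial i (\<lambda>x. exp (f x)))" for i
    by (rule ck_cong[OF assms(1), rotated]) (use assms Suc.prems in \<open>auto simp: partial_exp\<close>)
  with Suc assms show ?case by (auto simp: partial_exp intro: continuous_intros)
qed

lemma partial_coord: "partial i (\<lambda>x. x $ j) x = (if i = j then 1 else 0)"
   "has_partial i (\<lambda>x. x $ j) x"
proof -
  have "((\<lambda>t. (x + t *\<^sub>R axis i 1) $ j) has_vector_derivative (if i = j then 1 else 0)) (at 0)"
    by (auto simp: axis_def intro!: derivative_eq_intros)
  from partialI[OF this]
  show "partial i (\<lambda>x. x $ j) x = (if i = j then 1 else 0)"
   "has_partial i (\<lambda>x. x $ j) x" by auto
qed

lemma ck_coord: "ck U n (\<lambda>x. x $ j)"
proof (cases n)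
  case (Suc m)
  have "partial i (\<lambda>x::real^'a. x $ j) = (\<lambda>x. if i = j then 1 else 0)" for i
    by (rule ext) (rule partial_coord)
  then have "ck U m (partial i (\<lambda>x::real^'a. x $ j))" for i
    by (simp only: ck_const)
  with Suc show ?thesis by (auto simp: partial_coord intro!: continuous_intros)
qed (auto intro!: continuous_intros)

lemma smooth_on_const: "smooth_on U (\<lambda>x. a)"
  by (simp add: smooth_on_ck_iff ck_const)

lemma smooth_on_coord: "smooth_on U (\<lambda>x. x $ j)"
  by (simp add: smooth_on_ck_iff ck_coord)

lemma smooth_on_add: "open U \<Longrightarrow> smooth_on U f \<Longrightarrow> smooth_on U g \<Longrightarrow> smooth_on U (\<lambda>x. f x + g x)"
  by (simp add: smooth_on_ck_iff ck_add)

lemma smooth_on_mult: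
  fixes f g :: "real^'n::finite \<Rightarrow> 'b::real_normed_algebra"
  shows "open U \<Longrightarrow> smooth_on U f \<Longrightarrow> smooth_on U g \<Longrightarrow> smooth_on U (\<lambda>x. f x * g x)"
  by (simp add: smooth_on_ck_iff ck_mult)

lemma smooth_on_bounded_linear: "open U \<Longrightarrow> bounded_linear h \<Longrightarrow> smooth_on U f \<Longrightarrow> smooth_on U (\<lambda>x. h (f x))"
  by (simp add: smooth_on_ck_iff ck_bounded_linear)

lemma smooth_on_exp:
  fixes f :: "real^'n::finite \<Rightarrow> complex"
  shows "open U \<Longrightarrow> smooth_on U f \<Longrightarrow> smooth_on U (\<lambda>x. exp (f x))"
  by (simp add: smooth_on_ck_iff ck_exp)

lemma smooth_on_inverse:
  fixes f :: "real^'n::finite \<Rightarrow> real"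
  shows "open U \<Longrightarrow> (\<And>x. x \<in> U \<Longrightarrow> f x \<noteq> 0) \<Longrightarrow> smooth_on U f \<Longrightarrow> smooth_on U (\<lambda>x. inverse (f x))"
  by (simp add: smooth_on_ck_iff ck_inverse)

lemma smooth_on_cong: "open U \<Longrightarrow> (\<And>y. y \<in> U \<Longrightarrow> f y = g y) \<Longrightarrow> smooth_on U f \<Longrightarrow> smooth_on U g"
  unfolding smooth_on_ck_iff using ck_cong by blast

lemma smooth_on_subset: "smooth_on U f \<Longrightarrow> V \<subseteq> U \<Longrightarrow> smooth_on V f"
  unfolding smooth_on_ck_iff using ck_subset by blast

lemma smooth_on_Un: "open U \<Longrightarrow> open V \<Longrightarrow> smooth_on U f \<Longrightarrow> smooth_on V f \<Longrightarrow> smooth_on (U \<union> V) f"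
  unfolding smooth_on_ck_iff using ck_Un by blast

lemma smooth_on_of_real: "open U \<Longrightarrow> smooth_on U f \<Longrightarrow> smooth_on U (\<lambda>x. of_real (f x) :: complex)"
  by (rule smooth_on_bounded_linear[OF _ bounded_linear_of_real])

lemma smooth_on_scaleR: "open U \<Longrightarrow> smooth_on U f \<Longrightarrow> smooth_on U (\<lambda>x. c *\<^sub>R f x)"
  by (rule smooth_on_bounded_linear[OF _ bounded_linear_scaleR_right])

lemma smooth_on_cmult: 
  fixes f :: "real^'n::finite \<Rightarrow> 'b::real_normed_algebra"
  shows "open U \<Longrightarrow> smooth_on U f \<Longrightarrow> smooth_on U (\<lambda>x. c * f x)"
  by (rule smooth_on_bounded_linear[OF _ bounded_linear_mult_right])

lemma smooth_on_minus: "open U \<Longrightarrow> smooth_on U f \<Longrightarrow> smooth_on U (\<lambda>x. - f x)"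
  by (rule smooth_on_bounded_linear[OF _ bounded_linear_minus[OF bounded_linear_ident]])

lemma smooth_on_diff: "open U \<Longrightarrow> smooth_on U f \<Longrightarrow> smooth_on U g \<Longrightarrow> smooth_on U (\<lambda>x. f x - g x)"
  using smooth_on_add[OF _ _ smooth_on_minus, of U f g] by simp

lemma smooth_on_sum:
  "open U \<Longrightarrow> (\<And>i. i \<in> I \<Longrightarrow> smooth_on U (f i)) \<Longrightarrow> smooth_on U (\<lambda>x. \<Sum>i\<in>I. f i x)"
  by (induction I rule: infinite_finite_induct) (auto simp: smooth_on_const smooth_on_add)

lemma smooth_on_prod:
  fixes f :: "'i \<Rightarrow> real^'n::finite \<Rightarrow> 'b::real_normed_field"
  shows "open U \<Longrightarrow> (\<And>i. i \<in> I \<Longrightarrow> smooth_on U (f i)) \<Longrightarrow> smooth_on U (\<lambda>x. \<Prod>i\<in>I. f i x)"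
  by (induction I rule: infinite_finite_induct) (auto simp: smooth_on_const smooth_on_mult)

lemma smooth_on_power:
  fixes f :: "real^'n::finite \<Rightarrow> 'b::real_normed_field"
  shows "open U \<Longrightarrow> smooth_on U f \<Longrightarrow> smooth_on U (\<lambda>x. f x ^ m)"
  by (induction m) (auto simp: smooth_on_const smooth_on_mult)

lemmas smooth_intros = smooth_on_const smooth_on_coord smooth_on_add smooth_on_mult smooth_on_exp
  smooth_on_of_real smooth_on_scaleR smooth_on_minus smooth_on_diff smooth_on_sum smooth_on_prod
  smooth_on_power open_UNIV

subsection \<open>Cutoff functions\<close>

text \<open>The usual flat function is \<open>flat 0\<close>. The whole family is carried because
  the derivative of one member is a combination of two others, so smoothness goes by induction on
  the order with \<open>k\<close> arbitrary.\<close>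

definition flat :: "nat \<Rightarrow> real \<Rightarrow> real" where
  "flat k t = (if t > 0 then inverse t ^ k * exp (- inverse t) else 0)"

lemma flat_quotient_tendsto: "((\<lambda>t. flat k t) \<longlongrightarrow> 0) (at 0)"
proof -
  have "((\<lambda>x. x ^ k / exp x) \<longlongrightarrow> 0) (at_top :: real filter)" by (rule tendsto_power_div_exp_0)
  then have "((\<lambda>t. inverse t ^ k / exp (inverse t)) \<longlongrightarrow> 0) (at_right (0::real))"
    by (rule filterlim_compose[OF _ filterlim_inverse_at_top_right])
  then have r: "((\<lambda>t. flat k t) \<longlongrightarrow> 0) (at_right 0)"
    by (rule Lim_transform_eventually)
      (auto simp: flat_def exp_minus field_simps eventually_at_right_less intro!: eventually_at_rightI[of 0 1])
  have l: "((\<lambda>t. flat k t) \<longlongrightarrow> 0) (at_left 0)"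
    by (rule Lim_transform_eventually[of "\<lambda>_. 0"])
      (auto simp: flat_def intro!: eventually_at_leftI[of "-1"])
  from l r show ?thesis by (simp add: filterlim_split_at)
qed

lemma flat_deriv: "(flat k has_real_derivative (flat (k+2) t - real k * flat (k+1) t)) (at t)"
proof -
  consider "t > 0" | "t < 0" | "t = 0" by linarith
  then show ?thesis
  proof cases
    case 1
    have inv: "(inverse has_real_derivative - ((inverse t)\<^sup>2)) (at t)"
      using DERIV_inverse[of t UNIV] 1 by (simp add: numeral_2_eq_2)
    have "((\<lambda>t. inverse t ^ k * exp (- inverse t)) has_real_derivative
       (real k * inverse t ^ (k - 1) * - ((inverse t)\<^sup>2)) * exp (- inverse t)
         + exp (- inverse t) * (inverse t)\<^sup>2 * inverse t ^ k) (at t)"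
      by (rule derivative_eq_intros inv refl | simp)+
    also have "(real k * inverse t ^ (k - 1) * - ((inverse t)\<^sup>2)) * exp (- inverse t)
         + exp (- inverse t) * (inverse t)\<^sup>2 * inverse t ^ k = flat (k+2) t - real k * flat (k+1) t"
    proof -
      have "real k * inverse t ^ (k - 1) * (inverse t)\<^sup>2 = real k * inverse t ^ (k + 1)"
        by (cases k) (auto simp: power2_eq_square)
      then show ?thesis using 1 by (auto simp: flat_def power_add algebra_simps power2_eq_square)
    qed
    finally have "((\<lambda>t. inverse t ^ k * exp (- inverse t)) has_real_derivative (flat (k+2) t - real k * flat (k+1) t)) (at t)" .
    moreover have "\<forall>\<^sub>F s in nhds t. inverse s ^ k * exp (- inverse s) = flat k s"
      using 1 by (auto simp: flat_def eventually_nhds intro!: exI[of _ "{0<..}"])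
    ultimately show ?thesis by (subst DERIV_cong_ev[OF refl _ refl, where g="\<lambda>t. inverse t ^ k * exp (- inverse t)"]) (auto elim: eventually_mono)
  next
    case 2
    have "((\<lambda>t. 0) has_real_derivative (flat (k+2) t - real k * flat (k+1) t)) (at t)"
      using 2 by (auto simp: flat_def)
    moreover have "\<forall>\<^sub>F s in nhds t. flat k s = 0"
      using 2 by (auto simp: flat_def eventually_nhds intro!: exI[of _ "{..<0}"])
    ultimately show ?thesis by (subst DERIV_cong_ev[OF refl _ refl, where g="\<lambda>t. 0"]) auto
  next
    case 3
    \<comment> \<open>For \<open>h \<noteq> 0\<close> this difference quotient is
      \<open>flat (k + 1) h\<close>.\<close>
    have "((\<lambda>h. (flat k (0 + h) - flat k 0) / h) \<longlongrightarrow> 0) (at 0)"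
      by (rule Lim_transform_eventually[OF flat_quotient_tendsto[of "k+1"]])
        (auto simp: flat_def field_simps eventually_at_filter)
    then show ?thesis using 3 unfolding DERIV_def by (simp add: flat_def)
  qed
qed

lemma partial_flat:
  assumes "has_partial i g x"
  shows "partial i (\<lambda>x. flat k (g x)) x = partial i g x * (flat (k+2) (g x) - real k * flat (k+1) (g x))"
    "has_partial i (\<lambda>x. flat k (g x)) x"
proof -
  have "((flat k \<circ> (\<lambda>t. g (x + t *\<^sub>R axis i 1))) has_vector_derivative
     partial i g x * (flat (k+2) (g (x + 0 *\<^sub>R axis i 1)) - real k * flat (k+1) (g (x + 0 *\<^sub>R axis i 1)))) (at 0)"
    by (rule field_vector_diff_chain_at[OF has_vector_derivative_partial[OF assms] flat_deriv])
  then have "((\<lambda>t. flat k (g (x + t *\<^sub>R axis i 1))) has_vector_derivative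
      partial i g x * (flat (k+2) (g x) - real k * flat (k+1) (g x))) (at 0)"
    by (simp add: o_def)
  from partialI[OF this]
  show "partial i (\<lambda>x. flat k (g x)) x = partial i g x * (flat (k+2) (g x) - real k * flat (k+1) (g x))"
    "has_partial i (\<lambda>x. flat k (g x)) x" by auto
qed

lemma ck_flat:
  assumes "open U"
  shows "ck U n g \<Longrightarrow> ck U n (\<lambda>x. flat k (g x))"
proof (induction n arbitrary: k)
  case 0
  have "continuous_on UNIV (flat k)"
    using flat_deriv by (intro continuous_at_imp_continuous_on ballI) (blast intro: DERIV_isCont)
  with 0 show ?case by (auto intro: continuous_on_compose2)
next
  case (Suc n)
  have "ck U n g" using Suc.prems ck_Suc_le by blast
  then have "ck U n (\<lambda>x. partial i g x * (flat (k+2) (g x) + (- real k) * flat (k+1) (g x)))" for i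
    by (intro ck_mult ck_add ck_const assms Suc.IH) (use Suc.prems in auto)
  then have "ck U n (partial i (\<lambda>x. flat k (g x)))" for i
    by (rule ck_cong[OF assms(1), rotated]) (use assms Suc.prems in \<open>auto simp: partial_flat\<close>)
  moreover have "continuous_on UNIV (flat k)"
    using flat_deriv by (intro continuous_at_imp_continuous_on ballI) (blast intro: DERIV_isCont)
  then have "continuous_on U (\<lambda>x. flat k (g x))"
    using Suc.prems by (auto intro: continuous_on_compose2)
  ultimately show ?case using Suc.prems by (auto simp: partial_flat)
qed

lemma flat_pos: "t > 0 \<Longrightarrow> flat k t > 0" by (simp add: flat_def)
lemma flat_nonneg: "flat k t \<ge> 0" by (simp add: flat_def)
lemma flat_zero: "t \<le> 0 \<Longrightarrow> flat k t = 0" by (simp add: flat_def)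

text \<open>The quotient \<open>a / (a + b)\<close> of two flat functions of the squared distance:
  \<open>a\<close> is positive inside radius \<open>2 * r\<close> and \<open>b\<close> outside
  radius \<open>r\<close>, so the denominator never vanishes.\<close>

lemma cutoff_exists:
  fixes y :: "real^'n::finite"
  assumes "r > 0"
  obtains \<kappa> :: "real^'n \<Rightarrow> complex" where "smooth_on UNIV \<kappa>" "\<And>x. norm (x - y) \<le> r \<Longrightarrow> \<kappa> x = 1"
    "\<And>x. norm (x - y) \<ge> 2 * r \<Longrightarrow> \<kappa> x = 0"
proof -
  \<comment> \<open>The squared distance is a polynomial in the coordinates, hence smooth at
    \<open>y\<close> as well.\<close>
  define q :: "real^'n \<Rightarrow> real" where "q x = (\<Sum>i\<in>UNIV. (x$i - y$i)^2)" for x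
  have q: "q x = (norm (x - y))\<^sup>2" for x
    unfolding q_def power2_norm_eq_inner inner_vec_def by (simp add: power2_eq_square)
  have sq: "smooth_on UNIV q" unfolding q_def by (intro smooth_intros)
  define a where "a x = flat 0 (4 * r^2 - q x)" for x
  define b where "b x = flat 0 (q x - r^2)" for x
  have "smooth_on UNIV (\<lambda>x. 4 * r^2 - q x)" "smooth_on UNIV (\<lambda>x. q x - r^2)"
    by (intro smooth_intros sq)+
  then have sa: "smooth_on UNIV a" and sb: "smooth_on UNIV b"
    unfolding a_def b_def by (simp_all add: smooth_on_ck_iff ck_flat)
  have "a x + b x > 0" for x
  proof (cases "q x < 4 * r^2")
    case True
    then show ?thesis using flat_pos[of "4 * r^2 - q x" 0] flat_nonneg[of 0 "q x - r^2"] by (simp add: a_def b_def)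
  next
    case False
    have "r^2 > 0" using assms by simp
    with False have "q x - r^2 > 0" by linarith
    then show ?thesis using flat_pos[of "q x - r^2" 0] flat_nonneg[of 0 "4 * r^2 - q x"] by (simp add: a_def b_def)
  qed
  then have nz: "a x + b x \<noteq> 0" for x using less_irrefl by metis
  define \<kappa> where "\<kappa> x = complex_of_real (a x * inverse (a x + b x))" for x
  have "smooth_on UNIV \<kappa>"
    unfolding \<kappa>_def by (intro smooth_intros smooth_on_inverse sa sb nz)
  moreover have "\<kappa> x = 1" if "norm (x - y) \<le> r" for x
  proof -
    have "q x \<le> r^2" using that by (simp add: q power_mono)
    then have "b x = 0" by (simp add: b_def flat_zero)
    then show ?thesis using nz[of x] by (simp add: \<kappa>_def)
  qed
  moreover have "\<kappa> x = 0" if "norm (x - y) \<ge> 2 * r" for x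
  proof -
    have "(2*r)^2 \<le> q x" unfolding q using that assms by (intro power_mono) auto
    then have "a x = 0" by (simp add: a_def flat_zero power2_eq_square)
    then show ?thesis by (simp add: \<kappa>_def)
  qed
  ultimately show ?thesis using that by blast
qed

text \<open>Continuous partials give total differentiability. The increment is made one coordinate
  at a time, so the induction runs over the set \<open>I\<close> of coordinates already
  moved.\<close>

lemma partial_increment_approx:
  fixes f :: "real^'n::finite \<Rightarrow> 'b::real_normed_vector"
  assumes f: "smooth_on UNIV f" and "finite I" and "e > 0"
  shows "\<exists>d>0. \<forall>h. norm h < d \<longrightarrow>
     norm (f (x + (\<Sum>i\<in>I. h$i *\<^sub>R axis i 1)) - f x - (\<Sum>i\<in>I. h$i *\<^sub>R partial i f x)) \<le> e * norm h"
  using assms(2,3)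
proof (induction I arbitrary: e rule: finite_induct)
  case empty
  then show ?case by (auto intro: exI[of _ 1])
next
  case (insert j I)
  obtain d1 where d1: "d1 > 0" "\<And>h. norm h < d1 \<Longrightarrow>
     norm (f (x + (\<Sum>i\<in>I. h$i *\<^sub>R axis i 1)) - f x - (\<Sum>i\<in>I. h$i *\<^sub>R partial i f x)) \<le> e/2 * norm h"
    using insert.IH[of "e/2"] insert.prems by auto
  have "isCont (partial j f) x"
    using smooth_on_continuous[OF smooth_on_partial[OF f, of j]]
    by (simp add: continuous_on_eq_continuous_at)
  \<comment> \<open>Two values of \<open>partial j f\<close> this close to \<open>x\<close> differ
    by at most \<open>e/4\<close>. One \<open>e/4\<close> pays for the linearization along axis
    \<open>j\<close>, another for moving its derivative from \<open>p\<close> to \<open>x\<close>;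
    the remaining \<open>e/2\<close> is the induction hypothesis.\<close>
  then obtain d2 where d2: "d2 > 0" "\<And>y. norm (y - x) < d2 \<Longrightarrow> norm (partial j f y - partial j f x) < e/8"
    unfolding continuous_at_eps_delta dist_norm using insert.prems by (metis divide_pos_pos zero_less_numeral)
  show ?case
  proof (intro exI[of _ "min d1 d2"] conjI allI impI)
    fix h :: "real^'n" assume h: "norm h < min d1 d2"
    define p where "p = x + (\<Sum>i\<in>I. h$i *\<^sub>R axis i 1)"
    have near: "norm (p + t *\<^sub>R axis j 1 - x) < d2" if "t \<in> closed_segment 0 (h$j)" for t
    proof -
      have t: "\<bar>t\<bar> \<le> \<bar>h$j\<bar>" using that by (auto simp: closed_segment_eq_real_ivl split: if_splits)
      have "norm ((\<Sum>i\<in>I. h$i *\<^sub>R axis i 1) + t *\<^sub>R axis j (1::real)) \<le> norm h"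
      proof (rule norm_le_componentwise_cart)
        fix k
        have *: "((\<Sum>i\<in>I. h$i *\<^sub>R axis i (1::real)) $ k) = (if k \<in> I then h$k else 0)"
          using insert.hyps(1) by (simp add: axis_def if_distrib[where f="\<lambda>z. _ * z"] cong: if_cong)
        show "norm (((\<Sum>i\<in>I. h$i *\<^sub>R axis i 1) + t *\<^sub>R axis j (1::real)) $ k) \<le> norm (h $ k)"
          unfolding vector_add_component * using t insert.hyps(2) by (auto simp: axis_def)
      qed
      then show ?thesis using h by (simp add: p_def)
    qed
    have "norm (f (p + (h$j) *\<^sub>R axis j 1) - f (p + 0 *\<^sub>R axis j 1) - (h$j - 0) *\<^sub>R partial j f (p + 0 *\<^sub>R axis j 1))
       \<le> norm (h$j - 0) * (e/4)"
    proof (rule vector_differentiable_bound_linearization[where f="\<lambda>t. f (p + t *\<^sub>R axis j 1)" and f'="\<lambda>t. partial j f (p + t *\<^sub>R axis j 1)" and S="closed_segment 0 (h$j)"])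
      fix t assume t: "t \<in> closed_segment 0 (h$j)"
      show "((\<lambda>t. f (p + t *\<^sub>R axis j 1)) has_vector_derivative partial j f (p + t *\<^sub>R axis j 1)) (at t within closed_segment 0 (h$j))"
        by (rule has_vector_derivative_line, rule smooth_on_has_partial[OF f]) simp
      have "norm (partial j f (p + t *\<^sub>R axis j 1) - partial j f x) < e/8"
        by (rule d2(2)[OF near[OF t]])
      moreover have "norm (partial j f (p + 0 *\<^sub>R axis j 1) - partial j f x) < e/8"
        by (rule d2(2)[OF near]) simp
      ultimately show "norm (partial j f (p + t *\<^sub>R axis j 1) - partial j f (p + 0 *\<^sub>R axis j 1)) \<le> e / 4"
        using norm_triangle_ineq4[of "partial j f (p + t *\<^sub>R axis j 1) - partial j f x" "partial j f (p + 0 *\<^sub>R axis j 1) - partial j f x"]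
        by simp
    qed auto
    then have 1: "norm (f (p + (h$j) *\<^sub>R axis j 1) - f p - (h$j) *\<^sub>R partial j f p) \<le> \<bar>h$j\<bar> * (e/4)" by simp
    have 2: "norm ((h$j) *\<^sub>R partial j f p - (h$j) *\<^sub>R partial j f x) \<le> \<bar>h$j\<bar> * (e/4)"
    proof -
      have "norm (partial j f p - partial j f x) \<le> e/4" using d2(2)[OF near[of 0]] insert.prems by simp
      then show ?thesis unfolding scaleR_diff_right[symmetric] norm_scaleR by (rule mult_left_mono) simp
    qed
    have hj: "\<bar>h$j\<bar> \<le> norm h" by (rule component_le_norm_cart)
    have 3: "norm (f p - f x - (\<Sum>i\<in>I. h$i *\<^sub>R partial i f x)) \<le> e/2 * norm h"
      using d1(2) h by (simp add: p_def)
    have "f (x + (\<Sum>i\<in>insert j I. h$i *\<^sub>R axis i 1)) - f x - (\<Sum>i\<in>insert j I. h$i *\<^sub>R partial i f x)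
      = (f (p + (h$j) *\<^sub>R axis j 1) - f p - (h$j) *\<^sub>R partial j f p) + ((h$j) *\<^sub>R partial j f p - (h$j) *\<^sub>R partial j f x)
        + (f p - f x - (\<Sum>i\<in>I. h$i *\<^sub>R partial i f x))"
      using insert.hyps by (simp add: p_def algebra_simps)
    then have "norm (f (x + (\<Sum>i\<in>insert j I. h$i *\<^sub>R axis i 1)) - f x - (\<Sum>i\<in>insert j I. h$i *\<^sub>R partial i f x))
      \<le> \<bar>h$j\<bar> * (e/4) + \<bar>h$j\<bar> * (e/4) + e/2 * norm h"
      using 1 2 3 norm_triangle_ineq by (smt (verit))
    also have "\<dots> \<le> e * norm h" 
    proof -
      have "\<bar>h$j\<bar> * (e/2) \<le> norm h * (e/2)" using hj insert.prems by (intro mult_right_mono) auto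
      then show ?thesis by (simp add: field_simps)
    qed
    finally show "norm (f (x + (\<Sum>i\<in>insert j I. h$i *\<^sub>R axis i 1)) - f x - (\<Sum>i\<in>insert j I. h$i *\<^sub>R partial i f x)) \<le> e * norm h" .
  qed (use d1 d2 in auto)
qed

lemma smooth_has_derivative:
  fixes f :: "real^'n::finite \<Rightarrow> 'b::real_normed_vector"
  assumes f: "smooth_on UNIV f"
  shows "(f has_derivative (\<lambda>h. \<Sum>i\<in>UNIV. h$i *\<^sub>R partial i f x)) (at x)"
  unfolding has_derivative_at_alt
proof (intro conjI allI impI)
  show "bounded_linear (\<lambda>h. \<Sum>i\<in>UNIV. h$i *\<^sub>R partial i f x)"
    by (intro bounded_linear_sum bounded_linear_scaleR_const bounded_linear_vec_nth)
  fix e :: real assume "e > 0"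
  have exp: "(\<Sum>i\<in>UNIV. h$i *\<^sub>R axis i 1) = h" for h :: "real^'n"
    by (metis (no_types) basis_expansion scalar_mult_eq_scaleR sum.cong)
  obtain d where "d > 0" and d: "\<And>h. norm h < d \<Longrightarrow>
      norm (f (x + h) - f x - (\<Sum>i\<in>UNIV. h$i *\<^sub>R partial i f x)) \<le> e * norm h"
    using partial_increment_approx[OF f finite[of UNIV] \<open>e > 0\<close>, of x] by (auto simp: exp)
  show "\<exists>d>0. \<forall>y. norm (y - x) < d \<longrightarrow>
      norm (f y - f x - (\<Sum>i\<in>UNIV. (y - x)$i *\<^sub>R partial i f x)) \<le> e * norm (y - x)"
    using \<open>d > 0\<close> d[of "y - x" for y] by auto
qed

lemma smooth_has_vector_derivative_ray:
  fixes f :: "real^'n::finite \<Rightarrow> 'b::real_normed_vector"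
  assumes f: "smooth_on UNIV f"
  shows "((\<lambda>t. f (y + t *\<^sub>R v)) has_vector_derivative (\<Sum>i\<in>UNIV. v$i *\<^sub>R partial i f (y + t *\<^sub>R v))) (at t within S)"
proof -
  have "((\<lambda>t. y + t *\<^sub>R v) has_vector_derivative v) (at t within S)"
    by (auto intro!: derivative_eq_intros)
  from vector_derivative_diff_chain_within[OF this has_derivative_at_withinI[OF smooth_has_derivative[OF f]]]
  show ?thesis by (simp add: o_def)
qed

section \<open>Hadamard's lemma\<close>

lemma continuous_on_hadamard_integrand:
  fixes f :: "real^'n::finite \<Rightarrow> 'b::banach"
  assumes "continuous_on UNIV f"
  shows "continuous_on UNIV (\<lambda>x. integral {0..1} (\<lambda>t. t^m *\<^sub>R f (y + t *\<^sub>R (x - y))))"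
proof -
  have "continuous_on (UNIV \<times> cbox 0 1) (\<lambda>(x::real^'n, t::real). t^m *\<^sub>R f (y + t *\<^sub>R (x - y)))"
    unfolding split_beta
    by (intro continuous_intros continuous_on_compose2[OF assms]) auto
  from integral_continuous_on_param[OF this] show ?thesis by (simp add: cbox_interval)
qed

text \<open>Differentiating \<open>f (y + t *\<^sub>R (x - y))\<close> brings out a factor
  \<open>t\<close>; with the weight \<open>t^m\<close> the class of these integrals is closed under
  differentiation.\<close>

lemma partial_hadamard_integral:
  fixes f :: "real^'n::finite \<Rightarrow> 'b::banach"
  assumes c: "continuous_on UNIV f" "continuous_on UNIV (partial i f)" and d: "\<And>x. has_partial i f x"
  shows "partial i (\<lambda>x. integral {0..1} (\<lambda>t. t^m *\<^sub>R f (y + t *\<^sub>R (x - y)))) x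
     = integral {0..1} (\<lambda>t. t^(Suc m) *\<^sub>R partial i f (y + t *\<^sub>R (x - y)))" (is ?A)
    "has_partial i (\<lambda>x. integral {0..1} (\<lambda>t. t^m *\<^sub>R f (y + t *\<^sub>R (x - y)))) x" (is ?B)
proof -
  have "((\<lambda>s. integral (cbox 0 1) (\<lambda>t. t^m *\<^sub>R f (y + t *\<^sub>R (x + s *\<^sub>R axis i 1 - y))))
    has_vector_derivative integral (cbox 0 1) (\<lambda>t. t^(Suc m) *\<^sub>R partial i f (y + t *\<^sub>R (x + 0 *\<^sub>R axis i 1 - y)))) (at 0 within UNIV)"
  proof (rule leibniz_rule_vector_derivative[where fx="\<lambda>s t. t^(Suc m) *\<^sub>R partial i f (y + t *\<^sub>R (x + s *\<^sub>R axis i 1 - y))"])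
    fix s t :: real
    have "((\<lambda>u. f (y + t *\<^sub>R (x - y) + u *\<^sub>R axis i 1)) has_vector_derivative
        partial i f (y + t *\<^sub>R (x - y) + (t * s) *\<^sub>R axis i 1)) (at (t * s))"
      by (rule has_vector_derivative_line[OF d])
    then have "(((\<lambda>u. f (y + t *\<^sub>R (x - y) + u *\<^sub>R axis i 1)) \<circ> (\<lambda>s. t * s)) has_vector_derivative
        t *\<^sub>R partial i f (y + t *\<^sub>R (x - y) + (t * s) *\<^sub>R axis i 1)) (at s)"
      by (intro vector_diff_chain_at) (auto intro!: derivative_eq_intros simp: has_vector_derivative_def)
    then have "((\<lambda>s. f (y + t *\<^sub>R (x + s *\<^sub>R axis i 1 - y))) has_vector_derivative
        t *\<^sub>R partial i f (y + t *\<^sub>R (x + s *\<^sub>R axis i 1 - y))) (at s)"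
      by (simp add: o_def algebra_simps)
    then show "((\<lambda>s. t^m *\<^sub>R f (y + t *\<^sub>R (x + s *\<^sub>R axis i 1 - y))) has_vector_derivative
        t^(Suc m) *\<^sub>R partial i f (y + t *\<^sub>R (x + s *\<^sub>R axis i 1 - y))) (at s within UNIV)"
      by (auto intro!: derivative_eq_intros simp: mult.commute)
  next
    show "(\<lambda>t. t^m *\<^sub>R f (y + t *\<^sub>R (x + s *\<^sub>R axis i 1 - y))) integrable_on cbox 0 1" for s :: real
      by (intro integrable_continuous continuous_intros continuous_on_compose2[OF c(1)]) auto
    show "continuous_on (UNIV \<times> cbox 0 1) (\<lambda>(s::real, t::real). t^(Suc m) *\<^sub>R partial i f (y + t *\<^sub>R (x + s *\<^sub>R axis i 1 - y)))"
      unfolding split_beta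
      by (intro continuous_intros continuous_on_compose2[OF c(2)]) auto
  qed auto
  then have "((\<lambda>s. integral {0..1} (\<lambda>t. t^m *\<^sub>R f (y + t *\<^sub>R (x + s *\<^sub>R axis i 1 - y))))
    has_vector_derivative integral {0..1} (\<lambda>t. t^(Suc m) *\<^sub>R partial i f (y + t *\<^sub>R (x - y)))) (at 0)"
    by (simp add: cbox_interval)
  from partialI[OF this] show ?A ?B by auto
qed

lemma ck_hadamard_integral:
  fixes f :: "real^'n::finite \<Rightarrow> 'b::banach"
  shows "ck UNIV n f \<Longrightarrow> ck UNIV n (\<lambda>x. integral {0..1} (\<lambda>t. t^m *\<^sub>R f (y + t *\<^sub>R (x - y))))"
proof (induction n arbitrary: f m)
  case 0
  then show ?case using continuous_on_hadamard_integrand by auto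
next
  case (Suc n)
  have *: "continuous_on UNIV f" "continuous_on UNIV (partial i f)" "has_partial i f x" for i x
    using Suc.prems ck_continuous[of UNIV n "partial i f"] by auto
  have "partial i (\<lambda>x. integral {0..1} (\<lambda>t. t^m *\<^sub>R f (y + t *\<^sub>R (x - y))))
     = (\<lambda>x. integral {0..1} (\<lambda>t. t^(Suc m) *\<^sub>R partial i f (y + t *\<^sub>R (x - y))))" for i
    using partial_hadamard_integral(1)[OF *] by (intro ext)
  moreover have "ck UNIV n (\<lambda>x. integral {0..1} (\<lambda>t. t^(Suc m) *\<^sub>R partial i f (y + t *\<^sub>R (x - y))))" for i
    by (rule Suc.IH) (use Suc.prems in auto)
  ultimately show ?case using continuous_on_hadamard_integrand[OF *(1)] partial_hadamard_integral(2)[OF *] by simp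
qed

lemma hadamard_integral:
  fixes f :: "real^'n::finite \<Rightarrow> 'b::banach"
  assumes f: "smooth_on UNIV f"
  shows "smooth_on UNIV (\<lambda>x. integral {0..1} (\<lambda>t. t^m *\<^sub>R f (y + t *\<^sub>R (x - y))))"
    and "partials js (\<lambda>x. integral {0..1} (\<lambda>t. t^m *\<^sub>R f (y + t *\<^sub>R (x - y)))) =
      (\<lambda>x. integral {0..1} (\<lambda>t. t^(m + length js) *\<^sub>R partials js f (y + t *\<^sub>R (x - y))))"
proof -
  show "smooth_on UNIV (\<lambda>x. integral {0..1} (\<lambda>t. t^m *\<^sub>R f (y + t *\<^sub>R (x - y))))"
    using f unfolding smooth_on_ck_iff using ck_hadamard_integral by blast
  show "partials js (\<lambda>x. integral {0..1} (\<lambda>t. t^m *\<^sub>R f (y + t *\<^sub>R (x - y)))) =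
      (\<lambda>x. integral {0..1} (\<lambda>t. t^(m + length js) *\<^sub>R partials js f (y + t *\<^sub>R (x - y))))"
  proof (induction js)
    case (Cons i js)
    have s: "smooth_on UNIV (partials js f)" using f by (rule smooth_on_partials)
    have "partial i (\<lambda>x. integral {0..1} (\<lambda>t. t^(m + length js) *\<^sub>R partials js f (y + t *\<^sub>R (x - y))))
      = (\<lambda>x. integral {0..1} (\<lambda>t. t^(Suc (m + length js)) *\<^sub>R partial i (partials js f) (y + t *\<^sub>R (x - y))))"
      by (intro ext partial_hadamard_integral(1) smooth_on_continuous smooth_on_partial s smooth_on_has_partial[OF s]) auto
    then show ?case using Cons by simp
  qed simp
qed

text \<open>The coefficients of \<open>x - y\<close> in Hadamard's expansion about \<open>y\<close>.
  They are smooth again and inherit bounds on partials from \<open>f\<close>, so the expansion can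
  be iterated.\<close>

definition hquot :: "real^'n::finite \<Rightarrow> 'n \<Rightarrow> (real^'n \<Rightarrow> 'b::banach) \<Rightarrow> real^'n \<Rightarrow> 'b" where
  "hquot y i f x = integral {0..1} (\<lambda>t. partial i f (y + t *\<^sub>R (x - y)))"

lemma smooth_hquot: "smooth_on UNIV f \<Longrightarrow> smooth_on UNIV (hquot y i f)"
  using hadamard_integral(1)[OF smooth_on_partial, where f1=f and m=0 and y=y and i1=i] by (simp add: hquot_def[abs_def])

lemma partials_hquot: "smooth_on UNIV f \<Longrightarrow> partials is (hquot y i f) =
   (\<lambda>x. integral {0..1} (\<lambda>t. t^(length is) *\<^sub>R partials is (partial i f) (y + t *\<^sub>R (x - y))))"
  using hadamard_integral(2)[OF smooth_on_partial, where f1=f and m=0 and y=y and i1=i and js="is"] by (simp add: hquot_def[abs_def])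

lemma hquot_base: "hquot y i f y = partial i f y"
  by (simp add: hquot_def)

lemma norm_partials_hquot_le:
  assumes f: "smooth_on UNIV f" and B: "\<And>x. norm (partials is (partial i f) x) \<le> B"
  shows "norm (partials is (hquot y i f) x) \<le> B"
proof -
  have c: "continuous_on UNIV (partials is (partial i f))"
    by (intro smooth_on_continuous smooth_on_partials smooth_on_partial f)
  have "norm (integral {0..1} (\<lambda>t. t^(length is) *\<^sub>R partials is (partial i f) (y + t *\<^sub>R (x - y)))) \<le> B * (1 - 0)"
  proof (rule integral_bound)
    show "continuous_on {0..1} (\<lambda>t. t^(length is) *\<^sub>R partials is (partial i f) (y + t *\<^sub>R (x - y)))"
      by (intro continuous_intros continuous_on_compose2[OF c]) auto
    fix t :: real assume t: "t \<in> {0..1}"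
    have "t ^ length is * norm (partials is (partial i f) (y + t *\<^sub>R (x - y))) \<le> 1 * B"
      using t by (intro mult_mono B power_le_one) auto
    then show "norm (t^(length is) *\<^sub>R partials is (partial i f) (y + t *\<^sub>R (x - y))) \<le> B" using t by simp
  qed simp
  then show ?thesis by (simp add: partials_hquot[OF f])
qed

lemma hadamard:
  fixes f :: "real^'n::finite \<Rightarrow> 'b::banach"
  assumes f: "smooth_on UNIV f"
  shows "f x = f y + (\<Sum>i\<in>UNIV. (x - y)$i *\<^sub>R hquot y i f x)"
proof -
  have "((\<lambda>t. \<Sum>i\<in>UNIV. (x - y)$i *\<^sub>R partial i f (y + t *\<^sub>R (x - y))) has_integral
     (f (y + 1 *\<^sub>R (x - y)) - f (y + 0 *\<^sub>R (x - y)))) {0..1}"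
    by (rule fundamental_theorem_of_calculus[where f="\<lambda>t. f (y + t *\<^sub>R (x - y))"])
      (use smooth_has_vector_derivative_ray[OF f, of y "x - y"] in auto)
  then have "f x - f y = integral {0..1} (\<lambda>t. \<Sum>i\<in>UNIV. (x - y)$i *\<^sub>R partial i f (y + t *\<^sub>R (x - y)))"
    by (simp add: integral_unique)
  also have "\<dots> = (\<Sum>i\<in>UNIV. integral {0..1} (\<lambda>t. (x - y)$i *\<^sub>R partial i f (y + t *\<^sub>R (x - y))))"
    by (intro integral_sum integrable_continuous_interval continuous_intros
        continuous_on_compose2[OF smooth_on_continuous[OF smooth_on_partial[OF f]]]) auto
  also have "\<dots> = (\<Sum>i\<in>UNIV. (x - y)$i *\<^sub>R hquot y i f x)"
    by (simp add: hquot_def)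
  finally show ?thesis by (simp add: algebra_simps)
qed

lemma hadamard2:
  fixes f :: "real^'n::finite \<Rightarrow> 'b::banach"
  assumes f: "smooth_on UNIV f"
  shows "f x = f y + (\<Sum>i\<in>UNIV. (x - y)$i *\<^sub>R partial i f y)
    + (\<Sum>i\<in>UNIV. \<Sum>j\<in>UNIV. ((x - y)$i * (x - y)$j) *\<^sub>R hquot y j (hquot y i f) x)"
proof -
  have "hquot y i f x = partial i f y + (\<Sum>j\<in>UNIV. (x - y)$j *\<^sub>R hquot y j (hquot y i f) x)" for i
    using hadamard[OF smooth_hquot[OF f], of y i x y] by (simp add: hquot_base)
  with hadamard[OF f, of x y] show ?thesis
    by (simp add: scaleR_add_right sum.distrib scaleR_sum_right)
qed

section \<open>Families of weighted order\<close>

text \<open>The factor \<open>exp (e (\<rho> |x - y|)\<^sup>2)\<close> with arbitrary \<open>e > 0\<close> is absorbed later by the Gaussian decay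
  of \<open>exp (\<rho>\<^sup>2 \<phi>)\<close>; it makes every factor \<open>x - y\<close> count as \<open>1 / \<rho>\<close>.\<close>

definition obnd :: "real^'n::finite \<Rightarrow> int \<Rightarrow> (real \<Rightarrow> real^'n \<Rightarrow> complex) \<Rightarrow> bool" where
  "obnd y l u \<longleftrightarrow> (\<forall>e>0. \<exists>C. \<forall>\<rho>\<ge>1. \<forall>x.
     norm (u \<rho> x) \<le> C * \<rho> powi l * exp (e * (\<rho> * norm (x - y))\<^sup>2))"

text \<open>A derivative and the removal of a factor \<open>x - y\<close> cost the same, one power
  of \<open>\<rho>\<close>. A single integer \<open>m\<close> therefore records the order of a
  family that lives on the scale \<open>1/\<rho>\<close>.\<close>

definition osym :: "real^'n::finite \<Rightarrow> int \<Rightarrow> (real \<Rightarrow> real^'n \<Rightarrow> complex) \<Rightarrow> bool" where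
  "osym y m u \<longleftrightarrow> (\<forall>\<rho>. smooth_on UNIV (u \<rho>)) \<and>
     (\<forall>is. obnd y (int (length is) - m) (\<lambda>\<rho>. partials is (u \<rho>)))"

lemma obndI:
  assumes "\<And>e. e > 0 \<Longrightarrow> \<exists>C. \<forall>\<rho>\<ge>1. \<forall>x. norm (u \<rho> x) \<le> C * \<rho> powi l * exp (e * (\<rho> * norm (x - y))\<^sup>2)"
  shows "obnd y l u"
  using assms unfolding obnd_def by blast

lemma obndE:
  assumes "obnd y l u" "e > 0"
  obtains C where "C \<ge> 0" "\<And>\<rho> x. \<rho> \<ge> 1 \<Longrightarrow> norm (u \<rho> x) \<le> C * \<rho> powi l * exp (e * (\<rho> * norm (x - y))\<^sup>2)"
proof -
  obtain C where C: "\<And>\<rho> x. \<rho> \<ge> 1 \<Longrightarrow> norm (u \<rho> x) \<le> C * \<rho> powi l * exp (e * (\<rho> * norm (x - y))\<^sup>2)"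
    using assms unfolding obnd_def by blast
  have "C \<ge> 0" using order.trans[OF norm_ge_zero C[of 1 y]] by simp
  with C show ?thesis using that by blast
qed

lemma obnd_add:
  assumes "obnd y l u" "obnd y l v"
  shows "obnd y l (\<lambda>\<rho> x. u \<rho> x + v \<rho> x)"
proof (rule obndI)
  fix e :: real assume e: "e > 0"
  obtain C1 where 1: "\<And>\<rho> x. \<rho> \<ge> 1 \<Longrightarrow> norm (u \<rho> x) \<le> C1 * \<rho> powi l * exp (e * (\<rho> * norm (x - y))\<^sup>2)"
    using obndE[OF assms(1) e] by metis
  obtain C2 where 2: "\<And>\<rho> x. \<rho> \<ge> 1 \<Longrightarrow> norm (v \<rho> x) \<le> C2 * \<rho> powi l * exp (e * (\<rho> * norm (x - y))\<^sup>2)"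
    using obndE[OF assms(2) e] by metis
  have "norm (u \<rho> x + v \<rho> x) \<le> (C1 + C2) * \<rho> powi l * exp (e * (\<rho> * norm (x - y))\<^sup>2)" if "\<rho> \<ge> 1" for \<rho> x
    using norm_triangle_mono[OF 1[OF that] 2[OF that]] by (simp add: algebra_simps)
  then show "\<exists>C. \<forall>\<rho>\<ge>1. \<forall>x. norm (u \<rho> x + v \<rho> x) \<le> C * \<rho> powi l * exp (e * (\<rho> * norm (x - y))\<^sup>2)" by blast
qed

text \<open>That \<open>e\<close> is arbitrary is what closes the class under products: each factor
  is taken at \<open>e/2\<close>.\<close>

lemma obnd_mult:
  assumes "obnd y l u" "obnd y l' v"
  shows "obnd y (l + l') (\<lambda>\<rho> x. u \<rho> x * v \<rho> x)"
proof (rule obndI)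
  fix e :: real assume e: "e > 0"
  then have e2: "e/2 > 0" by simp
  obtain C1 where 1: "\<And>\<rho> x. \<rho> \<ge> 1 \<Longrightarrow> norm (u \<rho> x) \<le> C1 * \<rho> powi l * exp (e/2 * (\<rho> * norm (x - y))\<^sup>2)"
    using obndE[OF assms(1) e2] by metis
  obtain C2 where 2: "\<And>\<rho> x. \<rho> \<ge> 1 \<Longrightarrow> norm (v \<rho> x) \<le> C2 * \<rho> powi l' * exp (e/2 * (\<rho> * norm (x - y))\<^sup>2)"
    using obndE[OF assms(2) e2] by metis
  have "norm (u \<rho> x * v \<rho> x) \<le> (C1 * C2) * \<rho> powi (l + l') * exp (e * (\<rho> * norm (x - y))\<^sup>2)" if "\<rho> \<ge> 1" for \<rho> x
  proof -
    have "norm (u \<rho> x * v \<rho> x) \<le> (C1 * \<rho> powi l * exp (e/2 * (\<rho> * norm (x - y))\<^sup>2)) * (C2 * \<rho> powi l' * exp (e/2 * (\<rho> * norm (x - y))\<^sup>2))"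
      unfolding norm_mult using order.trans[OF norm_ge_zero 1[OF that]] by (intro mult_mono 1 2 that) auto
    also have "\<dots> = (C1 * C2) * \<rho> powi (l + l') * (exp (e/2 * (\<rho> * norm (x - y))\<^sup>2) * exp (e/2 * (\<rho> * norm (x - y))\<^sup>2))"
      using that by (simp add: power_int_add algebra_simps)
    also have "exp (e/2 * (\<rho> * norm (x - y))\<^sup>2) * exp (e/2 * (\<rho> * norm (x - y))\<^sup>2) = exp (e * (\<rho> * norm (x - y))\<^sup>2)"
      by (simp flip: exp_add)
    finally show ?thesis .
  qed
  then show "\<exists>C. \<forall>\<rho>\<ge>1. \<forall>x. norm (u \<rho> x * v \<rho> x) \<le> C * \<rho> powi (l + l') * exp (e * (\<rho> * norm (x - y))\<^sup>2)" by blast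
qed

lemma obnd_mono:
  assumes "obnd y l v" "l \<le> l'" "\<And>\<rho> x. \<rho> \<ge> 1 \<Longrightarrow> norm (u \<rho> x) \<le> K * norm (v \<rho> x)"
  shows "obnd y l' u"
proof (rule obndI)
  fix e :: real assume e: "e > 0"
  obtain C where C: "C \<ge> 0" "\<And>\<rho> x. \<rho> \<ge> 1 \<Longrightarrow> norm (v \<rho> x) \<le> C * \<rho> powi l * exp (e * (\<rho> * norm (x - y))\<^sup>2)"
    using obndE[OF assms(1) e] by metis
  have "norm (u \<rho> x) \<le> (\<bar>K\<bar> * C) * \<rho> powi l' * exp (e * (\<rho> * norm (x - y))\<^sup>2)" if "\<rho> \<ge> 1" for \<rho> x
  proof -
    have "norm (u \<rho> x) \<le> \<bar>K\<bar> * norm (v \<rho> x)"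
      using assms(3)[OF that, of x] by (meson abs_ge_self mult_right_mono norm_ge_zero order.trans)
    also have "\<dots> \<le> \<bar>K\<bar> * (C * \<rho> powi l * exp (e * (\<rho> * norm (x - y))\<^sup>2))"
      by (intro mult_left_mono C that) auto
    also have "\<dots> \<le> \<bar>K\<bar> * (C * \<rho> powi l' * exp (e * (\<rho> * norm (x - y))\<^sup>2))"
      using that assms(2) C(1) by (intro mult_left_mono mult_right_mono power_int_increasing) auto
    finally show ?thesis by (simp add: mult_ac)
  qed
  then show "\<exists>C. \<forall>\<rho>\<ge>1. \<forall>x. norm (u \<rho> x) \<le> C * \<rho> powi l' * exp (e * (\<rho> * norm (x - y))\<^sup>2)" by blast
qed

lemma obnd_const: "obnd y 0 (\<lambda>\<rho> x. a)"
  by (rule obndI, rule exI[of _ "norm a"]) (auto intro: mult_left_mono[of 1 _ "norm a", simplified])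

lemma obnd_dist: "obnd y (-1) (\<lambda>\<rho> x. of_real (norm (x - y)))"
proof (rule obndI)
  fix e :: real assume e: "e > 0"
  have "norm (of_real (norm (x - y)) :: complex) \<le> (1 + 1/e) * \<rho> powi (-1) * exp (e * (\<rho> * norm (x - y))\<^sup>2)" if "\<rho> \<ge> 1" for \<rho> and x :: "real^'a"
  proof -
    \<comment> \<open>In the scaled variable the claim is
      \<open>s \<le> (1 + 1/e) * exp (e * s\<^sup>2)\<close>, which follows from
      \<open>s \<le> 1 + s\<^sup>2\<close>.\<close>
    define s where "s = \<rho> * norm (x - y)"
    have "s \<le> 1 + s\<^sup>2" using zero_le_power2[of "s - 1/2"] by (simp add: power2_eq_square algebra_simps)
    also have "\<dots> \<le> 1 * exp (e * s\<^sup>2) + (1/e) * exp (e * s\<^sup>2)"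
    proof (rule add_mono)
      show "1 \<le> 1 * exp (e * s\<^sup>2)" using e by simp
      have "e * s\<^sup>2 \<le> exp (e * s\<^sup>2)" using exp_ge_add_one_self[of "e * s\<^sup>2"] by linarith
      then show "s\<^sup>2 \<le> (1/e) * exp (e * s\<^sup>2)" using e by (simp add: field_simps)
    qed
    finally have "s \<le> (1 + 1/e) * exp (e * s\<^sup>2)" by (simp add: algebra_simps)
    then show ?thesis using that unfolding s_def by (simp add: power_int_minus field_simps)
  qed
  then show "\<exists>C. \<forall>\<rho>\<ge>1. \<forall>x. norm (of_real (norm (x - y)) :: complex) \<le> C * \<rho> powi (-1) * exp (e * (\<rho> * norm (x - y))\<^sup>2)" by blast
qed

lemma obnd_dist_power: "obnd y (- int j) (\<lambda>\<rho> x. of_real (norm (x - y)) ^ j)"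
proof (induction j)
  case (Suc j)
  from obnd_mult[OF obnd_dist this] show ?case by simp
qed (simp add: obnd_const)

lemma partials_add:
  "smooth_on UNIV f \<Longrightarrow> smooth_on UNIV g \<Longrightarrow> partials is (\<lambda>x. f x + g x) = (\<lambda>x. partials is f x + partials is g x)"
  by (induction "is")
   (auto intro!: ext partial_add smooth_on_has_partial smooth_on_partials)

lemma partial_mult_fun:
  fixes f g :: "real^'n::finite \<Rightarrow> complex"
  shows "smooth_on UNIV f \<Longrightarrow> smooth_on UNIV g \<Longrightarrow> partial i (\<lambda>x. f x * g x) = (\<lambda>x. f x * partial i g x + partial i f x * g x)"
  by (auto intro!: ext partial_mult smooth_on_has_partial)

lemma partials_cmult:
  fixes f :: "real^'n::finite \<Rightarrow> complex"
  shows "smooth_on UNIV f \<Longrightarrow> partials is (\<lambda>x. a * f x) = (\<lambda>x. a * partials is f x)"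
  by (induction "is")
   (auto intro!: ext partial_bounded_linear(1)[OF bounded_linear_mult_right] smooth_on_has_partial smooth_on_partials)

lemma partials_sum:
  assumes "\<And>i. i \<in> I \<Longrightarrow> smooth_on UNIV (f i)"
  shows "partials is (\<lambda>x. \<Sum>i\<in>I. f i x) = (\<lambda>x. \<Sum>i\<in>I. partials is (f i) x)"
  using assms
proof (induction I rule: infinite_finite_induct)
  case (insert a I)
  then show ?case by (simp add: partials_add smooth_on_sum)
next
  case (infinite A)
  then show ?case by (induction "is") (auto simp: partial_const)
next
  case empty
  then show ?case by (induction "is") (auto simp: partial_const)
qed

lemma osym_smooth: "osym y m u \<Longrightarrow> smooth_on UNIV (u \<rho>)"
  by (simp add: osym_def)

lemma osym_obnd_partials: "osym y m u \<Longrightarrow> obnd y (int (length is) - m) (\<lambda>\<rho>. partials is (u \<rho>))"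
  unfolding osym_def by blast

lemma osym_obnd: "osym y m u \<Longrightarrow> obnd y (- m) u"
  using osym_obnd_partials[of y m u "[]"] by simp

lemma osym_partial: "osym y m u \<Longrightarrow> osym y (m - 1) (\<lambda>\<rho>. partial i (u \<rho>))"
  unfolding osym_def
proof (intro conjI allI, goal_cases)
  case (2 "is")
  then have "obnd y (int (length (is @ [i])) - m) (\<lambda>\<rho>. partials (is @ [i]) (u \<rho>))" by blast
  then show ?case by (simp add: partials_append algebra_simps)
qed (auto intro: smooth_on_partial)

lemma osym_step:
  assumes "\<And>\<rho>. smooth_on UNIV (u \<rho>)" "obnd y (- m) u" "\<And>i. osym y (m - 1) (\<lambda>\<rho>. partial i (u \<rho>))"
  shows "osym y m u"
  unfolding osym_def
proof (intro conjI allI)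
  fix "is" :: "'a list"
  show "obnd y (int (length is) - m) (\<lambda>\<rho>. partials is (u \<rho>))"
  proof (cases "is" rule: rev_cases)
    case (snoc js i)
    from osym_obnd_partials[OF assms(3)[of i], of js] show ?thesis
      by (simp add: snoc partials_append algebra_simps)
  qed (use assms(2) in simp)
qed (rule assms(1))

lemma osym_mono:
  assumes "osym y m u" "m' \<le> m"
  shows "osym y m' u"
  unfolding osym_def
  using assms by (auto simp: osym_smooth intro!: obnd_mono[OF osym_obnd_partials[OF assms(1)], where K=1])

lemma osym_add: "osym y m u \<Longrightarrow> osym y m v \<Longrightarrow> osym y m (\<lambda>\<rho> x. u \<rho> x + v \<rho> x)"
  unfolding osym_def by (auto simp: partials_add smooth_on_add obnd_add)

lemma obnd_cmult: "obnd y l u \<Longrightarrow> obnd y l (\<lambda>\<rho> x. a * u \<rho> x)"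
  by (erule obnd_mono[where K="norm a"]) (simp_all add: norm_mult)

lemma osym_cmult: "osym y m u \<Longrightarrow> osym y m (\<lambda>\<rho> x. a * u \<rho> x)"
  unfolding osym_def by (simp add: partials_cmult smooth_on_cmult obnd_cmult)

lemma osym_mult:
  assumes "osym y m u" "osym y m' v"
  shows "osym y (m + m') (\<lambda>\<rho> x. u \<rho> x * v \<rho> x)"
proof -
  have "osym y m u \<Longrightarrow> osym y m' v \<Longrightarrow>
    obnd y (int (length is) - (m + m')) (\<lambda>\<rho>. partials is (\<lambda>x. u \<rho> x * v \<rho> x))" for "is" m m' u v
  proof (induction "is" arbitrary: u v m m' rule: rev_induct)
    case Nil
    from obnd_mult[OF osym_obnd[OF Nil(1)] osym_obnd[OF Nil(2)]] show ?case by simp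
  next
    case (snoc i js)
    note s = osym_smooth[OF snoc.prems(1)] osym_smooth[OF snoc.prems(2)]
    have eq: "partials (js @ [i]) (\<lambda>x. u \<rho> x * v \<rho> x) =
      (\<lambda>x. partials js (\<lambda>x. u \<rho> x * partial i (v \<rho>) x) x + partials js (\<lambda>x. partial i (u \<rho>) x * v \<rho> x) x)" for \<rho>
      unfolding partials_append using s
      by (simp add: partial_mult_fun partials_add smooth_on_mult smooth_on_partial)
    from snoc.IH[OF snoc.prems(1) osym_partial[OF snoc.prems(2)]] snoc.IH[OF osym_partial[OF snoc.prems(1)] snoc.prems(2)]
    have "obnd y (int (length (js @ [i])) - (m + m')) (\<lambda>\<rho>. partials js (\<lambda>x. u \<rho> x * partial i (v \<rho>) x))"
      "obnd y (int (length (js @ [i])) - (m + m')) (\<lambda>\<rho>. partials js (\<lambda>x. partial i (u \<rho>) x * v \<rho> x))"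
      by (simp_all add: algebra_simps)
    from obnd_add[OF this] show ?case unfolding eq .
  qed
  with assms show ?thesis unfolding osym_def by (auto intro: smooth_on_mult)
qed

lemma partials_const: "partials is (\<lambda>x. a) = (\<lambda>x. if is = [] then a else 0)"
proof (induction "is")
  case (Cons i "is")
  have "partial i (\<lambda>x. if b then a else 0) = (\<lambda>x. 0)" for b using partial_const by blast
  then show ?case using Cons by auto
qed auto

lemma osym_const: "osym y 0 (\<lambda>\<rho> x. a)"
proof -
  have "obnd y (int (length is)) (\<lambda>\<rho> x. if is = [] then a else 0)" for "is" :: "'a list"
    by (rule obnd_mono[OF obnd_const[of y a], where K=1]) auto
  then show ?thesis unfolding osym_def by (auto simp: partials_const smooth_on_const)
qed

lemma osym_zero: "osym y m (\<lambda>\<rho> x. 0)"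
proof -
  have "obnd y k (\<lambda>\<rho> x. 0)" for k by (rule obndI, rule exI[of _ 0]) auto
  then show ?thesis unfolding osym_def by (simp add: partials_const smooth_on_const)
qed

lemma osym_rho: "osym y (- j) (\<lambda>\<rho> x. of_real (\<rho> powi j))"
  unfolding osym_def
proof (intro conjI allI)
  fix "is" :: "'a list"
  have "obnd y j (\<lambda>\<rho> x. of_real (\<rho> powi j))"
  proof (rule obndI, rule exI[of _ 1], intro allI impI)
    fix e \<rho> :: real and x assume e: "e > 0" "\<rho> \<ge> 1"
    then have "\<rho> powi j * 1 \<le> \<rho> powi j * exp (e * (\<rho> * norm (x - y))\<^sup>2)" by (intro mult_left_mono) auto
    then show "norm (of_real (\<rho> powi j) :: complex) \<le> 1 * \<rho> powi j * exp (e * (\<rho> * norm (x - y))\<^sup>2)" using e by (simp add: norm_power_int)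
  qed
  from obnd_mono[OF this, where K=1] show "obnd y (int (length is) - - j) (\<lambda>\<rho>. partials is (\<lambda>x. of_real (\<rho> powi j)))"
    by (simp add: partials_const)
qed (simp add: smooth_on_const)

lemma osym_coord: "osym y 1 (\<lambda>\<rho> x. of_real (x $ i - y $ i))"
proof (rule osym_step)
  show "smooth_on UNIV (\<lambda>x. complex_of_real (x $ i - y $ i))" by (intro smooth_intros)
  show "obnd y (- 1) (\<lambda>\<rho> x. of_real (x $ i - y $ i))"
  proof (rule obnd_mono[OF obnd_dist[of y] order.refl, where K=1])
    fix \<rho> :: real and x :: "real^'a"
    show "norm (complex_of_real (x $ i - y $ i)) \<le> 1 * norm (complex_of_real (norm (x - y)))"
      using component_le_norm_cart[of "x - y" i] by (simp flip: of_real_diff)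
  qed
  fix j
  have s: "smooth_on UNIV (\<lambda>x::real^'a. x $ i)" "smooth_on UNIV (\<lambda>x::real^'a. - (y $ i))" by (intro smooth_intros)+
  have "partial j (\<lambda>x::real^'a. x $ i + - (y $ i)) = (\<lambda>x. if j = i then 1 else 0)"
    using partial_add(1)[OF smooth_on_has_partial[OF s(1)] smooth_on_has_partial[OF s(2)]]
    by (auto simp: partial_coord partial_const)
  moreover have "partial j (\<lambda>x::real^'a. complex_of_real (x $ i + - (y $ i))) x = of_real (partial j (\<lambda>x. x $ i + - (y $ i)) x)" for x
    by (rule partial_bounded_linear(1)[OF bounded_linear_of_real smooth_on_has_partial[OF smooth_on_add[OF open_UNIV s]]]) simp
  ultimately have "partial j (\<lambda>x::real^'a. complex_of_real (x $ i - y $ i)) = (\<lambda>x. if j = i then 1 else 0)"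
    by (intro ext) simp
  then show "osym y (1 - 1) (\<lambda>\<rho>::real. partial j (\<lambda>x::real^'a. complex_of_real (x $ i - y $ i)))"
    using osym_const[of y "if j = i then 1 else 0"] by simp
qed

definition bsmooth :: "(real^'n::finite \<Rightarrow> complex) \<Rightarrow> bool" where
  "bsmooth f \<longleftrightarrow> smooth_on UNIV f \<and> (\<forall>is. \<exists>B. \<forall>x. norm (partials is f x) \<le> B)"

lemma osym_bsmooth:
  assumes "bsmooth f"
  shows "osym y 0 (\<lambda>\<rho>. f)"
  unfolding osym_def
proof (intro conjI allI)
  fix "is" :: "'a list"
  obtain B where B: "\<And>x. norm (partials is f x) \<le> B" using assms unfolding bsmooth_def by blast
  show "obnd y (int (length is) - 0) (\<lambda>\<rho>. partials is f)"
    by (rule obnd_mono[OF obnd_const[of y 1], where K=B]) (use B in auto)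
qed (use assms bsmooth_def in auto)

text \<open>Where \<open>f\<close> does not vanish, \<open>norm (x - y) / r\<close> is at least 1,
  so any power of it may be inserted, and each such factor is worth \<open>1/\<rho>\<close>. This is
  how cutting off near \<open>y\<close> becomes harmless.\<close>

lemma osym_flat:
  assumes f: "bsmooth f" and r: "r > 0" and z: "\<And>x. norm (x - y) < r \<Longrightarrow> f x = 0"
  shows "osym y m (\<lambda>\<rho>. f)"
  unfolding osym_def
proof (intro conjI allI)
  fix "is" :: "'a list"
  obtain B where B: "\<And>x. norm (partials is f x) \<le> B" using f unfolding bsmooth_def by blast
  have B0: "B \<ge> 0" using order.trans[OF norm_ge_zero B] .
  show "obnd y (int (length is) - m) (\<lambda>\<rho>. partials is f)"
  proof (rule obnd_mono[OF obnd_dist_power[of y "nat m"], where K="B / r ^ nat m"])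
    fix x :: "real^'a"
    have "r ^ nat m > 0" using r by simp
    show "norm (partials is f x) \<le> B / r ^ nat m * norm (complex_of_real (norm (x - y)) ^ nat m)"
    proof (cases "norm (x - y) < r")
      case True
      have "open (ball y r)" "x \<in> ball y r" "\<And>x. x \<in> ball y r \<Longrightarrow> f x = (\<lambda>x. 0) x"
        using True z by (auto simp: dist_norm norm_minus_commute)
      from partials_cong[OF this(1,3,2)] have "partials is f x = 0" by (simp add: partials_const)
      then show ?thesis using B0 r by simp
    next
      case False
      then have "r ^ nat m \<le> norm (x - y) ^ nat m" using r by (intro power_mono) auto
      then have "B * 1 \<le> B * (norm (x - y) ^ nat m / r ^ nat m)" using r by (intro mult_left_mono B0) simp
      with B[of x] show ?thesis by (simp add: norm_power)
    qed
  qed auto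
qed (use f bsmooth_def in auto)

lemma bsmooth_const: "bsmooth (\<lambda>x. a)"
  unfolding bsmooth_def by (auto simp: smooth_on_const partials_const)

lemma bsmooth_add: "bsmooth f \<Longrightarrow> bsmooth g \<Longrightarrow> bsmooth (\<lambda>x. f x + g x)"
  unfolding bsmooth_def
  by (auto simp: smooth_on_add partials_add) (meson norm_triangle_mono)

lemma bsmooth_hquot: "bsmooth f \<Longrightarrow> bsmooth (hquot y i f)"
  unfolding bsmooth_def
proof (intro conjI allI, goal_cases)
  case (2 "is")
  then obtain B where "\<And>x. norm (partials (is @ [i]) f x) \<le> B" by blast
  then show ?case using norm_partials_hquot_le[of f "is" i B y] 2 by (auto simp: partials_append)
qed (auto intro: smooth_hquot)

lemma bsmooth_compact_support:
  assumes f: "smooth_on UNIV f" and r: "\<And>x. norm (x - y) \<ge> r \<Longrightarrow> f x = 0"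
  shows "bsmooth f"
  unfolding bsmooth_def
proof (intro conjI allI f)
  fix "is" :: "'a list"
  have "compact (partials is f ` cball y r)"
    by (intro compact_continuous_image compact_cball continuous_on_subset[OF smooth_on_continuous[OF smooth_on_partials[OF f]]]) auto
  then obtain B where B: "\<And>x. x \<in> cball y r \<Longrightarrow> norm (partials is f x) \<le> B"
    by (meson bounded_iff compact_imp_bounded imageI)
  have "norm (partials is f x) \<le> max B 0" for x
  proof (cases "x \<in> cball y r")
    case False
    have "open (- cball y r)" "x \<in> - cball y r" "\<And>x. x \<in> - cball y r \<Longrightarrow> f x = (\<lambda>x. 0) x"
      using False r by (auto simp: dist_norm norm_minus_commute)
    from partials_cong[OF this(1,3,2)] show ?thesis by (simp add: partials_const)
  qed (use B in \<open>auto simp: le_max_iff_disj\<close>)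
  then show "\<exists>B. \<forall>x. norm (partials is f x) \<le> B" by blast
qed

text \<open>Keeps \<open>complex_of_real (x $ i - y $ i)\<close> in one piece, the form in which the
  coordinate functions are differentiated and graded below.\<close>

declare of_real_diff [simp del]

lemma osym_cong:
  assumes "osym y m u" "\<And>\<rho>. \<rho> \<ge> 1 \<Longrightarrow> v \<rho> = u \<rho>" "\<And>\<rho>. smooth_on UNIV (v \<rho>)"
  shows "osym y m v"
  unfolding osym_def
proof (intro conjI allI assms(3))
  fix "is"
  show "obnd y (int (length is) - m) (\<lambda>\<rho>. partials is (v \<rho>))"
    by (rule obnd_mono[OF osym_obnd_partials[OF assms(1), of "is"], where K=1]) (use assms(2) in auto)
qed

section \<open>Polynomial families in \<open>x - y\<close> and powers of
  \<open>\<rho>\<close>\<close>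

lemma smooth_coord_diff: "smooth_on UNIV (\<lambda>x. complex_of_real (x $ i - a))"
  by (intro smooth_intros)

lemma partial_coord_diff: "partial j (\<lambda>x::real^'n::finite. complex_of_real (x $ i - a)) = (\<lambda>x. if j = i then 1 else 0)"
proof (rule ext)
  fix x :: "real^'n"
  have s: "smooth_on UNIV (\<lambda>x::real^'n. x $ i)" "smooth_on UNIV (\<lambda>x::real^'n. - a)" by (intro smooth_intros)+
  have "partial j (\<lambda>x::real^'n. complex_of_real (x $ i + - a)) x = of_real (partial j (\<lambda>x. x $ i + - a) x)"
    by (rule partial_bounded_linear(1)[OF bounded_linear_of_real smooth_on_has_partial[OF smooth_on_add[OF open_UNIV s]]]) simp
  also have "partial j (\<lambda>x::real^'n. x $ i + - a) x = (if j = i then 1 else 0)"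
    using partial_add(1)[OF smooth_on_has_partial[OF s(1)] smooth_on_has_partial[OF s(2)]]
    by (simp add: partial_coord partial_const)
  finally show "partial j (\<lambda>x. complex_of_real (x $ i - a)) x = (if j = i then 1 else 0)" by simp
qed

lemma partial_add_fun:
  "smooth_on UNIV f \<Longrightarrow> smooth_on UNIV g \<Longrightarrow> partial i (\<lambda>x. f x + g x) = (\<lambda>x. partial i f x + partial i g x)"
  using partials_add[of f g "[i]"] by simp

lemma partial_cmult_fun:
  fixes f :: "real^'n::finite \<Rightarrow> complex"
  shows "smooth_on UNIV f \<Longrightarrow> partial i (\<lambda>x. a * f x) = (\<lambda>x. a * partial i f x)"
  using partials_cmult[of f "[i]" a] by simp

lemma partial_zero_fun: "partial i (\<lambda>x. 0) = (\<lambda>x. 0)"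
  using partial_const by blast

text \<open>Polynomials in \<open>x - y\<close> whose coefficients are powers of
  \<open>\<rho>\<close>, graded by weight. Generating them by rules makes closure under products and
  the nilpotency of constant vector fields plain rule inductions.\<close>

inductive pfam :: "real^'n::finite \<Rightarrow> int \<Rightarrow> (real \<Rightarrow> real^'n \<Rightarrow> complex) \<Rightarrow> bool" for y where
  pfam_const: "pfam y 0 (\<lambda>\<rho> x. a)"
| pfam_mono: "pfam y m u \<Longrightarrow> m' \<le> m \<Longrightarrow> pfam y m' u"
| pfam_add: "pfam y m u \<Longrightarrow> pfam y m v \<Longrightarrow> pfam y m (\<lambda>\<rho> x. u \<rho> x + v \<rho> x)"
| pfam_cmult: "pfam y m u \<Longrightarrow> pfam y m (\<lambda>\<rho> x. a * u \<rho> x)"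
| pfam_coord: "pfam y m u \<Longrightarrow> pfam y (m + 1) (\<lambda>\<rho> x. of_real (x $ i - y $ i) * u \<rho> x)"
| pfam_rho: "pfam y m u \<Longrightarrow> pfam y (m - j) (\<lambda>\<rho> x. of_real (\<rho> powi j) * u \<rho> x)"

lemma pfam_zero: "pfam y m (\<lambda>\<rho> x. 0)"
  using pfam_rho[OF pfam_const[of y 0], of "-m"] by simp

lemma pfam_osym: "pfam y m u \<Longrightarrow> osym y m u"
proof (induction rule: pfam.induct)
  case (pfam_coord m u i)
  from osym_mult[OF osym_coord this(2)] show ?case by (simp add: add.commute)
next
  case (pfam_rho m u j)
  from osym_mult[OF osym_rho this(2), of j] show ?case by simp
qed (auto intro: osym_const osym_mono osym_add osym_cmult)

lemma pfam_smooth: "pfam y m u \<Longrightarrow> smooth_on UNIV (u \<rho>)"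
  by (blast dest: pfam_osym osym_smooth)

lemma pfam_partial: "pfam y m u \<Longrightarrow> pfam y (m - 1) (\<lambda>\<rho>. partial i (u \<rho>))"
proof (induction rule: pfam.induct)
  case (pfam_const a)
  have "partial i (\<lambda>x. a) = (\<lambda>x. 0)" using partial_const by blast
  then show ?case using pfam_zero[of y "-1"] by simp
next
  case (pfam_mono m u m')
  then show ?case by (auto elim: pfam.pfam_mono)
next
  case (pfam_add m u v)
  then show ?case using pfam.pfam_add[OF pfam_add.IH] by (simp add: partial_add_fun pfam_smooth)
next
  case (pfam_cmult m u a)
  then show ?case using pfam.pfam_cmult[OF pfam_cmult.IH] by (simp add: partial_cmult_fun pfam_smooth)
next
  case (pfam_coord m u j)
  have "partial i (\<lambda>x. of_real (x $ j - y $ j) * u \<rho> x) = (\<lambda>x. of_real (x $ j - y $ j) * partial i (u \<rho>) x + (if i = j then 1 else 0) * u \<rho> x)" for \<rho>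
    using partial_mult_fun[OF smooth_coord_diff pfam_smooth[OF pfam_coord.hyps]] by (simp add: partial_coord_diff)
  moreover have "pfam y m (\<lambda>\<rho> x. of_real (x $ j - y $ j) * partial i (u \<rho>) x + (if i = j then 1 else 0) * u \<rho> x)"
    by (intro pfam.pfam_add pfam.pfam_cmult pfam_coord.hyps) (use pfam.pfam_coord[OF pfam_coord.IH] in simp)
  ultimately show ?case by simp
next
  case (pfam_rho m u j)
  have "pfam y (m - j - 1) (\<lambda>\<rho> x. of_real (\<rho> powi j) * partial i (u \<rho>) x)"
  proof -
    have e: "m - j - 1 = m - 1 - j" by simp
    show ?thesis unfolding e by (rule pfam.pfam_rho[OF pfam_rho.IH])
  qed
  then show ?case using pfam_rho.hyps by (simp add: partial_cmult_fun pfam_smooth)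
qed

lemma pfam_mult: "pfam y m u \<Longrightarrow> pfam y m' v \<Longrightarrow> pfam y (m + m') (\<lambda>\<rho> x. u \<rho> x * v \<rho> x)"
proof (induction rule: pfam.induct)
  case (pfam_const a)
  then show ?case using pfam_cmult by simp
next
  case (pfam_mono m u m'')
  then show ?case by (auto elim: pfam.pfam_mono)
next
  case (pfam_add m u w)
  then show ?case using pfam.pfam_add[OF pfam_add.IH(1,2)] by (simp add: algebra_simps)
next
  case (pfam_cmult m u a)
  then show ?case using pfam.pfam_cmult[OF pfam_cmult.IH] by (simp add: algebra_simps)
next
  case (pfam_coord m u j)
  then show ?case using pfam.pfam_coord[OF pfam_coord.IH] by (simp add: mult.assoc add_ac)
next
  case (pfam_rho m u j)
  then show ?case using pfam.pfam_rho[OF pfam_rho.IH] by (simp add: mult.assoc algebra_simps)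
qed

lemma pfam_sum:
  "(\<And>i. i \<in> I \<Longrightarrow> pfam y m (u i)) \<Longrightarrow> pfam y m (\<lambda>\<rho> x. \<Sum>i\<in>I. u i \<rho> x)"
  by (induction I rule: infinite_finite_induct) (auto simp: pfam_zero intro: pfam_add)

lemma osym_sum:
  "(\<And>i. i \<in> I \<Longrightarrow> osym y m (u i)) \<Longrightarrow> osym y m (\<lambda>\<rho> x. \<Sum>i\<in>I. u i \<rho> x)"
  by (induction I rule: infinite_finite_induct) (auto simp: osym_zero intro: osym_add)

subsection \<open>Constant vector fields on polynomial families\<close>

definition vfield :: "('n \<Rightarrow> complex) \<Rightarrow> (real \<Rightarrow> real^'n::finite \<Rightarrow> complex) \<Rightarrow> real \<Rightarrow> real^'n \<Rightarrow> complex" where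
  "vfield a u = (\<lambda>\<rho> x. \<Sum>i\<in>UNIV. a i * partial i (u \<rho>) x)"

lemma pfam_vfield: "pfam y m u \<Longrightarrow> pfam y (m - 1) (vfield a u)"
  unfolding vfield_def by (intro pfam_sum pfam_cmult pfam_partial)

lemma vfield_add: "(\<And>\<rho>. smooth_on UNIV (u \<rho>)) \<Longrightarrow> (\<And>\<rho>. smooth_on UNIV (v \<rho>)) \<Longrightarrow>
   vfield a (\<lambda>\<rho> x. u \<rho> x + v \<rho> x) = (\<lambda>\<rho> x. vfield a u \<rho> x + vfield a v \<rho> x)"
  unfolding vfield_def by (simp add: partial_add_fun sum.distrib algebra_simps)

lemma vfield_cmult: "(\<And>\<rho>. smooth_on UNIV (u \<rho>)) \<Longrightarrow>
   vfield a (\<lambda>\<rho> x. b \<rho> * u \<rho> x) = (\<lambda>\<rho> x. b \<rho> * vfield a u \<rho> x)"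
  unfolding vfield_def by (simp add: partial_cmult_fun sum_distrib_left algebra_simps)

lemma vfield_mult: "(\<And>\<rho>. smooth_on UNIV (u \<rho>)) \<Longrightarrow> (\<And>\<rho>. smooth_on UNIV (v \<rho>)) \<Longrightarrow>
   vfield a (\<lambda>\<rho> x. u \<rho> x * v \<rho> x) = (\<lambda>\<rho> x. u \<rho> x * vfield a v \<rho> x + vfield a u \<rho> x * v \<rho> x)"
  unfolding vfield_def by (simp add: partial_mult_fun sum.distrib sum_distrib_left sum_distrib_right algebra_simps)

lemma vfield_coord: "vfield a (\<lambda>\<rho> x. of_real (x $ i - c)) = (\<lambda>\<rho> x. a i)"
  unfolding vfield_def by (simp add: partial_coord_diff if_distrib[where f="\<lambda>z. _ * z"] cong: if_cong)

lemma vfield_zero: "vfield a (\<lambda>\<rho> x. 0) = (\<lambda>\<rho> x. 0)"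
  unfolding vfield_def by (simp add: partial_zero_fun)

lemma vfield_zero_pow: "(vfield a ^^ N) (\<lambda>\<rho> x. 0) = (\<lambda>\<rho> x. 0)"
  by (induction N) (simp_all add: vfield_zero)

lemma vfield_smooth: "(\<And>\<rho>. smooth_on UNIV (u \<rho>)) \<Longrightarrow> smooth_on UNIV (vfield a u \<rho>)"
  unfolding vfield_def by (intro smooth_intros smooth_on_cmult smooth_on_partial)

lemma vfield_pow_smooth: "(\<And>\<rho>. smooth_on UNIV (u \<rho>)) \<Longrightarrow> smooth_on UNIV ((vfield a ^^ N) u \<rho>)"
  by (induction N arbitrary: \<rho>) (simp_all add: vfield_smooth)

lemma vfield_pow_add: "(\<And>\<rho>. smooth_on UNIV (u \<rho>)) \<Longrightarrow> (\<And>\<rho>. smooth_on UNIV (v \<rho>)) \<Longrightarrow>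
   (vfield a ^^ N) (\<lambda>\<rho> x. u \<rho> x + v \<rho> x) = (\<lambda>\<rho> x. (vfield a ^^ N) u \<rho> x + (vfield a ^^ N) v \<rho> x)"
  by (induction N) (simp_all add: vfield_add vfield_pow_smooth)

lemma vfield_pow_cmult: "(\<And>\<rho>. smooth_on UNIV (u \<rho>)) \<Longrightarrow>
   (vfield a ^^ N) (\<lambda>\<rho> x. b \<rho> * u \<rho> x) = (\<lambda>\<rho> x. b \<rho> * (vfield a ^^ N) u \<rho> x)"
  by (induction N) (simp_all add: vfield_cmult vfield_pow_smooth)

lemma vfield_pow_zero_mono: "(vfield a ^^ N) u = (\<lambda>\<rho> x. 0) \<Longrightarrow> N \<le> M \<Longrightarrow> (vfield a ^^ M) u = (\<lambda>\<rho> x. 0)"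
  using vfield_zero_pow[where a=a and N="M - N"] by (metis funpow_add le_add_diff_inverse2 o_apply)

text \<open>Write \<open>D\<close> for the field. By Leibniz it sends \<open>x_i * u\<close> to
  \<open>x_i * D u + a i * u\<close>; the second term is killed by the same power as
  \<open>u\<close>, and in the first \<open>D u\<close> dies one step earlier.\<close>

lemma vfield_pow_coord_zero:
  assumes "\<And>\<rho>. smooth_on UNIV (u \<rho>)" "(vfield a ^^ N) u = (\<lambda>\<rho> x. 0)"
  shows "(vfield a ^^ Suc N) (\<lambda>\<rho> x. of_real (x $ i - c) * u \<rho> x) = (\<lambda>\<rho> x. 0)"
  using assms
proof (induction N arbitrary: u)
  case 0
  then show ?case by (simp add: vfield_zero)
next
  case (Suc N)
  have s: "smooth_on UNIV (vfield a u \<rho>)" for \<rho> using Suc.prems(1) by (rule vfield_smooth)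
  have "vfield a (\<lambda>\<rho> x. of_real (x $ i - c) * u \<rho> x) = (\<lambda>\<rho> x. of_real (x $ i - c) * vfield a u \<rho> x + a i * u \<rho> x)"
    using vfield_mult[OF smooth_coord_diff Suc.prems(1), where a=a] by (simp only: vfield_coord)
  then have "(vfield a ^^ Suc (Suc N)) (\<lambda>\<rho> x. of_real (x $ i - c) * u \<rho> x) =
    (vfield a ^^ Suc N) (\<lambda>\<rho> x. of_real (x $ i - c) * vfield a u \<rho> x + a i * u \<rho> x)"
    by (simp only: funpow_Suc_right o_apply)
  also have "\<dots> = (\<lambda>\<rho> x. (vfield a ^^ Suc N) (\<lambda>\<rho> x. of_real (x $ i - c) * vfield a u \<rho> x) \<rho> x + (vfield a ^^ Suc N) (\<lambda>\<rho> x. a i * u \<rho> x) \<rho> x)"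
    by (intro vfield_pow_add smooth_on_mult smooth_coord_diff s smooth_on_cmult Suc.prems open_UNIV)
  also have "(vfield a ^^ Suc N) (\<lambda>\<rho> x. of_real (x $ i - c) * vfield a u \<rho> x) = (\<lambda>\<rho> x. 0)"
    using Suc.prems(2) by (intro Suc.IH s) (simp only: funpow_Suc_right o_apply)
  also have "(vfield a ^^ Suc N) (\<lambda>\<rho> x. a i * u \<rho> x) = (\<lambda>\<rho> x. 0)"
    using vfield_pow_cmult[OF Suc.prems(1), where a=a and N="Suc N" and b="\<lambda>\<rho>. a i"] Suc.prems(2) by (simp only: mult_zero_right)
  finally show ?case by simp
qed

lemma pfam_vfield_nilpotent: "pfam y m u \<Longrightarrow> \<exists>N. (vfield a ^^ N) u = (\<lambda>\<rho> x. 0)"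
proof (induction rule: pfam.induct)
  case (pfam_const b)
  have "(vfield a ^^ 1) (\<lambda>\<rho> x. b) = (\<lambda>\<rho> x. 0)" by (simp add: vfield_def partial_const)
  then show ?case by blast
next
  case (pfam_add m u v)
  then obtain N M where "(vfield a ^^ N) u = (\<lambda>\<rho> x. 0)" "(vfield a ^^ M) v = (\<lambda>\<rho> x. 0)" by blast
  then have "(vfield a ^^ (max N M)) u = (\<lambda>\<rho> x. 0)" "(vfield a ^^ (max N M)) v = (\<lambda>\<rho> x. 0)"
    using vfield_pow_zero_mono max.cobounded1 max.cobounded2 by blast+
  then have "(vfield a ^^ (max N M)) (\<lambda>\<rho> x. u \<rho> x + v \<rho> x) = (\<lambda>\<rho> x. 0)"
    using pfam_add.hyps by (simp add: vfield_pow_add pfam_smooth)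
  then show ?case by blast
next
  case (pfam_cmult m u b)
  then obtain N where "(vfield a ^^ N) u = (\<lambda>\<rho> x. 0)" by blast
  then have "(vfield a ^^ N) (\<lambda>\<rho> x. b * u \<rho> x) = (\<lambda>\<rho> x. 0)"
    using vfield_pow_cmult[OF pfam_smooth[OF pfam_cmult.hyps], where a=a and N=N and b="\<lambda>\<rho>. b"] by simp
  then show ?case by blast
next
  case (pfam_coord m u i)
  then obtain N where "(vfield a ^^ N) u = (\<lambda>\<rho> x. 0)" by blast
  from vfield_pow_coord_zero[OF pfam_smooth[OF pfam_coord.hyps] this] show ?case by blast
next
  case (pfam_rho m u j)
  then obtain N where "(vfield a ^^ N) u = (\<lambda>\<rho> x. 0)" by blast
  then have "(vfield a ^^ N) (\<lambda>\<rho> x. of_real (\<rho> powi j) * u \<rho> x) = (\<lambda>\<rho> x. 0)"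
    using vfield_pow_cmult[OF pfam_smooth[OF pfam_rho.hyps], where a=a and N=N and b="\<lambda>\<rho>. of_real (\<rho> powi j)"] by simp
  then show ?case by blast
qed

text \<open>Integration by parts against a linear function \<open>l\<close> with
  \<open>D l = 1\<close>, where \<open>D\<close> is the field: since
  \<open>D (l^(k+1) q) = (k+1) l^k q + l^(k+1) D q\<close>, solving for \<open>l^k q\<close> reduces
  to solving for \<open>l^(k+1) D q\<close>, and nilpotency ends the recursion. Nothing here needs
  the coefficients of \<open>D\<close> to be real.\<close>

lemma pfam_vfield_solve:
  assumes q: "pfam y m q" and a: "a i \<noteq> 0"
  obtains g where "pfam y (m + 1) g" "vfield a g = q"
proof -
  define l where "l = (\<lambda>(\<rho>::real) x. inverse (a i) * complex_of_real (x $ i - y $ i))"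
  have pl: "pfam y 1 l" unfolding l_def
    using pfam_cmult[OF pfam_coord[OF pfam_const[of y 1]], of "inverse (a i)" i] by simp
  have Dl: "vfield a l = (\<lambda>\<rho> x. 1)"
    unfolding l_def using vfield_cmult[OF smooth_coord_diff, where a=a and b="\<lambda>_. inverse (a i)"] a by (simp add: vfield_coord)
  have pow: "pfam y (int k) (\<lambda>\<rho> x. l \<rho> x ^ k)" for k
  proof (induction k)
    case (Suc k)
    from pfam_mult[OF pl this] show ?case by simp
  qed (simp add: pfam_const)
  have Dpow: "vfield a (\<lambda>\<rho> x. l \<rho> x ^ Suc k) = (\<lambda>\<rho> x. of_nat (Suc k) * l \<rho> x ^ k)" for k
  proof (induction k)
    case (Suc k)
    have "vfield a (\<lambda>\<rho> x. l \<rho> x ^ Suc (Suc k)) = vfield a (\<lambda>\<rho> x. l \<rho> x * l \<rho> x ^ Suc k)" by simp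
    also have "\<dots> = (\<lambda>\<rho> x. l \<rho> x * vfield a (\<lambda>\<rho> x. l \<rho> x ^ Suc k) \<rho> x + vfield a l \<rho> x * l \<rho> x ^ Suc k)"
      by (rule vfield_mult[OF pfam_smooth[OF pl] pfam_smooth[OF pow]])
    also have "\<dots> = (\<lambda>\<rho> x. of_nat (Suc (Suc k)) * l \<rho> x ^ Suc k)"
      unfolding Suc Dl by (simp add: algebra_simps)
    finally show ?case .
  qed (simp add: Dl)
  have main: "(vfield a ^^ N) q = (\<lambda>\<rho> x. 0) \<Longrightarrow> pfam y m q \<Longrightarrow>
    \<exists>g. pfam y (m + 1 + int k) g \<and> vfield a g = (\<lambda>\<rho> x. l \<rho> x ^ k * q \<rho> x)" for N m q k
  proof (induction N arbitrary: q k m)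
    case 0
    then have "vfield a (\<lambda>\<rho> x. 0) = (\<lambda>\<rho> x. l \<rho> x ^ k * q \<rho> x)" by (simp add: vfield_zero)
    then show ?case using pfam_zero by blast
  next
    case (Suc N)
    have "(vfield a ^^ N) (vfield a q) = (\<lambda>\<rho> x. 0)" using Suc.prems(1) by (simp only: funpow_Suc_right o_apply)
    from Suc.IH[OF this pfam_vfield[OF Suc.prems(2)], of "Suc k"] obtain g' where
      g': "pfam y (m + 1 + int k) g'" "vfield a g' = (\<lambda>\<rho> x. l \<rho> x ^ Suc k * vfield a q \<rho> x)" by (auto simp: add_ac)
    define h where "h = (\<lambda>\<rho> x. l \<rho> x ^ Suc k * q \<rho> x)"
    define g where "g = (\<lambda>\<rho> x. inverse (of_nat (Suc k)) * (h \<rho> x + - 1 * g' \<rho> x))"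
    have ph: "pfam y (m + 1 + int k) h" unfolding h_def using pfam_mult[OF pow[of "Suc k"] Suc.prems(2)] by (simp add: add_ac)
    have pg: "pfam y (m + 1 + int k) g" unfolding g_def by (intro pfam_cmult pfam_add ph g')
    have "vfield a h = (\<lambda>\<rho> x. l \<rho> x ^ Suc k * vfield a q \<rho> x + of_nat (Suc k) * l \<rho> x ^ k * q \<rho> x)"
      unfolding h_def vfield_mult[OF pfam_smooth[OF pow] pfam_smooth[OF Suc.prems(2)]] Dpow by simp
    moreover have "vfield a g = (\<lambda>\<rho> x. inverse (of_nat (Suc k)) * (vfield a h \<rho> x + - 1 * vfield a g' \<rho> x))"
    proof -
      have s: "smooth_on UNIV (\<lambda>x. - 1 * g' \<rho> x)" "smooth_on UNIV (h \<rho>)" "smooth_on UNIV (g' \<rho>)" for \<rho>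
        using pfam_smooth ph g'(1) pfam_cmult by blast+
      then have s2: "smooth_on UNIV (\<lambda>x. h \<rho> x + - 1 * g' \<rho> x)" for \<rho> by (intro smooth_on_add) auto
      show ?thesis unfolding g_def using vfield_cmult[OF s2, where a=a and b="\<lambda>_. inverse (of_nat (Suc k))"]
          vfield_add[OF s(2) s(1), where a=a] vfield_cmult[OF s(3), where a=a and b="\<lambda>_. - 1"] by simp
    qed
    ultimately have "vfield a g = (\<lambda>\<rho> x. l \<rho> x ^ k * q \<rho> x)"
      unfolding g'(2) by (simp add: field_simps del: of_nat_Suc)
    with pg show ?case by blast
  qed
  obtain N where "(vfield a ^^ N) q = (\<lambda>\<rho> x. 0)" using pfam_vfield_nilpotent[OF q] by blast
  from main[OF this q, of 0] show ?thesis using that by auto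
qed

subsection \<open>Families with polynomial approximations\<close>

text \<open>Families with an asymptotic expansion. The transport equation is solved only for
  polynomial families, so every error term must be replaceable by one up to any prescribed order
  \<open>M\<close>.\<close>

definition apx :: "real^'n::finite \<Rightarrow> int \<Rightarrow> (real \<Rightarrow> real^'n \<Rightarrow> complex) \<Rightarrow> bool" where
  "apx y m u \<longleftrightarrow> osym y m u \<and> (\<forall>M. \<exists>q. pfam y m q \<and> osym y M (\<lambda>\<rho> x. u \<rho> x - q \<rho> x))"

lemma apx_osym: "apx y m u \<Longrightarrow> osym y m u" by (simp add: apx_def)

lemma apx_smooth: "apx y m u \<Longrightarrow> smooth_on UNIV (u \<rho>)" using apx_osym osym_smooth by blast

lemma apxE: assumes "apx y m u" obtains q where "pfam y m q" "osym y M (\<lambda>\<rho> x. u \<rho> x - q \<rho> x)"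
  using assms unfolding apx_def by blast

lemma pfam_apx: "pfam y m u \<Longrightarrow> apx y m u"
  unfolding apx_def using pfam_osym osym_zero by (auto intro!: exI[of _ u])

lemma apx_cong:
  assumes "apx y m u" "\<And>\<rho>. \<rho> \<ge> 1 \<Longrightarrow> v \<rho> = u \<rho>" "\<And>\<rho>. smooth_on UNIV (v \<rho>)"
  shows "apx y m v"
  unfolding apx_def
proof (intro conjI allI)
  show "osym y m v" using osym_cong[OF apx_osym[OF assms(1)] assms(2,3)] .
  fix M
  obtain q where q: "pfam y m q" "osym y M (\<lambda>\<rho> x. u \<rho> x - q \<rho> x)" by (rule apxE[OF assms(1)])
  have "osym y M (\<lambda>\<rho> x. v \<rho> x - q \<rho> x)"
    by (rule osym_cong[OF q(2)]) (use assms pfam_smooth[OF q(1)] in \<open>auto intro: smooth_on_diff\<close>)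
  with q show "\<exists>q. pfam y m q \<and> osym y M (\<lambda>\<rho> x. v \<rho> x - q \<rho> x)" by blast
qed

lemma apx_mono: "apx y m u \<Longrightarrow> m' \<le> m \<Longrightarrow> apx y m' u"
  unfolding apx_def using osym_mono pfam_mono by blast

lemma apx_add:
  assumes "apx y m u" "apx y m v"
  shows "apx y m (\<lambda>\<rho> x. u \<rho> x + v \<rho> x)"
  unfolding apx_def
proof (intro conjI allI)
  show "osym y m (\<lambda>\<rho> x. u \<rho> x + v \<rho> x)" using assms apx_osym osym_add by blast
  fix M
  obtain q where q: "pfam y m q" "osym y M (\<lambda>\<rho> x. u \<rho> x - q \<rho> x)" by (rule apxE[OF assms(1)])
  obtain r where r: "pfam y m r" "osym y M (\<lambda>\<rho> x. v \<rho> x - r \<rho> x)" by (rule apxE[OF assms(2)])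
  have "osym y M (\<lambda>\<rho> x. u \<rho> x + v \<rho> x - (q \<rho> x + r \<rho> x))"
    using osym_add[OF q(2) r(2)] by (simp add: algebra_simps)
  with pfam_add[OF q(1) r(1)] show "\<exists>q. pfam y m q \<and> osym y M (\<lambda>\<rho> x. u \<rho> x + v \<rho> x - q \<rho> x)" by blast
qed

lemma apx_mult:
  assumes "apx y m u" "apx y m' v"
  shows "apx y (m + m') (\<lambda>\<rho> x. u \<rho> x * v \<rho> x)"
  unfolding apx_def
proof (intro conjI allI)
  show "osym y (m + m') (\<lambda>\<rho> x. u \<rho> x * v \<rho> x)" using assms apx_osym osym_mult by blast
  fix M
  \<comment> \<open>The error of one factor is multiplied by the other factor, whose order
    \<open>m'\<close> may be negative; hence the shifted target \<open>M - m'\<close>.\<close>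
  obtain q where q: "pfam y m q" "osym y (M - m') (\<lambda>\<rho> x. u \<rho> x - q \<rho> x)" by (rule apxE[OF assms(1)])
  obtain r where r: "pfam y m' r" "osym y (M - m) (\<lambda>\<rho> x. v \<rho> x - r \<rho> x)" by (rule apxE[OF assms(2)])
  have "osym y M (\<lambda>\<rho> x. (u \<rho> x - q \<rho> x) * v \<rho> x)" "osym y M (\<lambda>\<rho> x. q \<rho> x * (v \<rho> x - r \<rho> x))"
    using osym_mult[OF q(2) apx_osym[OF assms(2)]] osym_mult[OF pfam_osym[OF q(1)] r(2)] by simp_all
  from osym_add[OF this] have "osym y M (\<lambda>\<rho> x. u \<rho> x * v \<rho> x - q \<rho> x * r \<rho> x)"
    by (simp add: algebra_simps)
  with pfam_mult[OF q(1) r(1)] show "\<exists>q. pfam y (m + m') q \<and> osym y M (\<lambda>\<rho> x. u \<rho> x * v \<rho> x - q \<rho> x)" by blast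
qed

lemma apx_partial:
  assumes "apx y m u"
  shows "apx y (m - 1) (\<lambda>\<rho>. partial i (u \<rho>))"
  unfolding apx_def
proof (intro conjI allI)
  show "osym y (m - 1) (\<lambda>\<rho>. partial i (u \<rho>))" using assms apx_osym osym_partial by blast
  fix M
  obtain q where q: "pfam y m q" "osym y (M + 1) (\<lambda>\<rho> x. u \<rho> x - q \<rho> x)" by (rule apxE[OF assms(1)])
  have "partial i (\<lambda>x. u \<rho> x + - 1 * q \<rho> x) = (\<lambda>x. partial i (u \<rho>) x - partial i (q \<rho>) x)" for \<rho>
    unfolding partial_add_fun[OF apx_smooth[OF assms] smooth_on_cmult[OF open_UNIV pfam_smooth[OF q(1)]]]
      partial_cmult_fun[OF pfam_smooth[OF q(1)]] by simp
  with osym_partial[OF q(2), of i] have "osym y M (\<lambda>\<rho> x. partial i (u \<rho>) x - partial i (q \<rho>) x)" by simp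
  with pfam_partial[OF q(1), of i] show "\<exists>q. pfam y (m - 1) q \<and> osym y M (\<lambda>\<rho> x. partial i (u \<rho>) x - q \<rho> x)" by blast
qed

lemma apx_const: "apx y 0 (\<lambda>\<rho> x. a)" by (intro pfam_apx pfam_const)
lemma apx_zero: "apx y m (\<lambda>\<rho> x. 0)" by (intro pfam_apx pfam_zero)
lemma apx_cmult: "apx y m u \<Longrightarrow> apx y m (\<lambda>\<rho> x. a * u \<rho> x)"
  using apx_mult[OF apx_const] by fastforce
lemma apx_rho: "apx y m u \<Longrightarrow> apx y (m - j) (\<lambda>\<rho> x. of_real (\<rho> powi j) * u \<rho> x)"
  using apx_mult[OF pfam_apx[OF pfam_rho[OF pfam_const[of y 1], of j]]] by fastforce
lemma apx_coord: "apx y m u \<Longrightarrow> apx y (m + 1) (\<lambda>\<rho> x. of_real (x $ i - y $ i) * u \<rho> x)"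
  using apx_mult[OF pfam_apx[OF pfam_coord[OF pfam_const[of y 1], of i]], of m u] by (simp add: add.commute)
lemma apx_sum: "(\<And>i. i \<in> I \<Longrightarrow> apx y m (u i)) \<Longrightarrow> apx y m (\<lambda>\<rho> x. \<Sum>i\<in>I. u i \<rho> x)"
  by (induction I rule: infinite_finite_induct) (auto simp: apx_zero intro: apx_add)

text \<open>Taylor expansion by iterating Hadamard's formula: every round brings out one more factor
  \<open>x - y\<close> and so gains one order.\<close>

lemma apx_bsmooth:
  assumes "bsmooth f"
  shows "apx y 0 (\<lambda>\<rho>. f)"
proof -
  have main: "\<exists>q. pfam y 0 q \<and> osym y (int J) (\<lambda>\<rho> x. f x - q \<rho> x)" if "bsmooth f" for J and f :: "real^'a \<Rightarrow> complex"
    using that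
  proof (induction J arbitrary: f)
    case 0
    then show ?case using osym_bsmooth[OF 0] pfam_zero[of y 0] by (intro exI[of _ "\<lambda>\<rho> x. 0"]) simp
  next
    case (Suc J)
    have "\<forall>i. \<exists>q. pfam y 0 q \<and> osym y (int J) (\<lambda>\<rho> x. hquot y i f x - q \<rho> x)"
      using Suc.IH bsmooth_hquot[OF Suc.prems] by blast
    then obtain q where q: "\<And>i. pfam y 0 (q i)" "\<And>i. osym y (int J) (\<lambda>\<rho> x. hquot y i f x - q i \<rho> x)" by metis
    define r where "r = (\<lambda>\<rho> x. f y + (\<Sum>i\<in>UNIV. of_real (x $ i - y $ i) * q i \<rho> x))"
    have "pfam y 0 r" unfolding r_def
      by (intro pfam_add pfam_const pfam_sum pfam_mono[OF pfam_coord[OF q(1)]]) simp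
    have "osym y (1 + int J) (\<lambda>\<rho> x. \<Sum>i\<in>UNIV. of_real (x $ i - y $ i) * (hquot y i f x - q i \<rho> x))"
      by (intro osym_sum osym_mult osym_coord q(2))
    moreover have "(\<lambda>\<rho> x. \<Sum>i\<in>UNIV. of_real (x $ i - y $ i) * (hquot y i f x - q i \<rho> x)) = (\<lambda>\<rho> x. f x - r \<rho> x)"
    proof (intro ext)
      fix \<rho> x
      have "f x = f y + (\<Sum>i\<in>UNIV. of_real (x $ i - y $ i) * hquot y i f x)"
        using hadamard[of f x y] Suc.prems by (simp add: bsmooth_def scaleR_conv_of_real)
      then show "(\<Sum>i\<in>UNIV. of_real (x $ i - y $ i) * (hquot y i f x - q i \<rho> x)) = f x - r \<rho> x"
        by (simp add: r_def right_diff_distrib sum_subtractf)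
    qed
    ultimately have "osym y (int (Suc J)) (\<lambda>\<rho> x. f x - r \<rho> x)" by simp
    with \<open>pfam y 0 r\<close> show ?case by blast
  qed
  show ?thesis unfolding apx_def
  proof (intro conjI allI osym_bsmooth assms)
    fix M
    from main[OF assms, of "nat M"] obtain q where "pfam y 0 q" "osym y (int (nat M)) (\<lambda>\<rho> x. f x - q \<rho> x)" by blast
    then show "\<exists>q. pfam y 0 q \<and> osym y M (\<lambda>\<rho> x. f x - q \<rho> x)" by (metis osym_mono nat_le_eq_zle int_nat_eq linear nle_le)
  qed
qed

section \<open>Approximate null solutions\<close>

fun lmono :: "('n \<Rightarrow> complex) \<Rightarrow> 'n list \<Rightarrow> complex" where
  "lmono \<zeta> [] = 1"
| "lmono \<zeta> (i # is) = \<zeta> i * lmono \<zeta> is"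

text \<open>The formal derivative of \<open>lmono\<close> with respect to the variable
  \<open>\<zeta> j\<close>, by the Leibniz rule along the list.\<close>

fun ldmono :: "('n \<Rightarrow> complex) \<Rightarrow> 'n \<Rightarrow> 'n list \<Rightarrow> complex" where
  "ldmono \<zeta> j [] = 0"
| "ldmono \<zeta> j (i # is) = (if i = j then lmono \<zeta> is else 0) + \<zeta> i * ldmono \<zeta> j is"

locale phase =
  fixes y :: "real^'n::finite" and \<zeta> :: "'n \<Rightarrow> complex" and S :: "'n \<Rightarrow> 'n \<Rightarrow> complex"
  assumes S_sym: "S i j = S j i"
begin

text \<open>The gradient of the quadratic phase \<open>phi\<close> minus its value
  \<open>\<zeta>\<close> at \<open>y\<close>.\<close>

definition lin :: "'n \<Rightarrow> real^'n \<Rightarrow> complex" where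
  "lin i x = (\<Sum>m\<in>UNIV. S i m * of_real (x $ m - y $ m))"

text \<open>\<open>T1 i\<close> is the conjugate of \<open>\<partial>\<^sub>i\<close> by \<open>exp (\<rho>\<^sup>2 phi)\<close>, split into its leading part and the part \<open>S1\<close> of lower order.
  \<open>Fl\<close> collects the terms of the expanded product with exactly one factor \<open>S1\<close>.\<close>

definition S1 :: "'n \<Rightarrow> (real \<Rightarrow> real^'n \<Rightarrow> complex) \<Rightarrow> real \<Rightarrow> real^'n \<Rightarrow> complex" where
  "S1 i u = (\<lambda>\<rho> x. partial i (u \<rho>) x + of_real (\<rho> powi 2) * (lin i x * u \<rho> x))"

definition T1 :: "'n \<Rightarrow> (real \<Rightarrow> real^'n \<Rightarrow> complex) \<Rightarrow> real \<Rightarrow> real^'n \<Rightarrow> complex" where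
  "T1 i u = (\<lambda>\<rho> x. of_real (\<rho> powi 2) * (\<zeta> i * u \<rho> x) + S1 i u \<rho> x)"

fun Tl :: "'n list \<Rightarrow> (real \<Rightarrow> real^'n \<Rightarrow> complex) \<Rightarrow> real \<Rightarrow> real^'n \<Rightarrow> complex" where
  "Tl [] u = u"
| "Tl (i # is) u = T1 i (Tl is u)"

fun Fl :: "'n list \<Rightarrow> (real \<Rightarrow> real^'n \<Rightarrow> complex) \<Rightarrow> real \<Rightarrow> real^'n \<Rightarrow> complex" where
  "Fl [] u = (\<lambda>\<rho> x. 0)"
| "Fl (i # is) u = (\<lambda>\<rho> x. of_real (\<rho> powi 2) * (\<zeta> i * Fl is u \<rho> x)
      + of_real (\<rho> powi (2 * int (length is))) * (lmono \<zeta> is * S1 i u \<rho> x))"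

definition phi :: "real^'n \<Rightarrow> complex" where
  "phi x = (\<Sum>i\<in>UNIV. \<zeta> i * of_real (x $ i - y $ i)) + 1/2 * (\<Sum>i\<in>UNIV. of_real (x $ i - y $ i) * lin i x)"

definition EE :: "real \<Rightarrow> real^'n \<Rightarrow> complex" where
  "EE \<rho> x = exp (of_real (\<rho> powi 2) * phi x)"

lemma smooth_lin: "smooth_on UNIV (lin i)"
  unfolding lin_def by (intro smooth_intros)

lemma pfam_lin: "pfam y 1 (\<lambda>\<rho>. lin i)"
  unfolding lin_def using pfam_sum[of UNIV y 1 "\<lambda>m \<rho> x. S i m * of_real (x $ m - y $ m)"]
    pfam_cmult[OF pfam_coord[OF pfam_const[of y 1]]] by simp

lemma S1_apx: "apx y m u \<Longrightarrow> apx y (m - 1) (S1 i u)"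
proof -
  assume u: "apx y m u"
  have "apx y (m - 1) (\<lambda>\<rho> x. of_real (\<rho> powi 2) * (lin i x * u \<rho> x))"
    using apx_rho[OF apx_mult[OF pfam_apx[OF pfam_lin] u], of 2] by simp
  from apx_add[OF apx_partial[OF u] this] show ?thesis unfolding S1_def .
qed

lemma T1_apx: "apx y m u \<Longrightarrow> apx y (m - 2) (T1 i u)"
  unfolding T1_def using S1_apx[of m u i]
  by (intro apx_add apx_rho apx_cmult) (auto intro: apx_mono)

lemma Tl_apx: "apx y m u \<Longrightarrow> apx y (m - 2 * int (length is)) (Tl is u)"
proof (induction "is")
  case (Cons i "is")
  from T1_apx[OF Cons.IH[OF Cons.prems], of i] show ?case by (simp add: algebra_simps)
qed simp

lemma osym_lin: "osym y 1 (\<lambda>\<rho>. lin i)" using pfam_lin pfam_osym by blast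

lemma S1_osym: "osym y m u \<Longrightarrow> osym y (m - 1) (S1 i u)"
proof -
  assume u: "osym y m u"
  have "osym y (m - 1) (\<lambda>\<rho> x. of_real (\<rho> powi 2) * (lin i x * u \<rho> x))"
    using osym_mult[OF osym_rho osym_mult[OF osym_lin u], of 2] by simp
  from osym_add[OF osym_partial[OF u] this] show ?thesis unfolding S1_def .
qed

lemma T1_osym: "osym y m u \<Longrightarrow> osym y (m - 2) (T1 i u)"
proof -
  assume u: "osym y m u"
  have "osym y (m - 2) (\<lambda>\<rho> x. of_real (\<rho> powi 2) * (\<zeta> i * u \<rho> x))"
    using osym_mult[OF osym_rho osym_cmult[OF u], of 2] by simp
  from osym_add[OF this osym_mono[OF S1_osym[OF u]]] show ?thesis unfolding T1_def by simp
qed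

lemma Tl_osym: "osym y m u \<Longrightarrow> osym y (m - 2 * int (length is)) (Tl is u)"
proof (induction "is")
  case (Cons i "is")
  from T1_osym[OF Cons.IH[OF Cons.prems], of i] show ?case by (simp add: algebra_simps)
qed simp

lemma Fl_apx: "apx y m u \<Longrightarrow> apx y (m - 2 * int (length is) + 1) (Fl is u)"
proof (induction "is")
  case (Cons i "is")
  have "apx y (m - 2 * int (length is) + 1 - 2) (\<lambda>\<rho> x. of_real (\<rho> powi 2) * (\<zeta> i * Fl is u \<rho> x))"
    by (intro apx_rho apx_cmult Cons)
  moreover have "apx y (m - 1 - 2 * int (length is)) (\<lambda>\<rho> x. of_real (\<rho> powi (2 * int (length is))) * (lmono \<zeta> is * S1 i u \<rho> x))"
    by (intro apx_rho apx_cmult S1_apx Cons)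
  ultimately show ?case using apx_add by (simp add: algebra_simps)
qed (simp add: apx_zero)

lemma S1_add:
  assumes "\<And>\<rho>. smooth_on UNIV (u \<rho>)" "\<And>\<rho>. smooth_on UNIV (v \<rho>)"
  shows "S1 i (\<lambda>\<rho> x. u \<rho> x + v \<rho> x) = (\<lambda>\<rho> x. S1 i u \<rho> x + S1 i v \<rho> x)"
  unfolding S1_def using assms by (simp add: partial_add_fun algebra_simps)

lemma S1_cmult:
  assumes "\<And>\<rho>. smooth_on UNIV (u \<rho>)"
  shows "S1 i (\<lambda>\<rho> x. b \<rho> * u \<rho> x) = (\<lambda>\<rho> x. b \<rho> * S1 i u \<rho> x)"
  unfolding S1_def using assms by (simp add: partial_cmult_fun algebra_simps)

lemma S1_smooth: "(\<And>\<rho>. smooth_on UNIV (u \<rho>)) \<Longrightarrow> smooth_on UNIV (S1 i u \<rho>)"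
  unfolding S1_def by (intro smooth_intros smooth_on_cmult smooth_on_partial smooth_lin)

lemma T1_smooth: "(\<And>\<rho>. smooth_on UNIV (u \<rho>)) \<Longrightarrow> smooth_on UNIV (T1 i u \<rho>)"
  unfolding T1_def by (intro smooth_intros smooth_on_cmult S1_smooth)

lemma Tl_smooth: "(\<And>\<rho>. smooth_on UNIV (u \<rho>)) \<Longrightarrow> smooth_on UNIV (Tl is u \<rho>)"
  by (induction "is" arbitrary: \<rho>) (auto intro: T1_smooth)

lemma Fl_smooth: "(\<And>\<rho>. smooth_on UNIV (u \<rho>)) \<Longrightarrow> smooth_on UNIV (Fl is u \<rho>)"
  by (induction "is" arbitrary: \<rho>) (auto intro!: smooth_intros smooth_on_cmult S1_smooth)

lemma Fl_add:
  assumes "\<And>\<rho>. smooth_on UNIV (u \<rho>)" "\<And>\<rho>. smooth_on UNIV (v \<rho>)"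
  shows "Fl is (\<lambda>\<rho> x. u \<rho> x + v \<rho> x) = (\<lambda>\<rho> x. Fl is u \<rho> x + Fl is v \<rho> x)"
  by (induction "is") (simp_all add: S1_add[OF assms] algebra_simps)

lemma Fl_cmult:
  assumes "\<And>\<rho>. smooth_on UNIV (u \<rho>)"
  shows "Fl is (\<lambda>\<rho> x. b * u \<rho> x) = (\<lambda>\<rho> x. b * Fl is u \<rho> x)"
  by (induction "is") (simp_all add: S1_cmult[OF assms, of _ "\<lambda>_. b"] algebra_simps)

text \<open>A leading factor \<open>\<rho>\<^sup>2 * \<zeta> i\<close> lowers the order by two, a
  factor \<open>S1\<close> by one only. Terms with two or more factors \<open>S1\<close> are
  therefore at least two orders better than the leading term, and only the terms with none or one
  are kept.\<close>

lemma Tl_expansion: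
  assumes u: "apx y m u"
  shows "apx y (m - 2 * int (length is) + 2)
    (\<lambda>\<rho> x. Tl is u \<rho> x - of_real (\<rho> powi (2 * int (length is))) * (lmono \<zeta> is * u \<rho> x) - Fl is u \<rho> x)"
proof (induction "is")
  case Nil
  then show ?case by (simp add: apx_zero)
next
  case (Cons i "is")
  define n where "n = length is"
  note us = apx_smooth[OF u]
  define A where "A = (\<lambda>\<rho> x. (of_real (\<rho> powi (2 * int n)) * lmono \<zeta> is) * u \<rho> x)"
  define R where "R = (\<lambda>\<rho> x. Tl is u \<rho> x - of_real (\<rho> powi (2 * int n)) * (lmono \<zeta> is * u \<rho> x) - Fl is u \<rho> x)"
  have R: "apx y (m - 2 * int n + 2) R" using Cons unfolding R_def n_def .
  note Rs = apx_smooth[OF R] and Fs = Fl_smooth[OF us, of "is"]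
  have As: "smooth_on UNIV (A \<rho>)" for \<rho> unfolding A_def by (intro smooth_on_cmult us) simp
  have AFs: "smooth_on UNIV (\<lambda>x. A \<rho> x + Fl is u \<rho> x)" for \<rho> by (intro smooth_on_add As Fs) simp
  have "Tl is u = (\<lambda>\<rho> x. (A \<rho> x + Fl is u \<rho> x) + R \<rho> x)"
    unfolding A_def R_def by (simp add: fun_eq_iff)
  then have "S1 i (Tl is u) = (\<lambda>\<rho> x. (of_real (\<rho> powi (2 * int n)) * lmono \<zeta> is * S1 i u \<rho> x + S1 i (Fl is u) \<rho> x) + S1 i R \<rho> x)"
    using S1_add[OF AFs Rs, of i] S1_add[OF As Fs, of i] S1_cmult[OF us, of i "\<lambda>\<rho>. of_real (\<rho> powi (2 * int n)) * lmono \<zeta> is"]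
    by (simp add: A_def)
  moreover have "Tl is u \<rho> x = A \<rho> x + Fl is u \<rho> x + R \<rho> x" for \<rho> x by (simp add: A_def R_def)
  ultimately have T: "T1 i (Tl is u) \<rho> x = of_real (\<rho> powi 2) * (\<zeta> i * (A \<rho> x + Fl is u \<rho> x + R \<rho> x))
      + (of_real (\<rho> powi (2 * int n)) * lmono \<zeta> is * S1 i u \<rho> x + S1 i (Fl is u) \<rho> x + S1 i R \<rho> x)" for \<rho> x
    unfolding T1_def by (simp only:)
  have pw: "complex_of_real (\<rho> powi (2 * int (Suc n))) = of_real (\<rho> powi 2) * of_real (\<rho> powi (2 * int n))" for \<rho>
  proof -
    have e: "\<rho> powi (2 * int n) = \<rho> ^ (2 * n)" for n
      using power_int_of_nat[of \<rho> "2 * n"] by simp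
    have "\<rho> powi (2 * int (Suc n)) = \<rho> powi 2 * \<rho> powi (2 * int n)"
      unfolding e by (simp add: power2_eq_square)
    then show ?thesis unfolding of_real_mult[symmetric] by (rule arg_cong)
  qed
  have aux: "p * (z * ((q * L) * w + F + R)) + (q * L * s + sF + sR) - (p * q) * ((z * L) * w) - (p * (z * F) + q * (L * s))
     = p * (z * R) + sF + sR" for p q z L F R s sF sR w :: complex by (simp add: algebra_simps)
  have "(\<lambda>\<rho> x. Tl (i # is) u \<rho> x - of_real (\<rho> powi (2 * int (length (i # is)))) * (lmono \<zeta> (i # is) * u \<rho> x) - Fl (i # is) u \<rho> x)
    = (\<lambda>\<rho> x. of_real (\<rho> powi 2) * (\<zeta> i * R \<rho> x) + S1 i (Fl is u) \<rho> x + S1 i R \<rho> x)"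
    unfolding Tl.simps T Fl.simps lmono.simps length_Cons n_def[symmetric] A_def pw by (intro ext, rule aux)
  moreover have "apx y (m - 2 * int (Suc n) + 2) (\<lambda>\<rho> x. of_real (\<rho> powi 2) * (\<zeta> i * R \<rho> x) + S1 i (Fl is u) \<rho> x + S1 i R \<rho> x)"
  proof (intro apx_add)
    show "apx y (m - 2 * int (Suc n) + 2) (\<lambda>\<rho> x. of_real (\<rho> powi 2) * (\<zeta> i * R \<rho> x))"
      using apx_rho[OF apx_cmult[OF R], of 2] by (simp add: algebra_simps)
    show "apx y (m - 2 * int (Suc n) + 2) (S1 i (Fl is u))"
      using S1_apx[OF Fl_apx[OF u, of "is"], of i] by (simp add: n_def algebra_simps)
    show "apx y (m - 2 * int (Suc n) + 2) (S1 i R)"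
      by (rule apx_mono[OF S1_apx[OF R]]) simp
  qed
  ultimately show ?case by (simp add: n_def)
qed

text \<open>In a product with a single \<open>S1\<close> all other factors are scalars, so the
  position of \<open>S1\<close> does not matter; summing over the positions is the Leibniz rule for
  the monomial.\<close>

lemma Fl_closed_form:
  assumes "\<rho> \<noteq> 0"
  shows "Fl is u \<rho> x = of_real (\<rho> powi (2 * int (length is) - 2)) * (\<Sum>j\<in>UNIV. ldmono \<zeta> j is * S1 j u \<rho> x)"
proof (induction "is")
  case (Cons i "is")
  have "\<rho> powi 2 * \<rho> powi (2 * int (length is) - 2) = \<rho> powi (2 + (2 * int (length is) - 2))"
    by (rule power_int_add[symmetric]) (use assms in simp)
  then have pw: "complex_of_real (\<rho> powi 2) * of_real (\<rho> powi (2 * int (length is) - 2)) = of_real (\<rho> powi (2 * int (length is)))"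
    unfolding of_real_mult[symmetric] by simp
  have "(\<Sum>j\<in>UNIV. ldmono \<zeta> j (i # is) * S1 j u \<rho> x) = lmono \<zeta> is * S1 i u \<rho> x + \<zeta> i * (\<Sum>j\<in>UNIV. ldmono \<zeta> j is * S1 j u \<rho> x)"
    by (simp add: algebra_simps sum.distrib sum_distrib_left if_distrib[where f="\<lambda>z. _ * z"] cong: if_cong)
  moreover have "Fl (i # is) u \<rho> x = (complex_of_real (\<rho> powi 2) * of_real (\<rho> powi (2 * int (length is) - 2))) * (\<zeta> i * (\<Sum>j\<in>UNIV. ldmono \<zeta> j is * S1 j u \<rho> x))
     + of_real (\<rho> powi (2 * int (length is))) * (lmono \<zeta> is * S1 i u \<rho> x)"
    by (simp add: Cons algebra_simps)
  ultimately show ?case unfolding pw by (simp add: algebra_simps)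
qed simp

lemma smooth_phi: "smooth_on UNIV phi"
  unfolding phi_def by (intro smooth_intros smooth_on_cmult smooth_lin)

lemma partial_phi: "partial j phi = (\<lambda>x. \<zeta> j + lin j x)"
proof -
  have lin: "partial j (lin i) = (\<lambda>x. S i j)" for i
  proof -
    have "partials [j] (\<lambda>x. \<Sum>m\<in>UNIV. S i m * complex_of_real (x $ m - y $ m)) = (\<lambda>x. \<Sum>m\<in>UNIV. partials [j] (\<lambda>x. S i m * complex_of_real (x $ m - y $ m)) x)"
      by (intro partials_sum smooth_on_cmult smooth_coord_diff) simp
    then show ?thesis unfolding lin_def[abs_def]
      by (simp add: partial_cmult_fun smooth_coord_diff partial_coord_diff if_distrib[where f="\<lambda>z. _ * z"] cong: if_cong)
  qed
  have "partials [j] (\<lambda>x. \<Sum>i\<in>UNIV. \<zeta> i * complex_of_real (x $ i - y $ i)) = (\<lambda>x. \<Sum>i\<in>UNIV. partials [j] (\<lambda>x. \<zeta> i * complex_of_real (x $ i - y $ i)) x)"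
    by (intro partials_sum smooth_on_cmult smooth_coord_diff) simp
  then have 1: "partial j (\<lambda>x. \<Sum>i\<in>UNIV. \<zeta> i * complex_of_real (x $ i - y $ i)) = (\<lambda>x. \<zeta> j)"
    by (simp add: partial_cmult_fun smooth_coord_diff partial_coord_diff if_distrib[where f="\<lambda>z. _ * z"] cong: if_cong)
  have "partials [j] (\<lambda>x. \<Sum>i\<in>UNIV. complex_of_real (x $ i - y $ i) * lin i x) = (\<lambda>x. \<Sum>i\<in>UNIV. partials [j] (\<lambda>x. complex_of_real (x $ i - y $ i) * lin i x) x)"
    by (intro partials_sum smooth_on_mult smooth_lin smooth_coord_diff) simp
  also have "\<dots> = (\<lambda>x. \<Sum>i\<in>UNIV. of_real (x $ i - y $ i) * S i j + (if j = i then lin i x else 0))"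
    using partial_mult_fun[OF smooth_coord_diff smooth_lin, of j]
    by (simp add: lin partial_coord_diff if_distrib[where f="\<lambda>z. z * _"] cong: if_cong)
  also have "\<dots> = (\<lambda>x. 2 * lin j x)"
    by (simp add: sum.distrib lin_def S_sym[of _ j] mult.commute)
  finally have 2: "partial j (\<lambda>x. \<Sum>i\<in>UNIV. complex_of_real (x $ i - y $ i) * lin i x) = (\<lambda>x. 2 * lin j x)" by simp
  have s1: "smooth_on UNIV (\<lambda>x. \<Sum>i\<in>UNIV. \<zeta> i * complex_of_real (x $ i - y $ i))"
    and s2: "smooth_on UNIV (\<lambda>x. \<Sum>i\<in>UNIV. complex_of_real (x $ i - y $ i) * lin i x)"
    by (intro smooth_intros smooth_on_cmult smooth_lin)+
  have "partial j phi = partial j (\<lambda>x. (\<Sum>i\<in>UNIV. \<zeta> i * of_real (x $ i - y $ i)) + 1/2 * (\<Sum>i\<in>UNIV. of_real (x $ i - y $ i) * lin i x))"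
    by (simp only: phi_def[abs_def])
  also have "\<dots> = (\<lambda>x. \<zeta> j + 1/2 * (2 * lin j x))"
    by (subst partial_add_fun[OF s1 smooth_on_cmult[OF open_UNIV s2]]) (simp only: partial_cmult_fun[OF s2] 1 2)
  finally show ?thesis by simp
qed

lemma smooth_EE: "smooth_on UNIV (EE \<rho>)"
  unfolding EE_def[abs_def] by (intro smooth_on_exp smooth_on_cmult smooth_phi) simp_all

lemma partials_EE:
  assumes us: "\<And>\<rho>. smooth_on UNIV (u \<rho>)"
  shows "partials is (\<lambda>x. EE \<rho> x * u \<rho> x) = (\<lambda>x. EE \<rho> x * Tl is u \<rho> x)"
proof (induction "is")
  case (Cons i "is")
  have E: "partial i (EE \<rho>) = (\<lambda>x. EE \<rho> x * (of_real (\<rho> powi 2) * (\<zeta> i + lin i x)))"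
  proof
    fix x
    have "has_partial i (\<lambda>x. of_real (\<rho> powi 2) * phi x) x"
      by (rule smooth_on_has_partial[OF smooth_on_cmult[OF open_UNIV smooth_phi]]) simp
    from partial_exp(1)[OF this] show "partial i (EE \<rho>) x = EE \<rho> x * (of_real (\<rho> powi 2) * (\<zeta> i + lin i x))"
      unfolding EE_def[abs_def] partial_cmult_fun[OF smooth_phi] partial_phi by (simp only: mult_ac)
  qed
  have "partials (i # is) (\<lambda>x. EE \<rho> x * u \<rho> x) = partial i (\<lambda>x. EE \<rho> x * Tl is u \<rho> x)" by (simp add: Cons)
  also have "\<dots> = (\<lambda>x. EE \<rho> x * partial i (Tl is u \<rho>) x + partial i (EE \<rho>) x * Tl is u \<rho> x)"
    by (rule partial_mult_fun[OF smooth_EE Tl_smooth[OF us]])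
  also have "\<dots> = (\<lambda>x. EE \<rho> x * T1 i (Tl is u) \<rho> x)"
    unfolding E T1_def S1_def by (simp add: algebra_simps)
  finally show ?case by simp
qed simp

lemma norm_EE:
  assumes "\<And>i. Re (\<zeta> i) = 0" and "\<And>v::real^'n. Re (\<Sum>i\<in>UNIV. \<Sum>j\<in>UNIV. S i j * of_real (v $ i * v $ j)) \<le> - 2 * \<kappa> * (norm v)\<^sup>2"
  shows "norm (EE \<rho> x) \<le> exp (- \<kappa> * (\<rho> * norm (x - y))\<^sup>2)"
proof -
  have "Re (\<Sum>i\<in>UNIV. \<zeta> i * of_real (x $ i - y $ i)) = 0" using assms(1) by simp
  moreover have "(\<Sum>i\<in>UNIV. of_real (x $ i - y $ i) * lin i x) = (\<Sum>i\<in>UNIV. \<Sum>j\<in>UNIV. S i j * of_real ((x - y) $ i * (x - y) $ j))"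
    by (simp add: lin_def sum_distrib_left mult_ac)
  ultimately have "Re (phi x) = 1/2 * Re (\<Sum>i\<in>UNIV. \<Sum>j\<in>UNIV. S i j * of_real ((x - y) $ i * (x - y) $ j))"
    unfolding phi_def by simp
  then have "Re (phi x) \<le> - \<kappa> * (norm (x - y))\<^sup>2" using assms(2)[of "x - y"] by linarith
  then have "\<rho>\<^sup>2 * Re (phi x) \<le> \<rho>\<^sup>2 * (- \<kappa> * (norm (x - y))\<^sup>2)" by (intro mult_left_mono) auto
  then show ?thesis unfolding EE_def by (simp add: power_mult_distrib mult_ac)
qed

end

section \<open>Amplitudes from the transport equation\<close>

lemma sum_of_real_scaleR: "(\<Sum>i\<in>UNIV. (x - y) $ i *\<^sub>R f i) = (\<Sum>i\<in>UNIV. complex_of_real (x $ i - y $ i) * f i)"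
  by (simp add: scaleR_conv_of_real)

text \<open>\<open>char\<close> and \<open>eik\<close> are the eikonal equation at \<open>y\<close>
  to orders zero and one: the leading symbol vanishes at \<open>(y, \<zeta>)\<close>, and so does
  the derivative at \<open>y\<close> of its value along
  \<open>x \<mapsto> (x, \<zeta> + S (x - y))\<close>. The vector \<open>a\<close> is the derivative
  of the symbol in \<open>\<zeta>\<close>, that is, the transport field frozen at
  \<open>y\<close>.\<close>

locale wkb = phase y \<zeta> S for y :: "real^'n::finite" and \<zeta> :: "'n \<Rightarrow> complex" and S +
  fixes I :: "'i set" and l :: "'i \<Rightarrow> 'n list" and c :: "'i \<Rightarrow> real^'n \<Rightarrow> complex" and k :: nat
    and a :: "'n \<Rightarrow> complex" and i0 :: 'n
  assumes finI: "finite I" and bs: "\<alpha> \<in> I \<Longrightarrow> bsmooth (c \<alpha>)" and len: "\<alpha> \<in> I \<Longrightarrow> length (l \<alpha>) \<le> k"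
    and char: "(\<Sum>\<alpha>\<in>{\<alpha>\<in>I. length (l \<alpha>) = k}. c \<alpha> y * lmono \<zeta> (l \<alpha>)) = 0"
    and a_eq: "a j = (\<Sum>\<alpha>\<in>{\<alpha>\<in>I. length (l \<alpha>) = k}. c \<alpha> y * ldmono \<zeta> j (l \<alpha>))"
    and eik: "(\<Sum>\<alpha>\<in>{\<alpha>\<in>I. length (l \<alpha>) = k}. partial m (c \<alpha>) y * lmono \<zeta> (l \<alpha>)) + (\<Sum>j\<in>UNIV. a j * S j m) = 0"
    and a_nz: "a i0 \<noteq> 0"
begin

definition Lop :: "(real^'n \<Rightarrow> complex) \<Rightarrow> real^'n \<Rightarrow> complex" where
  "Lop f x = (\<Sum>\<alpha>\<in>I. partials (l \<alpha>) (\<lambda>x. c \<alpha> x * f x) x)"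

definition Cop :: "(real \<Rightarrow> real^'n \<Rightarrow> complex) \<Rightarrow> real \<Rightarrow> real^'n \<Rightarrow> complex" where
  "Cop u = (\<lambda>\<rho> x. \<Sum>\<alpha>\<in>I. Tl (l \<alpha>) (\<lambda>\<rho> x. c \<alpha> x * u \<rho> x) \<rho> x)"

lemma Lop_EE:
  assumes us: "\<And>\<rho>. smooth_on UNIV (u \<rho>)"
  shows "Lop (\<lambda>x. EE \<rho> x * u \<rho> x) = (\<lambda>x. EE \<rho> x * Cop u \<rho> x)"
proof
  fix x
  have "partials (l \<alpha>) (\<lambda>x. c \<alpha> x * (EE \<rho> x * u \<rho> x)) x = EE \<rho> x * Tl (l \<alpha>) (\<lambda>\<rho> x. c \<alpha> x * u \<rho> x) \<rho> x" if "\<alpha> \<in> I" for \<alpha>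
  proof -
    have "smooth_on UNIV (\<lambda>x. c \<alpha> x * u \<rho> x)" for \<rho>
      using bs[OF that] us by (intro smooth_on_mult) (auto simp: bsmooth_def)
    from partials_EE[of "\<lambda>\<rho> x. c \<alpha> x * u \<rho> x" "l \<alpha>" \<rho>, OF this] show ?thesis
      by (simp add: mult.left_commute)
  qed
  then show "Lop (\<lambda>x. EE \<rho> x * u \<rho> x) x = EE \<rho> x * Cop u \<rho> x"
    unfolding Lop_def Cop_def by (simp add: sum_distrib_left)
qed

text \<open>In the leading term the coefficient is needed to first order. In the term with one
  \<open>S1\<close>, which is one order better already, its value at \<open>y\<close>
  suffices.\<close>

lemma coeff_expansion:
  assumes f: "bsmooth f" and u: "apx y m u"
  shows "apx y (m - 2 * int (length is) + 2) (\<lambda>\<rho> x. Tl is (\<lambda>\<rho> x. f x * u \<rho> x) \<rho> x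
     - of_real (\<rho> powi (2 * int (length is))) * (lmono \<zeta> is * ((f y + (\<Sum>i\<in>UNIV. of_real (x $ i - y $ i) * partial i f y)) * u \<rho> x))
     - f y * Fl is u \<rho> x)"
proof -
  define n where "n = length is"
  have fu: "apx y m (\<lambda>\<rho> x. f x * u \<rho> x)" using apx_mult[OF apx_bsmooth[OF f] u] by simp
  define g where "g = (\<lambda>(\<rho>::real) x. \<Sum>i\<in>UNIV. complex_of_real (x $ i - y $ i) * hquot y i f x)"
  have g: "apx y 1 g" unfolding g_def
    using apx_coord[OF apx_bsmooth[OF bsmooth_hquot[OF f]]] by (intro apx_sum) simp
  define h where "h = (\<lambda>(\<rho>::real) x. \<Sum>i\<in>UNIV. complex_of_real (x $ i - y $ i) * (\<Sum>j\<in>UNIV. complex_of_real (x $ j - y $ j) * hquot y j (hquot y i f) x))"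
  have h1: "apx y 1 (\<lambda>(\<rho>::real) x. \<Sum>j\<in>UNIV. complex_of_real (x $ j - y $ j) * hquot y j (hquot y i f) x)" for i
    using apx_coord[OF apx_bsmooth[OF bsmooth_hquot[OF bsmooth_hquot[OF f]]]] by (intro apx_sum) simp
  have h: "apx y 2 h" unfolding h_def
    using apx_coord[OF h1] by (intro apx_sum) simp
  have fs: "smooth_on UNIV f" using f by (simp add: bsmooth_def)
  have feq: "f x = f y + g \<rho> x" for x \<rho>
    using hadamard[OF fs, of x y] unfolding sum_of_real_scaleR g_def .
  have geq: "g \<rho> x = (\<Sum>i\<in>UNIV. of_real (x $ i - y $ i) * partial i f y) + h \<rho> x" for x \<rho>
  proof -
    have "hquot y i f x = partial i f y + (\<Sum>j\<in>UNIV. of_real (x $ j - y $ j) * hquot y j (hquot y i f) x)" for i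
      using hadamard[OF smooth_hquot[OF fs], of y i x y] unfolding hquot_base sum_of_real_scaleR .
    then show ?thesis unfolding g_def h_def by (simp add: distrib_left sum.distrib)
  qed
  have gu: "apx y (1 + m) (\<lambda>\<rho> x. g \<rho> x * u \<rho> x)" by (rule apx_mult[OF g u])
  have hu: "apx y (2 + m) (\<lambda>\<rho> x. h \<rho> x * u \<rho> x)" by (rule apx_mult[OF h u])
  have "smooth_on UNIV (\<lambda>x. f y * u \<rho> x)" for \<rho> by (intro smooth_on_cmult apx_smooth[OF u] open_UNIV)
  from Fl_add[OF this apx_smooth[OF gu]]
  have "Fl is (\<lambda>\<rho> x. f y * u \<rho> x + g \<rho> x * u \<rho> x) = (\<lambda>\<rho> x. f y * Fl is u \<rho> x + Fl is (\<lambda>\<rho> x. g \<rho> x * u \<rho> x) \<rho> x)"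
    by (simp add: Fl_cmult[OF apx_smooth[OF u]])
  moreover have "(\<lambda>\<rho> x. f x * u \<rho> x) = (\<lambda>\<rho> x. f y * u \<rho> x + g \<rho> x * u \<rho> x)"
  proof (intro ext)
    fix \<rho> x show "f x * u \<rho> x = f y * u \<rho> x + g \<rho> x * u \<rho> x" unfolding feq[of x \<rho>] by (simp add: algebra_simps)
  qed
  ultimately have F: "Fl is (\<lambda>\<rho> x. f x * u \<rho> x) \<rho> x = f y * Fl is u \<rho> x + Fl is (\<lambda>\<rho> x. g \<rho> x * u \<rho> x) \<rho> x" for \<rho> x
    by simp
  have t1: "apx y (m - 2 * int n + 2) (\<lambda>\<rho> x. Tl is (\<lambda>\<rho> x. f x * u \<rho> x) \<rho> x
     - of_real (\<rho> powi (2 * int n)) * (lmono \<zeta> is * (f x * u \<rho> x)) - Fl is (\<lambda>\<rho> x. f x * u \<rho> x) \<rho> x)"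
    using Tl_expansion[OF fu, of "is"] unfolding n_def .
  have t2: "apx y (m - 2 * int n + 2) (Fl is (\<lambda>\<rho> x. g \<rho> x * u \<rho> x))"
    using Fl_apx[OF gu, of "is"] by (simp add: n_def algebra_simps)
  have t3: "apx y (m - 2 * int n + 2) (\<lambda>\<rho> x. of_real (\<rho> powi (2 * int n)) * (lmono \<zeta> is * (h \<rho> x * u \<rho> x)))"
    using apx_rho[OF apx_cmult[OF hu], of "2 * int n" "lmono \<zeta> is"] by (simp add: algebra_simps)
  have aux: "T - p * (L * (fx * w)) - (fy * F + G) + G + p * (L * (H * w)) = T - p * (L * ((fy + Sm) * w)) - fy * F"
    if "fx = fy + (Sm + H)" for T p L fx w fy F G H Sm :: complex
    unfolding that by (simp add: algebra_simps)
  show ?thesis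
    using apx_add[OF apx_add[OF t1 t2] t3] unfolding F n_def[symmetric]
    by (subst (asm) aux[OF trans[OF feq arg_cong[where f="\<lambda>z. f y + z", OF geq]]])
qed

text \<open>The terms of order \<open>m - 2 * k\<close> cancel by \<open>char\<close>. One order
  further, the terms that carry a factor \<open>x - y\<close> come from the coefficients and from
  \<open>lin\<close>, and they cancel by \<open>eik\<close>; only the constant coefficient field
  remains there.\<close>

lemma Cop_expansion:
  assumes u: "apx y m u"
  shows "apx y (m - 2 * int k + 2) (\<lambda>\<rho> x. Cop u \<rho> x - of_real (\<rho> powi (2 * int k - 2)) * vfield a u \<rho> x)"
proof -
  define I' where "I' = {\<alpha>\<in>I. length (l \<alpha>) = k}"
  define lead where "lead \<alpha> = (\<lambda>\<rho> x. of_real (\<rho> powi (2 * int k)) * (lmono \<zeta> (l \<alpha>) * ((c \<alpha> y + (\<Sum>i\<in>UNIV. of_real (x $ i - y $ i) * partial i (c \<alpha>) y)) * u \<rho> x))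
     + c \<alpha> y * Fl (l \<alpha>) u \<rho> x)" for \<alpha>
  have 1: "apx y (m - 2 * int k + 2) (\<lambda>\<rho> x. Tl (l \<alpha>) (\<lambda>\<rho> x. c \<alpha> x * u \<rho> x) \<rho> x - lead \<alpha> \<rho> x)" if "\<alpha> \<in> I'" for \<alpha>
  proof -
    have "length (l \<alpha>) = k" "bsmooth (c \<alpha>)" using that bs by (auto simp: I'_def)
    with coeff_expansion[OF this(2) u, of "l \<alpha>"] show ?thesis unfolding lead_def by (simp add: diff_diff_eq)
  qed
  have 2: "apx y (m - 2 * int k + 2) (Tl (l \<alpha>) (\<lambda>\<rho> x. c \<alpha> x * u \<rho> x))" if "\<alpha> \<in> I - I'" for \<alpha>
  proof -
    have lt: "length (l \<alpha>) < k" and b: "bsmooth (c \<alpha>)" using that bs len[of \<alpha>] by (auto simp: I'_def)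
    have "apx y m (\<lambda>\<rho> x. c \<alpha> x * u \<rho> x)" using apx_mult[OF apx_bsmooth[OF b] u] by simp
    from Tl_apx[OF this, of "l \<alpha>"] show ?thesis by (rule apx_mono) (use lt in simp)
  qed
  have "apx y (m - 2 * int k + 2) (\<lambda>\<rho> x. (\<Sum>\<alpha>\<in>I'. Tl (l \<alpha>) (\<lambda>\<rho> x. c \<alpha> x * u \<rho> x) \<rho> x - lead \<alpha> \<rho> x) + (\<Sum>\<alpha>\<in>I - I'. Tl (l \<alpha>) (\<lambda>\<rho> x. c \<alpha> x * u \<rho> x) \<rho> x))"
    by (intro apx_add apx_sum 1 2)
  then show ?thesis
  proof (rule apx_cong)
    fix \<rho> :: real assume "\<rho> \<ge> 1"
    then have r: "\<rho> \<noteq> 0" by simp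
    have "\<rho> powi (2 * int k - 2) * \<rho> powi 2 = \<rho> powi (2 * int k - 2 + 2)"
      by (rule power_int_add[symmetric]) (use r in simp)
    then have pw: "complex_of_real (\<rho> powi (2 * int k)) = of_real (\<rho> powi (2 * int k - 2)) * of_real (\<rho> powi 2)"
      unfolding of_real_mult[symmetric] by simp
    show "(\<lambda>x. Cop u \<rho> x - of_real (\<rho> powi (2 * int k - 2)) * vfield a u \<rho> x) =
      (\<lambda>x. (\<Sum>\<alpha>\<in>I'. Tl (l \<alpha>) (\<lambda>\<rho> x. c \<alpha> x * u \<rho> x) \<rho> x - lead \<alpha> \<rho> x) + (\<Sum>\<alpha>\<in>I - I'. Tl (l \<alpha>) (\<lambda>\<rho> x. c \<alpha> x * u \<rho> x) \<rho> x))"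
    proof
      fix x
      let ?P = "complex_of_real (\<rho> powi (2 * int k))" and ?Q = "complex_of_real (\<rho> powi (2 * int k - 2))"
      let ?x = "\<lambda>i. complex_of_real (x $ i - y $ i)"
      define B where "B i = (\<Sum>\<alpha>\<in>I'. partial i (c \<alpha>) y * lmono \<zeta> (l \<alpha>))" for i
      have "(\<Sum>\<alpha>\<in>I'. lmono \<zeta> (l \<alpha>) * (c \<alpha> y + (\<Sum>i\<in>UNIV. ?x i * partial i (c \<alpha>) y)))
          = (\<Sum>\<alpha>\<in>I'. c \<alpha> y * lmono \<zeta> (l \<alpha>)) + (\<Sum>\<alpha>\<in>I'. \<Sum>i\<in>UNIV. ?x i * (partial i (c \<alpha>) y * lmono \<zeta> (l \<alpha>)))"
        by (simp add: distrib_left sum.distrib sum_distrib_left mult_ac)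
      also have "(\<Sum>\<alpha>\<in>I'. \<Sum>i\<in>UNIV. ?x i * (partial i (c \<alpha>) y * lmono \<zeta> (l \<alpha>))) = (\<Sum>i\<in>UNIV. ?x i * B i)"
        by (subst sum.swap) (simp add: B_def sum_distrib_left)
      finally have s1: "(\<Sum>\<alpha>\<in>I'. lmono \<zeta> (l \<alpha>) * (c \<alpha> y + (\<Sum>i\<in>UNIV. ?x i * partial i (c \<alpha>) y))) = (\<Sum>i\<in>UNIV. ?x i * B i)"
        using char by (simp add: I'_def)
      have "(\<Sum>\<alpha>\<in>I'. c \<alpha> y * Fl (l \<alpha>) u \<rho> x) = (\<Sum>\<alpha>\<in>I'. ?Q * (\<Sum>j\<in>UNIV. c \<alpha> y * ldmono \<zeta> j (l \<alpha>) * S1 j u \<rho> x))"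
        by (intro sum.cong refl) (simp add: Fl_closed_form[OF r] I'_def sum_distrib_left mult_ac)
      also have "\<dots> = ?Q * (\<Sum>j\<in>UNIV. a j * S1 j u \<rho> x)"
        by (subst sum_distrib_left[symmetric], subst sum.swap) (simp add: a_eq I'_def sum_distrib_right)
      also have "(\<Sum>j\<in>UNIV. a j * S1 j u \<rho> x) = vfield a u \<rho> x + of_real (\<rho> powi 2) * ((\<Sum>j\<in>UNIV. a j * lin j x) * u \<rho> x)"
        unfolding S1_def vfield_def by (simp add: distrib_left sum.distrib sum_distrib_left sum_distrib_right mult_ac)
      also have "(\<Sum>j\<in>UNIV. a j * lin j x) = (\<Sum>i\<in>UNIV. ?x i * (\<Sum>j\<in>UNIV. a j * S j i))"
        unfolding lin_def sum_distrib_left by (subst sum.swap) (simp add: mult_ac)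
      also have "\<dots> = (\<Sum>i\<in>UNIV. ?x i * (- B i))"
      proof (intro sum.cong refl arg_cong2[where f="(*)"])
        fix i show "(\<Sum>j\<in>UNIV. a j * S j i) = - B i" using eik[of i] unfolding B_def I'_def by (simp add: add_eq_0_iff)
      qed
      finally have s2: "(\<Sum>\<alpha>\<in>I'. c \<alpha> y * Fl (l \<alpha>) u \<rho> x) = ?Q * (vfield a u \<rho> x - of_real (\<rho> powi 2) * ((\<Sum>i\<in>UNIV. ?x i * B i) * u \<rho> x))"
        by (simp add: sum_negf)
      have "(\<Sum>\<alpha>\<in>I'. lead \<alpha> \<rho> x) = ?P * ((\<Sum>\<alpha>\<in>I'. lmono \<zeta> (l \<alpha>) * (c \<alpha> y + (\<Sum>i\<in>UNIV. ?x i * partial i (c \<alpha>) y))) * u \<rho> x) + (\<Sum>\<alpha>\<in>I'. c \<alpha> y * Fl (l \<alpha>) u \<rho> x)"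
        unfolding lead_def sum.distrib by (simp add: sum_distrib_left sum_distrib_right mult.assoc)
      also have "\<dots> = ?Q * vfield a u \<rho> x"
        unfolding s1 s2 pw by (simp add: algebra_simps)
      finally have "(\<Sum>\<alpha>\<in>I'. lead \<alpha> \<rho> x) = ?Q * vfield a u \<rho> x" .
      moreover have "Cop u \<rho> x = (\<Sum>\<alpha>\<in>I'. Tl (l \<alpha>) (\<lambda>\<rho> x. c \<alpha> x * u \<rho> x) \<rho> x) + (\<Sum>\<alpha>\<in>I - I'. Tl (l \<alpha>) (\<lambda>\<rho> x. c \<alpha> x * u \<rho> x) \<rho> x)"
        unfolding Cop_def by (subst sum.subset_diff[of I' I]) (auto simp: I'_def finI)
      ultimately show "Cop u \<rho> x - ?Q * vfield a u \<rho> x =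
        (\<Sum>\<alpha>\<in>I'. Tl (l \<alpha>) (\<lambda>\<rho> x. c \<alpha> x * u \<rho> x) \<rho> x - lead \<alpha> \<rho> x) + (\<Sum>\<alpha>\<in>I - I'. Tl (l \<alpha>) (\<lambda>\<rho> x. c \<alpha> x * u \<rho> x) \<rho> x)"
        by (simp add: sum_subtractf)
    qed
  next
    fix \<rho> :: real
    have "smooth_on UNIV (Tl (l \<alpha>) (\<lambda>\<rho> x. c \<alpha> x * u \<rho> x) \<rho>)" if "\<alpha> \<in> I" for \<alpha>
      using bs[OF that] apx_smooth[OF u] by (intro Tl_smooth smooth_on_mult) (auto simp: bsmooth_def)
    then show "smooth_on UNIV (\<lambda>x. Cop u \<rho> x - of_real (\<rho> powi (2 * int k - 2)) * vfield a u \<rho> x)"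
      unfolding Cop_def by (intro smooth_on_diff smooth_on_sum smooth_on_cmult vfield_smooth apx_smooth[OF u]) auto
  qed
qed

lemma Cop_add:
  assumes "\<And>\<rho>. smooth_on UNIV (u \<rho>)" "\<And>\<rho>. smooth_on UNIV (v \<rho>)"
  shows "Cop (\<lambda>\<rho> x. u \<rho> x + v \<rho> x) = (\<lambda>\<rho> x. Cop u \<rho> x + Cop v \<rho> x)"
proof -
  have T: "Tl is (\<lambda>\<rho> x. u \<rho> x + v \<rho> x) = (\<lambda>\<rho> x. Tl is u \<rho> x + Tl is v \<rho> x)"
    if "\<And>\<rho>. smooth_on UNIV (u \<rho>)" "\<And>\<rho>. smooth_on UNIV (v \<rho>)" for "is" u v
  proof (induction "is")
    case (Cons i "is")
    show ?case unfolding Tl.simps Cons T1_def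
      by (subst S1_add) (auto intro: Tl_smooth that simp: algebra_simps)
  qed simp
  have "Tl (l \<alpha>) (\<lambda>\<rho> x. c \<alpha> x * (u \<rho> x + v \<rho> x)) = (\<lambda>\<rho> x. Tl (l \<alpha>) (\<lambda>\<rho> x. c \<alpha> x * u \<rho> x) \<rho> x + Tl (l \<alpha>) (\<lambda>\<rho> x. c \<alpha> x * v \<rho> x) \<rho> x)" if "\<alpha> \<in> I" for \<alpha>
    unfolding distrib_left using bs[OF that] assms by (intro T smooth_on_mult) (auto simp: bsmooth_def)
  then show ?thesis unfolding Cop_def by (simp add: sum.distrib)
qed

lemma Cop_osym:
  assumes "osym y m u"
  shows "osym y (m - 2 * int k) (Cop u)"
  unfolding Cop_def
proof (rule osym_sum)
  fix \<alpha> assume "\<alpha> \<in> I"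
  have "osym y m (\<lambda>\<rho> x. c \<alpha> x * u \<rho> x)" using osym_mult[OF osym_bsmooth[OF bs[OF \<open>\<alpha> \<in> I\<close>]] assms] by simp
  from Tl_osym[OF this, of "l \<alpha>"] show "osym y (m - 2 * int k) (\<lambda>\<rho>. Tl (l \<alpha>) (\<lambda>\<rho> x. c \<alpha> x * u \<rho> x) \<rho>)"
    by (rule osym_mono) (use len[OF \<open>\<alpha> \<in> I\<close>] in simp)
qed

text \<open>The field annihilates the constant amplitude 1, so the first remainder has order
  \<open>2 - 2 * k\<close>. Each round solves the transport equation for the polynomial part of the
  remainder and gains one order; what the polynomial approximation misses is already of the final
  order \<open>M\<close>.\<close>

lemma amplitude_step: "\<exists>w r. pfam y 1 w \<and> apx y (int J + 2 - 2 * int k) r \<and> osym y M (\<lambda>\<rho> x. Cop (\<lambda>\<rho> x. 1 + w \<rho> x) \<rho> x - r \<rho> x)"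
proof (induction J)
  case 0
  have "apx y (0 - 2 * int k + 2) (\<lambda>\<rho> x. Cop (\<lambda>\<rho> x. 1) \<rho> x - of_real (\<rho> powi (2 * int k - 2)) * vfield a (\<lambda>\<rho> x. 1) \<rho> x)"
    by (rule Cop_expansion[OF apx_const])
  moreover have "vfield a (\<lambda>\<rho> x. 1) = (\<lambda>\<rho> x. 0)" by (simp add: vfield_def partial_const)
  ultimately have "apx y (int 0 + 2 - 2 * int k) (Cop (\<lambda>\<rho> x. 1 + 0))" by (simp add: algebra_simps)
  then show ?case using pfam_zero[of y 1] osym_zero[of y M]
    by (intro exI[of _ "\<lambda>\<rho> x. 0"] exI[of _ "Cop (\<lambda>\<rho> x. 1 + 0)"]) simp
next
  case (Suc J)
  then obtain w r where w: "pfam y 1 w" and r: "apx y (int J + 2 - 2 * int k) r"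
    and wr: "osym y M (\<lambda>\<rho> x. Cop (\<lambda>\<rho> x. 1 + w \<rho> x) \<rho> x - r \<rho> x)" by blast
  obtain q where q: "pfam y (int J + 2 - 2 * int k) q" "osym y M (\<lambda>\<rho> x. r \<rho> x - q \<rho> x)"
    by (rule apxE[OF r])
  \<comment> \<open>The weight \<open>\<rho> powi (2 * int k - 2)\<close> of the transport term is
    divided out, so that the correction \<open>g\<close> has order \<open>J + 1\<close>.\<close>
  have "pfam y (int J + 2 - 2 * int k - (2 - 2 * int k)) (\<lambda>\<rho> x. of_real (\<rho> powi (2 - 2 * int k)) * (- 1 * q \<rho> x))"
    by (intro pfam_rho pfam_cmult q)
  then have "pfam y (int J) (\<lambda>\<rho> x. of_real (\<rho> powi (2 - 2 * int k)) * (- 1 * q \<rho> x))" by simp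
  from pfam_vfield_solve[where a=a, OF this a_nz]
  obtain g where g: "pfam y (int J + 1) g" "vfield a g = (\<lambda>\<rho> x. of_real (\<rho> powi (2 - 2 * int k)) * (- 1 * q \<rho> x))"
    by blast
  have w': "pfam y 1 (\<lambda>\<rho> x. w \<rho> x + g \<rho> x)" using w pfam_mono[OF g(1)] by (intro pfam_add) auto
  have s1: "smooth_on UNIV (\<lambda>x. 1 + w \<rho> x)" for \<rho> by (intro smooth_on_add smooth_on_const pfam_smooth[OF w] open_UNIV)
  have C: "Cop (\<lambda>\<rho> x. 1 + (w \<rho> x + g \<rho> x)) = (\<lambda>\<rho> x. Cop (\<lambda>\<rho> x. 1 + w \<rho> x) \<rho> x + Cop g \<rho> x)"
    using Cop_add[OF s1 pfam_smooth[OF g(1)]] by (simp add: add.assoc)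
  define r' where "r' = (\<lambda>\<rho> x. Cop g \<rho> x - of_real (\<rho> powi (2 * int k - 2)) * vfield a g \<rho> x)"
  have r': "apx y (int (Suc J) + 2 - 2 * int k) r'"
    using Cop_expansion[OF pfam_apx[OF g(1)]] unfolding r'_def by (simp add: algebra_simps)
  have "osym y M (\<lambda>\<rho> x. (Cop (\<lambda>\<rho> x. 1 + w \<rho> x) \<rho> x - r \<rho> x) + (r \<rho> x - q \<rho> x))"
    by (rule osym_add[OF wr q(2)])
  then have "osym y M (\<lambda>\<rho> x. Cop (\<lambda>\<rho> x. 1 + (w \<rho> x + g \<rho> x)) \<rho> x - r' \<rho> x)"
  proof (rule osym_cong)
    fix \<rho> :: real assume "\<rho> \<ge> 1"
    then have "\<rho> powi (2 * int k - 2) * \<rho> powi (2 - 2 * int k) = \<rho> powi (2 * int k - 2 + (2 - 2 * int k))"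
      by (intro power_int_add[symmetric]) simp
    then have pw: "complex_of_real (\<rho> powi (2 * int k - 2)) * of_real (\<rho> powi (2 - 2 * int k)) = 1"
      unfolding of_real_mult[symmetric] by simp
    have "complex_of_real (\<rho> powi (2 * int k - 2)) * vfield a g \<rho> x = - q \<rho> x" for x
      unfolding g(2) mult.assoc[symmetric] pw by simp
    then show "(\<lambda>x. Cop (\<lambda>\<rho> x. 1 + (w \<rho> x + g \<rho> x)) \<rho> x - r' \<rho> x) =
       (\<lambda>x. (Cop (\<lambda>\<rho> x. 1 + w \<rho> x) \<rho> x - r \<rho> x) + (r \<rho> x - q \<rho> x))"
      unfolding C r'_def by (simp add: algebra_simps)
  next
    fix \<rho> :: real
    have "osym y (- (2 * int k)) (Cop (\<lambda>\<rho> x. 1 + (w \<rho> x + g \<rho> x)))"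
      using Cop_osym[OF osym_add[OF osym_const osym_mono[OF pfam_osym[OF w']]], of 1] by simp
    from osym_smooth[OF this] show "smooth_on UNIV (\<lambda>x. Cop (\<lambda>\<rho> x. 1 + (w \<rho> x + g \<rho> x)) \<rho> x - r' \<rho> x)"
      by (intro smooth_on_diff apx_smooth[OF r'] open_UNIV)
  qed
  with w' r' show ?case by blast
qed

lemma amplitude_exists:
  obtains w where "pfam y 1 w" "osym y M (Cop (\<lambda>\<rho> x. 1 + w \<rho> x))"
proof -
  define J where "J = nat (M + 2 * int k)"
  obtain w r where w: "pfam y 1 w" and r: "apx y (int J + 2 - 2 * int k) r"
    and wr: "osym y M (\<lambda>\<rho> x. Cop (\<lambda>\<rho> x. 1 + w \<rho> x) \<rho> x - r \<rho> x)"
    using amplitude_step by blast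
  have "osym y M r" by (rule osym_mono[OF apx_osym[OF r]]) (simp add: J_def)
  from osym_add[OF wr this] have "osym y M (Cop (\<lambda>\<rho> x. 1 + w \<rho> x))" by simp
  with w show ?thesis using that by blast
qed

end

section \<open>Gaussian quasimodes and their bounds\<close>

context phase
begin

lemma partials_EE_bound:
  assumes u: "osym y m u" and re: "\<And>i. Re (\<zeta> i) = 0" and \<kappa>: "\<kappa> > 0"
    and neg: "\<And>v::real^'n. Re (\<Sum>i\<in>UNIV. \<Sum>j\<in>UNIV. S i j * of_real (v $ i * v $ j)) \<le> - 2 * \<kappa> * (norm v)\<^sup>2"
  shows "\<exists>C. \<forall>\<rho>\<ge>1. \<forall>x. norm (partials is (\<lambda>x. EE \<rho> x * u \<rho> x) x) \<le> C * \<rho> powi (2 * int (length is) - m)"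
proof -
  have "osym y (m - 2 * int (length is)) (Tl is u)" by (rule Tl_osym[OF u])
  \<comment> \<open>The free exponent \<open>e\<close> is set to the decay rate
    \<open>\<kappa>\<close> of the Gaussian, so that the two exponentials cancel exactly.\<close>
  from osym_obnd[OF this] obtain C where C: "C \<ge> 0" "\<And>\<rho> x. \<rho> \<ge> 1 \<Longrightarrow>
    norm (Tl is u \<rho> x) \<le> C * \<rho> powi (- (m - 2 * int (length is))) * exp (\<kappa> * (\<rho> * norm (x - y))\<^sup>2)"
    by (rule obndE[OF _ \<kappa>]) blast
  have "norm (partials is (\<lambda>x. EE \<rho> x * u \<rho> x) x) \<le> C * \<rho> powi (2 * int (length is) - m)" if "\<rho> \<ge> 1" for \<rho> x
  proof -
    have "norm (partials is (\<lambda>x. EE \<rho> x * u \<rho> x) x) = norm (EE \<rho> x) * norm (Tl is u \<rho> x)"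
      by (simp add: partials_EE[of u, OF osym_smooth[OF u]] norm_mult)
    also have "\<dots> \<le> exp (- \<kappa> * (\<rho> * norm (x - y))\<^sup>2) * (C * \<rho> powi (- (m - 2 * int (length is))) * exp (\<kappa> * (\<rho> * norm (x - y))\<^sup>2))"
      by (intro mult_mono norm_EE re neg C that) auto
    also have "\<dots> = C * \<rho> powi (2 * int (length is) - m) * (exp (- \<kappa> * (\<rho> * norm (x - y))\<^sup>2) * exp (\<kappa> * (\<rho> * norm (x - y))\<^sup>2))"
      by (simp add: algebra_simps)
    also have "\<dots> = C * \<rho> powi (2 * int (length is) - m)" by (simp flip: exp_add)
    finally show ?thesis .
  qed
  then show ?thesis by blast
qed

text \<open>The linear part of the phase is imaginary, and on the ball of radius
  \<open>1/\<rho>\<close> the quadratic part times \<open>\<rho>\<^sup>2\<close> is bounded.\<close>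

lemma norm_EE_lower:
  assumes re: "\<And>i. Re (\<zeta> i) = 0"
  obtains K where "\<And>\<rho> x. \<rho> * norm (x - y) \<le> 1 \<Longrightarrow> \<rho> \<ge> 0 \<Longrightarrow> norm (EE \<rho> x) \<ge> exp (- K)"
proof -
  define K where "K = (\<Sum>i\<in>UNIV. \<Sum>j\<in>UNIV. norm (S i j))"
  have "norm (EE \<rho> x) \<ge> exp (- K)" if "\<rho> * norm (x - y) \<le> 1" "\<rho> \<ge> 0" for \<rho> x
  proof -
    define Q where "Q = (\<Sum>i\<in>UNIV. \<Sum>j\<in>UNIV. S i j * of_real ((x - y) $ i * (x - y) $ j))"
    have "(\<Sum>i\<in>UNIV. of_real (x $ i - y $ i) * lin i x) = Q"
      by (simp add: Q_def lin_def sum_distrib_left mult_ac)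
    moreover have "Re (\<Sum>i\<in>UNIV. \<zeta> i * of_real (x $ i - y $ i)) = 0" using re by simp
    ultimately have re_phi: "Re (phi x) = 1/2 * Re Q" unfolding phi_def by simp
    have "norm Q \<le> (\<Sum>i\<in>UNIV. \<Sum>j\<in>UNIV. norm (S i j) * (norm (x - y))\<^sup>2)"
      unfolding Q_def
    proof (intro sum_norm_le)
      fix i j
      have "\<bar>(x - y) $ i\<bar> * \<bar>(x - y) $ j\<bar> \<le> norm (x - y) * norm (x - y)"
        by (intro mult_mono component_le_norm_cart) auto
      then show "norm (S i j * of_real ((x - y) $ i * (x - y) $ j)) \<le> norm (S i j) * (norm (x - y))\<^sup>2"
        unfolding norm_mult norm_of_real abs_mult power2_eq_square by (rule mult_left_mono) simp
    qed
    also have "\<dots> = K * (norm (x - y))\<^sup>2" by (simp add: K_def sum_distrib_right)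
    finally have "Re Q \<ge> - (K * (norm (x - y))\<^sup>2)" using abs_Re_le_cmod[of Q] by linarith
    then have "\<rho>\<^sup>2 * Re Q \<ge> \<rho>\<^sup>2 * - (K * (norm (x - y))\<^sup>2)" by (intro mult_left_mono) auto
    then have 1: "\<rho>\<^sup>2 * Re Q \<ge> - (K * (\<rho> * norm (x - y))\<^sup>2)" by (simp add: power_mult_distrib mult_ac)
    have "(\<rho> * norm (x - y))\<^sup>2 \<le> 1" using that by (intro power_le_one) auto
    moreover have "K \<ge> 0" by (simp add: K_def sum_nonneg)
    ultimately have "K * (\<rho> * norm (x - y))\<^sup>2 \<le> K" by (simp add: mult_left_le)
    with 1 have "\<rho>\<^sup>2 * Re Q \<ge> - K" by linarith
    then have "- K \<le> \<rho>\<^sup>2 * Re (phi x)" using \<open>K \<ge> 0\<close> unfolding re_phi by linarith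
    then show ?thesis unfolding EE_def by simp
  qed
  then show ?thesis using that by blast
qed

end

context wkb
begin

lemma quasimode:
  assumes re: "\<And>i. Re (\<zeta> i) = 0" and \<kappa>: "\<kappa> > 0"
    and neg: "\<And>v::real^'n. Re (\<Sum>i\<in>UNIV. \<Sum>j\<in>UNIV. S i j * of_real (v $ i * v $ j)) \<le> - 2 * \<kappa> * (norm v)\<^sup>2"
    and r: "r > 0"
  obtains v where "\<And>\<rho>. smooth_on UNIV (v \<rho>)" "\<And>\<rho> x. norm (x - y) \<ge> r \<Longrightarrow> v \<rho> x = 0"
    "\<And>is. \<exists>C. \<forall>\<rho>\<ge>1. \<forall>x. norm (partials is (v \<rho>) x) \<le> C * \<rho> powi (2 * int (length is))"
    "\<And>is. \<exists>C. \<forall>\<rho>\<ge>1. \<forall>x. norm (partials is (Lop (v \<rho>)) x) \<le> C * \<rho> powi (2 * int (length is) - M)"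
    "\<exists>\<rho>0\<ge>1. \<exists>\<delta>>0. \<forall>\<rho>\<ge>\<rho>0. \<forall>x. \<rho> * norm (x - y) \<le> 1 \<longrightarrow> norm (v \<rho> x) \<ge> \<delta>"
proof -
  obtain w where w: "pfam y 1 w" "osym y M (Cop (\<lambda>\<rho> x. 1 + w \<rho> x))" by (rule amplitude_exists)
  obtain \<eta> :: "real^'n \<Rightarrow> complex" where \<eta>: "smooth_on UNIV \<eta>" "\<And>x. norm (x - y) \<le> r/2 \<Longrightarrow> \<eta> x = 1"
    "\<And>x. norm (x - y) \<ge> 2 * (r/2) \<Longrightarrow> \<eta> x = 0"
    using cutoff_exists[of "r/2" y] r by auto
  have b\<eta>: "bsmooth \<eta>" using bsmooth_compact_support[OF \<eta>(1), of r y] \<eta>(3) by simp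
  \<comment> \<open>\<open>\<eta> - 1\<close> vanishes near \<open>y\<close>, so cutting off changes
    the amplitude only by a family of every order.\<close>
  have fl: "osym y m (\<lambda>\<rho> x. \<eta> x + - 1)" for m
    by (rule osym_flat[OF bsmooth_add[OF b\<eta> bsmooth_const], of "r/2"]) (use r \<eta>(2) in auto)
  define A where "A = (\<lambda>\<rho> x. 1 + w \<rho> x)"
  have A: "osym y 0 A" unfolding A_def
    by (intro osym_add osym_const osym_mono[OF pfam_osym[OF w(1)]]) simp
  define B where "B = (\<lambda>\<rho> x. (\<eta> x + - 1) * A \<rho> x)"
  have B: "osym y m B" for m unfolding B_def using osym_mult[OF fl[of m] A] by simp
  have AB: "(\<lambda>\<rho> x. A \<rho> x + B \<rho> x) = (\<lambda>\<rho> x. \<eta> x * A \<rho> x)" by (simp add: B_def algebra_simps)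
  define u where "u = (\<lambda>\<rho> x. A \<rho> x + B \<rho> x)"
  have u0: "osym y 0 u" unfolding u_def by (intro osym_add A B)
  have uM: "osym y M (Cop u)"
  proof -
    have "osym y M (Cop B)" using Cop_osym[OF B[of "M + 2 * int k"]] by simp
    moreover have "Cop u = (\<lambda>\<rho> x. Cop A \<rho> x + Cop B \<rho> x)"
      unfolding u_def by (rule Cop_add[OF osym_smooth[OF A] osym_smooth[OF B]])
    moreover have "osym y M (Cop A)" using w(2) unfolding A_def .
    ultimately show ?thesis using osym_add[of y M "Cop A" "Cop B"] by simp
  qed
  define v where "v \<rho> = (\<lambda>x. EE \<rho> x * u \<rho> x)" for \<rho>
  have u\<eta>: "u \<rho> x = \<eta> x * A \<rho> x" for \<rho> x using AB unfolding u_def by metis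
  show ?thesis
  proof (rule that[of v])
    show "smooth_on UNIV (v \<rho>)" for \<rho> unfolding v_def by (intro smooth_on_mult smooth_EE osym_smooth[OF u0] open_UNIV)
    show "v \<rho> x = 0" if "norm (x - y) \<ge> r" for \<rho> x using \<eta>(3)[of x] that by (simp add: v_def u\<eta>)
    show "\<exists>C. \<forall>\<rho>\<ge>1. \<forall>x. norm (partials is (v \<rho>) x) \<le> C * \<rho> powi (2 * int (length is))" for "is"
      using partials_EE_bound[OF u0 re \<kappa> neg, of "is"] by (simp add: v_def)
    show "\<exists>C. \<forall>\<rho>\<ge>1. \<forall>x. norm (partials is (Lop (v \<rho>)) x) \<le> C * \<rho> powi (2 * int (length is) - M)" for "is"
      using partials_EE_bound[OF uM re \<kappa> neg, of "is"] by (simp add: v_def Lop_EE[of u, OF osym_smooth[OF u0]])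
    obtain K where K: "\<And>\<rho> x. \<rho> * norm (x - y) \<le> 1 \<Longrightarrow> \<rho> \<ge> 0 \<Longrightarrow> norm (EE \<rho> x) \<ge> exp (- K)"
      using norm_EE_lower[OF re] by blast
    obtain C where C: "C \<ge> 0" "\<And>\<rho> x. \<rho> \<ge> 1 \<Longrightarrow> norm (w \<rho> x) \<le> C * \<rho> powi (- 1) * exp (1 * (\<rho> * norm (x - y))\<^sup>2)"
      by (rule obndE[OF osym_obnd[OF pfam_osym[OF w(1)]], of 1]) auto
    \<comment> \<open>\<open>2/r\<close> puts the ball of radius \<open>1/\<rho>\<close> inside the
      region where \<open>\<eta> = 1\<close>; \<open>2 * C * exp 1\<close> makes the correction
      \<open>w\<close> at most 1/2 on that ball.\<close>
    define \<rho>0 where "\<rho>0 = max 1 (max (2/r) (2 * C * exp 1))"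
    show "\<exists>\<rho>0\<ge>1. \<exists>\<delta>>0. \<forall>\<rho>\<ge>\<rho>0. \<forall>x. \<rho> * norm (x - y) \<le> 1 \<longrightarrow> norm (v \<rho> x) \<ge> \<delta>"
    proof (rule exI[of _ \<rho>0], rule conjI[OF _ exI[of _ "exp (- K) * (1/2)"]], goal_cases)
      case 2
      show ?case
    proof (intro conjI allI impI)
      fix \<rho> x assume \<rho>: "\<rho>0 \<le> \<rho>" and x: "\<rho> * norm (x - y) \<le> 1"
      have \<rho>1: "\<rho> \<ge> 1" "\<rho> \<ge> 2/r" "\<rho> \<ge> 2 * C * exp 1" using \<rho> by (auto simp: \<rho>0_def)
      have "2/r * norm (x - y) \<le> 1" using x \<rho>1(2) by (meson mult_right_mono norm_ge_zero order.trans)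
      then have "\<eta> x = 1" using r by (intro \<eta>(2)) (simp add: field_simps)
      have "(\<rho> * norm (x - y))\<^sup>2 \<le> 1" using x \<rho>1 by (intro power_le_one) auto
      then have "C * \<rho> powi (- 1) * exp (1 * (\<rho> * norm (x - y))\<^sup>2) \<le> C * \<rho> powi (- 1) * exp 1"
        using C(1) \<rho>1 by (intro mult_left_mono) auto
      also have "\<dots> \<le> 1/2" using \<rho>1 by (simp add: power_int_minus field_simps)
      finally have "norm (w \<rho> x) \<le> 1/2" using C(2)[OF \<rho>1(1), of x] by linarith
      then have "norm (1 + w \<rho> x) \<ge> 1/2" using norm_triangle_ineq2[of 1 "- w \<rho> x"] by simp
      then have "exp (- K) * (1/2) \<le> norm (EE \<rho> x) * norm (1 + w \<rho> x)"
        using K[OF x] \<rho>1(1) by (intro mult_mono) auto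
      then show "exp (- K) * (1/2) \<le> norm (v \<rho> x)"
        unfolding v_def u\<eta> \<open>\<eta> x = 1\<close> A_def by (simp add: norm_mult)
    qed auto
    qed (auto simp: \<rho>0_def)
  qed
qed

end

section \<open>Functional analytic obstruction to solvability\<close>

lemma smooth_uniform_limit:
  fixes g :: "nat \<Rightarrow> real^'n::finite \<Rightarrow> complex"
  assumes g: "\<And>n. smooth_on UNIV (g n)"
    and lim: "\<And>is. uniform_limit UNIV (\<lambda>n. partials is (g n)) (G is) sequentially"
  shows "smooth_on UNIV (G [])"
proof -
  have cont: "continuous_on UNIV (G is)" for "is"
    by (rule uniform_limit_theorem[OF _ lim])
      (simp_all add: smooth_on_continuous smooth_on_partials g)
  have der: "((\<lambda>t. G is (x + t *\<^sub>R axis i 1)) has_vector_derivative G (i # is) x) (at 0)" for i "is" x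
  proof -
    have "\<exists>h. \<forall>t\<in>UNIV. (\<lambda>n. partials is (g n) (x + t *\<^sub>R axis i 1)) \<longlonglongrightarrow> h t \<and>
        (h has_derivative (\<lambda>s. s *\<^sub>R G (i # is) (x + t *\<^sub>R axis i 1))) (at t within UNIV)"
    proof (rule has_derivative_sequence[where S=UNIV and f="\<lambda>n t. partials is (g n) (x + t *\<^sub>R axis i 1)"
          and g'="\<lambda>t s. s *\<^sub>R G (i # is) (x + t *\<^sub>R axis i 1)" and f'="\<lambda>n t s. s *\<^sub>R partials (i # is) (g n) (x + t *\<^sub>R axis i 1)"])
      show "((\<lambda>t. partials is (g n) (x + t *\<^sub>R axis i 1)) has_derivative (\<lambda>s. s *\<^sub>R partials (i # is) (g n) (x + t *\<^sub>R axis i 1))) (at t within UNIV)" for n t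
      proof -
        have "has_partial i (partials is (g n)) (x + t *\<^sub>R axis i 1)"
          by (rule smooth_on_has_partial[OF smooth_on_partials[OF g]]) simp
        from has_vector_derivative_line[OF this, of UNIV] show ?thesis by (simp add: has_vector_derivative_def)
      qed
      show "(\<lambda>n. partials is (g n) (x + 0 *\<^sub>R axis i 1)) \<longlonglongrightarrow> G is (x + 0 *\<^sub>R axis i 1)"
        by (rule tendsto_uniform_limitI[OF lim]) simp
      fix e :: real assume "e > 0"
      from uniform_limitD[OF lim this, of "i # is"]
      show "\<forall>\<^sub>F n in sequentially. \<forall>t\<in>UNIV. \<forall>s. norm (s *\<^sub>R partials (i # is) (g n) (x + t *\<^sub>R axis i 1) - s *\<^sub>R G (i # is) (x + t *\<^sub>R axis i 1)) \<le> e * norm s"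
      proof (rule eventually_mono)
        fix n assume n: "\<forall>x\<in>UNIV. dist (partials (i # is) (g n) x) (G (i # is) x) < e"
        have "\<bar>s\<bar> * norm (partials (i # is) (g n) (x + t *\<^sub>R axis i 1) - G (i # is) (x + t *\<^sub>R axis i 1)) \<le> \<bar>s\<bar> * e" for s t
          using n by (intro mult_left_mono) (auto simp: dist_norm less_imp_le)
        then show "\<forall>t\<in>UNIV. \<forall>s. norm (s *\<^sub>R partials (i # is) (g n) (x + t *\<^sub>R axis i 1) - s *\<^sub>R G (i # is) (x + t *\<^sub>R axis i 1)) \<le> e * norm s"
          unfolding scaleR_diff_right[symmetric] norm_scaleR by (simp add: mult.commute)
      qed
    qed (rule convex_UNIV UNIV_I)+
    then obtain h where "\<forall>t\<in>UNIV. (\<lambda>n. partials is (g n) (x + t *\<^sub>R axis i 1)) \<longlonglongrightarrow> h t \<and>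
        (h has_derivative (\<lambda>s. s *\<^sub>R G (i # is) (x + t *\<^sub>R axis i 1))) (at t within UNIV)" ..
    note hh = bspec[OF this UNIV_I]
    have h1: "(\<lambda>n. partials is (g n) (x + t *\<^sub>R axis i 1)) \<longlonglongrightarrow> h t" for t using hh[of t] by (rule conjunct1)
    have h2: "(h has_derivative (\<lambda>s. s *\<^sub>R G (i # is) (x + t *\<^sub>R axis i 1))) (at t)" for t using hh[of t] by (rule conjunct2)
    have "(\<lambda>n. partials is (g n) (x + t *\<^sub>R axis i 1)) \<longlonglongrightarrow> G is (x + t *\<^sub>R axis i 1)" for t
      by (rule tendsto_uniform_limitI[OF lim]) simp
    then have "h t = G is (x + t *\<^sub>R axis i 1)" for t by (rule LIMSEQ_unique[OF h1])
    then have "h = (\<lambda>t. G is (x + t *\<^sub>R axis i 1))" by (rule ext)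
    with h2[of 0] show ?thesis by (simp add: has_vector_derivative_def)
  qed
  have eq: "partials is (G []) = G is" for "is"
  proof (induction "is")
    case (Cons i "is")
    show ?case unfolding partials.simps Cons by (rule ext, rule partialI(2)[OF der])
  qed simp
  show ?thesis unfolding smooth_on_def eq using cont partialI(1)[OF der] by blast
qed

lemma zero_off_test_fun:
  assumes "smooth_on UNIV \<phi>" "\<And>x. x \<notin> cball y r \<Longrightarrow> \<phi> x = 0" "cball y r \<subseteq> U"
  shows "test_fun U \<phi>" "tsupport \<phi> \<subseteq> cball y r"
proof -
  show s: "tsupport \<phi> \<subseteq> cball y r" unfolding tsupport_def
    by (rule closure_minimal) (use assms(2) in \<open>auto simp del: mem_cball\<close>)
  have "compact (tsupport \<phi>)" unfolding tsupport_def
    by (rule compact_closure[THEN iffD2], rule bounded_subset[OF bounded_cball[of y r]]) (use assms(2) in \<open>auto simp del: mem_cball\<close>)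
  with s assms show "test_fun U \<phi>" unfolding test_fun_def by auto
qed

lemma integral_zero_off:
  fixes g :: "real^'n::finite \<Rightarrow> 'b::euclidean_space"
  assumes "continuous_on UNIV g" "\<And>x. x \<notin> cball y r \<Longrightarrow> g x = 0"
  shows "g integrable_on UNIV"
proof -
  obtain a b where ab: "cball y r \<subseteq> cbox a b" using bounded_subset_cbox_symmetric[OF bounded_cball] by blast
  have "g integrable_on cbox a b" by (intro integrable_continuous continuous_on_subset[OF assms(1)]) auto
  then show ?thesis by (rule integrable_on_superset) (use assms(2) ab in \<open>auto simp del: mem_cball\<close>)
qed

lemma norm_integral_mult_le:
  fixes f v :: "real^'n::finite \<Rightarrow> complex"
  assumes "continuous_on UNIV f" "continuous_on UNIV v" "\<And>x. x \<notin> cball y r \<Longrightarrow> v x = 0" "\<And>x. norm (f x) \<le> s"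
  shows "norm (integral UNIV (\<lambda>x. f x * v x)) \<le> s * integral UNIV (\<lambda>x. norm (v x))"
proof -
  have i: "(\<lambda>x. norm (v x)) integrable_on UNIV"
    by (rule integral_zero_off[of _ y r]) (use assms in \<open>auto intro!: continuous_intros\<close>)
  have "norm (integral UNIV (\<lambda>x. f x * v x)) \<le> integral UNIV (\<lambda>x. s * norm (v x))"
  proof (rule integral_norm_bound_integral)
    show "(\<lambda>x. f x * v x) integrable_on UNIV"
      by (rule integral_zero_off[of _ y r]) (use assms in \<open>auto intro!: continuous_intros\<close>)
    show "(\<lambda>x. s * norm (v x)) integrable_on UNIV" using integrable_on_cmult_left[OF i, of s] by simp
    show "norm (f x * v x) \<le> s * norm (v x)" for x
      unfolding norm_mult by (rule mult_right_mono[OF assms(4)]) simp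
  qed
  then show ?thesis by simp
qed

lemma finite_mi: "finite {\<alpha>::'n::finite \<Rightarrow> nat. mi_abs \<alpha> \<le> N}"
proof (rule finite_subset)
  show "{\<alpha>::'n \<Rightarrow> nat. mi_abs \<alpha> \<le> N} \<subseteq> PiE UNIV (\<lambda>_. {..N})"
  proof
    fix \<alpha> :: "'n \<Rightarrow> nat" assume "\<alpha> \<in> {\<alpha>. mi_abs \<alpha> \<le> N}"
    then have "(\<Sum>i\<in>UNIV. \<alpha> i) \<le> N" by (simp add: mi_abs_def)
    moreover have "\<alpha> i \<le> (\<Sum>i\<in>UNIV. \<alpha> i)" for i by (rule member_le_sum) simp_all
    ultimately have "\<alpha> i \<le> N" for i by (rule order.trans[rotated])
    then show "\<alpha> \<in> PiE UNIV (\<lambda>_. {..N})" by auto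
  qed
  show "finite (PiE (UNIV::'n set) (\<lambda>_. {..N}))" by (intro finite_PiE) auto
qed

text \<open>\<open>mi_list\<close> is a choice, so a list with the prescribed multiplicities has to
  be exhibited first: each index repeated as often as \<open>\<alpha>\<close> says.\<close>

lemma mi_list_count: "count_list (mi_list \<alpha>) i = \<alpha> i"
proof -
  obtain us :: "'a list" where us: "set us = UNIV" "distinct us" using finite_distinct_list[OF finite[of UNIV]] by auto
  have rep: "count_list (replicate n j) i = (if i = j then n else 0)" for n i and j :: 'a
    by (induction n) auto
  have "count_list (concat (map (\<lambda>j. replicate (\<alpha> j) j) js)) i = (if i \<in> set js then \<alpha> i else 0)" if "distinct js" for js i
    using that by (induction js) (auto simp: count_list_append rep)
  then have "\<exists>xs. \<forall>i. count_list xs i = \<alpha> i"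
    using us by (intro exI[of _ "concat (map (\<lambda>j. replicate (\<alpha> j) j) us)"]) simp
  from someI_ex[OF this] show ?thesis unfolding mi_list_def by blast
qed

lemma length_mi_list: "length (mi_list \<alpha>) = mi_abs \<alpha>"
  using sum_count_set[of "mi_list \<alpha>" UNIV] by (simp add: mi_list_count mi_abs_def)

lemma distribution_bound:
  assumes u: "distribution U u" and K: "compact K" "K \<subseteq> U"
  obtains C N where "C \<ge> 0" "\<And>\<phi>. test_fun U \<phi> \<Longrightarrow> tsupport \<phi> \<subseteq> K \<Longrightarrow>
    (\<And>is x. length is \<le> N \<Longrightarrow> norm (partials is \<phi> x) \<le> 1) \<Longrightarrow> norm (u \<phi>) \<le> C"
proof -
  have "\<exists>C N. \<forall>\<phi>. test_fun U \<phi> \<and> tsupport \<phi> \<subseteq> K \<longrightarrow>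
      norm (u \<phi>) \<le> C * (\<Sum>\<alpha>\<in>{\<alpha>::'a\<Rightarrow>nat. mi_abs \<alpha> \<le> N}. Sup ((\<lambda>x. norm (dpart \<alpha> \<phi> x)) ` UNIV))"
    using u[unfolded distribution_def, THEN conjunct2, THEN spec, of K] K by (rule mp[OF _ conjI])
  then obtain C N where CN: "\<And>\<phi>. test_fun U \<phi> \<Longrightarrow> tsupport \<phi> \<subseteq> K \<Longrightarrow>
      norm (u \<phi>) \<le> C * (\<Sum>\<alpha>\<in>{\<alpha>. mi_abs \<alpha> \<le> N}. Sup ((\<lambda>x. norm (dpart \<alpha> \<phi> x)) ` UNIV))"
    by blast
  let ?I = "{\<alpha>::'a \<Rightarrow> nat. mi_abs \<alpha> \<le> N}"
  show ?thesis
  \<comment> \<open>The given constant may be negative, hence the absolute value; each of the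
    finitely many suprema is at most 1.\<close>
  proof (rule that[of "\<bar>C\<bar> * real (card ?I)" N])
    fix \<phi> assume \<phi>: "test_fun U \<phi>" "tsupport \<phi> \<subseteq> K" and b: "\<And>is x. length is \<le> N \<Longrightarrow> norm (partials is \<phi> x) \<le> 1"
    have s: "0 \<le> Sup ((\<lambda>x. norm (dpart \<alpha> \<phi> x)) ` UNIV) \<and> Sup ((\<lambda>x. norm (dpart \<alpha> \<phi> x)) ` UNIV) \<le> 1" if "\<alpha> \<in> ?I" for \<alpha>
    proof
      have b': "norm (dpart \<alpha> \<phi> x) \<le> 1" for x using that b unfolding dpart_def by (simp add: length_mi_list)
      show "Sup ((\<lambda>x. norm (dpart \<alpha> \<phi> x)) ` UNIV) \<le> 1" by (rule cSup_least) (use b' in auto)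
      have "norm (dpart \<alpha> \<phi> 0) \<le> Sup ((\<lambda>x. norm (dpart \<alpha> \<phi> x)) ` UNIV)"
        by (rule cSup_upper) (use b' in \<open>auto intro!: bdd_aboveI[of _ 1]\<close>)
      then show "0 \<le> Sup ((\<lambda>x. norm (dpart \<alpha> \<phi> x)) ` UNIV)" using norm_ge_zero order.trans by blast
    qed
    define T where "T = (\<Sum>\<alpha>\<in>?I. Sup ((\<lambda>x. norm (dpart \<alpha> \<phi> x)) ` UNIV))"
    have "0 \<le> T" unfolding T_def by (rule sum_nonneg) (rule s[THEN conjunct1])
    have "T \<le> real (card ?I) * 1" unfolding T_def by (rule sum_bounded_above) (rule s[THEN conjunct2])
    have "norm (u \<phi>) \<le> C * T" using CN[OF \<phi>] unfolding T_def .
    also have "\<dots> \<le> \<bar>C\<bar> * T" using \<open>0 \<le> T\<close> by (intro mult_right_mono) auto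
    also have "\<dots> \<le> \<bar>C\<bar> * (real (card ?I) * 1)" using \<open>T \<le> _\<close> by (intro mult_left_mono) auto
    finally show "norm (u \<phi>) \<le> \<bar>C\<bar> * real (card ?I)" by simp
  qed simp
qed

text \<open>A state of the recursion consists of a partial sum \<open>g\<close>, the current hump
  \<open>v\<close>, and a number \<open>L\<close> that bounds the L1 norms of all humps so far.
  Later increments are small relative to \<open>L\<close> and summable, so all of them together move
  the pairing with an old hump by at most 1: the limit \<open>f\<close> still pairs with
  \<open>v n\<close> to at least \<open>n + 1\<close>, while a distribution of finite order keeps
  these pairings bounded.\<close>

lemma gliding_hump:
  fixes P :: "(real^'n::finite \<Rightarrow> complex) \<Rightarrow> real^'n \<Rightarrow> complex"
  assumes cb: "cball y r \<subseteq> U"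
    and solv: "\<And>f. test_fun U f \<Longrightarrow> \<exists>u. distribution U u \<and>
        (\<forall>\<phi>. test_fun U \<phi> \<longrightarrow> u (P \<phi>) = integral UNIV (\<lambda>x. f x * \<phi> x))"
    and P: "\<And>\<phi>. smooth_on UNIV \<phi> \<Longrightarrow> (\<And>x. x \<notin> cball y r \<Longrightarrow> \<phi> x = 0) \<Longrightarrow>
        smooth_on UNIV (P \<phi>) \<and> (\<forall>x. x \<notin> cball y r \<longrightarrow> P \<phi> x = 0)"
    and quasi: "\<And>N \<delta> B. \<delta> > 0 \<Longrightarrow> \<exists>f v. smooth_on UNIV f \<and> (\<forall>x. x \<notin> cball y r \<longrightarrow> f x = 0) \<and>
        smooth_on UNIV v \<and> (\<forall>x. x \<notin> cball y r \<longrightarrow> v x = 0) \<and>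
        (\<forall>is x. length is \<le> N \<longrightarrow> norm (partials is f x) \<le> \<delta>) \<and>
        (\<forall>is x. length is \<le> N \<longrightarrow> norm (partials is (P v) x) \<le> 1) \<and>
        norm (integral UNIV (\<lambda>x. f x * v x)) \<ge> B"
  shows False
proof -
  define ok where "ok = (\<lambda>\<phi>::real^'n \<Rightarrow> complex. smooth_on UNIV \<phi> \<and> (\<forall>x. x \<notin> cball y r \<longrightarrow> \<phi> x = 0))"
  define st where "st = (\<lambda>n (g, v, L). ok g \<and> ok v \<and> (\<forall>is x. length is \<le> n \<longrightarrow> norm (partials is (P v) x) \<le> 1) \<and>
     norm (integral UNIV (\<lambda>x. g x * v x)) \<ge> real n + 2 \<and> L \<ge> (1::real) \<and> integral UNIV (\<lambda>x. norm (v x)) \<le> L)"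
  define tr where "tr = (\<lambda>n (g::real^'n \<Rightarrow> complex, v::real^'n \<Rightarrow> complex, L) (g'::real^'n \<Rightarrow> complex, v'::real^'n \<Rightarrow> complex, L').
     L \<le> L' \<and> (\<forall>is x. length is \<le> n + 1 \<longrightarrow> norm (partials is g' x - partials is g x) \<le> (1/2)^(n+1) / L))"
  have int: "(\<lambda>x. f x * v x) integrable_on UNIV" if "ok v" "ok f" for f v
    by (rule integral_zero_off[of _ y r]) (use that smooth_on_continuous in \<open>auto simp: ok_def intro!: continuous_intros\<close>)
  have step: "\<exists>s'. st (Suc n) s' \<and> tr n s s'" if "st n s" for n s
  proof -
    obtain g v L where s: "s = (g, v, L)" by (cases s) auto
    have g: "ok g" and L: "L \<ge> 1" using that by (auto simp: st_def s)
    obtain f v' where f: "ok f" and v': "ok v'"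
      and bf: "\<And>is x. length is \<le> Suc n \<Longrightarrow> norm (partials is f x) \<le> (1/2)^(n+1) / L"
      and bv: "\<And>is x. length is \<le> Suc n \<Longrightarrow> norm (partials is (P v') x) \<le> 1"
      and big: "norm (integral UNIV (\<lambda>x. f x * v' x)) \<ge> real (Suc n) + 2"
      using quasi[of "(1/2)^(n+1) / L" "Suc n" "real (Suc n) + 2"] L unfolding ok_def by auto
    note gs = g[unfolded ok_def, THEN conjunct1] and fs = f[unfolded ok_def, THEN conjunct1]
    \<comment> \<open>The old sum might cancel the new term. The pairings for the signs
      \<open>1\<close> and \<open>-1\<close> differ by twice the pairing of \<open>f\<close> with
      the new hump, so one of them is large enough.\<close>
    have "\<exists>e::complex. norm e = 1 \<and> norm (integral UNIV (\<lambda>x. (g x + e * f x) * v' x)) \<ge> real (Suc n) + 2"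
    proof (rule ccontr)
      define a where "a = integral UNIV (\<lambda>x. g x * v' x)"
      define b where "b = integral UNIV (\<lambda>x. f x * v' x)"
      have eq: "integral UNIV (\<lambda>x. (g x + e * f x) * v' x) = a + e * b" for e
        unfolding a_def b_def distrib_right mult.assoc
      proof (subst Henstock_Kurzweil_Integration.integral_add)
        show "(\<lambda>x. e * (f x * v' x)) integrable_on UNIV"
          by (rule integral_zero_off[of _ y r]) (use f v' smooth_on_continuous in \<open>auto simp: ok_def intro!: continuous_intros\<close>)
      qed (use int g v' in auto)
      assume "\<not> ?thesis"
      then have "norm (a + 1 * b) < real (Suc n) + 2" "norm (a + - 1 * b) < real (Suc n) + 2"
        unfolding eq by (metis linorder_not_le norm_one norm_minus_cancel)+
      moreover have "norm ((a + 1 * b) - (a + - 1 * b)) \<le> norm (a + 1 * b) + norm (a + - 1 * b)" by (rule norm_triangle_ineq4)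
      moreover have "(a + 1 * b) - (a + - 1 * b) = 2 * b" by simp
      ultimately show False using big unfolding b_def by (simp add: norm_mult)
    qed
    then obtain e :: complex where e: "norm e = 1" "norm (integral UNIV (\<lambda>x. (g x + e * f x) * v' x)) \<ge> real (Suc n) + 2" by blast
    define g' where "g' = (\<lambda>x. g x + e * f x)"
    have g': "ok g'" unfolding ok_def g'_def using g f
      by (auto simp: ok_def intro!: smooth_on_add smooth_on_cmult)
    have diff: "partials is g' x - partials is g x = e * partials is f x" for "is" x
      unfolding g'_def partials_add[OF gs smooth_on_cmult[OF open_UNIV fs]] partials_cmult[OF fs] by simp
    define L' where "L' = max L (integral UNIV (\<lambda>x. norm (v' x)))"
    have "st (Suc n) (g', v', L') \<and> tr n s (g', v', L')"
      unfolding st_def tr_def s using g' v' bv e(2)[folded fun_cong[OF g'_def]] L bf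
      by (auto simp: L'_def diff norm_mult e(1))
    then show ?thesis by blast
  qed
  have init: "\<exists>s. st 0 s"
  proof -
    obtain f v where f: "ok f" and v: "ok v"
      and bv: "\<And>is x. length is \<le> 0 \<Longrightarrow> norm (partials is (P v) x) \<le> 1"
      and big: "norm (integral UNIV (\<lambda>x. f x * v x)) \<ge> 2"
      using quasi[of 1 0 2] unfolding ok_def by auto
    then have "st 0 (f, v, max 1 (integral UNIV (\<lambda>x. norm (v x))))" unfolding st_def by auto
    then show ?thesis by blast
  qed
  obtain s where s: "\<And>n. st n (s n)" "\<And>n. tr n (s n) (s (Suc n))"
    using dependent_nat_choice[of st tr] init step by metis
  define g where "g n = fst (s n)" for n
  define v where "v n = fst (snd (s n))" for n
  define L where "L n = snd (snd (s n))" for n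
  have sn: "s n = (g n, v n, L n)" for n by (simp add: g_def v_def L_def)
  have g: "ok (g n)" and v: "ok (v n)" and L: "L n \<ge> 1" "integral UNIV (\<lambda>x. norm (v n x)) \<le> L n"
    and big: "norm (integral UNIV (\<lambda>x. g n x * v n x)) \<ge> real n + 2"
    and bv: "\<And>is x. length is \<le> n \<Longrightarrow> norm (partials is (P (v n)) x) \<le> 1" for n
    using s(1)[of n] by (auto simp: st_def sn)
  have Lm: "L n \<le> L (Suc n)" and inc: "length is \<le> n + 1 \<Longrightarrow> norm (partials is (g (Suc n)) x - partials is (g n) x) \<le> (1/2)^(n+1) / L n" for n "is" x
    using s(2)[of n] by (auto simp: tr_def sn)
  have Lmono: "n \<le> m \<Longrightarrow> L n \<le> L m" for n m by (rule lift_Suc_mono_le[of L, OF Lm])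
  have tele: "norm (partials is (g (n + j)) x - partials is (g n) x) \<le> ((1/2)^n - (1/2)^(n+j)) / L n" if "length is \<le> n + 1" for "is" n j x
  proof (induction j)
    case (Suc j)
    have "norm (partials is (g (Suc (n + j))) x - partials is (g (n + j)) x) \<le> (1/2)^(n+j+1) / L (n + j)"
      by (rule inc) (use that in simp)
    also have "\<dots> \<le> (1/2)^(n+j+1) / L n"
      using Lmono[of n "n + j"] L(1)[of n] by (intro divide_left_mono) auto
    finally have "norm (partials is (g (n + Suc j)) x - partials is (g n) x) \<le> (1/2)^(n+j+1) / L n + ((1/2)^n - (1/2)^(n+j)) / L n"
      using norm_triangle_ineq[of "partials is (g (Suc (n + j))) x - partials is (g (n + j)) x" "partials is (g (n + j)) x - partials is (g n) x"] Suc
      by simp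
    also have "\<dots> = ((1/2)^n - (1/2)^(n + Suc j)) / L n" using L(1)[of n] by (simp add: field_simps)
    finally show ?case .
  qed simp
  have tele2: "norm (partials is (g m) x - partials is (g n) x) \<le> (1/2)^n / L n" if "length is \<le> n + 1" "n \<le> m" for "is" n m x
  proof -
    have "((1/2)^n - (1/2)^(n+(m - n))) / L n \<le> (1/2)^n / L n" using L(1)[of n] by (intro divide_right_mono) auto
    with tele[OF that(1), of "m - n" x] that(2) show ?thesis by simp
  qed
  have "\<exists>G. uniform_limit UNIV (\<lambda>n. partials is (g n)) G sequentially" for "is"
  proof -
    have "uniformly_Cauchy_on UNIV (\<lambda>n. partials is (g n))"
      unfolding uniformly_Cauchy_on_def
    proof (intro allI impI)
      fix e :: real assume "e > 0"
      then obtain N where N: "(1/2::real)^N < e/2" using real_arch_pow_inv[of "e/2" "1/2"] by auto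
      define M where "M = max N (length is)"
      have "(1/2::real)^M \<le> (1/2)^N" by (rule power_decreasing) (auto simp: M_def)
      moreover have "(1/2)^M / L M \<le> (1/2)^M" using L(1)[of M] by (simp add: divide_le_eq mult_left_le)
      ultimately have eM: "(1/2)^M / L M < e/2" using N by linarith
      have "norm (partials is (g m) x - partials is (g M) x) < e/2" if "m \<ge> M" for m x
        by (rule le_less_trans[OF tele2 eM]) (use that in \<open>simp_all add: M_def\<close>)
      then have "dist (partials is (g m) x) (partials is (g n) x) < e" if "m \<ge> M" "n \<ge> M" for m n x
        using that dist_triangle_half_l[of "partials is (g m) x" "partials is (g M) x" e "partials is (g n) x"] by (simp add: dist_norm)
      then show "\<exists>M. \<forall>x\<in>UNIV. \<forall>m\<ge>M. \<forall>n\<ge>M. dist (partials is (g m) x) (partials is (g n) x) < e" by blast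
    qed
    then show ?thesis using Cauchy_uniformly_convergent uniformly_convergent_on_def by blast
  qed
  then obtain G where G: "\<And>is. uniform_limit UNIV (\<lambda>n. partials is (g n)) (G is) sequentially" by metis
  define f where "f = G []"
  have fs: "smooth_on UNIV f" unfolding f_def by (rule smooth_uniform_limit[OF _ G]) (use g in \<open>simp add: ok_def\<close>)
  have flim: "(\<lambda>n. g n x) \<longlonglongrightarrow> f x" for x using tendsto_uniform_limitI[OF G[of "[]"], of x] by (simp add: f_def)
  have f0: "f x = 0" if "x \<notin> cball y r" for x
    using flim[of x] g that unfolding ok_def by (simp add: LIMSEQ_const_iff)
  have fok: "ok f" using fs f0 by (simp add: ok_def)
  have fg: "norm (f x - g n x) \<le> 1 / L n" for x n
  proof (rule Lim_norm_ubound[of sequentially "\<lambda>m. g m x - g n x"])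
    show "(\<lambda>m. g m x - g n x) \<longlonglongrightarrow> f x - g n x" by (intro tendsto_intros flim)
    have "norm (g m x - g n x) \<le> 1 / L n" if "m \<ge> n" for m
    proof -
      have "(1/2)^n / L n \<le> 1 / L n" using L(1)[of n] by (intro divide_right_mono power_le_one) auto
      with tele2[of "[]" n m x] that show ?thesis by simp
    qed
    then show "\<forall>\<^sub>F m in sequentially. norm (g m x - g n x) \<le> 1 / L n" using eventually_sequentially by blast
  qed simp
  have "test_fun U f" by (rule zero_off_test_fun(1)[OF fs f0 cb])
  from solv[OF this] obtain u where u: "distribution U u"
    and us: "\<And>\<phi>. test_fun U \<phi> \<Longrightarrow> u (P \<phi>) = integral UNIV (\<lambda>x. f x * \<phi> x)" by blast
  obtain C N where C: "\<And>\<phi>. test_fun U \<phi> \<Longrightarrow> tsupport \<phi> \<subseteq> cball y r \<Longrightarrow>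
    (\<And>is x. length is \<le> N \<Longrightarrow> norm (partials is \<phi> x) \<le> 1) \<Longrightarrow> norm (u \<phi>) \<le> C"
    using distribution_bound[OF u compact_cball cb] by metis
  \<comment> \<open>This index exceeds both the order \<open>N\<close> of the distribution on the
    ball and its bound \<open>C\<close>; then \<open>n + 2 \<le> C + 1\<close> and
    \<open>C \<le> n\<close> collide.\<close>
  define n where "n = max N (nat \<lceil>C\<rceil>)"
  have vn: "smooth_on UNIV (v n)" "\<And>x. x \<notin> cball y r \<Longrightarrow> v n x = 0" using v[of n] by (auto simp: ok_def)
  have Pv: "smooth_on UNIV (P (v n))" "\<And>x. x \<notin> cball y r \<Longrightarrow> P (v n) x = 0" using P[OF vn] by auto
  have "norm (u (P (v n))) \<le> C"
    by (rule C[OF zero_off_test_fun[OF Pv cb]]) (use bv[of _ n] in \<open>auto simp: n_def\<close>)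
  then have 1: "norm (integral UNIV (\<lambda>x. f x * v n x)) \<le> C"
    using us[OF zero_off_test_fun(1)[OF vn cb]] by simp
  have "norm (integral UNIV (\<lambda>x. (f x - g n x) * v n x)) \<le> 1 / L n * integral UNIV (\<lambda>x. norm (v n x))"
    using g[of n] by (intro norm_integral_mult_le[of _ _ y r] fg vn continuous_on_diff smooth_on_continuous fs) (auto simp: ok_def)
  also have "\<dots> \<le> 1 / L n * L n" using L[of n] by (intro mult_left_mono) auto
  finally have 2: "norm (integral UNIV (\<lambda>x. (f x - g n x) * v n x)) \<le> 1" using L(1)[of n] by simp
  have "integral UNIV (\<lambda>x. (f x - g n x) * v n x) = integral UNIV (\<lambda>x. f x * v n x) - integral UNIV (\<lambda>x. g n x * v n x)"
    unfolding left_diff_distrib by (intro Henstock_Kurzweil_Integration.integral_diff int fok g v)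
  then have "norm (integral UNIV (\<lambda>x. g n x * v n x)) \<le> C + 1"
    using 1 2 norm_triangle_ineq4[of "integral UNIV (\<lambda>x. f x * v n x)" "integral UNIV (\<lambda>x. (f x - g n x) * v n x)"] by simp
  with big[of n] have "real n + 1 \<le> C" by linarith
  moreover have "C \<le> real n" unfolding n_def by linarith
  ultimately show False by linarith
qed

section \<open>Complex symmetric matrices with positive definite imaginary part and a prescribed
  value\<close>

lemma positive_symmetric_solution_dep:
  fixes u p q :: "real^'n::finite"
  assumes pos: "q \<bullet> u > 0"
  obtains R T :: "'n \<Rightarrow> 'n \<Rightarrow> real" and \<kappa> where "\<And>i j. R i j = R j i" "\<And>i j. T i j = T j i" "\<kappa> > 0"
    "\<And>m. (\<Sum>j\<in>UNIV. R m j * u $ j) = p $ m" "\<And>m. (\<Sum>j\<in>UNIV. T m j * u $ j) = q $ m"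
    "\<And>v::real^'n. (\<Sum>i\<in>UNIV. \<Sum>j\<in>UNIV. T i j * (v $ i * v $ j)) \<ge> \<kappa> * (norm v)\<^sup>2"
proof -
  define n where "n = u \<bullet> u"
  have n: "n > 0" using pos by (auto simp: n_def)
  define R where "R i j = (p $ i * u $ j + u $ i * p $ j) / n - (p \<bullet> u) * (u $ i * u $ j) / n\<^sup>2" for i j
  \<comment> \<open>The rank one part sends \<open>u\<close> to \<open>q\<close>; the rest is the
    projection orthogonal to \<open>u\<close>. A null vector would be a multiple of \<open>u\<close>
    orthogonal to \<open>q\<close>, which \<open>q \<bullet> u > 0\<close> forbids.\<close>
  define T where "T i j = q $ i * q $ j / (q \<bullet> u) + ((if i = j then 1 else 0) - u $ i * u $ j / n)" for i j
  have Ru: "(\<Sum>j\<in>UNIV. R m j * u $ j) = p $ m" for m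
  proof -
    have "(\<Sum>j\<in>UNIV. R m j * u $ j) = (\<Sum>j\<in>UNIV. (p $ m / n) * (u $ j * u $ j) + (u $ m / n) * (p $ j * u $ j) - ((p \<bullet> u) * u $ m / n\<^sup>2) * (u $ j * u $ j))"
      unfolding R_def by (intro sum.cong refl) (simp add: algebra_simps add_divide_distrib)
    also have "\<dots> = (p $ m / n) * n + (u $ m / n) * (p \<bullet> u) - ((p \<bullet> u) * u $ m / n\<^sup>2) * n"
      unfolding sum_subtractf sum.distrib sum_distrib_left[symmetric] n_def inner_vec_def inner_real_def ..
    also have "\<dots> = p $ m" using n by (simp add: field_simps power2_eq_square)
    finally show ?thesis .
  qed
  have Tu: "(\<Sum>j\<in>UNIV. T m j * u $ j) = q $ m" for m
  proof -
    have "(\<Sum>j\<in>UNIV. T m j * u $ j) = q $ m * (q \<bullet> u) / (q \<bullet> u) + (u $ m - u $ m * n / n)"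
    proof -
      have "(\<Sum>j\<in>UNIV. T m j * u $ j) = (\<Sum>j\<in>UNIV. (q $ m / (q \<bullet> u)) * (q $ j * u $ j) + ((if m = j then u $ j else 0) - (u $ m / n) * (u $ j * u $ j)))"
        unfolding T_def by (intro sum.cong refl) (simp add: algebra_simps)
      also have "\<dots> = (q $ m / (q \<bullet> u)) * (q \<bullet> u) + (u $ m - (u $ m / n) * n)"
        unfolding sum_subtractf sum.distrib sum_distrib_left[symmetric] n_def inner_vec_def inner_real_def by simp
      finally show ?thesis by simp
    qed
    then show ?thesis using n pos by simp
  qed
  define Q where "Q v = (\<Sum>i\<in>UNIV. \<Sum>j\<in>UNIV. T i j * (v $ i * v $ j))" for v :: "real^'n"
  have Q: "Q v = (q \<bullet> v)\<^sup>2 / (q \<bullet> u) + (v \<bullet> v - (u \<bullet> v)\<^sup>2 / n)" for v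
  proof -
    have "Q v = (\<Sum>i\<in>UNIV. \<Sum>j\<in>UNIV. (q $ i * v $ i) * (q $ j * v $ j)) / (q \<bullet> u) + ((\<Sum>i\<in>UNIV. v $ i * v $ i) - (\<Sum>i\<in>UNIV. \<Sum>j\<in>UNIV. (u $ i * v $ i) * (u $ j * v $ j)) / n)"
    proof -
      have "Q v = (\<Sum>i\<in>UNIV. \<Sum>j\<in>UNIV. (1 / (q \<bullet> u)) * ((q $ i * v $ i) * (q $ j * v $ j)) + ((if i = j then v $ i * v $ j else 0) - (1 / n) * ((u $ i * v $ i) * (u $ j * v $ j))))"
        unfolding Q_def T_def by (intro sum.cong refl) (simp add: algebra_simps)
      then show ?thesis unfolding sum_subtractf sum.distrib sum_distrib_left[symmetric] by simp
    qed
    then show ?thesis by (simp add: sum_product[symmetric] inner_vec_def power2_eq_square)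
  qed
  have Qpos: "Q v > 0" if "v \<noteq> 0" for v
  proof -
    have "(u \<bullet> v)\<^sup>2 \<le> n * (v \<bullet> v)" using Cauchy_Schwarz_ineq[of u v] by (simp add: n_def)
    then have 1: "v \<bullet> v - (u \<bullet> v)\<^sup>2 / n \<ge> 0" using n by (simp add: field_simps)
    have 2: "(q \<bullet> v)\<^sup>2 / (q \<bullet> u) \<ge> 0" using pos by simp
    show ?thesis
    proof (rule ccontr)
      assume "\<not> Q v > 0"
      then have z: "(q \<bullet> v)\<^sup>2 / (q \<bullet> u) = 0" "v \<bullet> v - (u \<bullet> v)\<^sup>2 / n = 0" using 1 2 unfolding Q by linarith+
      then have qv: "q \<bullet> v = 0" using pos by simp
      define w where "w = n *\<^sub>R v - (u \<bullet> v) *\<^sub>R u"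
      have "w \<bullet> w = n * (n * (v \<bullet> v) - (u \<bullet> v)\<^sup>2)"
        by (simp add: w_def inner_diff_left inner_diff_right n_def[symmetric] inner_commute power2_eq_square algebra_simps)
      also have "\<dots> = 0" using z(2) n by (simp add: field_simps)
      finally have "w = 0" by simp
      then have "q \<bullet> w = 0" by simp
      then have "(u \<bullet> v) * (q \<bullet> u) = 0" using qv by (simp add: w_def inner_diff_right)
      then have "u \<bullet> v = 0" using pos by simp
      with \<open>w = 0\<close> n have "v = 0" by (simp add: w_def)
      with that show False by simp
    qed
  qed
  obtain \<kappa> where \<kappa>: "\<kappa> > 0" "\<And>v. Q v \<ge> \<kappa> * (norm v)\<^sup>2"
  proof -
    have cont: "continuous_on (sphere 0 1) Q" unfolding Q by (intro continuous_intros) (use pos n in auto)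
    have ne: "sphere (0::real^'n) 1 \<noteq> {}" by simp
    obtain v0 where v0: "v0 \<in> sphere 0 1" "\<And>v. v \<in> sphere 0 1 \<Longrightarrow> Q v0 \<le> Q v"
      using continuous_attains_inf[OF compact_sphere ne cont] by blast
    have "Q v \<ge> Q v0 * (norm v)\<^sup>2" for v
    proof (cases "v = 0")
      case False
      have "Q (t *\<^sub>R v) = t\<^sup>2 * Q v" for t
        unfolding Q by (simp add: power2_eq_square algebra_simps)
      from this[of "1 / norm v"] have "Q ((1 / norm v) *\<^sub>R v) = Q v / (norm v)\<^sup>2"
        by (simp add: power_divide)
      moreover have "Q v0 \<le> Q ((1 / norm v) *\<^sub>R v)" by (rule v0(2)) (use False in simp)
      ultimately have "Q v0 \<le> Q v / (norm v)\<^sup>2" by (simp only:)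
      moreover have "(norm v)\<^sup>2 > 0" using False by simp
      ultimately show ?thesis by (simp only: pos_le_divide_eq)
    qed (simp add: Q)
    moreover have "Q v0 > 0" by (rule Qpos) (use v0(1) in auto)
    ultimately show ?thesis using that by blast
  qed
  show ?thesis
  proof (rule that[of R T \<kappa>])
    show "R i j = R j i" "T i j = T j i" for i j by (simp_all add: R_def T_def mult.commute add.commute)
    show "\<kappa> * (norm v)\<^sup>2 \<le> (\<Sum>i\<in>UNIV. \<Sum>j\<in>UNIV. T i j * (v $ i * v $ j))" for v
      using \<kappa>(2)[of v] unfolding Q_def .
  qed (rule Ru Tu \<kappa>(1))+
qed

text \<open>\<open>comp\<close> is the symmetry condition on the two prescribed images. With the
  basis \<open>e\<close>, \<open>f\<close> dual to \<open>u\<close>, \<open>v\<close> the images are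
  prescribed and symmetrized; this counts the values on pairs from \<open>u\<close>,
  \<open>v\<close> twice, which the subtracted terms correct.\<close>

lemma symmetric_solution_indep:
  fixes u v p q :: "real^'n::finite"
  assumes ind: "(u \<bullet> v)\<^sup>2 < (u \<bullet> u) * (v \<bullet> v)" and comp: "u \<bullet> q = v \<bullet> p"
  obtains R :: "'n \<Rightarrow> 'n \<Rightarrow> real" where "\<And>i j. R i j = R j i"
    "\<And>m. (\<Sum>j\<in>UNIV. R m j * u $ j) = p $ m" "\<And>m. (\<Sum>j\<in>UNIV. R m j * v $ j) = q $ m"
proof -
  define D where "D = (u \<bullet> u) * (v \<bullet> v) - (u \<bullet> v)\<^sup>2"
  have D: "D > 0" using ind by (simp add: D_def)
  define e where "e = (1/D) *\<^sub>R ((v \<bullet> v) *\<^sub>R u - (u \<bullet> v) *\<^sub>R v)"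
  define f where "f = (1/D) *\<^sub>R ((u \<bullet> u) *\<^sub>R v - (u \<bullet> v) *\<^sub>R u)"
  have du: "e \<bullet> u = 1" "e \<bullet> v = 0" "f \<bullet> u = 0" "f \<bullet> v = 1"
  proof -
    have "e \<bullet> u = D / D" "e \<bullet> v = 0" "f \<bullet> u = 0" "f \<bullet> v = D / D"
      by (simp_all add: e_def f_def inner_diff_left inner_commute[of v u] D_def power2_eq_square mult_ac)
    then show "e \<bullet> u = 1" "e \<bullet> v = 0" "f \<bullet> u = 0" "f \<bullet> v = 1" using D by simp_all
  qed
  define R where "R i j = p $ i * e $ j + e $ i * p $ j + q $ i * f $ j + f $ i * q $ j
     - (p \<bullet> u) * (e $ i * e $ j) - (p \<bullet> v) * (e $ i * f $ j + f $ i * e $ j) - (q \<bullet> v) * (f $ i * f $ j)" for i j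
  have Rw: "(\<Sum>j\<in>UNIV. R m j * w $ j) = p $ m * (e \<bullet> w) + e $ m * (p \<bullet> w) + q $ m * (f \<bullet> w) + f $ m * (q \<bullet> w)
     - (p \<bullet> u) * (e $ m * (e \<bullet> w)) - (p \<bullet> v) * (e $ m * (f \<bullet> w) + f $ m * (e \<bullet> w)) - (q \<bullet> v) * (f $ m * (f \<bullet> w))" for m w
  proof -
    have "(\<Sum>j\<in>UNIV. R m j * w $ j) = (\<Sum>j\<in>UNIV. p $ m * (e $ j * w $ j) + e $ m * (p $ j * w $ j) + q $ m * (f $ j * w $ j) + f $ m * (q $ j * w $ j)
     - (p \<bullet> u) * e $ m * (e $ j * w $ j) - ((p \<bullet> v) * e $ m * (f $ j * w $ j) + (p \<bullet> v) * f $ m * (e $ j * w $ j)) - (q \<bullet> v) * f $ m * (f $ j * w $ j))"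
      unfolding R_def by (intro sum.cong refl) (simp add: algebra_simps)
    then show ?thesis
      unfolding sum_subtractf sum.distrib sum_distrib_left[symmetric] inner_vec_def inner_real_def by (simp add: algebra_simps)
  qed
  have c: "q \<bullet> u = p \<bullet> v" using comp by (simp add: inner_commute)
  show ?thesis
  proof (rule that[of R])
    show "R i j = R j i" for i j by (simp add: R_def algebra_simps)
    show "(\<Sum>j\<in>UNIV. R m j * u $ j) = p $ m" for m unfolding Rw by (simp add: du c algebra_simps)
    show "(\<Sum>j\<in>UNIV. R m j * v $ j) = q $ m" for m unfolding Rw by (simp add: du c algebra_simps)
  qed
qed

text \<open>The sign condition is forced: \<open>W a = b\<close> with \<open>W\<close> symmetric
  makes the sum the Hermitian square of \<open>a\<close> under \<open>W\<close>. For its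
  sufficiency, if the real and imaginary parts of \<open>a\<close> are independent, a multiple of
  the identity serves as \<open>Im W\<close>; otherwise \<open>a\<close> is a complex multiple of a
  real vector and the equation splits into two real ones.\<close>

lemma positive_symmetric_matrix:
  fixes a b :: "'n::finite \<Rightarrow> complex"
  assumes pos: "Im (\<Sum>j\<in>UNIV. b j * cnj (a j)) > 0"
  obtains W :: "'n \<Rightarrow> 'n \<Rightarrow> complex" and \<kappa> where "\<And>i j. W i j = W j i" "\<kappa> > 0"
    "\<And>m. (\<Sum>j\<in>UNIV. W m j * a j) = b m"
    "\<And>v::real^'n. (\<Sum>i\<in>UNIV. \<Sum>j\<in>UNIV. Im (W i j) * (v $ i * v $ j)) \<ge> \<kappa> * (norm v)\<^sup>2"
proof -
  define a1 a2 b1 b2 :: "real^'n" where "a1 = (\<chi> j. Re (a j))" and "a2 = (\<chi> j. Im (a j))"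
    and "b1 = (\<chi> j. Re (b j))" and "b2 = (\<chi> j. Im (b j))"
  define c where "c = a1 \<bullet> b2 - a2 \<bullet> b1"
  have c: "c > 0" using pos by (simp add: c_def a1_def a2_def b1_def b2_def inner_vec_def sum_subtractf mult_ac)
  show ?thesis
  proof (cases "(a1 \<bullet> a2)\<^sup>2 < (a1 \<bullet> a1) * (a2 \<bullet> a2)")
    case True
    define n where "n = a1 \<bullet> a1 + a2 \<bullet> a2"
    have "n > 0"
    proof (rule ccontr)
      assume "\<not> n > 0"
      then have "a1 \<bullet> a1 = 0" using inner_ge_zero[of a1] inner_ge_zero[of a2] unfolding n_def by linarith
      with True show False by simp
    qed
    \<comment> \<open>The one value for which the two equations for the real part \<open>R\<close>
      satisfy the symmetry condition.\<close>
    define t where "t = c / n"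
    have t: "t > 0" using c \<open>n > 0\<close> by (simp add: t_def)
    have "a1 \<bullet> (b2 - t *\<^sub>R a1) = a2 \<bullet> (b1 + t *\<^sub>R a2)"
    proof -
      have "t * n = c" using \<open>n > 0\<close> by (simp add: t_def)
      then show ?thesis by (simp add: n_def c_def inner_diff_right inner_add_right algebra_simps)
    qed
    then obtain R where R: "\<And>i j. R i j = R j i" "\<And>m. (\<Sum>j\<in>UNIV. R m j * a1 $ j) = (b1 + t *\<^sub>R a2) $ m"
      "\<And>m. (\<Sum>j\<in>UNIV. R m j * a2 $ j) = (b2 - t *\<^sub>R a1) $ m"
      using symmetric_solution_indep[OF True] by blast
    define W where "W i j = Complex (R i j) (if i = j then t else 0)" for i j
    show ?thesis
    proof (rule that[of W t])
      show "W i j = W j i" for i j by (simp add: W_def R(1)[of i j])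
      show "t > 0" by (rule t)
      show "(\<Sum>j\<in>UNIV. W m j * a j) = b m" for m
      proof (rule complex_eqI)
        have "Re (\<Sum>j\<in>UNIV. W m j * a j) = (\<Sum>j\<in>UNIV. R m j * a1 $ j) - t * a2 $ m"
          by (simp add: W_def sum_subtractf a1_def a2_def if_distrib[where f="\<lambda>z. z * _"] cong: if_cong)
        then show "Re (\<Sum>j\<in>UNIV. W m j * a j) = Re (b m)" unfolding R(2) by (simp del: Re_sum add: b1_def)
        have "Im (\<Sum>j\<in>UNIV. W m j * a j) = (\<Sum>j\<in>UNIV. R m j * a2 $ j) + t * a1 $ m"
          by (simp add: W_def sum.distrib a1_def a2_def if_distrib[where f="\<lambda>z. z * _"] cong: if_cong)
        then show "Im (\<Sum>j\<in>UNIV. W m j * a j) = Im (b m)" unfolding R(3) by (simp del: Im_sum add: b2_def)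
      qed
      show "(\<Sum>i\<in>UNIV. \<Sum>j\<in>UNIV. Im (W i j) * (v $ i * v $ j)) \<ge> t * (norm v)\<^sup>2" for v :: "real^'n"
        by (simp add: W_def if_distrib[where f="\<lambda>z. z * _"] power2_norm_eq_inner inner_vec_def sum_distrib_left cong: if_cong)
    qed
  next
    case False
    \<comment> \<open>Equality in the Cauchy-Schwarz inequality: the real and imaginary parts of
      \<open>a\<close> are parallel.\<close>
    obtain \<zeta> and u :: "real^'n" where u: "\<zeta> \<noteq> 0" "\<And>j. a j = \<zeta> * of_real (u $ j)"
    proof (cases "a1 = 0")
      case True
      have "a j = \<i> * of_real (a2 $ j)" for j
        using True by (auto simp: complex_eq_iff a1_def a2_def vec_eq_iff)
      then show ?thesis using that[of \<i> a2] by simp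
    next
      case a1: False
      define \<mu> where "\<mu> = (a1 \<bullet> a2) / (a1 \<bullet> a1)"
      have a11: "a1 \<bullet> a1 > 0" using a1 by simp
      have "(a2 - \<mu> *\<^sub>R a1) \<bullet> (a2 - \<mu> *\<^sub>R a1) = a2 \<bullet> a2 - (a1 \<bullet> a2)\<^sup>2 / (a1 \<bullet> a1)"
        using a11 by (simp add: \<mu>_def inner_diff_left inner_diff_right inner_commute[of a2 a1] power2_eq_square field_simps)
      also have "\<dots> \<le> 0" using False a11 by (simp add: field_simps)
      finally have "a2 - \<mu> *\<^sub>R a1 = 0" using inner_ge_zero[of "a2 - \<mu> *\<^sub>R a1"] inner_eq_zero_iff by (metis order.antisym)
      then have "a2 = \<mu> *\<^sub>R a1" by simp
      then have m: "Im (a j) = \<mu> * Re (a j)" for j by (simp add: a1_def a2_def vec_eq_iff)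
      have "a j = Complex 1 \<mu> * of_real (a1 $ j)" for j by (simp add: complex_eq_iff a1_def m)
      then show ?thesis using that[of "Complex 1 \<mu>" a1] by (simp add: complex_eq_iff)
    qed
    define p q :: "real^'n" where "p = (\<chi> j. Re (b j / \<zeta>))" and "q = (\<chi> j. Im (b j / \<zeta>))"
    have bq: "b j = \<zeta> * Complex (p $ j) (q $ j)" for j using u(1) by (simp add: p_def q_def)
    have "(\<Sum>j\<in>UNIV. b j * cnj (a j)) = (\<Sum>j\<in>UNIV. of_real ((norm \<zeta>)\<^sup>2) * (Complex (p $ j) (q $ j) * of_real (u $ j)))"
      unfolding u(2) bq complex_norm_square by (intro sum.cong refl) (simp add: mult_ac)
    then have "Im (\<Sum>j\<in>UNIV. b j * cnj (a j)) = (norm \<zeta>)\<^sup>2 * (q \<bullet> u)"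
      by (simp add: inner_vec_def sum_distrib_left)
    with pos u(1) have qu: "q \<bullet> u > 0" by (simp add: zero_less_mult_iff)
    show ?thesis
    proof (rule positive_symmetric_solution_dep[OF qu, of p])
    fix R T :: "'n \<Rightarrow> 'n \<Rightarrow> real" and \<kappa>
    assume R: "\<And>i j. R i j = R j i" "\<And>i j. T i j = T j i" "\<kappa> > 0"
    "\<And>m. (\<Sum>j\<in>UNIV. R m j * u $ j) = p $ m" "\<And>m. (\<Sum>j\<in>UNIV. T m j * u $ j) = q $ m"
    "\<And>v::real^'n. (\<Sum>i\<in>UNIV. \<Sum>j\<in>UNIV. T i j * (v $ i * v $ j)) \<ge> \<kappa> * (norm v)\<^sup>2"
    define W where "W i j = Complex (R i j) (T i j)" for i j
    show ?thesis
    proof (rule that[of W \<kappa>])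
      show "W i j = W j i" for i j unfolding W_def by (rule arg_cong2[where f=Complex, OF R(1,2)])
      show "(\<Sum>j\<in>UNIV. W m j * a j) = b m" for m
      proof -
        have "(\<Sum>j\<in>UNIV. W m j * a j) = \<zeta> * (\<Sum>j\<in>UNIV. W m j * of_real (u $ j))"
          unfolding u(2) sum_distrib_left by (intro sum.cong refl mult.left_commute)
        also have "(\<Sum>j\<in>UNIV. W m j * of_real (u $ j)) = Complex (p $ m) (q $ m)"
        proof (rule complex_eqI)
          show "Re (\<Sum>j\<in>UNIV. W m j * of_real (u $ j)) = Re (Complex (p $ m) (q $ m))"
            unfolding complex.sel R(4)[symmetric] by (simp add: W_def)
          show "Im (\<Sum>j\<in>UNIV. W m j * of_real (u $ j)) = Im (Complex (p $ m) (q $ m))"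
            unfolding complex.sel R(5)[symmetric] by (simp add: W_def)
        qed
        finally show ?thesis unfolding bq[of m] .
      qed
      show "\<kappa> * (norm v)\<^sup>2 \<le> (\<Sum>i\<in>UNIV. \<Sum>j\<in>UNIV. Im (W i j) * (v $ i * v $ j))" for v :: "real^'n"
        unfolding W_def complex.sel by (rule R(6))
    qed (rule R(3))
    qed
  qed
qed

section \<open>Hoermander's necessary condition\<close>

lemma list_uniform_bound:
  fixes F :: "'i::finite list \<Rightarrow> real \<Rightarrow> 'x \<Rightarrow> real"
  assumes "\<And>is. \<exists>C. \<forall>\<rho>\<ge>1. \<forall>x. F is \<rho> x \<le> C * \<rho> powi (2 * int (length is) + m)"
  obtains C where "C > 0" "\<And>is \<rho> x. length is \<le> N \<Longrightarrow> \<rho> \<ge> 1 \<Longrightarrow> F is \<rho> x \<le> C * \<rho> powi (2 * int N + m)"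
proof -
  obtain D where D: "\<And>is \<rho> x. \<rho> \<ge> 1 \<Longrightarrow> F is \<rho> x \<le> D is * \<rho> powi (2 * int (length is) + m)"
    using assms by metis
  define A where "A = {is :: 'i list. length is \<le> N}"
  have "finite {is :: 'i list. set is \<subseteq> UNIV \<and> length is \<le> N}" by (rule finite_lists_length_le) simp
  then have fA: "finite A" by (simp add: A_def)
  define C where "C = 1 + (\<Sum>is\<in>A. \<bar>D is\<bar>)"
  have C: "C > 0" by (simp add: C_def add_pos_nonneg sum_nonneg)
  have "F is \<rho> x \<le> C * \<rho> powi (2 * int N + m)" if "length is \<le> N" "\<rho> \<ge> 1" for "is" \<rho> x
  proof -
    have "\<bar>D is\<bar> \<le> (\<Sum>is\<in>A. \<bar>D is\<bar>)" by (rule member_le_sum) (use that fA in \<open>auto simp: A_def\<close>)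
    then have "D is \<le> C" by (simp add: C_def)
    have "F is \<rho> x \<le> D is * \<rho> powi (2 * int (length is) + m)" by (rule D[OF that(2)])
    also have "\<dots> \<le> C * \<rho> powi (2 * int (length is) + m)" using that \<open>D is \<le> C\<close> by (intro mult_right_mono) auto
    also have "\<dots> \<le> C * \<rho> powi (2 * int N + m)"
      using that C by (intro mult_left_mono power_int_increasing) auto
    finally show ?thesis .
  qed
  with C show ?thesis using that by blast
qed

lemma partials_cnj:
  assumes "smooth_on UNIV f"
  shows "partials is (\<lambda>x. cnj (f x)) = (\<lambda>x. cnj (partials is f x))"
proof (induction "is")
  case (Cons i "is")
  have "has_partial i (partials is f) x" for x
    by (rule smooth_on_has_partial[OF smooth_on_partials[OF assms]]) simp
  from partial_bounded_linear(1)[OF bounded_linear_cnj this] show ?case by (simp add: Cons fun_eq_iff)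
qed simp

lemma integral_norm_square_lower:
  fixes v :: "real^'n::finite \<Rightarrow> complex"
  assumes v: "continuous_on UNIV v" "\<And>x. x \<notin> cball y r \<Longrightarrow> v x = 0"
    and \<rho>: "\<rho> \<ge> 1" and \<delta>: "\<delta> > 0" and low: "\<And>x. \<rho> * norm (x - y) \<le> 1 \<Longrightarrow> norm (v x) \<ge> \<delta>"
  shows "integral UNIV (\<lambda>x. (norm (v x))\<^sup>2) \<ge> \<delta>\<^sup>2 * (2 / real CARD('n)) ^ CARD('n) * \<rho> powi (- int CARD('n))"
proof -
  define n where "n = CARD('n)"
  have n: "n > 0" by (simp add: n_def)
  \<comment> \<open>Half the side of a cube around \<open>y\<close>: bounding the norm by the sum of
    coordinates keeps the cube inside the ball of radius \<open>1/\<rho>\<close>.\<close>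
  define s where "s = 1 / (real n * \<rho>)"
  have s: "s > 0" using n \<rho> by (simp add: s_def)
  define a b :: "real^'n" where "a = (\<chi> i. y $ i - s)" and "b = (\<chi> i. y $ i + s)"
  have i1: "(\<lambda>x. (norm (v x))\<^sup>2) integrable_on UNIV"
    by (rule integral_zero_off[of _ y r]) (use v in \<open>auto intro!: continuous_intros\<close>)
  have i2: "(\<lambda>x. (norm (v x))\<^sup>2) integrable_on cbox a b"
    by (intro integrable_continuous continuous_intros continuous_on_subset[OF v(1)]) auto
  have near: "\<rho> * norm (x - y) \<le> 1" if "x \<in> cbox a b" for x
  proof -
    have "\<bar>(x - y) $ i\<bar> \<le> s" for i using that by (auto simp: a_def b_def mem_box_cart abs_le_iff) (smt (verit))+
    then have "(\<Sum>i\<in>UNIV. \<bar>(x - y) $ i\<bar>) \<le> real n * s"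
      using sum_bounded_above[of UNIV "\<lambda>i. \<bar>(x - y) $ i\<bar>" s] by (simp add: n_def)
    then have "norm (x - y) \<le> real n * s" using norm_le_l1_cart[of "x - y"] by linarith
    then have "\<rho> * norm (x - y) \<le> \<rho> * (real n * s)" using \<rho> by (intro mult_left_mono) auto
    also have "\<dots> = 1" using n \<rho> by (simp add: s_def)
    finally show ?thesis .
  qed
  have "integral (cbox a b) (\<lambda>x. \<delta>\<^sup>2) \<le> integral (cbox a b) (\<lambda>x. (norm (v x))\<^sup>2)"
    by (intro integral_le i2) (use low near \<delta> in \<open>auto intro!: power_mono\<close>)
  also have "\<dots> \<le> integral UNIV (\<lambda>x. (norm (v x))\<^sup>2)"
    by (intro integral_subset_le i1 i2) auto
  finally have m1: "measure lborel (cbox a b) * \<delta>\<^sup>2 \<le> integral UNIV (\<lambda>x. (norm (v x))\<^sup>2)" by simp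
  have m2: "measure lborel (cbox a b) = (2 * s) ^ n"
  proof -
    have "cbox a b \<noteq> {}" using s by (simp add: a_def b_def interval_ne_empty_cart)
    then have "measure lborel (cbox a b) = (\<Prod>i\<in>UNIV. b $ i - a $ i)" by (rule content_cbox_cart)
    also have "\<dots> = (\<Prod>i\<in>(UNIV::'n set). 2 * s)" by (simp add: a_def b_def)
    finally show ?thesis by (simp add: n_def)
  qed
  have m3: "(2 * s) ^ n = (2 / real n) ^ n * \<rho> powi (- int n)"
    using n \<rho> by (simp add: s_def power_divide power_mult_distrib power_int_minus field_simps)
  show ?thesis using m1[unfolded m2, unfolded m3, unfolded n_def] by (simp only: mult_ac)
qed

definition rcx :: "real^'n \<Rightarrow> 'n \<Rightarrow> complex" where "rcx \<xi> i = of_real (\<xi> $ i)"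

lemma bsmooth_cmult: "bsmooth f \<Longrightarrow> bsmooth (\<lambda>x. a * f x)"
  unfolding bsmooth_def
proof (intro conjI allI, goal_cases)
  case (2 "is")
  then obtain B where "\<And>x. norm (partials is f x) \<le> B" by blast
  then have "norm (a * partials is f x) \<le> norm a * B" for x by (simp add: norm_mult mult_left_mono)
  then show ?case using 2 by (auto simp: partials_cmult)
qed (auto intro: smooth_on_cmult)

lemma lmono_scale:
  assumes "\<And>i. e * \<zeta> i = \<eta> i"
  shows "e ^ length is * lmono \<zeta> is = lmono \<eta> is" "e ^ length is * ldmono \<zeta> j is = e * ldmono \<eta> j is"
proof -
  show 1: "e ^ length is * lmono \<zeta> is = lmono \<eta> is" for "is"
  proof (induction "is")
    case (Cons i "is")
    have "e ^ length (i # is) * lmono \<zeta> (i # is) = (e * \<zeta> i) * (e ^ length is * lmono \<zeta> is)" by (simp add: mult_ac)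
    then show ?case by (simp only: Cons assms) simp
  qed simp
  show "e ^ length is * ldmono \<zeta> j is = e * ldmono \<eta> j is"
  proof (induction "is")
    case (Cons i "is")
    have "e ^ length (i # is) * ldmono \<zeta> j (i # is) = e * (if i = j then e ^ length is * lmono \<zeta> is else 0) + (e * \<zeta> i) * (e ^ length is * ldmono \<zeta> j is)"
      by (simp add: algebra_simps)
    then show ?case by (simp only: Cons assms 1) (simp add: algebra_simps)
  qed simp
qed

text \<open>The sign condition is what \<open>positive_symmetric_matrix\<close> asks for. The
  resulting \<open>W\<close> carries the gradient in \<open>\<xi>\<close> to the gradient in
  \<open>x\<close>, up to the factor \<open>2 * pi\<close>, which is the first order eikonal
  equation for the transpose; \<open>Im W > 0\<close> is the Gaussian decay.\<close>

theorem hoermander_positive: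
  fixes c :: "('n::finite \<Rightarrow> nat) \<Rightarrow> real^'n \<Rightarrow> complex" and y \<xi> :: "real^'n"
  assumes bs: "\<And>\<alpha>. mi_abs \<alpha> \<le> k \<Longrightarrow> bsmooth (c \<alpha>)"
    and U: "open U" "y \<in> U"
    and solv: "\<And>f. test_fun U f \<Longrightarrow> \<exists>u. distribution U u \<and>
        (\<forall>\<phi>. test_fun U \<phi> \<longrightarrow> u (transpose_op k c \<phi>) = integral UNIV (\<lambda>x. f x * \<phi> x))"
    and p0: "(\<Sum>\<alpha>\<in>{\<alpha>. mi_abs \<alpha> = k}. c \<alpha> y * lmono (rcx \<xi>) (mi_list \<alpha>)) = 0"
    and px: "\<And>m. px m = (\<Sum>\<alpha>\<in>{\<alpha>. mi_abs \<alpha> = k}. partial m (c \<alpha>) y * lmono (rcx \<xi>) (mi_list \<alpha>))"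
    and pxi: "\<And>j. pxi j = (\<Sum>\<alpha>\<in>{\<alpha>. mi_abs \<alpha> = k}. c \<alpha> y * ldmono (rcx \<xi>) j (mi_list \<alpha>))"
    and pos: "Im (\<Sum>j\<in>UNIV. px j * cnj (pxi j)) > 0"
  shows False
proof -
  have "Im (\<Sum>j\<in>UNIV. (2 * pi * px j) * cnj (pxi j)) = 2 * pi * Im (\<Sum>j\<in>UNIV. px j * cnj (pxi j))"
    unfolding mult.assoc sum_distrib_left[symmetric] by simp
  then have pos': "Im (\<Sum>j\<in>UNIV. (2 * pi * px j) * cnj (pxi j)) > 0" using pos by simp
  show False
  proof (rule positive_symmetric_matrix[OF pos'])
    fix W :: "'n \<Rightarrow> 'n \<Rightarrow> complex" and \<kappa>
    assume Wsym: "\<And>i j. W i j = W j i" and \<kappa>: "\<kappa> > 0"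
      and Wa: "\<And>m. (\<Sum>j\<in>UNIV. W m j * pxi j) = 2 * pi * px m"
      and Wpos: "\<And>v::real^'n. (\<Sum>i\<in>UNIV. \<Sum>j\<in>UNIV. Im (W i j) * (v $ i * v $ j)) \<ge> \<kappa> * (norm v)\<^sup>2"
    \<comment> \<open>\<open>e ^ mi_abs \<alpha>\<close> absorbs both the sign in the transpose and
      the normalization of \<open>Dop\<close>; the phase gradient \<open>\<zeta>\<close> is then the
      solution of \<open>e * \<zeta> i = rcx \<xi> i\<close>.\<close>
    define e :: complex where "e = - 1 / (2 * pi * \<i>)"
    define \<zeta> where "\<zeta> i = - (2 * pi * \<i>) * rcx \<xi> i" for i
    have e\<zeta>: "e * \<zeta> i = rcx \<xi> i" for i by (simp add: e_def \<zeta>_def)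
    \<comment> \<open>The factor \<open>\<i>\<close> turns positivity of \<open>Im W\<close> into
      negativity of \<open>Re S\<close>.\<close>
    define S where "S i j = \<i> * W i j" for i j
    define I where "I = {\<alpha>::'n \<Rightarrow> nat. mi_abs \<alpha> \<le> k}"
    define c' where "c' \<alpha> x = e ^ mi_abs \<alpha> * c \<alpha> x" for \<alpha> x
    have Ik: "{\<alpha> \<in> I. length (mi_list \<alpha>) = k} = {\<alpha>. mi_abs \<alpha> = k}" by (auto simp: I_def length_mi_list)
    obtain i0 where i0: "pxi i0 \<noteq> 0"
    proof -
      have "\<exists>i. pxi i \<noteq> 0"
      proof (rule ccontr)
        assume "\<not> ?thesis"
        then have "(\<Sum>j\<in>UNIV. px j * cnj (pxi j)) = 0" by simp
        with pos show False by simp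
      qed
      then show ?thesis using that by blast
    qed
    have lm: "e ^ k * lmono \<zeta> (mi_list \<alpha>) = lmono (rcx \<xi>) (mi_list \<alpha>)" if "mi_abs \<alpha> = k" for \<alpha>
      using lmono_scale(1)[of e \<zeta> "rcx \<xi>", OF e\<zeta>, of "mi_list \<alpha>"] that by (simp add: length_mi_list)
    have ldm: "e ^ k * ldmono \<zeta> j (mi_list \<alpha>) = e * ldmono (rcx \<xi>) j (mi_list \<alpha>)" if "mi_abs \<alpha> = k" for \<alpha> j
      using lmono_scale(2)[of e \<zeta> "rcx \<xi>", OF e\<zeta>, of "mi_list \<alpha>" j] that by (simp add: length_mi_list)
    have pc': "partial m (c' \<alpha>) y = e ^ mi_abs \<alpha> * partial m (c \<alpha>) y" if "mi_abs \<alpha> \<le> k" for m \<alpha>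
      using partial_cmult_fun[of "c \<alpha>" m "e ^ mi_abs \<alpha>"] bs[OF that] unfolding c'_def[abs_def] bsmooth_def by simp
    have wkb: "wkb y \<zeta> S I mi_list c' k (\<lambda>j. e * pxi j) i0"
    proof
      show "S i j = S j i" for i j unfolding S_def by (rule arg_cong[OF Wsym])
      show "finite I" unfolding I_def by (rule finite_mi)
      show "bsmooth (c' \<alpha>)" if "\<alpha> \<in> I" for \<alpha>
        unfolding c'_def[abs_def] using that by (intro bsmooth_cmult bs) (simp add: I_def)
      show "length (mi_list \<alpha>) \<le> k" if "\<alpha> \<in> I" for \<alpha> using that by (simp add: I_def length_mi_list)
      show "(\<Sum>\<alpha>\<in>{\<alpha> \<in> I. length (mi_list \<alpha>) = k}. c' \<alpha> y * lmono \<zeta> (mi_list \<alpha>)) = 0"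
        unfolding Ik p0[symmetric] by (intro sum.cong refl) (simp add: c'_def lm[symmetric] mult_ac)
      show "e * pxi j = (\<Sum>\<alpha>\<in>{\<alpha> \<in> I. length (mi_list \<alpha>) = k}. c' \<alpha> y * ldmono \<zeta> j (mi_list \<alpha>))" for j
      proof -
        have "c' \<alpha> y * ldmono \<zeta> j (mi_list \<alpha>) = e * (c \<alpha> y * ldmono (rcx \<xi>) j (mi_list \<alpha>))" if "mi_abs \<alpha> = k" for \<alpha>
          using ldm[OF that, of j] that by (simp add: c'_def mult_ac)
        then show ?thesis unfolding Ik pxi sum_distrib_left by (intro sum.cong refl) simp
      qed
      show "(\<Sum>\<alpha>\<in>{\<alpha> \<in> I. length (mi_list \<alpha>) = k}. partial m (c' \<alpha>) y * lmono \<zeta> (mi_list \<alpha>)) + (\<Sum>j\<in>UNIV. e * pxi j * S j m) = 0" for m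
      proof -
        have "(\<Sum>\<alpha>\<in>{\<alpha> \<in> I. length (mi_list \<alpha>) = k}. partial m (c' \<alpha>) y * lmono \<zeta> (mi_list \<alpha>)) = px m"
          unfolding Ik px by (intro sum.cong refl) (simp add: pc' lm[symmetric] mult_ac)
        moreover have "(\<Sum>j\<in>UNIV. e * pxi j * S j m) = e * \<i> * (\<Sum>j\<in>UNIV. W m j * pxi j)"
          unfolding S_def sum_distrib_left
        proof (intro sum.cong refl)
          fix j show "e * pxi j * (\<i> * W j m) = e * \<i> * (W m j * pxi j)"
            using Wsym[of j m] by (simp add: mult_ac)
        qed
        moreover have "e * \<i> * (2 * pi * px m) = - px m" by (simp add: e_def)
        ultimately show ?thesis unfolding Wa by simp
      qed
      show "e * pxi i0 \<noteq> 0" using i0 by (simp add: e_def)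
    qed
    have re\<zeta>: "Re (\<zeta> i) = 0" for i by (simp add: \<zeta>_def rcx_def)
    have \<kappa>2: "\<kappa> / 2 > 0" using \<kappa> by simp
    have neg: "Re (\<Sum>i\<in>UNIV. \<Sum>j\<in>UNIV. S i j * of_real (v $ i * v $ j)) \<le> - 2 * (\<kappa> / 2) * (norm v)\<^sup>2" for v :: "real^'n"
      using Wpos[of v] by (simp add: S_def sum_negf)
    obtain r where r: "r > 0" "cball y r \<subseteq> U" using U open_contains_cball by blast
    have L: "wkb.Lop I mi_list c' f = transpose_op k c f" if "smooth_on UNIV f" for f
    proof
      fix x
      have "partials (mi_list \<alpha>) (\<lambda>x. c' \<alpha> x * f x) x = (- 1) ^ mi_abs \<alpha> * Dop \<alpha> (\<lambda>y. c \<alpha> y * f y) x" if "\<alpha> \<in> I" for \<alpha>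
      proof -
        have s: "smooth_on UNIV (\<lambda>x. c \<alpha> x * f x)"
          using that bs[of \<alpha>] \<open>smooth_on UNIV f\<close> by (intro smooth_on_mult) (auto simp: I_def bsmooth_def)
        have "(- 1) ^ mi_abs \<alpha> * (1 / (2 * of_real pi * \<i>)) ^ mi_abs \<alpha> = e ^ mi_abs \<alpha>"
          unfolding power_mult_distrib[symmetric] by (simp add: e_def)
        then show ?thesis
          unfolding Dop_def dpart_def c'_def mult.assoc[symmetric] by (simp add: partials_cmult[OF s] mult.assoc)
      qed
      then show "wkb.Lop I mi_list c' f x = transpose_op k c f x"
        unfolding wkb.Lop_def[OF wkb] transpose_op_def I_def[symmetric] by (intro sum.cong refl) simp
    qed
    show False
    proof (rule gliding_hump[OF r(2) solv])
      fix \<phi> :: "real^'n \<Rightarrow> complex" assume \<phi>: "smooth_on UNIV \<phi>" "\<And>x. x \<notin> cball y r \<Longrightarrow> \<phi> x = 0"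
      show "smooth_on UNIV (transpose_op k c \<phi>) \<and> (\<forall>x. x \<notin> cball y r \<longrightarrow> transpose_op k c \<phi> x = 0)"
      proof (intro conjI allI impI)
        have s: "smooth_on UNIV (\<lambda>x. c' \<alpha> x * \<phi> x)" if "\<alpha> \<in> I" for \<alpha>
          using wkb.bs[OF wkb that] \<phi>(1) by (intro smooth_on_mult) (auto simp: bsmooth_def)
        show "smooth_on UNIV (transpose_op k c \<phi>)"
          unfolding L[OF \<phi>(1), symmetric] wkb.Lop_def[OF wkb, abs_def]
          by (intro smooth_on_sum smooth_on_partials s open_UNIV)
        fix x assume x: "x \<notin> cball y r"
        have "partials (mi_list \<alpha>) (\<lambda>x. c' \<alpha> x * \<phi> x) x = partials (mi_list \<alpha>) (\<lambda>x. 0) x" for \<alpha>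
          by (rule partials_cong[of "- cball y r"]) (use x \<phi>(2) in auto)
        then show "transpose_op k c \<phi> x = 0"
          unfolding L[OF \<phi>(1), symmetric] wkb.Lop_def[OF wkb] by (simp add: partials_const)
      qed
    next
      fix N and \<delta> B :: real assume \<delta>: "\<delta> > 0"
      define n where "n = CARD('n)"
      \<comment> \<open>Normalizing \<open>f\<close> and the hump up to order \<open>N\<close> costs
        \<open>2 * N\<close> powers of \<open>\<rho>\<close> each, the L2 mass of the quasimode
        costs \<open>n\<close>, and the last 1 makes the pairing grow.\<close>
      define M where "M = 4 * int N + int n + 1"
      show "\<exists>f v. smooth_on UNIV f \<and> (\<forall>x. x \<notin> cball y r \<longrightarrow> f x = 0) \<and>
        smooth_on UNIV v \<and> (\<forall>x. x \<notin> cball y r \<longrightarrow> v x = 0) \<and>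
        (\<forall>is x. length is \<le> N \<longrightarrow> norm (partials is f x) \<le> \<delta>) \<and>
        (\<forall>is x. length is \<le> N \<longrightarrow> norm (partials is (transpose_op k c v) x) \<le> 1) \<and>
        B \<le> norm (integral UNIV (\<lambda>x. f x * v x))"
      proof (rule wkb.quasimode[OF wkb re\<zeta> \<kappa>2 neg r(1), of M])
        fix v assume v: "\<And>\<rho>. smooth_on UNIV (v \<rho>)" "\<And>\<rho> x. norm (x - y) \<ge> r \<Longrightarrow> v \<rho> x = 0"
          and v1: "\<And>is. \<exists>C. \<forall>\<rho>\<ge>1. \<forall>x. norm (partials is (v \<rho>) x) \<le> C * \<rho> powi (2 * int (length is))"
          and v2: "\<And>is. \<exists>C. \<forall>\<rho>\<ge>1. \<forall>x. norm (partials is (wkb.Lop I mi_list c' (v \<rho>)) x) \<le> C * \<rho> powi (2 * int (length is) - M)"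
          and v3: "\<exists>\<rho>0\<ge>1. \<exists>\<delta>>0. \<forall>\<rho>\<ge>\<rho>0. \<forall>x. \<rho> * norm (x - y) \<le> 1 \<longrightarrow> norm (v \<rho> x) \<ge> \<delta>"
        obtain C1 where C1: "C1 > 0" "\<And>is \<rho> x. length is \<le> N \<Longrightarrow> \<rho> \<ge> 1 \<Longrightarrow> norm (partials is (v \<rho>) x) \<le> C1 * \<rho> powi (2 * int N + 0)"
          using list_uniform_bound[of "\<lambda>is \<rho> x. norm (partials is (v \<rho>) x)" 0 N] v1 by auto
        have v2': "\<exists>C. \<forall>\<rho>\<ge>1. \<forall>x. norm (partials is (transpose_op k c (v \<rho>)) x) \<le> C * \<rho> powi (2 * int (length is) + (- M))" for "is"
          using v2[of "is"] by (simp add: L[OF v(1)])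
        obtain C2 where C2: "C2 > 0" "\<And>is \<rho> x. length is \<le> N \<Longrightarrow> \<rho> \<ge> 1 \<Longrightarrow> norm (partials is (transpose_op k c (v \<rho>)) x) \<le> C2 * \<rho> powi (2 * int N + (- M))"
          by (rule list_uniform_bound[of "\<lambda>is \<rho> x. norm (partials is (transpose_op k c (v \<rho>)) x)", OF v2', of N]) blast
        obtain \<rho>0 d where d: "\<rho>0 \<ge> 1" "d > 0" "\<And>\<rho> x. \<rho> \<ge> \<rho>0 \<Longrightarrow> \<rho> * norm (x - y) \<le> 1 \<Longrightarrow> norm (v \<rho> x) \<ge> d"
          using v3 by blast
        define c0 where "c0 = d\<^sup>2 * (2 / real n) ^ n"
        have c0: "c0 > 0" using d(2) by (simp add: c0_def n_def)
        define \<rho> where "\<rho> = max \<rho>0 (B * C1 * C2 / (\<delta> * c0))"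
        have \<rho>: "\<rho> \<ge> 1" "\<rho> \<ge> \<rho>0" "\<rho> \<ge> B * C1 * C2 / (\<delta> * c0)" using d(1) by (auto simp: \<rho>_def)
        have off: "v \<rho> x = 0" if "x \<notin> cball y r" for x
          using v(2)[of x \<rho>] that by (simp add: dist_norm norm_minus_commute)
        define s1 where "s1 = \<delta> / (C1 * \<rho> powi (2 * int N))"
        define s2 where "s2 = 1 / (C2 * \<rho> powi (2 * int N - M))"
        have s1: "s1 > 0" and s2: "s2 > 0" using \<delta> C1(1) C2(1) \<rho>(1) by (simp_all add: s1_def s2_def)
        \<comment> \<open>The conjugate of the quasimode, so that pairing it with the quasimode
          gives a squared L2 norm.\<close>
        define f where "f x = of_real s1 * cnj (v \<rho> x)" for x
        define w where "w x = of_real s2 * v \<rho> x" for x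
        have scnj: "smooth_on UNIV (\<lambda>x. cnj (v \<rho> x))" by (rule smooth_on_bounded_linear[OF open_UNIV bounded_linear_cnj v(1)])
        have fs: "smooth_on UNIV f" and ws: "smooth_on UNIV w"
          unfolding f_def[abs_def] w_def[abs_def] by (intro smooth_on_cmult scnj v open_UNIV)+
        show ?thesis
        proof (rule exI[of _ f], rule exI[of _ w], intro conjI allI impI fs ws)
          show "f x = 0" if "x \<notin> cball y r" for x using off[OF that] by (simp add: f_def)
          show "w x = 0" if "x \<notin> cball y r" for x using off[OF that] by (simp add: w_def)
        next
          fix "is" :: "'n list" and x assume len: "length is \<le> N"
          have "norm (partials is f x) = s1 * norm (partials is (v \<rho>) x)"
            unfolding f_def[abs_def] using s1 by (simp add: partials_cmult[OF scnj] partials_cnj[OF v(1)] norm_mult)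
          also have "\<dots> \<le> s1 * (C1 * \<rho> powi (2 * int N + 0))"
            using s1 by (intro mult_left_mono C1 len \<rho>) auto
          also have "\<dots> = \<delta>" using C1(1) \<rho>(1) by (simp add: s1_def)
          finally show "norm (partials is f x) \<le> \<delta>" .
          have "transpose_op k c w = (\<lambda>x. of_real s2 * transpose_op k c (v \<rho>) x)"
          proof -
            have p: "partials (mi_list \<alpha>) (\<lambda>x. c' \<alpha> x * w x) x = of_real s2 * partials (mi_list \<alpha>) (\<lambda>x. c' \<alpha> x * v \<rho> x) x" if "\<alpha> \<in> I" for \<alpha> x
            proof -
              have s: "smooth_on UNIV (\<lambda>x. c' \<alpha> x * v \<rho> x)"
                using wkb.bs[OF wkb that] v(1) by (intro smooth_on_mult) (auto simp: bsmooth_def)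
              show ?thesis using fun_cong[OF partials_cmult[OF s, of "mi_list \<alpha>" "of_real s2"], of x]
                by (simp add: w_def[abs_def] mult.left_commute)
            qed
            show ?thesis unfolding L[OF ws, symmetric] L[OF v(1), symmetric] wkb.Lop_def[OF wkb, abs_def]
              by (rule ext) (simp add: p sum_distrib_left)
          qed
          moreover have "smooth_on UNIV (transpose_op k c (v \<rho>))"
          proof -
            have s: "smooth_on UNIV (\<lambda>x. c' \<alpha> x * v \<rho> x)" if "\<alpha> \<in> I" for \<alpha>
              using wkb.bs[OF wkb that] v(1) by (intro smooth_on_mult) (auto simp: bsmooth_def)
            show ?thesis unfolding L[OF v(1), symmetric] wkb.Lop_def[OF wkb, abs_def]
              by (intro smooth_on_sum smooth_on_partials s open_UNIV)
          qed
          ultimately have "norm (partials is (transpose_op k c w) x) = s2 * norm (partials is (transpose_op k c (v \<rho>)) x)"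
            using s2 by (simp add: partials_cmult norm_mult)
          also have "\<dots> \<le> s2 * (C2 * \<rho> powi (2 * int N + (- M)))"
            using s2 by (intro mult_left_mono C2 len \<rho>) auto
          also have "\<dots> = 1" using C2(1) \<rho>(1) by (simp add: s2_def)
          finally show "norm (partials is (transpose_op k c w) x) \<le> 1" .
        next
          have vv: "cnj z * z = of_real ((norm z)\<^sup>2)" for z :: complex
            unfolding complex_norm_square by (rule mult.commute)
          have "(\<lambda>x. f x * w x) = (\<lambda>x. of_real (s1 * s2) * of_real ((norm (v \<rho> x))\<^sup>2))"
            unfolding vv[symmetric] by (rule ext) (simp add: f_def w_def mult_ac)
          then have "integral UNIV (\<lambda>x. f x * w x) = of_real (s1 * s2) * integral UNIV (\<lambda>x. of_real ((norm (v \<rho> x))\<^sup>2))"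
            by (simp only: integral_mult_right)
          also have "integral UNIV (\<lambda>x. of_real ((norm (v \<rho> x))\<^sup>2)) = complex_of_real (integral UNIV (\<lambda>x. (norm (v \<rho> x))\<^sup>2))"
          proof -
            have "(\<lambda>x. (norm (v \<rho> x))\<^sup>2) integrable_on UNIV"
              by (rule integral_zero_off[of _ y r]) (use off smooth_on_continuous[OF v(1)] in \<open>auto intro!: continuous_intros simp del: mem_cball\<close>)
            from integral_linear[OF this bounded_linear_of_real] show ?thesis by (simp add: o_def)
          qed
          finally have eq: "norm (integral UNIV (\<lambda>x. f x * w x)) = s1 * s2 * \<bar>integral UNIV (\<lambda>x. (norm (v \<rho> x))\<^sup>2)\<bar>"
            using s1 s2 by (simp only: norm_mult norm_of_real abs_mult)
          have low: "integral UNIV (\<lambda>x. (norm (v \<rho> x))\<^sup>2) \<ge> c0 * \<rho> powi (- int n)"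
            unfolding c0_def n_def
            by (rule integral_norm_square_lower[of _ y r, OF smooth_on_continuous[OF v(1)] off \<rho>(1) d(2) d(3)[OF \<rho>(2)]])
          have "s1 * s2 * (c0 * \<rho> powi (- int n)) = \<delta> * c0 / (C1 * C2) * \<rho>"
          proof -
            have "\<rho> powi (2 * int N) * \<rho> powi (2 * int N - M) * \<rho> = \<rho> powi (2 * int N + (2 * int N - M) + 1)"
            proof -
              have "\<rho> \<noteq> 0" using \<rho>(1) by simp
              from power_int_add[OF disjI1[OF this], of "2 * int N" "2 * int N - M"] power_int_add[OF disjI1[OF this], of "2 * int N + (2 * int N - M)" 1]
              show ?thesis by (simp only: power_int_1_right)
            qed
            then have pw: "\<rho> powi (2 * int N) * \<rho> powi (2 * int N - M) * \<rho> = \<rho> powi (- int n)"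
              by (simp add: M_def)
            have nz: "\<rho> powi (2 * int N) \<noteq> 0" "\<rho> powi (2 * int N - M) \<noteq> 0" using \<rho>(1) by simp_all
            show ?thesis unfolding s1_def s2_def pw[symmetric] using nz C1(1) C2(1) by simp
          qed
          also have "\<dots> \<ge> B"
          proof -
            have "\<delta> * c0 / (C1 * C2) * (B * C1 * C2 / (\<delta> * c0)) \<le> \<delta> * c0 / (C1 * C2) * \<rho>"
              using \<delta> c0 C1(1) C2(1) by (intro mult_left_mono \<rho>) auto
            then show ?thesis using \<delta> c0 C1(1) C2(1) by simp
          qed
          finally have "B \<le> s1 * s2 * (c0 * \<rho> powi (- int n))" .
          also have "\<dots> \<le> s1 * s2 * \<bar>integral UNIV (\<lambda>x. (norm (v \<rho> x))\<^sup>2)\<bar>"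
            using low s1 s2 by (intro mult_left_mono) auto
          finally show "B \<le> norm (integral UNIV (\<lambda>x. f x * w x))" unfolding eq .
        qed
      qed
    qed
  qed
qed

section \<open>Pairs of real quadratic forms\<close>

definition bf :: "real^'m::finite^'m \<Rightarrow> real^'m \<Rightarrow> real^'m \<Rightarrow> real" where
  "bf M x y = x \<bullet> (M *v y)"

lemma bf_add: "bf M (x + y) z = bf M x z + bf M y z" "bf M z (x + y) = bf M z x + bf M z y"
  by (simp_all add: bf_def inner_add_left inner_add_right matrix_vector_right_distrib)

lemma bf_scaleR: "bf M (r *\<^sub>R x) y = r * bf M x y" "bf M x (r *\<^sub>R y) = r * bf M x y"
  by (simp_all add: bf_def matrix_vector_mult_scaleR)

lemma bf_minus: "bf M (- x) y = - bf M x y" "bf M x (- y) = - bf M x y"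
  using bf_scaleR[of M "-1"] bf_scaleR(2)[of M x "-1" y] by simp_all

lemma bf_diff: "bf M (x - y) z = bf M x z - bf M y z" "bf M z (x - y) = bf M z x - bf M z y"
  using bf_add[of M x "- y" z] bf_add(2)[of M z x "- y"] by (simp_all add: bf_minus)

lemma bf_zero: "bf M 0 x = 0" "bf M x 0 = 0"
  by (simp_all add: bf_def)

lemmas bf_lin = bf_add bf_scaleR bf_minus bf_diff bf_zero

lemma bf_sym: "sym_mat M \<Longrightarrow> bf M x y = bf M y x"
  unfolding bf_def sym_mat_def by (metis dot_lmul_matrix inner_commute vector_transpose_matrix)

lemma bf_mat_add: "bf (M + N) x y = bf M x y + bf N x y"
  by (simp add: bf_def matrix_vector_mult_add_rdistrib inner_add_right)

lemma bf_mat_scaleR: "bf (r *\<^sub>R M) x y = r * bf M x y"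
  by (simp add: bf_def flip: scaleR_matrix_vector_assoc)

lemma bf_mat_minus: "bf (- M) x y = - bf M x y"
  using bf_mat_scaleR[of "-1" M x y] by simp

lemma bf_mat_diff: "bf (M - N) x y = bf M x y - bf N x y"
  using bf_mat_add[of M "- N" x y] by (simp add: bf_mat_minus)

lemmas bf_mat = bf_mat_add bf_mat_scaleR bf_mat_minus bf_mat_diff

lemma bf_ker: "M *v y = 0 \<Longrightarrow> bf M x y = 0" by (simp add: bf_def)

lemma bf_nondeg: "(\<And>x. bf M x y = 0) \<Longrightarrow> M *v y = 0"
  using inner_eq_zero_iff unfolding bf_def by blast

lemma sym_mat_add: "sym_mat M \<Longrightarrow> sym_mat N \<Longrightarrow> sym_mat (M + N)"
  and sym_mat_scaleR: "sym_mat M \<Longrightarrow> sym_mat (r *\<^sub>R M)"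
  and sym_mat_minus: "sym_mat M \<Longrightarrow> sym_mat (- M)"
  and sym_mat_diff: "sym_mat M \<Longrightarrow> sym_mat N \<Longrightarrow> sym_mat (M - N)"
  by (simp_all add: sym_mat_def transpose_def vec_eq_iff)

lemma bf_polar: "sym_mat M \<Longrightarrow> bf M (x + y) (x + y) = bf M x x + 2 * bf M x y + bf M y y"
  using bf_sym[of M y x] by (simp add: bf_add)

lemma bf_quad_zero: assumes "sym_mat M" "\<And>x. bf M x x = 0" shows "M = 0"
proof -
  have "bf M x y = 0" for x y using bf_polar[OF assms(1), of x y] assms(2) by simp
  then have "M *v y = 0" for y by (rule bf_nondeg)
  then show ?thesis by (simp add: matrix_eq)
qed

lemma bf_quad_ext: assumes "sym_mat M" "sym_mat N" "\<And>x. bf M x x = bf N x x" shows "M = N"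
  using bf_quad_zero[of "M - N"] assms by (simp add: sym_mat_diff bf_mat)

lemma bf_bilinear: "bounded_bilinear (bf M)"
proof -
  have "bounded_linear (\<lambda>y. M *v y)" by (simp add: matrix_vector_mul_bounded_linear)
  from bounded_bilinear.comp[OF bounded_bilinear_inner bounded_linear_ident this] show ?thesis unfolding bf_def .
qed

lemma continuous_on_bf[continuous_intros]:
  "continuous_on S f \<Longrightarrow> continuous_on S g \<Longrightarrow> continuous_on S (\<lambda>x. bf M (f x) (g x))"
  using bounded_bilinear.continuous_on[OF bf_bilinear] by blast

lemma bf_bound: "\<exists>K\<ge>0. \<forall>x y. \<bar>bf M x y\<bar> \<le> norm x * norm y * K"
  using bounded_bilinear.nonneg_bounded[OF bf_bilinear, of M] by (auto simp: real_norm_def)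

subsection \<open>The S-lemma\<close>

lemma quadratic_opposite_roots:
  fixes a b c :: real
  assumes "a < 0" "c > 0"
  obtains s1 s2 where "s1 > 0" "s2 < 0" "c + 2 * s1 * b + s1\<^sup>2 * a = 0" "c + 2 * s2 * b + s2\<^sup>2 * a = 0"
    "s1 * s2 = c / a" "s1 + s2 = - 2 * b / a"
proof -
  define d where "d = sqrt (b\<^sup>2 - a * c)"
  have ac: "a * c < 0" using assms by (simp add: mult_neg_pos)
  then have d2: "d\<^sup>2 = b\<^sup>2 - a * c" unfolding d_def by (smt (verit) real_sqrt_pow2 zero_le_power2)
  have "d > \<bar>b\<bar>" unfolding d_def using ac by (intro real_less_rsqrt) simp
  then have db: "b + d > 0" "b - d < 0" by linarith+
  show ?thesis
  proof (rule that[of "(b + d) / (- a)" "(b - d) / (- a)"])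
    show "(b + d) / (- a) > 0" "(b - d) / (- a) < 0" using db assms by (intro divide_pos_pos divide_neg_pos; simp)+
    have "c + 2 * s * b + s\<^sup>2 * a = 0" if "(a * s + b)\<^sup>2 = d\<^sup>2" for s
    proof -
      have "a * (c + 2 * s * b + s\<^sup>2 * a) = (a * s + b)\<^sup>2 - d\<^sup>2" unfolding d2 by (simp add: power2_eq_square algebra_simps)
      then show ?thesis using that assms by simp
    qed
    moreover have "(a * ((b + d) / (- a)) + b)\<^sup>2 = d\<^sup>2" "(a * ((b - d) / (- a)) + b)\<^sup>2 = d\<^sup>2" using assms by simp_all
    ultimately show "c + 2 * ((b + d) / (- a)) * b + ((b + d) / (- a))\<^sup>2 * a = 0" "c + 2 * ((b - d) / (- a)) * b + ((b - d) / (- a))\<^sup>2 * a = 0" by blast+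
    have "(b + d) / (- a) * ((b - d) / (- a)) = (b\<^sup>2 - d\<^sup>2) / a\<^sup>2" by (simp add: power2_eq_square algebra_simps)
    also have "\<dots> = c / a" unfolding d2 using assms by (simp add: power2_eq_square)
    finally show "(b + d) / (- a) * ((b - d) / (- a)) = c / a" .
    show "(b + d) / (- a) + (b - d) / (- a) = - 2 * b / a" using assms by (simp add: field_simps)
  qed
qed

text \<open>Take \<open>x\<close> with \<open>A\<close> positive and \<open>y\<close> with
  \<open>A\<close> negative. The line \<open>x + s *\<^sub>R y\<close> meets the cone of
  \<open>A\<close> at some \<open>s1 > 0\<close> and \<open>s2 < 0\<close>; adding the two
  inequalities for \<open>B\<close> with weights \<open>- s2\<close> and \<open>s1\<close>
  eliminates the mixed term. This separates the quotients of \<open>B\<close> by \<open>A\<close> on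
  the two sides, and \<open>t\<close> is a number between them.\<close>

lemma s_lemma_on:
  assumes A: "sym_mat A" and B: "sym_mat B" and H: "subspace H"
    and x0: "x0 \<in> H" "bf A x0 x0 > 0" and y0: "y0 \<in> H" "bf A y0 y0 < 0"
    and nn: "\<And>z. z \<in> H \<Longrightarrow> bf A z z = 0 \<Longrightarrow> bf B z z \<ge> 0"
  obtains t where "\<And>z. z \<in> H \<Longrightarrow> bf B z z + t * bf A z z \<ge> 0"
proof -
  have key: "- bf B x x / bf A x x \<le> bf B y y / (- bf A y y)"
    if xy: "x \<in> H" "y \<in> H" "bf A x x > 0" "bf A y y < 0" for x y
  proof -
    obtain s1 s2 where s: "s1 > 0" "s2 < 0"
      "bf A x x + 2 * s1 * bf A x y + s1\<^sup>2 * bf A y y = 0" "bf A x x + 2 * s2 * bf A x y + s2\<^sup>2 * bf A y y = 0"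
      "s1 * s2 = bf A x x / bf A y y"
      using quadratic_opposite_roots[OF xy(4,3)] by metis
    have ex: "bf M (x + s *\<^sub>R y) (x + s *\<^sub>R y) = bf M x x + 2 * s * bf M x y + s\<^sup>2 * bf M y y" if "sym_mat M" for M s
      using bf_polar[OF that, of x "s *\<^sub>R y"] by (simp add: bf_lin power2_eq_square)
    have mem: "x + s *\<^sub>R y \<in> H" for s using xy H by (simp add: subspace_add subspace_scale)
    have 1: "bf B x x + 2 * s1 * bf B x y + s1\<^sup>2 * bf B y y \<ge> 0"
      using nn[OF mem[of s1]] s(3) unfolding ex[OF A] ex[OF B] by simp
    have 2: "bf B x x + 2 * s2 * bf B x y + s2\<^sup>2 * bf B y y \<ge> 0"
      using nn[OF mem[of s2]] s(4) unfolding ex[OF A] ex[OF B] by simp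
    have "0 \<le> (- s2) * (bf B x x + 2 * s1 * bf B x y + s1\<^sup>2 * bf B y y) + s1 * (bf B x x + 2 * s2 * bf B x y + s2\<^sup>2 * bf B y y)"
      using mult_nonneg_nonneg[OF _ 1, of "- s2"] mult_nonneg_nonneg[OF _ 2, of s1] s(1,2) by linarith
    also have "\<dots> = (s1 - s2) * (bf B x x - s1 * s2 * bf B y y)" by (simp add: power2_eq_square algebra_simps)
    finally have "bf B x x - s1 * s2 * bf B y y \<ge> 0" using s(1,2) by (simp add: zero_le_mult_iff)
    then have "bf B x x \<ge> bf A x x / bf A y y * bf B y y" unfolding s(5) by simp
    then have "bf B x x / bf A x x \<ge> bf B y y / bf A y y" using xy(3,4) by (simp add: field_simps)
    then show ?thesis by simp
  qed
  define t where "t = Sup ((\<lambda>x. - bf B x x / bf A x x) ` {x \<in> H. bf A x x > 0})"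
  have bdd: "bdd_above ((\<lambda>x. - bf B x x / bf A x x) ` {x \<in> H. bf A x x > 0})"
    using key[OF _ y0(1) _ y0(2)] by (intro bdd_aboveI2[of _ _ "bf B y0 y0 / (- bf A y0 y0)"]) auto
  have t1: "- bf B x x / bf A x x \<le> t" if "x \<in> H" "bf A x x > 0" for x
    unfolding t_def using that by (intro cSup_upper bdd) auto
  have t2: "t \<le> bf B y y / (- bf A y y)" if "y \<in> H" "bf A y y < 0" for y
    unfolding t_def by (rule cSup_least) (use key[OF _ that(1) _ that(2)] x0 in auto)
  have "bf B z z + t * bf A z z \<ge> 0" if "z \<in> H" for z
  proof -
    consider "bf A z z > 0" | "bf A z z < 0" | "bf A z z = 0" by linarith
    then show ?thesis
    proof cases
      case 1 then show ?thesis using t1[OF that 1] by (simp add: field_simps)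
    next
      case 2 then show ?thesis using t2[OF that 2] by (simp add: field_simps)
    next
      case 3 then show ?thesis using nn[OF that] by simp
    qed
  qed
  then show ?thesis using that by blast
qed

text \<open>Apply the S-lemma to \<open>F\<close> and to \<open>- F\<close>. Since \<open>A\<close>
  is indefinite on \<open>H\<close>, the two multipliers must be opposite, and both inequalities
  become equalities.\<close>

lemma form_multiple_on:
  assumes A: "sym_mat A" and F: "sym_mat F" and H: "subspace H"
    and x0: "x0 \<in> H" "bf A x0 x0 > 0" and y0: "y0 \<in> H" "bf A y0 y0 < 0"
    and z: "\<And>z. z \<in> H \<Longrightarrow> bf A z z = 0 \<Longrightarrow> bf F z z = 0"
  obtains t where "\<And>z. z \<in> H \<Longrightarrow> bf F z z = t * bf A z z"
proof -
  obtain t where t: "\<And>z. z \<in> H \<Longrightarrow> bf F z z + t * bf A z z \<ge> 0"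
    using s_lemma_on[OF A F H x0 y0] z by (metis order.refl)
  obtain t' where t': "\<And>z. z \<in> H \<Longrightarrow> bf (- F) z z + t' * bf A z z \<ge> 0"
    using s_lemma_on[OF A sym_mat_minus[OF F] H x0 y0] z by (metis bf_mat_minus neg_0_equal_iff_equal order.refl)
  have s: "(t + t') * bf A z z \<ge> 0" if "z \<in> H" for z using t[OF that] t'[OF that] by (simp add: bf_mat algebra_simps)
  have "t + t' = 0" using s[OF x0(1)] s[OF y0(1)] x0(2) y0(2) by (simp add: zero_le_mult_iff)
  then have t'': "t' = - t" by simp
  have "bf F z z = (- t) * bf A z z" if "z \<in> H" for z using t[OF that] t'[OF that] by (simp add: bf_mat t'')
  then show ?thesis using that by blast
qed

subsection \<open>Ranks\<close>

text \<open>Codimension at most \<open>k\<close>, written with a sum to avoid truncated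
  subtraction.\<close>

definition cod :: "nat \<Rightarrow> (real^'m::finite) set \<Rightarrow> bool" where
  "cod k T \<longleftrightarrow> subspace T \<and> CARD('m) \<le> dim T + k"

lemma cod_Int: assumes "cod j S" "cod k T" shows "cod (j + k) (S \<inter> (T :: (real^'m::finite) set))"
proof -
  have s: "subspace S" "subspace T" using assms by (auto simp: cod_def)
  have "dim {x + y | x y. x \<in> S \<and> y \<in> T} + dim (S \<inter> T) = dim S + dim T" using dim_sums_Int[OF s] by simp
  moreover have "dim {x + y | x y. x \<in> S \<and> y \<in> T} \<le> CARD('m)" using dim_subset_UNIV[of "{x + y | x y. x \<in> S \<and> y \<in> T}"] by simp
  ultimately show ?thesis using assms s by (auto simp: cod_def subspace_inter)
qed

lemma cod_mono: "cod k T \<Longrightarrow> k \<le> j \<Longrightarrow> cod j T" by (simp add: cod_def)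
lemma cod_superset: "cod k T \<Longrightarrow> T \<subseteq> S \<Longrightarrow> subspace S \<Longrightarrow> cod k S"
  using dim_subset[of T S] by (auto simp: cod_def)

lemma cod_orth: assumes "subspace R" "dim R \<le> k" shows "cod k {y::real^'m::finite. \<forall>x\<in>R. orthogonal x y}"
proof -
  have "dim {y \<in> UNIV. \<forall>x\<in>R. orthogonal x y} + dim R = dim (UNIV :: (real^'m) set)"
    by (rule dim_subspace_orthogonal_to_vectors[OF assms(1)]) auto
  moreover have "subspace {y::real^'m. \<forall>x\<in>R. orthogonal x y}"
    by (auto simp: subspace_def orthogonal_def inner_add_right)
  ultimately show ?thesis using assms(2) by (simp add: cod_def)
qed

lemma cod_hyperplane: "cod 1 {v::real^'m::finite. g \<bullet> v = 0}"
proof -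
  have "dim (span {g}) \<le> 1" using dim_le_card'[of "{g}"] by simp
  from cod_orth[OF subspace_span this] show ?thesis
  proof (rule cod_superset)
    show "{y. \<forall>x\<in>span {g}. orthogonal x y} \<subseteq> {v. g \<bullet> v = 0}" using span_base[of g "{g}"] by (auto simp: orthogonal_def)
    show "subspace {v. g \<bullet> v = 0}" by (rule subspace_hyperplane)
  qed
qed

lemma subspace_matrix_range: "subspace (range (\<lambda>x. (M::real^'m::finite^'m) *v x))"
  by (rule linear_subspace_image[OF matrix_vector_mul_linear subspace_UNIV])

lemma matrix_range_orth: "sym_mat M \<Longrightarrow> {y. \<forall>x\<in>range (\<lambda>x. M *v x). orthogonal x y} = {y. M *v y = 0}"
proof (intro equalityI subsetI CollectI; clarsimp)
  fix y assume M: "sym_mat M" and o: "\<forall>x. orthogonal (M *v x) y"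
  have "bf M x y = 0" for x using o bf_sym[OF M, of x y] by (simp add: bf_def orthogonal_def inner_commute)
  then show "M *v y = 0" by (rule bf_nondeg)
next
  fix y x assume M: "sym_mat M" and "M *v y = 0"
  then show "orthogonal (M *v x) y" using bf_sym[OF M, of x y] by (simp add: bf_def orthogonal_def inner_commute)
qed

lemma cod_ker: assumes "sym_mat M" shows "cod (rank M) {y. M *v y = 0}"
  using cod_orth[OF subspace_matrix_range order.refl, of M] unfolding matrix_range_orth[OF assms] rank_dim_range .

lemma rank_le_cod_ker:
  assumes M: "sym_mat (M::real^'m::finite^'m)" and c: "cod k {y. M *v y = 0}"
  shows "rank M \<le> k"
proof -
  have "dim {y \<in> UNIV. \<forall>x\<in>range (\<lambda>x. M *v x). orthogonal x y} + dim (range (\<lambda>x. M *v x)) = dim (UNIV :: (real^'m) set)"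
    by (rule dim_subspace_orthogonal_to_vectors[OF subspace_matrix_range]) auto
  then have "dim {y. M *v y = 0} + rank M = CARD('m)"
    unfolding rank_dim_range matrix_range_orth[OF M, symmetric] by simp
  then show ?thesis using c by (simp add: cod_def)
qed

text \<open>Isotropy sends \<open>y\<close> in \<open>T\<close> to a vector \<open>M y\<close> in
  the orthogonal complement \<open>P\<close> of \<open>T\<close>. If \<open>y\<close> is also
  orthogonal to the image of \<open>P\<close> under \<open>M\<close>, then the squared norm of
  \<open>M y\<close>, which is the pairing of \<open>y\<close> with \<open>M (M y)\<close>,
  vanishes. So two conditions of codimension \<open>k\<close> each already cut out part of the
  kernel.\<close>

lemma rank_le_isotropic:
  assumes M: "sym_mat (M::real^'m::finite^'m)" and T: "cod k T" and z: "\<And>v. v \<in> T \<Longrightarrow> bf M v v = 0"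
  shows "rank M \<le> 2 * k"
proof -
  have sT: "subspace T" using T by (simp add: cod_def)
  define P where "P = {y. \<forall>x\<in>T. orthogonal x y}"
  have "dim P + dim T = CARD('m)"
    using dim_subspace_orthogonal_to_vectors[OF sT subspace_UNIV] by (simp add: P_def)
  then have "dim P \<le> k" using T by (simp add: cod_def)
  have sP: "subspace P" by (auto simp: P_def subspace_def orthogonal_def inner_add_right)
  define R where "R = (\<lambda>x. M *v x) ` P"
  have "subspace R" unfolding R_def by (rule linear_subspace_image[OF matrix_vector_mul_linear sP])
  moreover have "dim R \<le> k" unfolding R_def using dim_image_le[OF matrix_vector_mul_linear, of M P] \<open>dim P \<le> k\<close> by linarith
  ultimately have "cod k {y. \<forall>x\<in>R. orthogonal x y}" by (rule cod_orth)
  from cod_Int[OF T this] have c: "cod (k + k) (T \<inter> {y. \<forall>x\<in>R. orthogonal x y})" .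
  have bT: "bf M u v = 0" if "u \<in> T" "v \<in> T" for u v
    using bf_polar[OF M, of u v] z[OF that(1)] z[OF that(2)] z[OF subspace_add[OF sT that]] by simp
  have "T \<inter> {y. \<forall>x\<in>R. orthogonal x y} \<subseteq> {y. M *v y = 0}"
  proof clarsimp
    fix y assume y: "y \<in> T" "\<forall>x\<in>R. orthogonal x y"
    have "M *v y \<in> P" unfolding P_def using bT[OF _ y(1)] by (auto simp: bf_def orthogonal_def)
    then have "orthogonal (M *v (M *v y)) y" using y(2) by (auto simp: R_def)
    then have "bf M y (M *v y) = 0" by (simp add: bf_def orthogonal_def inner_commute)
    then have "bf M (M *v y) y = 0" using bf_sym[OF M] by metis
    then show "M *v y = 0" by (simp add: bf_def)
  qed
  from cod_superset[OF c this] have "cod (k + k) {y. M *v y = 0}"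
    using cod_ker[OF M] by (simp add: cod_def)
  from rank_le_cod_ker[OF M this] show ?thesis by simp
qed

text \<open>Nondissipativity together with linear independence of \<open>D\<close> and
  \<open>E\<close>: the coefficients themselves are forced to vanish. In this form the notion is
  stable under change of basis of the pencil.\<close>

definition nondis :: "real^'m::finite^'m \<Rightarrow> real^'m^'m \<Rightarrow> bool" where
  "nondis D E \<longleftrightarrow> sym_mat D \<and> sym_mat E \<and>
     (\<forall>s t. (\<forall>z. s * bf D z z + t * bf E z z \<ge> 0) \<longrightarrow> s = 0 \<and> t = 0)"

lemma nondisD: "nondis D E \<Longrightarrow> (\<And>z. s * bf D z z + t * bf E z z \<ge> 0) \<Longrightarrow> s = 0 \<and> t = 0"
  unfolding nondis_def by blast

lemma nondis_sym: "nondis D E \<Longrightarrow> sym_mat D" "nondis D E \<Longrightarrow> sym_mat E"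
  unfolding nondis_def by blast+

lemma nondis_basis_change:
  assumes "nondis D E" "a * d - b * c \<noteq> 0"
  shows "nondis (a *\<^sub>R D + b *\<^sub>R E) (c *\<^sub>R D + d *\<^sub>R E)"
  unfolding nondis_def
proof (intro conjI allI impI)
  have "sym_mat D" "sym_mat E" using nondis_sym[OF assms(1)] .
  then show "sym_mat (a *\<^sub>R D + b *\<^sub>R E)" "sym_mat (c *\<^sub>R D + d *\<^sub>R E)"
    by (simp_all add: sym_mat_add sym_mat_scaleR)
  fix p q assume h: "\<forall>z. p * bf (a *\<^sub>R D + b *\<^sub>R E) z z + q * bf (c *\<^sub>R D + d *\<^sub>R E) z z \<ge> 0"
  have "(p * a + q * c) * bf D z z + (p * b + q * d) * bf E z z \<ge> 0" for z
    using h[rule_format, of z] by (simp add: bf_mat algebra_simps)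
  then have e: "p * a + q * c = 0" "p * b + q * d = 0" using nondisD[OF assms(1)] by blast+
  have "p * (a * d - b * c) = d * (p * a + q * c) - c * (p * b + q * d)"
    "q * (a * d - b * c) = a * (p * b + q * d) - b * (p * a + q * c)" by (simp_all add: algebra_simps)
  then have "p * (a * d - b * c) = 0" "q * (a * d - b * c) = 0" unfolding e by simp_all
  then show "p = 0" "q = 0" using assms(2) by simp_all
qed

lemma nondis_swap: "nondis D E \<Longrightarrow> nondis E D"
  using nondis_basis_change[of D E 0 0 1 1] by simp

lemma nondis_uminus: "nondis D E \<Longrightarrow> nondis D (- E)"
  using nondis_basis_change[of D E 1 "-1" 0 0] by simp

lemma nondis_indefinite:
  assumes "nondis D E"
  obtains x y where "bf D x x > 0" "bf D y y < 0"
proof -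
  have "\<exists>x. bf D x x > 0"
  proof (rule ccontr)
    assume "\<not> ?thesis"
    then have "(-1) * bf D z z + 0 * bf E z z \<ge> 0" for z by (simp add: not_less)
    from nondisD[OF assms this] show False by simp
  qed
  moreover have "\<exists>x. bf D x x < 0"
  proof (rule ccontr)
    assume "\<not> ?thesis"
    then have "1 * bf D z z + 0 * bf E z z \<ge> 0" for z by (simp add: not_less)
    from nondisD[OF assms this] show False by simp
  qed
  ultimately show ?thesis using that by blast
qed

text \<open>If \<open>E\<close> were nonnegative on the cone of \<open>D\<close>, the S-lemma would
  produce a positive semidefinite form \<open>E + t *\<^sub>R D\<close>.\<close>

lemma nondis_negative_on_cone:
  assumes "nondis D E"
  obtains w where "bf D w w = 0" "bf E w w < 0"
proof -
  obtain x y where xy: "bf D x x > 0" "bf D y y < 0" using nondis_indefinite[OF assms] .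
  have s: "sym_mat D" "sym_mat E" using nondis_sym[OF assms] .
  have "\<exists>w. bf D w w = 0 \<and> bf E w w < 0"
  proof (rule ccontr)
    assume "\<not> ?thesis"
    then have nn: "bf D z z = 0 \<Longrightarrow> bf E z z \<ge> 0" for z by (meson not_less)
    show False
    proof (rule s_lemma_on[OF s subspace_UNIV UNIV_I xy(1) UNIV_I xy(2)])
      show "bf E z z \<ge> 0" if "bf D z z = 0" for z by (rule nn[OF that])
      fix t assume t: "\<And>z. z \<in> UNIV \<Longrightarrow> bf E z z + t * bf D z z \<ge> 0"
      have "t * bf D z z + 1 * bf E z z \<ge> 0" for z using t[of z] by simp
      from nondisD[OF assms this] show False by simp
    qed
  qed
  then show ?thesis using that by blast
qed

lemma nondis_positive_on_cone:
  assumes "nondis D E"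
  obtains w where "bf D w w = 0" "bf E w w > 0"
  using nondis_negative_on_cone[OF nondis_uminus[OF assms]] by (auto simp: bf_mat)

lemma isotropic_line:
  assumes D: "sym_mat D" and x: "bf D x x > 0" and y: "bf D y y < 0"
  obtains s1 s2 where "s1 > 0" "s2 < 0" "bf D (x + s1 *\<^sub>R y) (x + s1 *\<^sub>R y) = 0" "bf D (x + s2 *\<^sub>R y) (x + s2 *\<^sub>R y) = 0"
    "bf D (x + s1 *\<^sub>R y) (x + s2 *\<^sub>R y) > 0"
proof -
  obtain s1 s2 where s: "s1 > 0" "s2 < 0"
    "bf D x x + 2 * s1 * bf D x y + s1\<^sup>2 * bf D y y = 0" "bf D x x + 2 * s2 * bf D x y + s2\<^sup>2 * bf D y y = 0"
    "s1 * s2 = bf D x x / bf D y y" "s1 + s2 = - 2 * bf D x y / bf D y y"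
    by (rule quadratic_opposite_roots[OF y x])
  have ex: "bf D (x + s *\<^sub>R y) (x + s *\<^sub>R y) = bf D x x + 2 * s * bf D x y + s\<^sup>2 * bf D y y" for s
    using bf_polar[OF D, of x "s *\<^sub>R y"] by (simp add: bf_lin power2_eq_square)
  have "bf D (x + s1 *\<^sub>R y) (x + s2 *\<^sub>R y) = bf D x x + (s1 + s2) * bf D x y + s1 * s2 * bf D y y"
    using bf_sym[OF D, of y x] by (simp add: bf_lin algebra_simps)
  also have "\<dots> = 2 * bf D x x - 2 * (bf D x y)\<^sup>2 / bf D y y" unfolding s(5,6) using y by (simp add: power2_eq_square)
  also have "\<dots> > 0" using x y by (smt (verit) divide_nonneg_neg zero_le_power2)
  finally show ?thesis using that[of s1 s2] s ex by simp
qed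

text \<open>The two isotropic points on a line pair nontrivially under \<open>D\<close>, so neither
  lies in the kernel. Both can be orthogonal to \<open>g\<close> only if the base point of the line
  is, and a small move of that point along \<open>g\<close> prevents it.\<close>

lemma isotropic_not_kernel:
  assumes D: "sym_mat D" and x: "bf D x x > 0" and y: "bf D y y < 0" and g: "g \<noteq> 0"
  obtains z where "bf D z z = 0" "D *v z \<noteq> 0" "g \<bullet> z \<noteq> 0"
proof -
  have base: "\<exists>z. bf D z z = 0 \<and> D *v z \<noteq> 0 \<and> g \<bullet> z \<noteq> 0" if pp: "bf D p p > 0" "g \<bullet> p \<noteq> 0" for p
  proof -
    obtain s1 s2 where s: "s1 > 0" "s2 < 0" "bf D (p + s1 *\<^sub>R y) (p + s1 *\<^sub>R y) = 0" "bf D (p + s2 *\<^sub>R y) (p + s2 *\<^sub>R y) = 0"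
      "bf D (p + s1 *\<^sub>R y) (p + s2 *\<^sub>R y) > 0" by (rule isotropic_line[OF D pp(1) y])
    have nk: "D *v (p + s1 *\<^sub>R y) \<noteq> 0" "D *v (p + s2 *\<^sub>R y) \<noteq> 0"
      using s(5) bf_ker[of D "p + s2 *\<^sub>R y" "p + s1 *\<^sub>R y"] bf_ker[of D "p + s1 *\<^sub>R y" "p + s2 *\<^sub>R y"] bf_sym[OF D, of "p + s1 *\<^sub>R y" "p + s2 *\<^sub>R y"] by auto
    have "g \<bullet> (p + s1 *\<^sub>R y) \<noteq> 0 \<or> g \<bullet> (p + s2 *\<^sub>R y) \<noteq> 0"
    proof (rule ccontr)
      assume "\<not> ?thesis"
      then have "g \<bullet> p + s1 * (g \<bullet> y) = 0" "g \<bullet> p + s2 * (g \<bullet> y) = 0" by (simp_all add: inner_add_right)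
      then have "(s1 - s2) * (g \<bullet> y) = 0" unfolding left_diff_distrib by linarith
      then have "g \<bullet> y = 0" using s(1,2) by simp
      with \<open>g \<bullet> p + s1 * (g \<bullet> y) = 0\<close> pp(2) show False by simp
    qed
    then show ?thesis using s(3,4) nk by blast
  qed
  have "\<exists>p. bf D p p > 0 \<and> g \<bullet> p \<noteq> 0"
  proof (cases "g \<bullet> x = 0")
    case True
    have "continuous_on UNIV (\<lambda>e::real. bf D (x + e *\<^sub>R g) (x + e *\<^sub>R g))" by (intro continuous_intros)
    then have "isCont (\<lambda>e::real. bf D (x + e *\<^sub>R g) (x + e *\<^sub>R g)) 0" by (simp add: continuous_on_eq_continuous_at)
    then have "((\<lambda>e::real. bf D (x + e *\<^sub>R g) (x + e *\<^sub>R g)) \<longlongrightarrow> bf D x x) (at 0)" by (simp add: isCont_def)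
    then have "\<forall>\<^sub>F e in at 0. bf D (x + e *\<^sub>R g) (x + e *\<^sub>R g) > 0" by (rule order_tendstoD(1)[OF _ x])
    moreover have "\<forall>\<^sub>F e::real in at 0. e \<noteq> 0" by (simp add: eventually_at_filter)
    ultimately have "\<forall>\<^sub>F e::real in at 0. e \<noteq> 0 \<and> bf D (x + e *\<^sub>R g) (x + e *\<^sub>R g) > 0" by eventually_elim simp
    from eventually_happens'[OF at_neq_bot this]
    obtain e :: real where "e \<noteq> 0" "bf D (x + e *\<^sub>R g) (x + e *\<^sub>R g) > 0" by blast
    then show ?thesis using True g by (intro exI[of _ "x + e *\<^sub>R g"]) (simp add: inner_add_right)
  qed (use x in auto)
  then show ?thesis using base that by blast
qed

section \<open>Existence of regular common zeros\<close>

definition regular :: "real^'m::finite^'m \<Rightarrow> real^'m^'m \<Rightarrow> real^'m \<Rightarrow> bool" where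
  "regular D E z \<longleftrightarrow> bf D z z = 0 \<and> bf E z z = 0 \<and> (\<forall>s t. s *\<^sub>R (D *v z) + t *\<^sub>R (E *v z) = 0 \<longrightarrow> s = 0 \<and> t = 0)"

lemma regular_basis_change:
  assumes "regular (a *\<^sub>R D + b *\<^sub>R E) (c *\<^sub>R D + d *\<^sub>R E) z" "a * d - b * c \<noteq> 0"
  shows "regular D E z"
  unfolding regular_def
proof (intro conjI allI impI)
  have z: "a * bf D z z + b * bf E z z = 0" "c * bf D z z + d * bf E z z = 0"
    using assms(1) by (auto simp: regular_def bf_mat)
  have "bf D z z * (a * d - b * c) = d * (a * bf D z z + b * bf E z z) - b * (c * bf D z z + d * bf E z z)"
    "bf E z z * (a * d - b * c) = a * (c * bf D z z + d * bf E z z) - c * (a * bf D z z + b * bf E z z)" by (simp_all add: algebra_simps)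
  then show "bf D z z = 0" "bf E z z = 0" using assms(2) unfolding z by simp_all
  define \<Delta> where "\<Delta> = a * d - b * c"
  fix s t assume h: "s *\<^sub>R (D *v z) + t *\<^sub>R (E *v z) = 0"
  have mv: "(p *\<^sub>R D + q *\<^sub>R E) *v z = p *\<^sub>R (D *v z) + q *\<^sub>R (E *v z)" for p q
    by (simp add: matrix_vector_mult_add_rdistrib scaleR_matrix_vector_assoc)
  have li: "p *\<^sub>R ((a *\<^sub>R D + b *\<^sub>R E) *v z) + q *\<^sub>R ((c *\<^sub>R D + d *\<^sub>R E) *v z) = 0 \<Longrightarrow> p = 0 \<and> q = 0" for p q
    using assms(1) unfolding regular_def by blast
  have "(s * d - t * c) *\<^sub>R ((a *\<^sub>R D + b *\<^sub>R E) *v z) + (t * a - s * b) *\<^sub>R ((c *\<^sub>R D + d *\<^sub>R E) *v z)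
     = \<Delta> *\<^sub>R (s *\<^sub>R (D *v z) + t *\<^sub>R (E *v z))"
    unfolding mv \<Delta>_def by (simp add: algebra_simps)
  then have "s * d - t * c = 0 \<and> t * a - s * b = 0" unfolding h by (intro li) (simp only: scaleR_zero_right)
  then have "s * d - t * c = 0" "t * a - s * b = 0" by blast+
  moreover have "s * \<Delta> = a * (s * d - t * c) + c * (t * a - s * b)" "t * \<Delta> = b * (s * d - t * c) + d * (t * a - s * b)"
    by (simp_all add: \<Delta>_def algebra_simps)
  ultimately have "s * \<Delta> = 0" "t * \<Delta> = 0" by simp_all
  then show "s = 0" "t = 0" using assms(2) by (simp_all add: \<Delta>_def)
qed

text \<open>Moving along \<open>z\<close> does not change \<open>D\<close>. In the plane of
  \<open>z\<close> and an isotropic \<open>x\<close> only \<open>E\<close> has to be made zero, and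
  because \<open>E\<close> vanishes at \<open>z\<close> this is a linear equation, solved by
  \<open>w\<close>.\<close>

lemma regular_from_singular:
  assumes nd: "nondis D E" and z: "bf D z z = 0" "bf E z z = 0" "D *v z = 0" "E *v z \<noteq> 0"
  shows "\<exists>z'. regular D E z'"
proof -
  have s: "sym_mat D" "sym_mat E" using nondis_sym[OF nd] .
  obtain p q where pq: "bf D p p > 0" "bf D q q < 0" using nondis_indefinite[OF nd] .
  obtain x where x: "bf D x x = 0" "D *v x \<noteq> 0" "(E *v z) \<bullet> x \<noteq> 0"
    by (rule isotropic_not_kernel[OF s(1) pq z(4)])
  define e where "e = bf E z x"
  have e: "e \<noteq> 0" using x(3) bf_sym[OF s(2), of z x] by (simp add: e_def bf_def inner_commute)
  define w where "w = bf E x x *\<^sub>R z - (2 * e) *\<^sub>R x"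
  have Dx: "bf D z u = 0" "bf D u z = 0" for u using bf_ker[OF z(3), of u] bf_sym[OF s(1), of u z] by auto
  have "bf D w w = 0" unfolding w_def by (simp add: bf_lin Dx x(1))
  moreover have "bf E w w = 0" unfolding w_def using bf_sym[OF s(2), of x z]
    by (simp add: bf_lin z(2) e_def[symmetric] algebra_simps)
  moreover have "a = 0 \<and> b = 0" if h: "a *\<^sub>R (D *v w) + b *\<^sub>R (E *v w) = 0" for a b
  proof -
    have "z \<bullet> (a *\<^sub>R (D *v w) + b *\<^sub>R (E *v w)) = a * bf D z w + b * bf E z w" by (simp add: bf_def inner_add_right)
    also have "\<dots> = b * (- 2 * e * e)" by (simp add: Dx w_def bf_lin z(2) e_def)
    finally have "b = 0" using h e by simp
    have "D *v w = (- 2 * e) *\<^sub>R (D *v x)" unfolding w_def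
      by (simp add: matrix_vector_mult_diff_distrib matrix_vector_mult_scaleR z(3))
    with h \<open>b = 0\<close> x(2) e show ?thesis by simp
  qed
  ultimately show ?thesis unfolding regular_def by blast
qed

lemma regular_from_noncommon_kernel:
  assumes nd: "nondis D E" and z: "bf D z z = 0" "bf E z z = 0" "\<not> (D *v z = 0 \<and> E *v z = 0)"
  shows "\<exists>z'. regular D E z'"
proof (cases "regular D E z")
  case False
  then obtain s t where st: "s *\<^sub>R (D *v z) + t *\<^sub>R (E *v z) = 0" "\<not> (s = 0 \<and> t = 0)"
    using z by (auto simp: regular_def)
  have mv: "(p *\<^sub>R D + q *\<^sub>R E) *v z = p *\<^sub>R (D *v z) + q *\<^sub>R (E *v z)" for p q
    by (simp add: matrix_vector_mult_add_rdistrib scaleR_matrix_vector_assoc)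
  show ?thesis
  proof (cases "s = 0")
    case True
    then have "E *v z = 0" using st by simp
    with z regular_from_singular[OF nondis_swap[OF nd], of z] obtain z' where "regular E D z'" by auto
    then have "regular (0 *\<^sub>R D + 1 *\<^sub>R E) (1 *\<^sub>R D + 0 *\<^sub>R E) z'" by simp
    from regular_basis_change[OF this] show ?thesis by auto
  next
    case s: False
    have "E *v z \<noteq> 0" using st z(3) s by auto
    moreover have "nondis (s *\<^sub>R D + t *\<^sub>R E) (0 *\<^sub>R D + 1 *\<^sub>R E)" by (rule nondis_basis_change[OF nd]) (use s in simp)
    ultimately have "\<exists>z'. regular (s *\<^sub>R D + t *\<^sub>R E) (0 *\<^sub>R D + 1 *\<^sub>R E) z'"
      by (intro regular_from_singular[of _ _ z]) (use z st mv in \<open>auto simp: bf_mat\<close>)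
    then obtain z' where "regular (s *\<^sub>R D + t *\<^sub>R E) (0 *\<^sub>R D + 1 *\<^sub>R E) z'" by blast
    from regular_basis_change[OF this] s show ?thesis by auto
  qed
qed blast

text \<open>If \<open>D\<close> vanished on the complement of the hyperbolic plane of
  \<open>w0\<close> and \<open>w1\<close>, that complement would lie in the kernel, and the rank
  would be 2.\<close>

lemma isotropic_complement:
  assumes D: "sym_mat (D::real^'m::finite^'m)" and r: "rank D \<ge> 3" and w: "bf D w0 w0 = 0" "bf D w1 w1 = 0" "bf D w0 w1 \<noteq> 0"
  obtains x where "bf D w0 x = 0" "bf D w1 x = 0" "bf D x x \<noteq> 0"
proof -
  define W where "W = {v. (D *v w0) \<bullet> v = 0} \<inter> {v. (D *v w1) \<bullet> v = 0}"
  have W: "v \<in> W \<longleftrightarrow> bf D w0 v = 0 \<and> bf D w1 v = 0" for v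
    using bf_sym[OF D, of w0 v] bf_sym[OF D, of w1 v] by (auto simp: W_def bf_def inner_commute)
  have cW: "cod (1 + 1) W" unfolding W_def by (intro cod_Int cod_hyperplane)
  have "\<exists>x\<in>W. bf D x x \<noteq> 0"
  proof (rule ccontr)
    assume n: "\<not> ?thesis"
    have sW: "subspace W" using cW by (simp add: cod_def)
    have bW: "bf D u v = 0" if "u \<in> W" "v \<in> W" for u v
      using bf_polar[OF D, of u v] n that subspace_add[OF sW that] by auto
    have "D *v v = 0" if v: "v \<in> W" for v
    proof (rule bf_nondeg)
      fix x
      define d where "d = bf D w0 w1"
      have d10: "bf D w1 w0 = d" using bf_sym[OF D] by (simp add: d_def)
      define u where "u = x - (bf D w1 x / d) *\<^sub>R w0 - (bf D w0 x / d) *\<^sub>R w1"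
      have "u \<in> W" unfolding W u_def using w d10 by (simp add: bf_lin d_def[symmetric])
      then have "bf D u v = 0" using bW v by blast
      then show "bf D x v = 0" using v unfolding u_def W by (simp add: bf_lin)
    qed
    then have "W \<subseteq> {y. D *v y = 0}" by blast
    from cod_superset[OF cW this] have "cod (1+1) {y. D *v y = 0}" using cod_ker[OF D] by (simp add: cod_def)
    from rank_le_cod_ker[OF D this] r show False by simp
  qed
  then show ?thesis using that W by blast
qed

text \<open>It suffices to find a common zero outside the common kernel. A path on the cone of
  \<open>D\<close> from negative to positive values of \<open>E\<close> meets one by the
  intermediate value theorem: a straight line if \<open>w0\<close> and \<open>w1\<close> are
  orthogonal for \<open>D\<close>, otherwise an arc of a conic that bends into a third direction
  \<open>x\<close>, available because the rank is at least 3.\<close>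

lemma regular_exists:
  assumes nd: "nondis D E" and r: "rank D \<ge> 3"
  shows "\<exists>z. regular D E z"
proof -
  have s: "sym_mat D" "sym_mat E" using nondis_sym[OF nd] .
  obtain w0 where w0: "bf D w0 w0 = 0" "bf E w0 w0 < 0" using nondis_negative_on_cone[OF nd] .
  obtain w1 where w1: "bf D w1 w1 = 0" "bf E w1 w1 > 0" using nondis_positive_on_cone[OF nd] .
  show ?thesis
  proof (cases "bf D w0 w1 = 0")
    case True
    obtain s1 s2 where st: "bf E (w1 + s1 *\<^sub>R w0) (w1 + s1 *\<^sub>R w0) = 0" "bf E (w1 + s1 *\<^sub>R w0) (w1 + s2 *\<^sub>R w0) > 0"
      by (rule isotropic_line[OF s(2) w1(2) w0(2)])
    define z where "z = w1 + s1 *\<^sub>R w0"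
    have "E *v z \<noteq> 0" using st(2) bf_ker[of E z "w1 + s2 *\<^sub>R w0"] bf_sym[OF s(2), of z "w1 + s2 *\<^sub>R w0"] by (auto simp: z_def)
    moreover have "bf D z z = 0" unfolding z_def using True bf_sym[OF s(1), of w1 w0] by (simp add: bf_lin w0 w1)
    ultimately show ?thesis using regular_from_noncommon_kernel[OF nd, of z] st(1) by (simp add: z_def)
  next
    case False
    obtain x where x: "bf D w0 x = 0" "bf D w1 x = 0" "bf D x x \<noteq> 0" by (rule isotropic_complement[OF s(1) r w0(1) w1(1) False])
    \<comment> \<open>On the arc \<open>z\<close> the form \<open>D\<close> consists of a term with
      \<open>bf D w0 v1\<close> and one with \<open>bf D x x\<close>. The sign in \<open>v1\<close>
      makes the two opposite and \<open>\<tau>\<close> makes them cancel. The kernel is avoided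
      since \<open>D\<close> pairs every point of the arc nontrivially with \<open>w0\<close> or
      \<open>w1\<close>.\<close>
    define \<sigma> where "\<sigma> = - bf D x x / (2 * bf D w0 w1)"
    define v1 where "v1 = sgn \<sigma> *\<^sub>R w1"
    define \<tau> where "\<tau> = 1 / sqrt \<bar>\<sigma>\<bar>"
    have \<sigma>0: "\<sigma> \<noteq> 0" using x(3) False by (simp add: \<sigma>_def)
    define z where "z \<theta> = (1 - \<theta>)\<^sup>2 *\<^sub>R w0 + \<theta>\<^sup>2 *\<^sub>R v1 + (\<theta> * (1 - \<theta>) * \<tau>) *\<^sub>R x" for \<theta>
    have xs: "bf D x w0 = 0" "bf D x w1 = 0" "bf D w1 w0 = bf D w0 w1" using x bf_sym[OF s(1), of x w0] bf_sym[OF s(1), of x w1] bf_sym[OF s(1), of w1 w0] by simp_all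
    have Dz: "bf D (z \<theta>) (z \<theta>) = 0" for \<theta>
    proof -
      have "bf D (z \<theta>) (z \<theta>) = (\<theta> * (1 - \<theta>))\<^sup>2 * (2 * sgn \<sigma> * bf D w0 w1 + \<tau>\<^sup>2 * bf D x x)"
        unfolding z_def v1_def by (simp add: bf_lin w0 w1 x xs power2_eq_square algebra_simps)
      also have "bf D x x = - 2 * \<sigma> * bf D w0 w1" using False by (simp add: \<sigma>_def)
      also have "2 * sgn \<sigma> * bf D w0 w1 + \<tau>\<^sup>2 * (- 2 * \<sigma> * bf D w0 w1) = 2 * bf D w0 w1 * (sgn \<sigma> - \<tau>\<^sup>2 * \<sigma>)" by (simp add: algebra_simps)
      also have "\<tau>\<^sup>2 * \<sigma> = sgn \<sigma>" using \<sigma>0 by (simp add: \<tau>_def power_divide sgn_real_def)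
      finally show ?thesis by simp
    qed
    have nk: "D *v z \<theta> \<noteq> 0" for \<theta>
    proof
      assume "D *v z \<theta> = 0"
      then have "bf D w0 (z \<theta>) = 0" "bf D w1 (z \<theta>) = 0" by (simp_all add: bf_ker)
      then have "\<theta> = 0" "1 - \<theta> = 0" using False \<sigma>0 by (simp_all add: z_def v1_def bf_lin w0 w1 x xs sgn_zero_iff)
      then show False by simp
    qed
    have v1: "bf E v1 v1 > 0" using w1(2) \<sigma>0 by (simp add: v1_def bf_lin sgn_real_def)
    have c: "continuous_on {0..1} (\<lambda>\<theta>. bf E (z \<theta>) (z \<theta>))" unfolding z_def by (intro continuous_intros)
    have "\<exists>\<theta>\<ge>0. \<theta> \<le> 1 \<and> bf E (z \<theta>) (z \<theta>) = 0"
      by (rule IVT'[of "\<lambda>\<theta>. bf E (z \<theta>) (z \<theta>)"]) (use w0 v1 c in \<open>auto simp: z_def\<close>)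
    then obtain \<theta> where "bf E (z \<theta>) (z \<theta>) = 0" by blast
    then show ?thesis using regular_from_noncommon_kernel[OF nd Dz, of \<theta>] nk by blast
  qed
qed

subsection \<open>The tangent space at a regular common zero\<close>

lemma dual_vectors:
  fixes u v :: "real^'m::finite"
  assumes ind: "\<And>s t. s *\<^sub>R u + t *\<^sub>R v = 0 \<Longrightarrow> s = 0 \<and> t = 0"
  obtains e f where "u \<bullet> e = 1" "v \<bullet> e = 0" "u \<bullet> f = 0" "v \<bullet> f = (1::real)"
proof -
  define D where "D = (u \<bullet> u) * (v \<bullet> v) - (u \<bullet> v)\<^sup>2"
  have "D \<noteq> 0"
  proof
    assume D0: "D = 0"
    define w where "w = (v \<bullet> v) *\<^sub>R u - (u \<bullet> v) *\<^sub>R v"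
    have "w \<bullet> w = (v \<bullet> v) * D"
      by (simp add: w_def D_def inner_diff_left inner_diff_right inner_commute[of v u] power2_eq_square algebra_simps)
    then have "w = 0" using D0 by simp
    then have "(v \<bullet> v) *\<^sub>R u + (- (u \<bullet> v)) *\<^sub>R v = 0" by (simp add: w_def)
    from ind[OF this] have "v = 0" by simp
    then show False using ind[of 0 1] by simp
  qed
  define e where "e = (1/D) *\<^sub>R ((v \<bullet> v) *\<^sub>R u - (u \<bullet> v) *\<^sub>R v)"
  define f where "f = (1/D) *\<^sub>R ((u \<bullet> u) *\<^sub>R v - (u \<bullet> v) *\<^sub>R u)"
  have "u \<bullet> e = D / D" "v \<bullet> e = 0" "u \<bullet> f = 0" "v \<bullet> f = D / D"
    by (simp_all add: e_def f_def inner_diff_right inner_commute[of v u] D_def power2_eq_square mult_ac)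
  then show ?thesis using that \<open>D \<noteq> 0\<close> by simp
qed

lemma regular_dual:
  assumes s: "sym_mat D" "sym_mat E" and r: "regular D E z"
  obtains u1 u2 where "bf D z u1 = 1" "bf E z u1 = 0" "bf D z u2 = 0" "bf E z u2 = 1"
proof -
  have li: "s *\<^sub>R (D *v z) + t *\<^sub>R (E *v z) = 0 \<Longrightarrow> s = 0 \<and> t = 0" for s t
    using r unfolding regular_def by blast
  have sw: "bf M z u = (M *v z) \<bullet> u" if "sym_mat M" for M u
    using bf_sym[OF that, of z u] by (simp add: bf_def inner_commute)
  show ?thesis
  proof (rule dual_vectors[OF li])
    fix e f assume "(D *v z) \<bullet> e = 1" "(E *v z) \<bullet> e = 0" "(D *v z) \<bullet> f = 0" "(E *v z) \<bullet> f = 1"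
    then show ?thesis using that[of e f] sw[OF s(1)] sw[OF s(2)] by simp
  qed
qed

text \<open>The two conditions on the correction \<open>s1 u1 + s2 u2\<close> are a fixed point equation, solved by Brouwer's theorem.\<close>

lemma zero_set_curve:
  assumes s: "sym_mat D" "sym_mat E" and z: "bf D z z = 0" "bf E z z = 0"
    and u: "bf D z u1 = 1" "bf E z u1 = 0" "bf D z u2 = 0" "bf E z u2 = 1"
    and v: "bf D z v = 0" "bf E z v = 0"
  obtains K \<delta> where "K > 0" "\<delta> > 0" "\<And>t. \<bar>t\<bar> < \<delta> \<Longrightarrow> \<exists>s1 s2. \<bar>s1\<bar> \<le> K * t\<^sup>2 \<and> \<bar>s2\<bar> \<le> K * t\<^sup>2 \<and>
     (let w = t *\<^sub>R v + s1 *\<^sub>R u1 + s2 *\<^sub>R u2 in s1 = - bf D w w / 2 \<and> s2 = - bf E w w / 2 \<and> bf D (z + w) (z + w) = 0 \<and> bf E (z + w) (z + w) = 0)"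
proof -
  obtain K1 where K1: "K1 \<ge> 0" "\<And>x y. \<bar>bf D x y\<bar> \<le> norm x * norm y * K1" using bf_bound[of D] by blast
  obtain K2 where K2: "K2 \<ge> 0" "\<And>x y. \<bar>bf E x y\<bar> \<le> norm x * norm y * K2" using bf_bound[of E] by blast
  define H where "H = norm v + norm u1 + norm u2"
  define K where "K = (K1 + K2) * H\<^sup>2 + 1"
  have H: "H \<ge> 0" by (simp add: H_def)
  have K: "K \<ge> 1" using K1 K2 by (simp add: K_def)
  have "\<exists>s1 s2. \<bar>s1\<bar> \<le> K * t\<^sup>2 \<and> \<bar>s2\<bar> \<le> K * t\<^sup>2 \<and>
     (let w = t *\<^sub>R v + s1 *\<^sub>R u1 + s2 *\<^sub>R u2 in s1 = - bf D w w / 2 \<and> s2 = - bf E w w / 2 \<and> bf D (z + w) (z + w) = 0 \<and> bf E (z + w) (z + w) = 0)"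
    if t: "\<bar>t\<bar> < 1 / K" for t
  proof -
    \<comment> \<open>The correction is expected to be quadratic in \<open>t\<close>. For
      \<open>\<bar>t\<bar> < 1 / K\<close> also \<open>r \<le> \<bar>t\<bar>\<close>, so
      \<open>w\<close> has size \<open>\<bar>t\<bar>\<close> on the square \<open>S\<close>, and the
      quadratic map \<open>F\<close> sends \<open>S\<close> into itself.\<close>
    define r where "r = K * t\<^sup>2"
    have r0: "r \<ge> 0" using K by (simp add: r_def)
    have "K * \<bar>t\<bar> \<le> 1" using t K by (simp add: field_simps)
    then have "K * \<bar>t\<bar> * \<bar>t\<bar> \<le> 1 * \<bar>t\<bar>" by (rule mult_right_mono) simp
    then have rt: "r \<le> \<bar>t\<bar>" by (simp add: r_def power2_eq_square mult.assoc flip: abs_mult)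
    define w where "w p = t *\<^sub>R v + fst p *\<^sub>R u1 + snd p *\<^sub>R u2" for p :: "real \<times> real"
    define F where "F p = (- bf D (w p) (w p) / 2, - bf E (w p) (w p) / 2)" for p
    define S where "S = {- r..r} \<times> {- r..r}"
    have wn: "norm (w p) \<le> \<bar>t\<bar> * H" if "p \<in> S" for p
    proof -
      have p: "\<bar>fst p\<bar> \<le> \<bar>t\<bar>" "\<bar>snd p\<bar> \<le> \<bar>t\<bar>" using that rt by (auto simp: S_def)
      have "norm (w p) \<le> \<bar>t\<bar> * norm v + \<bar>fst p\<bar> * norm u1 + \<bar>snd p\<bar> * norm u2"
        unfolding w_def by (intro order.trans[OF norm_triangle_ineq] add_mono order.trans[OF norm_triangle_ineq]) auto
      also have "\<dots> \<le> \<bar>t\<bar> * norm v + \<bar>t\<bar> * norm u1 + \<bar>t\<bar> * norm u2" using p by (intro add_mono mult_right_mono) auto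
      finally show ?thesis by (simp add: H_def algebra_simps)
    qed
    have bnd: "\<bar>- bf M (w p) (w p) / 2\<bar> \<le> r" if "p \<in> S" "\<And>x y. \<bar>bf M x y\<bar> \<le> norm x * norm y * k" "k \<ge> 0" "k \<le> K1 + K2" for p M k
    proof -
      have "\<bar>bf M (w p) (w p)\<bar> \<le> norm (w p) * norm (w p) * k" by (rule that(2))
      also have "\<dots> \<le> (\<bar>t\<bar> * H) * (\<bar>t\<bar> * H) * (K1 + K2)" using wn[OF that(1)] H that by (intro mult_mono) auto
      also have "\<dots> = t\<^sup>2 * ((K1 + K2) * H\<^sup>2)" by (simp add: power2_eq_square mult_ac flip: abs_mult)
      also have "\<dots> \<le> t\<^sup>2 * K" by (intro mult_left_mono) (simp_all add: K_def)
      finally have "\<bar>bf M (w p) (w p)\<bar> \<le> r" by (simp add: r_def mult.commute)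
      then show ?thesis using r0 by simp
    qed
    have "continuous_on S F" unfolding F_def w_def by (intro continuous_intros) auto
    moreover have "F \<in> S \<rightarrow> S"
    proof
      fix p assume p: "p \<in> S"
      have "\<bar>fst (F p)\<bar> \<le> r" "\<bar>snd (F p)\<bar> \<le> r" unfolding F_def fst_conv snd_conv using K1 K2 by (intro bnd[OF p K1(2)] bnd[OF p K2(2)]; simp)+
      then show "F p \<in> S" unfolding S_def by (auto simp: mem_Times_iff abs_le_iff)
    qed
    moreover have "compact S" "convex S" "S \<noteq> {}" unfolding S_def using r0 by (auto intro: compact_Times convex_Times)
    ultimately obtain p where p: "p \<in> S" "F p = p" using brouwer[of S F] by blast
    have fp: "fst p = - bf D (w p) (w p) / 2" "snd p = - bf E (w p) (w p) / 2" using p(2) unfolding F_def by (auto simp: prod_eq_iff)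
    have zw: "bf D z (w p) = fst p" "bf E z (w p) = snd p" unfolding w_def by (simp_all add: bf_lin u v)
    have "bf D (z + w p) (z + w p) = 0" "bf E (z + w p) (z + w p) = 0"
      unfolding bf_polar[OF s(1)] bf_polar[OF s(2)] z zw using fp by simp_all
    moreover have "\<bar>fst p\<bar> \<le> K * t\<^sup>2" "\<bar>snd p\<bar> \<le> K * t\<^sup>2" using p(1) by (auto simp: S_def r_def)
    ultimately show ?thesis unfolding Let_def using fp unfolding w_def by blast
  qed
  then show ?thesis using that[of K "1/K"] K by simp
qed

lemma eq_zero_of_linear_bound:
  assumes "\<delta> > 0" "\<And>t. 0 < t \<Longrightarrow> t < \<delta> \<Longrightarrow> \<bar>x\<bar> \<le> C * t"
  shows "x = (0::real)"
proof (rule ccontr)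
  assume x: "x \<noteq> 0"
  define t where "t = min (\<delta>/2) (\<bar>x\<bar> / (2 * (\<bar>C\<bar> + 1)))"
  have t: "0 < t" "t < \<delta>" using assms(1) x by (auto simp: t_def min_less_iff_disj)
  have "\<bar>x\<bar> \<le> C * t" by (rule assms(2)[OF t])
  also have "\<dots> \<le> (\<bar>C\<bar> + 1) * t" using t by (intro mult_right_mono) auto
  also have "\<dots> \<le> (\<bar>C\<bar> + 1) * (\<bar>x\<bar> / (2 * (\<bar>C\<bar> + 1)))" by (intro mult_left_mono) (auto simp: t_def)
  also have "\<dots> = \<bar>x\<bar> / 2" by (simp add: field_simps)
  finally show False using x by simp
qed

text \<open>The coefficients are Lagrange multipliers, read off from the dual vectors
  \<open>u1\<close>, \<open>u2\<close>: since \<open>C\<close> vanishes on the zero set, its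
  differential at \<open>z\<close> is a combination of those of \<open>D\<close> and
  \<open>E\<close>. After the subtraction \<open>z\<close> lies in the kernel of \<open>F\<close>,
  so the correction of size \<open>t\<^sup>2\<close> to the curve no longer enters at order
  \<open>t\<^sup>2\<close>, and only the value of \<open>F\<close> at \<open>v\<close> is left
  there.\<close>

lemma second_order:
  assumes s: "sym_mat D" "sym_mat E" "sym_mat C" and z: "bf D z z = 0" "bf E z z = 0"
    and u: "bf D z u1 = 1" "bf E z u1 = 0" "bf D z u2 = 0" "bf E z u2 = 1"
    and C: "\<And>x. bf D x x = 0 \<Longrightarrow> bf E x x = 0 \<Longrightarrow> bf C x x = 0"
  defines "F \<equiv> C - bf C z u1 *\<^sub>R D - bf C z u2 *\<^sub>R E"
  shows "F *v z = 0" "\<And>v. bf D z v = 0 \<Longrightarrow> bf E z v = 0 \<Longrightarrow> bf F v v = 0"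
proof -
  have first: "bf C z v = 0" if v: "bf D z v = 0" "bf E z v = 0" for v
  proof -
    obtain K \<delta> where K: "K > 0" "\<delta> > 0" "\<And>t. \<bar>t\<bar> < \<delta> \<Longrightarrow> \<exists>s1 s2. \<bar>s1\<bar> \<le> K * t\<^sup>2 \<and> \<bar>s2\<bar> \<le> K * t\<^sup>2 \<and>
     (let w = t *\<^sub>R v + s1 *\<^sub>R u1 + s2 *\<^sub>R u2 in s1 = - bf D w w / 2 \<and> s2 = - bf E w w / 2 \<and> bf D (z + w) (z + w) = 0 \<and> bf E (z + w) (z + w) = 0)"
      using zero_set_curve[OF s(1,2) z u v] by blast
    obtain K3 where K3: "K3 \<ge> 0" "\<And>x y. \<bar>bf C x y\<bar> \<le> norm x * norm y * K3" using bf_bound[of C] by blast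
    define H where "H = norm v + K * norm u1 + K * norm u2"
    have H0: "H \<ge> 0" using K(1) by (simp add: H_def)
    show ?thesis
    proof (rule eq_zero_of_linear_bound)
      show "min \<delta> 1 > 0" using K by simp
      fix t :: real assume t: "0 < t" "t < min \<delta> 1"
      obtain s1 s2 where s12: "\<bar>s1\<bar> \<le> K * t\<^sup>2" "\<bar>s2\<bar> \<le> K * t\<^sup>2"
        "bf D (z + (t *\<^sub>R v + s1 *\<^sub>R u1 + s2 *\<^sub>R u2)) (z + (t *\<^sub>R v + s1 *\<^sub>R u1 + s2 *\<^sub>R u2)) = 0"
        "bf E (z + (t *\<^sub>R v + s1 *\<^sub>R u1 + s2 *\<^sub>R u2)) (z + (t *\<^sub>R v + s1 *\<^sub>R u1 + s2 *\<^sub>R u2)) = 0"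
        using K(3)[of t] t unfolding Let_def by auto
      define w where "w = t *\<^sub>R v + s1 *\<^sub>R u1 + s2 *\<^sub>R u2"
      have "t\<^sup>2 \<le> t" using t by (simp add: power2_eq_square mult_left_le)
      then have Kt: "K * t\<^sup>2 \<le> K * t" using K(1) by simp
      have "norm w \<le> \<bar>t\<bar> * norm v + \<bar>s1\<bar> * norm u1 + \<bar>s2\<bar> * norm u2"
        unfolding w_def by (intro order.trans[OF norm_triangle_ineq] add_mono order.trans[OF norm_triangle_ineq]) auto
      also have "\<dots> \<le> t * norm v + (K * t) * norm u1 + (K * t) * norm u2"
        using s12(1,2) Kt t by (intro add_mono mult_right_mono) auto
      finally have wn: "norm w \<le> t * H" by (simp add: H_def algebra_simps)
      have "bf C (z + w) (z + w) = 0" by (rule C) (use s12 in \<open>simp_all add: w_def\<close>)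
      then have "2 * bf C z w + bf C w w = 0" using C[OF z] by (simp add: bf_polar[OF s(3)])
      then have e: "2 * t * bf C z v = - 2 * s1 * bf C z u1 - 2 * s2 * bf C z u2 - bf C w w"
        by (simp add: w_def bf_lin)
      have "\<bar>bf C w w\<bar> \<le> norm w * norm w * K3" by (rule K3)
      also have "\<dots> \<le> (t * H) * (t * H) * K3" using wn K3 t H0 by (intro mult_right_mono mult_mono) auto
      also have "\<dots> = t\<^sup>2 * (H\<^sup>2 * K3)" by (simp add: power2_eq_square mult_ac)
      finally have cw: "\<bar>bf C w w\<bar> \<le> t\<^sup>2 * (H\<^sup>2 * K3)" .
      have c1: "\<bar>2 * s1 * bf C z u1\<bar> \<le> t\<^sup>2 * (2 * K * \<bar>bf C z u1\<bar>)" "\<bar>2 * s2 * bf C z u2\<bar> \<le> t\<^sup>2 * (2 * K * \<bar>bf C z u2\<bar>)"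
        using mult_right_mono[OF s12(1), of "2 * \<bar>bf C z u1\<bar>"] mult_right_mono[OF s12(2), of "2 * \<bar>bf C z u2\<bar>"]
        by (simp_all add: abs_mult mult_ac)
      have "\<bar>2 * t * bf C z v\<bar> \<le> t\<^sup>2 * (2 * K * \<bar>bf C z u1\<bar> + 2 * K * \<bar>bf C z u2\<bar> + H\<^sup>2 * K3)"
        unfolding e distrib_left using c1 cw by linarith
      then have "t * (2 * \<bar>bf C z v\<bar>) \<le> t * (t * (2 * K * \<bar>bf C z u1\<bar> + 2 * K * \<bar>bf C z u2\<bar> + H\<^sup>2 * K3))"
        using t by (simp add: abs_mult power2_eq_square mult_ac)
      then have "2 * \<bar>bf C z v\<bar> \<le> t * (2 * K * \<bar>bf C z u1\<bar> + 2 * K * \<bar>bf C z u2\<bar> + H\<^sup>2 * K3)"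
        using t by (simp only: mult_le_cancel_left_pos)
      then show "\<bar>bf C z v\<bar> \<le> (2 * K * \<bar>bf C z u1\<bar> + 2 * K * \<bar>bf C z u2\<bar> + H\<^sup>2 * K3) * t"
        using abs_ge_zero[of "bf C z v"] by (simp only: mult.commute[of t])
    qed
  qed
  have sF: "sym_mat F" unfolding F_def by (intro sym_mat_diff sym_mat_scaleR s)
  have Fz: "bf F z x = 0" for x
  proof -
    define v where "v = x - bf D z x *\<^sub>R u1 - bf E z x *\<^sub>R u2"
    have "bf C z v = 0" by (rule first) (simp_all add: v_def bf_lin u)
    then show ?thesis by (simp add: v_def F_def bf_mat bf_lin mult.commute)
  qed
  show "F *v z = 0" by (rule bf_nondeg) (use Fz bf_sym[OF sF] in simp)
  fix v assume v: "bf D z v = 0" "bf E z v = 0"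
  obtain K \<delta> where K: "K > 0" "\<delta> > 0" "\<And>t. \<bar>t\<bar> < \<delta> \<Longrightarrow> \<exists>s1 s2. \<bar>s1\<bar> \<le> K * t\<^sup>2 \<and> \<bar>s2\<bar> \<le> K * t\<^sup>2 \<and>
     (let w = t *\<^sub>R v + s1 *\<^sub>R u1 + s2 *\<^sub>R u2 in s1 = - bf D w w / 2 \<and> s2 = - bf E w w / 2 \<and> bf D (z + w) (z + w) = 0 \<and> bf E (z + w) (z + w) = 0)"
      using zero_set_curve[OF s(1,2) z u v] by blast
  obtain K3 where K3: "K3 \<ge> 0" "\<And>x y. \<bar>bf F x y\<bar> \<le> norm x * norm y * K3" using bf_bound[of F] by blast
  define H where "H = K * norm u1 + K * norm u2"
  have H0: "H \<ge> 0" using K(1) by (simp add: H_def)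
  show "bf F v v = 0"
  proof (rule eq_zero_of_linear_bound)
    show "min \<delta> 1 > 0" using K by simp
    fix t :: real assume t: "0 < t" "t < min \<delta> 1"
    obtain s1 s2 where s12: "\<bar>s1\<bar> \<le> K * t\<^sup>2" "\<bar>s2\<bar> \<le> K * t\<^sup>2"
      "bf D (z + (t *\<^sub>R v + s1 *\<^sub>R u1 + s2 *\<^sub>R u2)) (z + (t *\<^sub>R v + s1 *\<^sub>R u1 + s2 *\<^sub>R u2)) = 0"
      "bf E (z + (t *\<^sub>R v + s1 *\<^sub>R u1 + s2 *\<^sub>R u2)) (z + (t *\<^sub>R v + s1 *\<^sub>R u1 + s2 *\<^sub>R u2)) = 0"
      using K(3)[of t] t unfolding Let_def by auto
    define q where "q = s1 *\<^sub>R u1 + s2 *\<^sub>R u2"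
    have "norm q \<le> \<bar>s1\<bar> * norm u1 + \<bar>s2\<bar> * norm u2"
      unfolding q_def by (intro order.trans[OF norm_triangle_ineq] add_mono) auto
    also have "\<dots> \<le> (K * t\<^sup>2) * norm u1 + (K * t\<^sup>2) * norm u2" using s12 by (intro add_mono mult_right_mono) auto
    finally have qn: "norm q \<le> t\<^sup>2 * H" by (simp add: H_def algebra_simps)
    have "bf F (z + (t *\<^sub>R v + q)) (z + (t *\<^sub>R v + q)) = 0"
      unfolding F_def using s12(3,4) C[OF s12(3,4)] by (simp add: bf_mat q_def add.assoc)
    then have "bf F (t *\<^sub>R v + q) (t *\<^sub>R v + q) = 0" by (simp add: bf_polar[OF sF, of z] Fz)
    then have e: "t\<^sup>2 * bf F v v = - 2 * t * bf F v q - bf F q q"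
      using bf_sym[OF sF, of q v] by (simp add: bf_lin power2_eq_square algebra_simps)
    have "\<bar>bf F v q\<bar> \<le> norm v * norm q * K3" by (rule K3)
    also have "\<dots> \<le> norm v * (t\<^sup>2 * H) * K3" using qn K3 by (intro mult_right_mono mult_left_mono) auto
    finally have 1: "\<bar>bf F v q\<bar> \<le> t\<^sup>2 * (norm v * H * K3)" by (simp add: mult_ac)
    have "\<bar>bf F q q\<bar> \<le> norm q * norm q * K3" by (rule K3)
    also have "\<dots> \<le> (t\<^sup>2 * H) * (t\<^sup>2 * H) * K3" using qn K3 H0 by (intro mult_right_mono mult_mono) auto
    also have "\<dots> = t\<^sup>2 * (t * (t * (H\<^sup>2 * K3)))" by (simp add: power2_eq_square mult_ac)
    also have "\<dots> \<le> t\<^sup>2 * (t * (1 * (H\<^sup>2 * K3)))" using t K3 by (intro mult_left_mono mult_right_mono) auto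
    finally have 2: "\<bar>bf F q q\<bar> \<le> t\<^sup>2 * (t * (H\<^sup>2 * K3))" by simp
    have 3: "\<bar>2 * t * bf F v q\<bar> \<le> t\<^sup>2 * (t * (2 * (norm v * H * K3)))"
      using mult_left_mono[OF 1, of "2 * t"] t by (simp add: abs_mult mult_ac)
    have "\<bar>t\<^sup>2 * bf F v v\<bar> \<le> t\<^sup>2 * (t * (2 * (norm v * H * K3)) + t * (H\<^sup>2 * K3))"
      unfolding e distrib_left[of "t\<^sup>2"] using 2 3 by linarith
    then have "t\<^sup>2 * \<bar>bf F v v\<bar> \<le> t\<^sup>2 * ((2 * (norm v * H * K3) + H\<^sup>2 * K3) * t)"
      by (simp add: abs_mult algebra_simps)
    moreover have "t\<^sup>2 > 0" using t by simp
    ultimately show "\<bar>bf F v v\<bar> \<le> (2 * (norm v * H * K3) + H\<^sup>2 * K3) * t" by (simp only: mult_le_cancel_left_pos)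
  qed
qed

lemma eventually_at_0_small:
  assumes "\<forall>\<^sub>F t in at (0::real). P t"
  obtains \<delta> where "\<delta> > 0" "\<And>t. t \<noteq> 0 \<Longrightarrow> \<bar>t\<bar> < \<delta> \<Longrightarrow> P t"
  using assms unfolding eventually_at by (auto simp: dist_real_def)

lemma isCont_eq_0:
  fixes f :: "real \<Rightarrow> real"
  assumes "continuous_on UNIV f" "\<delta> > 0" "\<And>t. t \<noteq> 0 \<Longrightarrow> \<bar>t\<bar> < \<delta> \<Longrightarrow> f t = 0"
  shows "f 0 = 0"
proof -
  have "isCont f 0" using assms(1) by (simp add: continuous_on_eq_continuous_at)
  then have 1: "(f \<longlongrightarrow> f 0) (at 0)" by (simp add: isCont_def)
  have "\<forall>\<^sub>F t in at 0. f t = 0"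
    unfolding eventually_at using assms(2,3) by (intro exI[of _ \<delta>]) (auto simp: dist_real_def)
  then have "(f \<longlongrightarrow> 0) (at 0)" by (rule tendsto_eventually)
  from LIM_unique[OF 1 this] show ?thesis .
qed

lemma near_point:
  fixes x a y :: "real^'m::finite"
  assumes "r > 0"
  obtains \<delta> where "\<delta> > 0" "\<And>s t. \<bar>s\<bar> < \<delta> \<Longrightarrow> \<bar>t\<bar> < \<delta> \<Longrightarrow> x + s *\<^sub>R y + t *\<^sub>R a \<in> ball x r"
proof -
  define \<delta> where "\<delta> = r / (norm y + norm a + 1)"
  have d: "norm y + norm a + 1 > 0" by (smt (verit) norm_ge_zero)
  have d0: "\<delta> > 0" using assms d by (simp add: \<delta>_def)
  have "x + s *\<^sub>R y + t *\<^sub>R a \<in> ball x r" if "\<bar>s\<bar> < \<delta>" "\<bar>t\<bar> < \<delta>" for s t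
  proof -
    have "norm (s *\<^sub>R y + t *\<^sub>R a) \<le> \<bar>s\<bar> * norm y + \<bar>t\<bar> * norm a" by (intro order.trans[OF norm_triangle_ineq]) simp
    also have "\<dots> \<le> \<delta> * norm y + \<delta> * norm a" using that by (intro add_mono mult_right_mono) auto
    also have "\<dots> < \<delta> * (norm y + norm a + 1)" using d0 by (simp add: distrib_left)
    also have "\<dots> = r" using d by (simp add: \<delta>_def)
    finally have "norm (s *\<^sub>R y + t *\<^sub>R a) < r" .
    moreover have "dist (x + 0) (x + (s *\<^sub>R y + t *\<^sub>R a)) = norm (s *\<^sub>R y + t *\<^sub>R a)"
      unfolding dist_add_cancel by simp
    ultimately show ?thesis by (simp add: add.assoc)
  qed
  then show ?thesis using that[of \<delta>] assms d by (simp add: \<delta>_def)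
qed

lemma near_point_in_ball:
  fixes x a :: "real^'m::finite"
  assumes "x \<in> ball x1 r"
  shows "\<exists>\<delta>>0. \<forall>t. \<bar>t\<bar> < \<delta> \<longrightarrow> x + t *\<^sub>R a \<in> ball x1 r"
proof -
  obtain e where e: "e > 0" "ball x e \<subseteq> ball x1 r" using open_ball assms open_contains_ball by blast
  obtain \<delta> where \<delta>: "\<delta> > 0" "\<And>s t. \<bar>s\<bar> < \<delta> \<Longrightarrow> \<bar>t\<bar> < \<delta> \<Longrightarrow> x + s *\<^sub>R a + t *\<^sub>R a \<in> ball x e"
    using near_point[OF e(1), of x a a] by blast
  have "x + t *\<^sub>R a \<in> ball x1 r" if "\<bar>t\<bar> < \<delta>" for t
    using subsetD[OF e(2) \<delta>(2)[of 0 t]] that \<delta>(1) by simp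
  with \<delta>(1) show ?thesis by blast
qed

text \<open>Isotropic vectors of \<open>D\<close> are parametrised by \<open>x \<mapsto> D(x) w0 - 2 D(w0, x) x\<close>, so it suffices to know
  that \<open>F\<close> vanishes on an open piece of the cone \<open>D = 0\<close>.\<close>

lemma multiple_from_open_cone:
  assumes s: "sym_mat (D::real^'m::finite^'m)" "sym_mat F" and r: "rank D \<ge> 3"
    and w0: "bf D w0 w0 = 0" "D *v w0 \<noteq> 0" "w0 \<in> G"
    and G: "open G" "\<And>x c. x \<in> G \<Longrightarrow> c \<noteq> 0 \<Longrightarrow> c *\<^sub>R x \<in> G"
    and F: "\<And>x. x \<in> G \<Longrightarrow> bf D x x = 0 \<Longrightarrow> bf F x x = 0"
  shows "\<exists>c. F = c *\<^sub>R D"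
proof -
  define \<alpha> where "\<alpha> x = bf D w0 x" for x
  define \<gamma> where "\<gamma> x = bf F w0 x" for x
  have \<alpha>: "\<alpha> x = (D *v w0) \<bullet> x" for x using bf_sym[OF s(1), of w0 x] by (simp add: \<alpha>_def bf_def inner_commute)
  have "\<exists>x1. \<alpha> x1 = 0 \<and> bf D x1 x1 \<noteq> 0"
  proof (rule ccontr)
    assume n: "\<not> ?thesis"
    have "rank D \<le> 2 * 1"
      by (rule rank_le_isotropic[OF s(1) cod_hyperplane[of "D *v w0"]]) (use n \<alpha> in auto)
    with r show False by simp
  qed
  then obtain x1 where x1: "\<alpha> x1 = 0" "bf D x1 x1 \<noteq> 0" by blast
  define a where "a = (1 / ((D *v w0) \<bullet> (D *v w0))) *\<^sub>R (D *v w0)"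
  have a: "\<alpha> a = 1" using w0(2) by (simp add: \<alpha> a_def)
  have \<alpha>l: "\<alpha> (x + y) = \<alpha> x + \<alpha> y" "\<alpha> (t *\<^sub>R x) = t * \<alpha> x" for x y t by (simp_all add: \<alpha>_def bf_lin)
  have \<gamma>l: "\<gamma> (x + y) = \<gamma> x + \<gamma> y" "\<gamma> (t *\<^sub>R x) = t * \<gamma> x" for x y t by (simp_all add: \<gamma>_def bf_lin)
  define R where "R x = bf D x x *\<^sub>R w0 - (2 * \<alpha> x) *\<^sub>R x" for x
  have DR: "bf D (R x) (R x) = 0" for x
    using bf_sym[OF s(1), of x w0] by (simp add: R_def bf_lin w0(1) \<alpha>_def algebra_simps)
  have FR: "bf F (R x) (R x) = 4 * \<alpha> x * (\<alpha> x * bf F x x - bf D x x * \<gamma> x)" for x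
    using bf_sym[OF s(2), of x w0] F[OF w0(3,1)] by (simp add: R_def bf_lin \<gamma>_def algebra_simps)
  have cR: "continuous_on UNIV R" unfolding R_def \<alpha>_def by (intro continuous_intros)
  have "open (R -` G \<inter> UNIV)" using cR G(1) by (simp add: continuous_on_open_vimage[OF open_UNIV])
  then have "open (R -` G)" by simp
  moreover have "continuous_on UNIV (\<lambda>x. bf D x x)" by (intro continuous_intros)
  then have "open ((\<lambda>x. bf D x x) -` (- {0}))" using continuous_on_open_vimage[OF open_UNIV, of "\<lambda>x. bf D x x"] by auto
  ultimately have "open (R -` G \<inter> (\<lambda>x. bf D x x) -` (- {0}))" by (rule open_Int)
  moreover have "x1 \<in> R -` G \<inter> (\<lambda>x. bf D x x) -` (- {0})" using x1 G(2)[OF w0(3), of "bf D x1 x1"] by (simp add: R_def)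
  ultimately obtain r where r: "r > 0" "ball x1 r \<subseteq> R -` G \<inter> (\<lambda>x. bf D x x) -` (- {0})" using open_contains_ball by blast
  have nz: "bf D x x \<noteq> 0" if "x \<in> ball x1 r" for x using r(2) that by auto
  have rel: "\<alpha> x * (\<alpha> x * bf F x x - bf D x x * \<gamma> x) = 0" if "x \<in> ball x1 r" for x
    using F[OF _ DR[of x]] r(2) that unfolding FR by auto
  \<comment> \<open>Cancels the factor \<open>\<alpha> x\<close>. Where it vanishes, the point is
    moved along \<open>a\<close>, on which \<open>\<alpha>\<close> is 1, and continuity brings the
    relation back.\<close>
  have rel2: "\<alpha> x * bf F x x - bf D x x * \<gamma> x = 0" if x: "x \<in> ball x1 r" for x
  proof (cases "\<alpha> x = 0")
    case True
    obtain \<delta> where \<delta>: "\<delta> > 0" "\<And>t. \<bar>t\<bar> < \<delta> \<Longrightarrow> x + t *\<^sub>R a \<in> ball x1 r"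
      using near_point_in_ball[OF x, of a] by blast
    have "(\<lambda>t. \<alpha> (x + t *\<^sub>R a) * bf F (x + t *\<^sub>R a) (x + t *\<^sub>R a) - bf D (x + t *\<^sub>R a) (x + t *\<^sub>R a) * \<gamma> (x + t *\<^sub>R a)) 0 = 0"
    proof (rule isCont_eq_0[OF _ \<delta>(1)])
      show "continuous_on UNIV (\<lambda>t. \<alpha> (x + t *\<^sub>R a) * bf F (x + t *\<^sub>R a) (x + t *\<^sub>R a) - bf D (x + t *\<^sub>R a) (x + t *\<^sub>R a) * \<gamma> (x + t *\<^sub>R a))"
        unfolding \<alpha>_def \<gamma>_def by (intro continuous_intros)
      fix t :: real assume t: "t \<noteq> 0" "\<bar>t\<bar> < \<delta>"
      have "\<alpha> (x + t *\<^sub>R a) \<noteq> 0" using True t(1) by (simp add: \<alpha>l a)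
      with rel[OF \<delta>(2)[OF t(2)]] show "\<alpha> (x + t *\<^sub>R a) * bf F (x + t *\<^sub>R a) (x + t *\<^sub>R a) - bf D (x + t *\<^sub>R a) (x + t *\<^sub>R a) * \<gamma> (x + t *\<^sub>R a) = 0" by simp
    qed
    then show ?thesis by simp
  qed (use rel[OF x] in simp)
  \<comment> \<open>On the part of the ball where \<open>\<alpha> = 0\<close> the relation reads
    \<open>bf D x x * \<gamma> x = 0\<close>, with \<open>D\<close> nonzero there. By linearity
    \<open>\<gamma>\<close> vanishes on the whole hyperplane, hence is a multiple of
    \<open>\<alpha>\<close>.\<close>
  have \<gamma>0: "\<gamma> y = 0" if "\<alpha> y = 0" for y
  proof -
    obtain \<delta> where \<delta>: "\<delta> > 0" "\<And>s t. \<bar>s\<bar> < \<delta> \<Longrightarrow> \<bar>t\<bar> < \<delta> \<Longrightarrow> x1 + s *\<^sub>R y + t *\<^sub>R a \<in> ball x1 r" using near_point[OF r(1)] by blast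
    have g: "\<gamma> x = 0" if "x \<in> ball x1 r" "\<alpha> x = 0" for x using rel2[OF that(1)] nz[OF that(1)] that(2) by simp
    have "\<gamma> x1 = 0" by (rule g) (use r(1) x1 in auto)
    moreover have "\<gamma> (x1 + (\<delta>/2) *\<^sub>R y) = 0" by (rule g) (use \<delta>(2)[of "\<delta>/2" 0] \<delta>(1) x1 that in \<open>auto simp: \<alpha>l\<close>)
    ultimately show ?thesis using \<delta>(1) by (simp add: \<gamma>l)
  qed
  define c where "c = \<gamma> a"
  have \<gamma>c: "\<gamma> x = c * \<alpha> x" for x
  proof -
    have "\<gamma> (x + (- \<alpha> x) *\<^sub>R a) = 0" by (rule \<gamma>0) (simp only: \<alpha>l a mult_1_right add.right_inverse)
    then show ?thesis unfolding \<gamma>l c_def by simp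
  qed
  define L where "L = F - c *\<^sub>R D"
  have sL: "sym_mat L" unfolding L_def by (intro sym_mat_diff sym_mat_scaleR s)
  have L1: "bf L x x = 0" if "x \<in> ball x1 r" "\<alpha> x \<noteq> 0" for x
  proof -
    have "\<alpha> x * bf L x x = 0" using rel2[OF that(1)] by (simp add: L_def bf_mat \<gamma>c algebra_simps)
    with that(2) show ?thesis by simp
  qed
  have L2: "bf L x x = 0" if x: "x \<in> ball x1 r" for x
  proof (cases "\<alpha> x = 0")
    case True
    obtain \<delta> where \<delta>: "\<delta> > 0" "\<And>t. \<bar>t\<bar> < \<delta> \<Longrightarrow> x + t *\<^sub>R a \<in> ball x1 r"
      using near_point_in_ball[OF x, of a] by blast
    have "(\<lambda>t. bf L (x + t *\<^sub>R a) (x + t *\<^sub>R a)) 0 = 0"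
    proof (rule isCont_eq_0[OF _ \<delta>(1)])
      show "continuous_on UNIV (\<lambda>t. bf L (x + t *\<^sub>R a) (x + t *\<^sub>R a))" by (intro continuous_intros)
      fix t :: real assume t: "t \<noteq> 0" "\<bar>t\<bar> < \<delta>"
      show "bf L (x + t *\<^sub>R a) (x + t *\<^sub>R a) = 0" by (rule L1[OF \<delta>(2)[OF t(2)]]) (use True t(1) in \<open>simp add: \<alpha>l a\<close>)
    qed
    then show ?thesis by simp
  qed (use L1[OF x] in simp)
  have "bf L y y = 0" for y
  proof -
    obtain \<delta> where \<delta>: "\<delta> > 0" "\<And>s t. \<bar>s\<bar> < \<delta> \<Longrightarrow> \<bar>t\<bar> < \<delta> \<Longrightarrow> x1 + s *\<^sub>R y + t *\<^sub>R a \<in> ball x1 r" using near_point[OF r(1)] by blast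
    define t where "t = \<delta>/2"
    have t: "t > 0" using \<delta>(1) by (simp add: t_def)
    have "bf L (x1 + t *\<^sub>R y) (x1 + t *\<^sub>R y) = 0" "bf L (x1 + (- t) *\<^sub>R y) (x1 + (- t) *\<^sub>R y) = 0" "bf L x1 x1 = 0"
      using \<delta>(2)[of t 0] \<delta>(2)[of "-t" 0] \<delta>(1) r(1) by (auto intro!: L2 simp: t_def)
    then have "bf L x1 x1 + 2 * t * bf L x1 y + t * t * bf L y y = 0" "bf L x1 x1 - 2 * t * bf L x1 y + t * t * bf L y y = 0" "bf L x1 x1 = 0"
      unfolding bf_polar[OF sL] by (simp_all add: bf_lin)
    then have "t * t * bf L y y = 0" by linarith
    then show ?thesis using t by simp
  qed
  then have "L = 0" by (rule bf_quad_zero[OF sL])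
  then show ?thesis unfolding L_def by (intro exI[of _ c]) simp
qed

text \<open>Suppose \<open>E\<close> is positive at \<open>v\<close>; otherwise pass to
  \<open>- E\<close>. Let \<open>x\<close> be on the cone of \<open>D\<close> with \<open>E\<close>
  negative. Both \<open>D\<close> and \<open>F\<close> ignore \<open>v\<close>, so some
  \<open>v + s1 *\<^sub>R x\<close> is a common zero, and there \<open>F\<close> is
  \<open>s1\<^sup>2\<close> times its value at \<open>x\<close>. Thus \<open>F\<close> vanishes on
  an open piece of the cone of \<open>D\<close>.\<close>

lemma multiple_from_kernel:
  assumes nd: "nondis D E" and r: "rank D \<ge> 3" and F: "sym_mat F"
    and F0: "\<And>z. bf D z z = 0 \<Longrightarrow> bf E z z = 0 \<Longrightarrow> bf F z z = 0"
    and v: "D *v v = 0" "F *v v = 0" "bf E v v \<noteq> 0"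
  shows "\<exists>c. F = c *\<^sub>R D"
proof -
  have main: "\<exists>c. F = c *\<^sub>R D" if nd: "nondis D E" and F0: "\<And>z. bf D z z = 0 \<Longrightarrow> bf E z z = 0 \<Longrightarrow> bf F z z = 0" and v: "D *v v = 0" "F *v v = 0" "bf E v v > 0" for E
  proof -
    note s = nondis_sym[OF nd]
    obtain w where w: "bf D w w = 0" "bf E w w < 0" using nondis_negative_on_cone[OF nd] .
    \<comment> \<open>If the vector found lies in the kernel of \<open>D\<close>, a small multiple
      of an isotropic \<open>u\<close> outside the kernel is added: \<open>D\<close> stays zero and
      \<open>E\<close> stays negative.\<close>
    obtain w0 where w0: "bf D w0 w0 = 0" "bf E w0 w0 < 0" "D *v w0 \<noteq> 0"
    proof (cases "D *v w = 0")
      case True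
      obtain p q where pq: "bf D p p > 0" "bf D q q < 0" using nondis_indefinite[OF nd] .
      have "p \<noteq> 0" using pq(1) by (auto simp: bf_zero)
      obtain u where u: "bf D u u = 0" "D *v u \<noteq> 0" by (rule isotropic_not_kernel[OF s(1) pq \<open>p \<noteq> 0\<close>])
      have "continuous_on UNIV (\<lambda>e::real. bf E (w + e *\<^sub>R u) (w + e *\<^sub>R u))" by (intro continuous_intros)
      then have "isCont (\<lambda>e::real. bf E (w + e *\<^sub>R u) (w + e *\<^sub>R u)) 0" by (simp add: continuous_on_eq_continuous_at)
      then have "((\<lambda>e::real. bf E (w + e *\<^sub>R u) (w + e *\<^sub>R u)) \<longlongrightarrow> bf E w w) (at 0)" by (simp add: isCont_def)
      then have "\<forall>\<^sub>F e in at 0. bf E (w + e *\<^sub>R u) (w + e *\<^sub>R u) < 0" by (rule order_tendstoD(2)[OF _ w(2)])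
      then obtain \<delta> where \<delta>: "\<delta> > 0" "\<And>t. t \<noteq> 0 \<Longrightarrow> \<bar>t\<bar> < \<delta> \<Longrightarrow> bf E (w + t *\<^sub>R u) (w + t *\<^sub>R u) < 0"
        using eventually_at_0_small by blast
      have k: "bf D w x = 0" "bf D x w = 0" for x using bf_ker[OF True, of x] bf_sym[OF s(1), of w x] by auto
      show ?thesis
      proof (rule that[of "w + (\<delta>/2) *\<^sub>R u"])
        show "bf D (w + (\<delta>/2) *\<^sub>R u) (w + (\<delta>/2) *\<^sub>R u) = 0" by (simp add: bf_lin k u(1))
        show "bf E (w + (\<delta>/2) *\<^sub>R u) (w + (\<delta>/2) *\<^sub>R u) < 0" using \<delta> by simp
        show "D *v (w + (\<delta>/2) *\<^sub>R u) \<noteq> 0" using u(2) \<delta>(1) by (simp add: matrix_vector_right_distrib matrix_vector_mult_scaleR True)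
      qed
    qed (use w that in blast)
    show ?thesis
    proof (rule multiple_from_open_cone[OF s(1) F r w0(1,3), where G="{x. bf E x x < 0}"])
      show "w0 \<in> {x. bf E x x < 0}" using w0 by simp
      show "open {x. bf E x x < 0}" by (intro open_Collect_less continuous_intros)
      show "c *\<^sub>R x \<in> {x. bf E x x < 0}" if "x \<in> {x. bf E x x < 0}" "c \<noteq> 0" for x c
      proof -
        have "c * c > 0" using that(2) by (metis not_real_square_gt_zero)
        then show ?thesis using that(1) by (simp add: bf_lin mult_pos_neg flip: mult.assoc)
      qed
      fix x assume x: "x \<in> {x. bf E x x < 0}" "bf D x x = 0"
      obtain s1 where s1: "bf E (v + s1 *\<^sub>R x) (v + s1 *\<^sub>R x) = 0" "s1 > 0"
        using isotropic_line[OF s(2) v(3), of x] x(1) by blast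
      have kD: "bf D v y = 0" "bf D y v = 0" for y using bf_ker[OF v(1), of y] bf_sym[OF s(1), of v y] by auto
      have kF: "bf F v y = 0" "bf F y v = 0" for y using bf_ker[OF v(2), of y] bf_sym[OF F, of v y] by auto
      have "bf F (v + s1 *\<^sub>R x) (v + s1 *\<^sub>R x) = 0"
        by (rule F0[OF _ s1(1)]) (simp add: bf_lin kD x(2))
      then show "bf F x x = 0" using s1(2) by (simp add: bf_lin kF)
    qed
  qed
  show ?thesis
  proof (cases "bf E v v > 0")
    case True
    show ?thesis by (rule main[OF nd F0 v(1,2) True])
  next
    case False
    show ?thesis by (rule main[OF nondis_uminus[OF nd] _ v(1,2)]) (use F0 v(3) False in \<open>auto simp: bf_mat\<close>)
  qed
qed

text \<open>A condition that is linear in the point sees the curve at order \<open>t\<^sup>2\<close>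
  only through the corrections \<open>s1\<close> and \<open>s2\<close>. They are therefore needed up
  to a cubic error: \<open>- 1/2\<close> times \<open>t\<^sup>2\<close> times the value of the form
  at \<open>v\<close>.\<close>

lemma zero_set_curve_expansion:
  assumes s: "sym_mat D" "sym_mat E" and z: "bf D z z = 0" "bf E z z = 0"
    and u: "bf D z u1 = 1" "bf E z u1 = 0" "bf D z u2 = 0" "bf E z u2 = 1"
    and v: "bf D z v = 0" "bf E z v = 0"
  shows "\<exists>K>0. \<exists>\<delta>>0. \<forall>t. 0 < t \<longrightarrow> t < \<delta> \<longrightarrow> (\<exists>s1 s2. \<bar>s1\<bar> \<le> K * t\<^sup>2 \<and> \<bar>s2\<bar> \<le> K * t\<^sup>2 \<and>
     norm (t *\<^sub>R v + s1 *\<^sub>R u1 + s2 *\<^sub>R u2) \<le> K * t \<and>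
     \<bar>2 * s1 + t\<^sup>2 * bf D v v\<bar> \<le> K * t ^ 3 \<and> \<bar>2 * s2 + t\<^sup>2 * bf E v v\<bar> \<le> K * t ^ 3 \<and>
     bf D (z + (t *\<^sub>R v + s1 *\<^sub>R u1 + s2 *\<^sub>R u2)) (z + (t *\<^sub>R v + s1 *\<^sub>R u1 + s2 *\<^sub>R u2)) = 0 \<and>
     bf E (z + (t *\<^sub>R v + s1 *\<^sub>R u1 + s2 *\<^sub>R u2)) (z + (t *\<^sub>R v + s1 *\<^sub>R u1 + s2 *\<^sub>R u2)) = 0)"
proof -
  obtain K \<delta> where K: "K > 0" "\<delta> > 0" "\<And>t. \<bar>t\<bar> < \<delta> \<Longrightarrow> \<exists>s1 s2. \<bar>s1\<bar> \<le> K * t\<^sup>2 \<and> \<bar>s2\<bar> \<le> K * t\<^sup>2 \<and>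
     (let w = t *\<^sub>R v + s1 *\<^sub>R u1 + s2 *\<^sub>R u2 in s1 = - bf D w w / 2 \<and> s2 = - bf E w w / 2 \<and> bf D (z + w) (z + w) = 0 \<and> bf E (z + w) (z + w) = 0)"
    using zero_set_curve[OF s z u v] by blast
  obtain K1 where K1: "K1 \<ge> 0" "\<And>x y. \<bar>bf D x y\<bar> \<le> norm x * norm y * K1" using bf_bound[of D] by blast
  obtain K2 where K2: "K2 \<ge> 0" "\<And>x y. \<bar>bf E x y\<bar> \<le> norm x * norm y * K2" using bf_bound[of E] by blast
  define H where "H = K * norm u1 + K * norm u2"
  have H0: "H \<ge> 0" using K(1) by (simp add: H_def)
  define M where "M = 2 * (norm v * H) * (K1 + K2) + H\<^sup>2 * (K1 + K2)"
  have M0: "M \<ge> 0" using K1 K2 H0 by (simp add: M_def)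
  define L where "L = K + (norm v + H) + M"
  have L: "L > 0" "K \<le> L" "norm v + H \<le> L" "M \<le> L" using K(1) H0 M0 by (simp_all add: L_def add_pos_nonneg add_nonneg_nonneg)
  show ?thesis
  proof (rule exI[of _ L], rule conjI[OF L(1)], rule exI[of _ "min \<delta> 1"], rule conjI, goal_cases)
    case 1 show ?case using K(2) by simp
  next
    case 2
    show ?case
    proof (intro allI impI)
      fix t :: real assume t: "0 < t" "t < min \<delta> 1"
      obtain s1 s2 where s12: "\<bar>s1\<bar> \<le> K * t\<^sup>2" "\<bar>s2\<bar> \<le> K * t\<^sup>2"
        "s1 = - bf D (t *\<^sub>R v + s1 *\<^sub>R u1 + s2 *\<^sub>R u2) (t *\<^sub>R v + s1 *\<^sub>R u1 + s2 *\<^sub>R u2) / 2"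
        "s2 = - bf E (t *\<^sub>R v + s1 *\<^sub>R u1 + s2 *\<^sub>R u2) (t *\<^sub>R v + s1 *\<^sub>R u1 + s2 *\<^sub>R u2) / 2"
        "bf D (z + (t *\<^sub>R v + s1 *\<^sub>R u1 + s2 *\<^sub>R u2)) (z + (t *\<^sub>R v + s1 *\<^sub>R u1 + s2 *\<^sub>R u2)) = 0"
        "bf E (z + (t *\<^sub>R v + s1 *\<^sub>R u1 + s2 *\<^sub>R u2)) (z + (t *\<^sub>R v + s1 *\<^sub>R u1 + s2 *\<^sub>R u2)) = 0"
        using K(3)[of t] t unfolding Let_def by auto
      define q where "q = s1 *\<^sub>R u1 + s2 *\<^sub>R u2"
      have w: "t *\<^sub>R v + s1 *\<^sub>R u1 + s2 *\<^sub>R u2 = t *\<^sub>R v + q" by (simp add: q_def add.assoc)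
      have "norm q \<le> \<bar>s1\<bar> * norm u1 + \<bar>s2\<bar> * norm u2"
        unfolding q_def by (intro order.trans[OF norm_triangle_ineq] add_mono) auto
      also have "\<dots> \<le> (K * t\<^sup>2) * norm u1 + (K * t\<^sup>2) * norm u2" using s12 by (intro add_mono mult_right_mono) auto
      finally have qn: "norm q \<le> t\<^sup>2 * H" by (simp add: H_def algebra_simps)
      have t2: "t\<^sup>2 \<le> t" using t by (simp add: power2_eq_square mult_left_le)
      have "norm (t *\<^sub>R v + q) \<le> t * norm v + norm q" by (intro order.trans[OF norm_triangle_ineq]) (use t in simp)
      also have "\<dots> \<le> t * norm v + t * H" using order.trans[OF qn mult_right_mono[OF t2 H0]] by simp
      also have "\<dots> = t * (norm v + H)" by (simp add: distrib_left)
      also have "\<dots> \<le> t * L" using t L by (intro mult_left_mono) auto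
      finally have wn: "norm (t *\<^sub>R v + q) \<le> L * t" by (simp add: mult.commute)
      have cub: "\<bar>bf N (t *\<^sub>R v + q) (t *\<^sub>R v + q) - t\<^sup>2 * bf N v v\<bar> \<le> L * t ^ 3"
        if "sym_mat N" "\<And>x y. \<bar>bf N x y\<bar> \<le> norm x * norm y * k" "k \<ge> 0" "k \<le> K1 + K2" for N k
      proof -
        have e: "bf N (t *\<^sub>R v + q) (t *\<^sub>R v + q) - t\<^sup>2 * bf N v v = 2 * t * bf N v q + bf N q q"
          using bf_sym[OF that(1), of q v] by (simp add: bf_lin power2_eq_square algebra_simps)
        have "\<bar>bf N v q\<bar> \<le> norm v * norm q * k" by (rule that(2))
        also have "\<dots> \<le> norm v * (t\<^sup>2 * H) * (K1 + K2)" using qn that(3,4) H0 by (intro mult_mono) auto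
        finally have "2 * t * \<bar>bf N v q\<bar> \<le> 2 * t * (norm v * (t\<^sup>2 * H) * (K1 + K2))" using t by (intro mult_left_mono) auto
        then have 1: "\<bar>2 * t * bf N v q\<bar> \<le> t ^ 3 * (2 * (norm v * H) * (K1 + K2))"
          using t by (simp add: abs_mult power2_eq_square power3_eq_cube mult_ac)
        have "\<bar>bf N q q\<bar> \<le> norm q * norm q * k" by (rule that(2))
        also have "\<dots> \<le> (t\<^sup>2 * H) * (t\<^sup>2 * H) * (K1 + K2)" using qn that(3,4) H0 by (intro mult_mono) auto
        also have "\<dots> = t ^ 3 * (t * (H\<^sup>2 * (K1 + K2)))" by (simp add: power2_eq_square power3_eq_cube mult_ac)
        also have "\<dots> \<le> t ^ 3 * (1 * (H\<^sup>2 * (K1 + K2)))" using t K1 K2 by (intro mult_left_mono mult_right_mono) auto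
        finally have 2: "\<bar>bf N q q\<bar> \<le> t ^ 3 * (H\<^sup>2 * (K1 + K2))" by simp
        have "\<bar>2 * t * bf N v q + bf N q q\<bar> \<le> t ^ 3 * M" unfolding M_def distrib_left[of "t ^ 3"] using 1 2 by linarith
        also have "\<dots> \<le> t ^ 3 * L" using t L by (intro mult_left_mono) auto
        finally show ?thesis unfolding e by (simp add: mult.commute)
      qed
      have "\<bar>2 * s1 + t\<^sup>2 * bf D v v\<bar> \<le> L * t ^ 3" using cub[OF s(1) K1(2) K1(1)] K2(1) s12(3) unfolding w by simp
      moreover have "\<bar>2 * s2 + t\<^sup>2 * bf E v v\<bar> \<le> L * t ^ 3" using cub[OF s(2) K2(2) K2(1)] K1(1) s12(4) unfolding w by simp
      moreover have "K * t\<^sup>2 \<le> L * t\<^sup>2" using L(2) by (intro mult_right_mono) auto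
      ultimately show "\<exists>s1 s2. \<bar>s1\<bar> \<le> L * t\<^sup>2 \<and> \<bar>s2\<bar> \<le> L * t\<^sup>2 \<and>
         norm (t *\<^sub>R v + s1 *\<^sub>R u1 + s2 *\<^sub>R u2) \<le> L * t \<and>
         \<bar>2 * s1 + t\<^sup>2 * bf D v v\<bar> \<le> L * t ^ 3 \<and> \<bar>2 * s2 + t\<^sup>2 * bf E v v\<bar> \<le> L * t ^ 3 \<and>
         bf D (z + (t *\<^sub>R v + s1 *\<^sub>R u1 + s2 *\<^sub>R u2)) (z + (t *\<^sub>R v + s1 *\<^sub>R u1 + s2 *\<^sub>R u2)) = 0 \<and>
         bf E (z + (t *\<^sub>R v + s1 *\<^sub>R u1 + s2 *\<^sub>R u2)) (z + (t *\<^sub>R v + s1 *\<^sub>R u1 + s2 *\<^sub>R u2)) = 0"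
        using s12 wn unfolding w[symmetric] by (intro exI[of _ s1] exI[of _ s2]) linarith
    qed
  qed
qed

section \<open>Pencils whose nonzero forms have rank at least three\<close>

lemma regular_nearby:
  assumes s: "sym_mat D" "sym_mat E" and u: "bf D z u1 = 1" "bf E z u1 = 0" "bf D z u2 = 0" "bf E z u2 = 1"
  shows "\<exists>e>0. \<forall>w. norm w < e \<longrightarrow> bf D (z + w) (z + w) = 0 \<longrightarrow> bf E (z + w) (z + w) = 0 \<longrightarrow> regular D E (z + w)"
proof -
  \<comment> \<open>A two by two minor of the pair of differentials, equal to 1 at
    \<open>w = 0\<close>; where it is nonzero the differentials are independent.\<close>
  define d where "d w = bf D (z + w) u1 * bf E (z + w) u2 - bf D (z + w) u2 * bf E (z + w) u1" for w
  have c: "continuous_on UNIV d" unfolding d_def by (intro continuous_intros)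
  have "d 0 = 1" by (simp add: d_def u)
  have "open (d -` {0<..})" using continuous_on_open_vimage[OF open_UNIV, of d] c by auto
  moreover have "0 \<in> d -` {0<..}" using \<open>d 0 = 1\<close> by simp
  ultimately obtain e where e: "e > 0" "ball 0 e \<subseteq> d -` {0<..}" using open_contains_ball by blast
  have "regular D E (z + w)" if w: "norm w < e" and h: "bf D (z + w) (z + w) = 0" "bf E (z + w) (z + w) = 0" for w
  proof -
    have d: "d w \<noteq> 0" using subsetD[OF e(2), of w] w by auto
    have "p = 0 \<and> q = 0" if l: "p *\<^sub>R (D *v (z + w)) + q *\<^sub>R (E *v (z + w)) = 0" for p q
    proof -
      have x: "p * bf D (z + w) x + q * bf E (z + w) x = 0" for x
      proof -
        have "x \<bullet> (p *\<^sub>R (D *v (z + w)) + q *\<^sub>R (E *v (z + w))) = p * bf D x (z + w) + q * bf E x (z + w)"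
          by (simp add: bf_def inner_add_right)
        then show ?thesis using l bf_sym[OF s(1), of x "z + w"] bf_sym[OF s(2), of x "z + w"] by simp
      qed
      have "p * d w = bf E (z + w) u2 * (p * bf D (z + w) u1 + q * bf E (z + w) u1) - bf E (z + w) u1 * (p * bf D (z + w) u2 + q * bf E (z + w) u2)"
        "q * d w = bf D (z + w) u1 * (p * bf D (z + w) u2 + q * bf E (z + w) u2) - bf D (z + w) u2 * (p * bf D (z + w) u1 + q * bf E (z + w) u1)"
        by (simp_all add: d_def algebra_simps)
      then have "p * d w = 0" "q * d w = 0" unfolding x by simp_all
      then show ?thesis using d by simp
    qed
    with h show ?thesis unfolding regular_def by blast
  qed
  with e(1) show ?thesis by blast
qed

text \<open>If the complementary form \<open>E\<close> vanished on \<open>N\<close> as well, the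
  whole pencil would be isotropic on a subspace of codimension 8 and have rank at most 16. So
  \<open>E\<close> is nonzero at some \<open>v\<close> in \<open>N\<close>, a vector in the kernels
  of both \<open>D\<close> and \<open>F\<close>, and \<open>multiple_from_kernel\<close>
  applies.\<close>

lemma span_from_kernel:
  assumes nd: "nondis A B" and C: "sym_mat C" and C0: "\<And>z. bf A z z = 0 \<Longrightarrow> bf B z z = 0 \<Longrightarrow> bf C z z = 0"
    and mn: "\<And>s t. \<not> (s = 0 \<and> t = 0) \<Longrightarrow> rank (s *\<^sub>R A + t *\<^sub>R B) \<ge> 3"
    and mx: "rank (s0 *\<^sub>R A + t0 *\<^sub>R B) \<ge> 17"
    and pq: "\<not> (p = 0 \<and> q = 0)" and F: "F = C - l *\<^sub>R A - m *\<^sub>R B"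
    and N: "cod 8 N" "\<And>v. v \<in> N \<Longrightarrow> (p *\<^sub>R A + q *\<^sub>R B) *v v = 0" "\<And>v. v \<in> N \<Longrightarrow> F *v v = 0"
  shows "\<exists>c d. C = c *\<^sub>R A + d *\<^sub>R B"
proof -
  note s = nondis_sym[OF nd]
  define D where "D = p *\<^sub>R A + q *\<^sub>R B"
  \<comment> \<open>\<open>E\<close> is whichever of \<open>A\<close> and \<open>B\<close> completes
    \<open>D\<close> to a basis of the pencil.\<close>
  define e1 e2 where "e1 = (if p = 0 then 1 else (0::real))" and "e2 = (if p = 0 then 0 else (1::real))"
  define E where "E = e1 *\<^sub>R A + e2 *\<^sub>R B"
  have det: "p * e2 - q * e1 \<noteq> 0" using pq by (auto simp: e1_def e2_def)
  have ndDE: "nondis D E" unfolding D_def E_def by (rule nondis_basis_change[OF nd det])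
  have AB: "bf A z z = 0 \<and> bf B z z = 0" if "bf D z z = 0" "bf E z z = 0" for z
    using that pq by (auto simp: D_def E_def bf_mat e1_def e2_def split: if_splits)
  have sF: "sym_mat F" unfolding F by (intro sym_mat_diff sym_mat_scaleR s C)
  have "\<exists>v\<in>N. bf E v v \<noteq> 0"
  proof (rule ccontr)
    assume n: "\<not> ?thesis"
    have "bf (s0 *\<^sub>R A + t0 *\<^sub>R B) v v = 0" if "v \<in> N" for v
    proof -
      have "bf D v v = 0" using N(2)[OF that] by (simp add: D_def bf_ker)
      with n that AB[of v] show ?thesis by (auto simp: bf_mat)
    qed
    from rank_le_isotropic[OF _ N(1) this] s have "rank (s0 *\<^sub>R A + t0 *\<^sub>R B) \<le> 2 * 8" by (simp add: sym_mat_add sym_mat_scaleR)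
    with mx show False by simp
  qed
  then obtain v where v: "v \<in> N" "bf E v v \<noteq> 0" by blast
  have "\<exists>c. F = c *\<^sub>R D"
  proof (rule multiple_from_kernel[OF ndDE _ sF _ _ _ v(2)])
    show "3 \<le> rank D" unfolding D_def by (rule mn[OF pq])
    show "bf F z z = 0" if "bf D z z = 0" "bf E z z = 0" for z using AB[OF that] C0[of z] by (simp add: F bf_mat)
    show "D *v v = 0" "F *v v = 0" using N(2,3)[OF v(1)] by (simp_all add: D_def)
  qed
  then obtain c where "F = c *\<^sub>R D" by blast
  then have "C = (l + c * p) *\<^sub>R A + (m + c * q) *\<^sub>R B" unfolding F D_def by (simp add: algebra_simps)
  then show ?thesis by blast
qed

theorem vanishing_form_in_span:
  assumes nd: "nondis A B" and C: "sym_mat C" and C0: "\<And>z. bf A z z = 0 \<Longrightarrow> bf B z z = 0 \<Longrightarrow> bf C z z = 0"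
    and mn: "\<And>s t. \<not> (s = 0 \<and> t = 0) \<Longrightarrow> rank (s *\<^sub>R A + t *\<^sub>R B) \<ge> 3"
    and mx: "rank (s0 *\<^sub>R A + t0 *\<^sub>R B) \<ge> 17"
  shows "\<exists>c d. C = c *\<^sub>R A + d *\<^sub>R B"
proof -
  note s = nondis_sym[OF nd]
  note fin = span_from_kernel[OF nd C C0 mn mx]
  have "rank A \<ge> 3" using mn[of 1 0] by simp
  then obtain z where z: "regular A B z" using regular_exists[OF nd] by blast
  obtain u1 u2 where u: "bf A z u1 = 1" "bf B z u1 = 0" "bf A z u2 = 0" "bf B z u2 = 1" using regular_dual[OF s z] by blast
  define l m where "l = bf C z u1" and "m = bf C z u2"
  define F where "F = C - l *\<^sub>R A - m *\<^sub>R B"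
  have z0: "bf A z z = 0" "bf B z z = 0" using z by (auto simp: regular_def)
  have cT: "cod 2 {v. bf A y v = 0 \<and> bf B y v = 0}" for y
  proof -
    have "bf M y v = (M *v y) \<bullet> v" if "sym_mat M" for M v using bf_sym[OF that, of y v] by (simp add: bf_def inner_commute)
    then have "{v. bf A y v = 0 \<and> bf B y v = 0} = {v. (A *v y) \<bullet> v = 0} \<inter> {v. (B *v y) \<bullet> v = 0}" using s by auto
    moreover have "cod (1 + 1) ({v. (A *v y) \<bullet> v = 0} \<inter> {v. (B *v y) \<bullet> v = 0})" by (intro cod_Int cod_hyperplane)
    ultimately show ?thesis by (simp only: one_add_one)
  qed
  have sF: "sym_mat F" unfolding F_def by (intro sym_mat_diff sym_mat_scaleR s C)
  have so: "F *v z = 0" "\<And>v. bf A z v = 0 \<Longrightarrow> bf B z v = 0 \<Longrightarrow> bf F v v = 0"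
    using second_order[OF s C z0 u C0] unfolding F_def l_def m_def by blast+
  have rF: "cod 4 {v. F *v v = 0}"
  proof -
    have "rank F \<le> 2 * 2" by (rule rank_le_isotropic[OF sF cT[of z]]) (use so(2) in auto)
    then show ?thesis using cod_mono[OF cod_ker[OF sF]] by simp
  qed
  show ?thesis
  proof (cases "\<exists>z'. regular A B z' \<and> F *v z' \<noteq> 0")
    case True
    then obtain z' where z': "regular A B z'" "F *v z' \<noteq> 0" by blast
    obtain w1 w2 where w: "bf A z' w1 = 1" "bf B z' w1 = 0" "bf A z' w2 = 0" "bf B z' w2 = 1" using regular_dual[OF s z'(1)] by blast
    have z'0: "bf A z' z' = 0" "bf B z' z' = 0" using z'(1) by (auto simp: regular_def)
    define l' m' where "l' = bf C z' w1" and "m' = bf C z' w2"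
    define F' where "F' = C - l' *\<^sub>R A - m' *\<^sub>R B"
    have sF': "sym_mat F'" unfolding F'_def by (intro sym_mat_diff sym_mat_scaleR s C)
    have so': "F' *v z' = 0" "\<And>v. bf A z' v = 0 \<Longrightarrow> bf B z' v = 0 \<Longrightarrow> bf F' v v = 0"
      using second_order[OF s C z'0 w C0] unfolding F'_def l'_def m'_def by blast+
    have rF': "cod 4 {v. F' *v v = 0}"
    proof -
      have "rank F' \<le> 2 * 2" by (rule rank_le_isotropic[OF sF' cT[of z']]) (use so'(2) in auto)
      then show ?thesis using cod_mono[OF cod_ker[OF sF']] by simp
    qed
    have dF: "(l - l') *\<^sub>R A + (m - m') *\<^sub>R B = F' - F" by (simp add: F_def F'_def algebra_simps)
    show ?thesis
    \<comment> \<open>The difference \<open>F' - F\<close> lies in the pencil and is nonzero because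
      only \<open>F'\<close> annihilates \<open>z'\<close>; it vanishes on the intersection of the
      two kernels, of codimension 4 + 4.\<close>
    proof (rule fin[where p="l - l'" and q="m - m'" and F=F and l=l and m=m and N="{v. F *v v = 0} \<inter> {v. F' *v v = 0}"])
      show "\<not> (l - l' = 0 \<and> m - m' = 0)"
      proof
        assume "l - l' = 0 \<and> m - m' = 0"
        then have "F' = F" using dF by simp
        with so'(1) z'(2) show False by simp
      qed
      show "F = C - l *\<^sub>R A - m *\<^sub>R B" by (rule F_def)
      show "cod 8 ({v. F *v v = 0} \<inter> {v. F' *v v = 0})" using cod_Int[OF rF rF'] by simp
      show "((l - l') *\<^sub>R A + (m - m') *\<^sub>R B) *v v = 0" if "v \<in> {v. F *v v = 0} \<inter> {v. F' *v v = 0}" for v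
        unfolding dF using that by (simp add: matrix_vector_mult_diff_rdistrib)
      show "F *v v = 0" if "v \<in> {v. F *v v = 0} \<inter> {v. F' *v v = 0}" for v using that by simp
    qed
  next
    case False
    then have Freg: "F *v y = 0" if "regular A B y" for y using that by blast
    obtain e where e: "e > 0" "\<And>w. norm w < e \<Longrightarrow> bf A (z + w) (z + w) = 0 \<Longrightarrow> bf B (z + w) (z + w) = 0 \<Longrightarrow> regular A B (z + w)"
      using regular_nearby[OF s u] by blast
    \<comment> \<open>\<open>F\<close> annihilates every point of the curve through \<open>z\<close>
      in direction \<open>v\<close>. Order \<open>t\<close> gives \<open>F *v v = 0\<close>; order
      \<open>t\<^sup>2\<close> then gives the relation between \<open>bf A v v\<close> and
      \<open>bf B v v\<close>, because up to the factor \<open>- 1/2\<close> these are the leading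
      coefficients of \<open>s1\<close> and \<open>s2\<close>.\<close>
    have main: "bf F x v = 0 \<and> bf A v v * bf F x u1 + bf B v v * bf F x u2 = 0" if v: "bf A z v = 0" "bf B z v = 0" for x v
    proof -
      obtain K \<delta> where K: "K > 0" "\<delta> > 0" "\<And>t. 0 < t \<Longrightarrow> t < \<delta> \<Longrightarrow> (\<exists>s1 s2. \<bar>s1\<bar> \<le> K * t\<^sup>2 \<and> \<bar>s2\<bar> \<le> K * t\<^sup>2 \<and>
         norm (t *\<^sub>R v + s1 *\<^sub>R u1 + s2 *\<^sub>R u2) \<le> K * t \<and>
         \<bar>2 * s1 + t\<^sup>2 * bf A v v\<bar> \<le> K * t ^ 3 \<and> \<bar>2 * s2 + t\<^sup>2 * bf B v v\<bar> \<le> K * t ^ 3 \<and>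
         bf A (z + (t *\<^sub>R v + s1 *\<^sub>R u1 + s2 *\<^sub>R u2)) (z + (t *\<^sub>R v + s1 *\<^sub>R u1 + s2 *\<^sub>R u2)) = 0 \<and>
         bf B (z + (t *\<^sub>R v + s1 *\<^sub>R u1 + s2 *\<^sub>R u2)) (z + (t *\<^sub>R v + s1 *\<^sub>R u1 + s2 *\<^sub>R u2)) = 0)"
        using zero_set_curve_expansion[OF s z0 u v] by blast
      define a b where "a = bf F x u1" and "b = bf F x u2"
      have crv: "\<exists>s1 s2. \<bar>s1\<bar> \<le> K * t\<^sup>2 \<and> \<bar>s2\<bar> \<le> K * t\<^sup>2 \<and> \<bar>2 * s1 + t\<^sup>2 * bf A v v\<bar> \<le> K * t ^ 3 \<and> \<bar>2 * s2 + t\<^sup>2 * bf B v v\<bar> \<le> K * t ^ 3 \<and> t * bf F x v + s1 * a + s2 * b = 0"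
        if t: "0 < t" "t < min \<delta> (e / K)" for t
      proof -
        obtain s1 s2 where s12: "\<bar>s1\<bar> \<le> K * t\<^sup>2" "\<bar>s2\<bar> \<le> K * t\<^sup>2" "norm (t *\<^sub>R v + s1 *\<^sub>R u1 + s2 *\<^sub>R u2) \<le> K * t"
         "\<bar>2 * s1 + t\<^sup>2 * bf A v v\<bar> \<le> K * t ^ 3" "\<bar>2 * s2 + t\<^sup>2 * bf B v v\<bar> \<le> K * t ^ 3"
         "bf A (z + (t *\<^sub>R v + s1 *\<^sub>R u1 + s2 *\<^sub>R u2)) (z + (t *\<^sub>R v + s1 *\<^sub>R u1 + s2 *\<^sub>R u2)) = 0"
         "bf B (z + (t *\<^sub>R v + s1 *\<^sub>R u1 + s2 *\<^sub>R u2)) (z + (t *\<^sub>R v + s1 *\<^sub>R u1 + s2 *\<^sub>R u2)) = 0"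
          using K(3)[of t] t by auto
        have "K * t < e" using t K(1) by (simp add: field_simps)
        then have "norm (t *\<^sub>R v + s1 *\<^sub>R u1 + s2 *\<^sub>R u2) < e" using s12(3) by linarith
        from Freg[OF e(2)[OF this s12(6,7)]] have "bf F x (z + (t *\<^sub>R v + s1 *\<^sub>R u1 + s2 *\<^sub>R u2)) = 0" by (rule bf_ker)
        then have "t * bf F x v + s1 * a + s2 * b = 0" using bf_ker[OF so(1), of x] by (simp add: bf_lin a_def b_def)
        with s12 show ?thesis by blast
      qed
      have m0: "min \<delta> (e / K) > 0" using K e(1) by simp
      have Fv: "bf F x v = 0"
      proof (rule eq_zero_of_linear_bound[OF m0])
        fix t :: real assume t: "0 < t" "t < min \<delta> (e / K)"
        obtain s1 s2 where s12: "\<bar>s1\<bar> \<le> K * t\<^sup>2" "\<bar>s2\<bar> \<le> K * t\<^sup>2" "t * bf F x v + s1 * a + s2 * b = 0" using crv[OF t] by blast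
        have "\<bar>s1 * a\<bar> \<le> K * t\<^sup>2 * \<bar>a\<bar>" "\<bar>s2 * b\<bar> \<le> K * t\<^sup>2 * \<bar>b\<bar>" unfolding abs_mult using s12 by (intro mult_right_mono; simp)+
        moreover have "t * bf F x v = - (s1 * a) - s2 * b" using s12(3) by linarith
        ultimately have "\<bar>t * bf F x v\<bar> \<le> K * t\<^sup>2 * \<bar>a\<bar> + K * t\<^sup>2 * \<bar>b\<bar>" by linarith
        then have "t * \<bar>bf F x v\<bar> \<le> t * (K * (\<bar>a\<bar> + \<bar>b\<bar>) * t)" using t by (simp add: abs_mult power2_eq_square algebra_simps)
        then show "\<bar>bf F x v\<bar> \<le> K * (\<bar>a\<bar> + \<bar>b\<bar>) * t" using t by (simp only: mult_le_cancel_left_pos)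
      qed
      have "bf A v v * a + bf B v v * b = 0"
      proof (rule eq_zero_of_linear_bound[OF m0])
        fix t :: real assume t: "0 < t" "t < min \<delta> (e / K)"
        obtain s1 s2 where s12: "\<bar>2 * s1 + t\<^sup>2 * bf A v v\<bar> \<le> K * t ^ 3" "\<bar>2 * s2 + t\<^sup>2 * bf B v v\<bar> \<le> K * t ^ 3" "t * bf F x v + s1 * a + s2 * b = 0" using crv[OF t] by blast
        have ab: "\<bar>(2 * s1 + t\<^sup>2 * bf A v v) * a\<bar> \<le> K * t ^ 3 * \<bar>a\<bar>" "\<bar>(2 * s2 + t\<^sup>2 * bf B v v) * b\<bar> \<le> K * t ^ 3 * \<bar>b\<bar>"
          unfolding abs_mult using s12 by (intro mult_right_mono; simp)+
        have "s1 * a + s2 * b = 0" using s12(3) Fv by simp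
        moreover have "t\<^sup>2 * (bf A v v * a + bf B v v * b) = (2 * s1 + t\<^sup>2 * bf A v v) * a + (2 * s2 + t\<^sup>2 * bf B v v) * b - 2 * (s1 * a + s2 * b)"
          by (simp add: algebra_simps)
        ultimately have eq: "t\<^sup>2 * (bf A v v * a + bf B v v * b) = (2 * s1 + t\<^sup>2 * bf A v v) * a + (2 * s2 + t\<^sup>2 * bf B v v) * b" by simp
        have "\<bar>t\<^sup>2 * (bf A v v * a + bf B v v * b)\<bar> \<le> K * t ^ 3 * \<bar>a\<bar> + K * t ^ 3 * \<bar>b\<bar>"
          unfolding eq by (rule order.trans[OF abs_triangle_ineq add_mono[OF ab]])
        then have "t\<^sup>2 * \<bar>bf A v v * a + bf B v v * b\<bar> \<le> K * t ^ 3 * \<bar>a\<bar> + K * t ^ 3 * \<bar>b\<bar>"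
          unfolding abs_mult[of "t\<^sup>2"] abs_power2 .
        also have "K * t ^ 3 * \<bar>a\<bar> + K * t ^ 3 * \<bar>b\<bar> = t\<^sup>2 * (K * (\<bar>a\<bar> + \<bar>b\<bar>) * t)"
          by (simp add: power2_eq_square power3_eq_cube algebra_simps)
        finally have "t\<^sup>2 * \<bar>bf A v v * a + bf B v v * b\<bar> \<le> t\<^sup>2 * (K * (\<bar>a\<bar> + \<bar>b\<bar>) * t)" .
        moreover have "t\<^sup>2 > 0" using t by simp
        ultimately show "\<bar>bf A v v * a + bf B v v * b\<bar> \<le> K * (\<bar>a\<bar> + \<bar>b\<bar>) * t" by (simp only: mult_le_cancel_left_pos)
      qed
      with Fv show ?thesis by (simp add: a_def b_def)
    qed
    show ?thesis
    proof (cases "\<forall>x. bf F x u1 = 0 \<and> bf F x u2 = 0")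
      case True
      have "bf F x y = 0" for x y
      proof -
        define v where "v = y - bf A z y *\<^sub>R u1 - bf B z y *\<^sub>R u2"
        have "bf A z v = 0" "bf B z v = 0" by (simp_all add: v_def bf_lin u)
        with main have "bf F x v = 0" by blast
        with True show ?thesis by (simp add: v_def bf_lin)
      qed
      then have "F = 0" by (intro bf_quad_zero[OF sF])
      then have "C = l *\<^sub>R A + m *\<^sub>R B" by (simp add: F_def algebra_simps)
      then show ?thesis by blast
    next
      case False
      then obtain x where x: "\<not> (bf F x u1 = 0 \<and> bf F x u2 = 0)" by blast
      \<comment> \<open>By the second half of \<open>main\<close> this element of the pencil
        vanishes on the tangent space, so its kernel has codimension at most 4; by the first half
        the tangent space lies in the kernel of \<open>F\<close>. The intersection has codimension
        at most 6.\<close>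
      define p q where "p = bf F x u1" and "q = bf F x u2"
      define D where "D = p *\<^sub>R A + q *\<^sub>R B"
      have sD: "sym_mat D" unfolding D_def by (intro sym_mat_add sym_mat_scaleR s)
      define T where "T = {v. bf A z v = 0 \<and> bf B z v = 0}"
      have "rank D \<le> 2 * 2"
        by (rule rank_le_isotropic[OF sD cT[of z]]) (use main[of _ x] in \<open>auto simp: D_def bf_mat p_def q_def mult.commute\<close>)
      then have rD: "cod 4 {v. D *v v = 0}" using cod_mono[OF cod_ker[OF sD]] by simp
      show ?thesis
      proof (rule fin[where p=p and q=q and F=F and l=l and m=m and N="T \<inter> {v. D *v v = 0}"])
        show "\<not> (p = 0 \<and> q = 0)" using x by (simp add: p_def q_def)
        show "F = C - l *\<^sub>R A - m *\<^sub>R B" by (rule F_def)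
        show "cod 8 (T \<inter> {v. D *v v = 0})" using cod_mono[OF cod_Int[OF cT[of z] rD]] by (simp add: T_def)
        show "(p *\<^sub>R A + q *\<^sub>R B) *v v = 0" if "v \<in> T \<inter> {v. D *v v = 0}" for v using that by (simp add: D_def)
        show "F *v v = 0" if "v \<in> T \<inter> {v. D *v v = 0}" for v
          by (rule bf_nondeg) (use main that in \<open>auto simp: T_def\<close>)
      qed
    qed
  qed
qed

subsection \<open>A pencil containing a form of rank two\<close>

lemma partial_qform:
  assumes "sym_mat M"
  shows "partial j (qform M) z = 2 * (M *v z) $ j"
proof -
  have eq: "qform M (z + t *\<^sub>R axis j 1) = bf M z z + t * (2 * (M *v z) $ j) + t\<^sup>2 * bf M (axis j 1) (axis j 1)" for t
  proof -
    have "bf M z (axis j 1) = (M *v z) $ j" using bf_sym[OF assms, of z "axis j 1"] by (simp add: bf_def cart_eq_inner_axis inner_commute)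
    then show ?thesis using bf_polar[OF assms, of z "t *\<^sub>R axis j 1"]
      by (simp add: qform_def bf_def[symmetric] bf_lin power2_eq_square)
  qed
  have "((\<lambda>t. qform M (z + t *\<^sub>R axis j 1)) has_vector_derivative 2 * (M *v z) $ j) (at 0)"
    unfolding eq has_real_derivative_iff_has_vector_derivative[symmetric] by (auto intro!: derivative_eq_intros)
  then show ?thesis unfolding partial_def by (rule vector_derivative_at)
qed

lemma poisson_qform:
  assumes "sym_mat A" "sym_mat B"
  shows "poisson (qform A) (qform B) z = 4 * symp (A *v z) (B *v z)"
  unfolding poisson_def symp_def partial_qform[OF assms(1)] partial_qform[OF assms(2)] sum_distrib_left
  by (intro sum.cong refl) (simp add: algebra_simps)

lemma symp_lin: "symp (a *\<^sub>R u + b *\<^sub>R v) w = a * symp u w + b * symp v w"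
  by (simp add: symp_def sum_distrib_left algebra_simps flip: sum.distrib sum_subtractf)

lemma symp_anti: "symp u v = - symp v u"
  by (simp add: symp_def flip: sum_negf)

lemma symp_lin2: "symp w (a *\<^sub>R u + b *\<^sub>R v) = a * symp w u + b * symp w v"
  using symp_lin[of a u b v w] by (simp add: symp_anti[of w])

lemma symp_self: "symp u u = 0" using symp_anti[of u u] by simp

text \<open>The Hamilton vector of the linear form with gradient \<open>b\<close>: bracketing with
  that form is pairing with \<open>hamv b\<close>.\<close>

definition hamv :: "real^('n::finite + 'n) \<Rightarrow> real^('n + 'n)" where
  "hamv b = (\<chi> j. case j of Inl i \<Rightarrow> b $ Inr i | Inr i \<Rightarrow> - b $ Inl i)"

lemma sum_Plus_UNIV: "(\<Sum>j\<in>(UNIV::('n::finite + 'n) set). f j) = (\<Sum>i\<in>UNIV. f (Inl i)) + (\<Sum>i\<in>UNIV. f (Inr i))"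
  using sum.Plus[of "UNIV::'n set" "UNIV::'n set" f] by (simp add: o_def)

lemma symp_hamv: "symp b w = hamv b \<bullet> w"
  by (simp add: symp_def hamv_def inner_vec_def sum_Plus_UNIV sum_subtractf sum_negf mult.commute)

lemma symp_hamv_left: "symp (hamv b) w = - (b \<bullet> w)"
  by (simp add: symp_def hamv_def inner_vec_def sum_Plus_UNIV sum_subtractf sum_negf mult.commute)

lemma hamv_nonzero: "b \<noteq> 0 \<Longrightarrow> hamv b \<noteq> 0"
  using symp_hamv_left[of b b] by (auto simp: symp_def)

text \<open>Two isotropic points \<open>p\<close>, \<open>q\<close> on a line that joins opposite
  signs pair nontrivially, so \<open>D *v p\<close> and \<open>D *v q\<close> span the range. With
  respect to \<open>p\<close> and \<open>q\<close> the form has only a mixed term, which is the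
  product of two linear forms.\<close>

lemma rank2_factor:
  assumes D: "sym_mat (D::real^'m::finite^'m)" and r: "rank D = 2" and x: "bf D x x > 0" and y: "bf D y y < 0"
  shows "\<exists>a b. (\<forall>v. D *v v = (1/2) *\<^sub>R ((b \<bullet> v) *\<^sub>R a + (a \<bullet> v) *\<^sub>R b)) \<and>
    (\<forall>s t. s *\<^sub>R a + t *\<^sub>R b = 0 \<longrightarrow> s = 0 \<and> t = 0)"
proof -
  obtain s1 s2 where st: "bf D (x + s1 *\<^sub>R y) (x + s1 *\<^sub>R y) = 0" "bf D (x + s2 *\<^sub>R y) (x + s2 *\<^sub>R y) = 0"
    "bf D (x + s1 *\<^sub>R y) (x + s2 *\<^sub>R y) > 0" using isotropic_line[OF D x y] by blast
  define p q where "p = x + s1 *\<^sub>R y" and "q = x + s2 *\<^sub>R y"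
  define d where "d = bf D p q"
  have d: "d > 0" and pp: "bf D p p = 0" and qq: "bf D q q = 0" and qp: "bf D q p = d"
    using st bf_sym[OF D, of q p] by (simp_all add: p_def q_def d_def)
  have li: "s = 0 \<and> t = 0" if "s *\<^sub>R (D *v p) + t *\<^sub>R (D *v q) = 0" for s t
  proof -
    have e: "w \<bullet> (s *\<^sub>R (D *v p) + t *\<^sub>R (D *v q)) = s * bf D w p + t * bf D w q" for w by (simp add: bf_def inner_add_right)
    have "s * bf D p p + t * bf D p q = 0" "s * bf D q p + t * bf D q q = 0" using e[of p] e[of q] that by simp_all
    then show ?thesis using d pp qq qp by (simp add: d_def[symmetric])
  qed
  have ne: "D *v p \<noteq> D *v q" using li[of 1 "-1"] by auto
  have ind: "independent {D *v p, D *v q}"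
  proof
    assume "dependent {D *v p, D *v q}"
    then obtain u where u: "(\<Sum>v\<in>{D *v p, D *v q}. u v *\<^sub>R v) = 0" "\<exists>v\<in>{D *v p, D *v q}. u v \<noteq> 0" by (auto simp: dependent_finite)
    then have "u (D *v p) *\<^sub>R (D *v p) + u (D *v q) *\<^sub>R (D *v q) = 0" using ne by simp
    from li[OF this] u(2) show False by auto
  qed
  have sub: "{D *v p, D *v q} \<subseteq> range (\<lambda>x. D *v x)" by auto
  have "range (\<lambda>x. D *v x) \<subseteq> span {D *v p, D *v q}"
    by (rule card_ge_dim_independent[OF sub ind]) (use r ne in \<open>simp add: rank_dim_range\<close>)
  then have rng: "\<exists>s t. D *v v = s *\<^sub>R (D *v p) + t *\<^sub>R (D *v q)" for v
    by (auto simp: span_insert span_singleton subset_iff algebra_simps)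
  have rep: "D *v v = (bf D q v / d) *\<^sub>R (D *v p) + (bf D p v / d) *\<^sub>R (D *v q)" for v
  proof -
    obtain s t where e: "D *v v = s *\<^sub>R (D *v p) + t *\<^sub>R (D *v q)" using rng by blast
    have "bf D w v = s * bf D w p + t * bf D w q" for w using e by (simp add: bf_def inner_add_right)
    from this[of p] this[of q] have "bf D p v = t * d" "bf D q v = s * d" using pp qq qp by (simp_all add: d_def)
    then show ?thesis using e d by simp
  qed
  define a where "a = (2/d) *\<^sub>R (D *v p)"
  define b where "b = D *v q"
  have "D *v v = (1/2) *\<^sub>R ((b \<bullet> v) *\<^sub>R a + (a \<bullet> v) *\<^sub>R b)" for v
  proof -
    have "b \<bullet> v = bf D q v" "a \<bullet> v = (2/d) * bf D p v" using bf_sym[OF D, of v q] bf_sym[OF D, of v p]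
      by (simp_all add: a_def b_def bf_def inner_commute)
    then show ?thesis using rep[of v] d
      by (simp add: a_def b_def algebra_simps)
  qed
  moreover have "s = 0 \<and> t = 0" if st: "s *\<^sub>R a + t *\<^sub>R b = 0" for s t
  proof -
    have "(s * (2/d)) *\<^sub>R (D *v p) + t *\<^sub>R (D *v q) = 0" using st by (simp add: a_def b_def)
    from li[OF this] d show ?thesis by simp
  qed
  ultimately show ?thesis by blast
qed

lemma bf_rank2:
  assumes "\<And>v. D *v v = (1/2) *\<^sub>R ((b \<bullet> v) *\<^sub>R a + (a \<bullet> v) *\<^sub>R b)"
  shows "bf D x y = ((b \<bullet> y) * (a \<bullet> x) + (a \<bullet> y) * (b \<bullet> x)) / 2"
  by (simp add: bf_def assms inner_add_right inner_commute)

text \<open>With \<open>D = (a \<bullet> \<cdot>)(b \<bullet> \<cdot>)\<close>, the form \<open>E\<close> restricted to the hyperplane \<open>a = 0\<close> cannot be semidefinite: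
  otherwise the bracket \<open>{D, E}\<close> vanishes on the hyperplane \<open>b = 0\<close>, so \<open>E\<close> maps the Hamilton vector of \<open>b\<close> to a multiple
  of \<open>b\<close>.\<close>

lemma rank2_semidefinite_False:
  fixes D E F :: "real^('n::finite + 'n)^('n + 'n)"
  assumes nd: "nondis D E" and sF: "sym_mat F"
    and D: "\<And>v. D *v v = (1/2) *\<^sub>R ((b \<bullet> v) *\<^sub>R a + (a \<bullet> v) *\<^sub>R b)"
    and ind: "\<And>s t. s *\<^sub>R a + t *\<^sub>R b = 0 \<Longrightarrow> s = 0 \<and> t = 0"
    and F: "\<And>z. bf F z z = symp (D *v z) (E *v z)"
    and F0: "\<And>z. bf D z z = 0 \<Longrightarrow> bf E z z = 0 \<Longrightarrow> bf F z z = 0"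
    and v0: "a \<bullet> v0 = 0" "b \<bullet> v0 = 0" "bf E v0 v0 \<noteq> 0"
    and K: "{z. D *v z = 0 \<and> E *v z = 0} = {0} \<or> symplectic_subspace {z. D *v z = 0 \<and> E *v z = 0}"
    and nn: "\<And>z. a \<bullet> z = 0 \<Longrightarrow> bf E z z \<ge> 0"
  shows False
proof -
  note s = nondis_sym[OF nd]
  note Dq = bf_rank2[of D b a, OF D]
  have Fe: "bf F z z = ((b \<bullet> z) * (hamv a \<bullet> (E *v z)) + (a \<bullet> z) * (hamv b \<bullet> (E *v z))) / 2" for z
    unfolding F D symp_hamv[symmetric] by (simp add: symp_lin[of "b \<bullet> z / 2" a "a \<bullet> z / 2" b, simplified] scaleR_add_right add_divide_distrib)
  have v0p: "bf E v0 v0 > 0" using nn[OF v0(1)] v0(3) by simp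
  have v0H: "v0 \<in> {v. b \<bullet> v = 0}" using v0 by simp
  obtain w where w: "bf D w w = 0" "bf E w w < 0" using nondis_negative_on_cone[OF nd] by blast
  have bw: "b \<bullet> w = 0" using w nn[of w] by (auto simp: Dq not_less)
  then have wH: "w \<in> {v. b \<bullet> v = 0}" by simp
  have sub: "subspace {v. b \<bullet> v = 0}" by (rule subspace_hyperplane)
  have z0: "bf F z z = 0" if "z \<in> {v. b \<bullet> v = 0}" "bf E z z = 0" for z
    using F0[of z] that by (simp add: Dq)
  obtain \<mu> where mu: "\<And>z. z \<in> {v. b \<bullet> v = 0} \<Longrightarrow> bf F z z = \<mu> * bf E z z"
    by (rule form_multiple_on[OF s(2) sF sub v0H v0p wH w(2) z0]) blast+
  \<comment> \<open>At \<open>v0\<close> both linear factors vanish, so \<open>F\<close> does, while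
    \<open>E\<close> is positive.\<close>
  have "\<mu> = 0" using mu[OF v0H] v0p by (simp add: Fe v0)
  then have ab: "(a \<bullet> z) * bf E (hamv b) z = 0" if "b \<bullet> z = 0" for z
    using mu[of z] that Fe[of z] by (simp add: bf_def)
  obtain ea eb where e: "a \<bullet> ea = 1" "b \<bullet> ea = 0" "a \<bullet> eb = 0" "b \<bullet> eb = (1::real)" by (rule dual_vectors[OF ind]) blast
  have hb: "bf E (hamv b) z = 0" if z: "b \<bullet> z = 0" for z
  proof (cases "a \<bullet> z = 0")
    case True
    have "bf E (hamv b) (z + ea) = 0" "bf E (hamv b) ea = 0" using ab[of "z + ea"] ab[of ea] True z e by (simp_all add: inner_add_right)
    then show ?thesis by (simp add: bf_lin)
  next
    case False then show ?thesis using ab[OF z] by simp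
  qed
  define h where "h = hamv b"
  define \<nu> where "\<nu> = bf E h eb"
  have Eh: "bf E h z = \<nu> * (b \<bullet> z)" for z
  proof -
    have "bf E h (z - (b \<bullet> z) *\<^sub>R eb) = 0" unfolding h_def by (rule hb) (simp add: inner_diff_right e)
    then show ?thesis by (simp add: bf_lin \<nu>_def)
  qed
  have bh: "b \<bullet> h = 0" using symp_hamv_left[of b b] symp_hamv[of b b] symp_self[of b] symp_hamv[of b "hamv b"] symp_hamv_left[of b "hamv b"]
    by (simp add: h_def inner_commute)
  have Ehh: "bf E h h = 0" by (simp add: Eh bh)
  have b0: "b \<noteq> 0" using ind[of 0 1] by auto
  show False
  proof (cases "a \<bullet> h = 0")
    case False
    \<comment> \<open>For this \<open>t\<close> the form \<open>G\<close> annihilates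
      \<open>h\<close>, which is transverse to the hyperplane \<open>a = 0\<close>. So
      \<open>G\<close> is determined by its restriction to that hyperplane, where it equals
      \<open>E\<close> and is nonnegative: a positive semidefinite element of the pencil.\<close>
    define t where "t = - 2 * \<nu> / (a \<bullet> h)"
    define G where "G = E + t *\<^sub>R D"
    have sG: "sym_mat G" unfolding G_def by (intro sym_mat_add sym_mat_scaleR s)
    have Gh: "bf G h z = 0" for z using False by (simp add: G_def bf_mat Eh Dq bh t_def)
    have "bf G z z \<ge> 0" for z
    proof -
      define y where "y = z - (a \<bullet> z / (a \<bullet> h)) *\<^sub>R h"
      have ay: "a \<bullet> y = 0" using False by (simp add: y_def inner_diff_right)
      have zz: "z = y + (a \<bullet> z / (a \<bullet> h)) *\<^sub>R h" by (simp add: y_def)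
      have "bf G z z = bf G y y"
        by (subst (1 2) zz) (simp add: bf_lin Gh bf_sym[OF sG, of y h])
      also have "\<dots> = bf E y y" using ay by (simp add: G_def bf_mat Dq)
      finally show ?thesis using nn[OF ay] by simp
    qed
    then have "t * bf D z z + 1 * bf E z z \<ge> 0" for z by (simp add: G_def bf_mat add.commute)
    from nondisD[OF nd this] show False by simp
  next
    case ah: True
    \<comment> \<open>Now \<open>h\<close> lies in the hyperplane \<open>a = 0\<close>, where
      \<open>E\<close> is nonnegative. On \<open>s *\<^sub>R h + eb\<close> the value of
      \<open>E\<close> is affine in \<open>s\<close> with slope \<open>2 * \<nu>\<close>, so the
      slope must vanish.\<close>
    have "\<nu> = 0"
    proof -
      have "bf E (s *\<^sub>R h + eb) (s *\<^sub>R h + eb) \<ge> 0" for s by (rule nn) (simp add: inner_add_right ah e)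
      then have q: "2 * s * \<nu> + bf E eb eb \<ge> 0" for s
        using Ehh bf_sym[OF s(2), of eb h] by (simp add: bf_lin \<nu>_def algebra_simps)
      show ?thesis
      proof (rule ccontr)
        assume n: "\<nu> \<noteq> 0"
        show False using q[of "- (bf E eb eb + 1) / (2 * \<nu>)"] n by (simp add: field_simps)
      qed
    qed
    then have "E *v h = 0" using Eh bf_sym[OF s(2)] by (intro bf_nondeg) simp
    moreover have "D *v h = 0" by (simp add: D bh ah)
    ultimately have hK: "h \<in> {z. D *v z = 0 \<and> E *v z = 0}" by simp
    have hn: "h \<noteq> 0" unfolding h_def by (rule hamv_nonzero[OF b0])
    then have sy: "symplectic_subspace {z. D *v z = 0 \<and> E *v z = 0}" using K hK by auto
    \<comment> \<open>A vector of the common kernel is annihilated by both linear factors of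
      \<open>D\<close>, and \<open>symp h\<close> is minus the factor \<open>b\<close>. So the
      nonzero \<open>h\<close> is in the radical of the common kernel.\<close>
    have "symp h k = 0" if k: "k \<in> {z. D *v z = 0 \<and> E *v z = 0}" for k
    proof -
      have "((b \<bullet> k) / 2) *\<^sub>R a + ((a \<bullet> k) / 2) *\<^sub>R b = 0" using k D[of k] by (simp add: scaleR_add_right)
      from ind[OF this] have "b \<bullet> k = 0" by simp
      then show ?thesis by (simp add: h_def symp_hamv_left)
    qed
    with sy hK hn show False unfolding symplectic_subspace_def by blast
  qed
qed

lemma rank2_sign:
  fixes D E F :: "real^('n::finite + 'n)^('n + 'n)"
  assumes nd: "nondis D E" and sF: "sym_mat F"
    and D: "\<And>v. D *v v = (1/2) *\<^sub>R ((b \<bullet> v) *\<^sub>R a + (a \<bullet> v) *\<^sub>R b)"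
    and ind: "\<And>s t. s *\<^sub>R a + t *\<^sub>R b = 0 \<Longrightarrow> s = 0 \<and> t = 0"
    and F: "\<And>z. bf F z z = symp (D *v z) (E *v z)"
    and F0: "\<And>z. bf D z z = 0 \<Longrightarrow> bf E z z = 0 \<Longrightarrow> bf F z z = 0"
    and v0: "a \<bullet> v0 = 0" "b \<bullet> v0 = 0" "bf E v0 v0 \<noteq> 0"
    and K: "{z. D *v z = 0 \<and> E *v z = 0} = {0} \<or> symplectic_subspace {z. D *v z = 0 \<and> E *v z = 0}"
  shows "\<exists>x y. a \<bullet> x = 0 \<and> bf E x x > 0 \<and> a \<bullet> y = 0 \<and> bf E y y < 0"
proof -
  have mE: "(- E) *v z = - (E *v z)" for z using scaleR_matrix_vector_assoc[of "-1" E z] by simp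
  have "\<exists>y. a \<bullet> y = 0 \<and> bf E y y < 0"
    using rank2_semidefinite_False[OF nd sF D ind F F0 v0 K] not_less by blast
  moreover have "\<exists>x. a \<bullet> x = 0 \<and> bf (- E) x x < 0"
  proof (rule ccontr)
    assume n: "\<not> ?thesis"
    show False
    proof (rule rank2_semidefinite_False[OF nondis_uminus[OF nd] sym_mat_minus[OF sF] D ind])
      show "bf (- F) z z = symp (D *v z) ((- E) *v z)" for z
        using symp_lin2[of "D *v z" "-1" "E *v z" 0 0] by (simp add: bf_mat F mE)
      show "bf (- F) z z = 0" if "bf D z z = 0" "bf (- E) z z = 0" for z using F0[of z] that by (simp add: bf_mat)
      show "a \<bullet> v0 = 0" "b \<bullet> v0 = 0" "bf (- E) v0 v0 \<noteq> 0" using v0 by (simp_all add: bf_mat)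
      show "{z. D *v z = 0 \<and> - E *v z = 0} = {0} \<or> symplectic_subspace {z. D *v z = 0 \<and> - E *v z = 0}"
        using K by (simp add: mE)
      show "bf (- E) z z \<ge> 0" if "a \<bullet> z = 0" for z using n that by (meson not_less)
    qed
  qed
  ultimately show ?thesis by (auto simp: bf_mat)
qed

theorem vanishing_bracket_in_span:
  fixes A B C :: "real^('n::finite + 'n)^('n + 'n)"
  assumes nd: "nondis A B" and C: "sym_mat C" and Cq: "\<And>z. bf C z z = 4 * symp (A *v z) (B *v z)"
    and C0: "\<And>z. bf A z z = 0 \<Longrightarrow> bf B z z = 0 \<Longrightarrow> bf C z z = 0"
    and rD: "rank (p *\<^sub>R A + q *\<^sub>R B) = 2" and mx: "rank (s0 *\<^sub>R A + t0 *\<^sub>R B) \<ge> 5"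
    and K: "{z. A *v z = 0 \<and> B *v z = 0} = {0} \<or> symplectic_subspace {z. A *v z = 0 \<and> B *v z = 0}"
  shows "\<exists>c d. C = c *\<^sub>R A + d *\<^sub>R B"
proof -
  note s = nondis_sym[OF nd]
  have pq: "\<not> (p = 0 \<and> q = 0)" using rD by auto
  define D where "D = p *\<^sub>R A + q *\<^sub>R B"
  define e1 e2 where "e1 = (if p = 0 then 1 else (0::real))" and "e2 = (if p = 0 then 0 else (1::real))"
  define E where "E = e1 *\<^sub>R A + e2 *\<^sub>R B"
  define \<delta> where "\<delta> = p * e2 - q * e1"
  have det: "\<delta> \<noteq> 0" using pq by (auto simp: e1_def e2_def \<delta>_def)
  have ndDE: "nondis D E" unfolding D_def E_def by (rule nondis_basis_change[OF nd det[unfolded \<delta>_def]])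
  note sDE = nondis_sym[OF ndDE]
  have AB: "bf A z z = 0 \<and> bf B z z = 0" if "bf D z z = 0" "bf E z z = 0" for z
    using that pq by (auto simp: D_def E_def bf_mat e1_def e2_def split: if_splits)
  have mv: "(x *\<^sub>R A + y *\<^sub>R B) *v z = x *\<^sub>R (A *v z) + y *\<^sub>R (B *v z)" for x y z
    by (simp add: matrix_vector_mult_add_rdistrib scaleR_matrix_vector_assoc)
  have kerDE: "{z. D *v z = 0 \<and> E *v z = 0} = {z. A *v z = 0 \<and> B *v z = 0}"
    using pq by (auto simp: D_def E_def mv e1_def e2_def split: if_splits)
  \<comment> \<open>The 4 comes from the gradients \<open>2 * A z\<close> and
    \<open>2 * B z\<close>; \<open>\<delta>\<close> is the determinant by which the antisymmetric
    bracket changes with the basis of the pencil.\<close>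
  define F where "F = (\<delta> / 4) *\<^sub>R C"
  have sF: "sym_mat F" unfolding F_def by (intro sym_mat_scaleR C)
  have "symp (D *v z) (E *v z) = \<delta> * symp (A *v z) (B *v z)" for z
    unfolding D_def E_def mv symp_lin symp_lin2 symp_self symp_anti[of "B *v z" "A *v z"] \<delta>_def by (simp add: algebra_simps)
  then have Fq: "bf F z z = symp (D *v z) (E *v z)" for z by (simp add: F_def bf_mat Cq)
  have F0: "bf F z z = 0" if "bf D z z = 0" "bf E z z = 0" for z
    using C0[of z] AB[OF that] by (simp add: F_def bf_mat)
  obtain x y where xy: "bf D x x > 0" "bf D y y < 0" using nondis_indefinite[OF ndDE] by blast
  obtain a b where D0: "\<forall>v. D *v v = (1/2) *\<^sub>R ((b \<bullet> v) *\<^sub>R a + (a \<bullet> v) *\<^sub>R b)"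
    and ind0: "\<forall>s t. s *\<^sub>R a + t *\<^sub>R b = 0 \<longrightarrow> s = 0 \<and> t = 0"
    using rank2_factor[OF sDE(1) rD[folded D_def] xy] by blast
  note D = D0[rule_format] and ind = ind0[rule_format]
  note Dq = bf_rank2[of D b a, OF D]
  have D': "D *v v = (1/2) *\<^sub>R ((a \<bullet> v) *\<^sub>R b + (b \<bullet> v) *\<^sub>R a)" for v by (simp add: D add.commute)
  have ind': "s = 0 \<and> t = 0" if "s *\<^sub>R b + t *\<^sub>R a = 0" for s t using ind[of t s] that by (simp add: add.commute)
  \<comment> \<open>Otherwise every form of the pencil is isotropic on a subspace of codimension 2
    and has rank at most 4.\<close>
  have "\<exists>v. a \<bullet> v = 0 \<and> b \<bullet> v = 0 \<and> bf E v v \<noteq> 0"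
  proof (rule ccontr)
    assume n: "\<not> ?thesis"
    have "bf (s0 *\<^sub>R A + t0 *\<^sub>R B) v v = 0" if "v \<in> {v. a \<bullet> v = 0} \<inter> {v. b \<bullet> v = 0}" for v
      using n that AB[of v] by (auto simp: Dq bf_mat)
    from rank_le_isotropic[OF _ cod_Int[OF cod_hyperplane cod_hyperplane] this] s
    have "rank (s0 *\<^sub>R A + t0 *\<^sub>R B) \<le> 2 * (1 + 1)" by (simp add: sym_mat_add sym_mat_scaleR)
    with mx show False by simp
  qed
  then obtain v0 where v0: "a \<bullet> v0 = 0" "b \<bullet> v0 = 0" "bf E v0 v0 \<noteq> 0" by blast
  have K': "{z. D *v z = 0 \<and> E *v z = 0} = {0} \<or> symplectic_subspace {z. D *v z = 0 \<and> E *v z = 0}" using K unfolding kerDE .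
  obtain xa ya where xa: "a \<bullet> xa = 0" "bf E xa xa > 0" "a \<bullet> ya = 0" "bf E ya ya < 0"
    using rank2_sign[OF ndDE sF D ind Fq F0 v0 K'] by blast
  obtain xb yb where xb: "b \<bullet> xb = 0" "bf E xb xb > 0" "b \<bullet> yb = 0" "bf E yb yb < 0"
    using rank2_sign[OF ndDE sF D' ind' Fq F0 v0(2,1,3) K'] by blast
  have z0: "bf F z z = 0" if "a \<bullet> z = 0 \<or> b \<bullet> z = 0" "bf E z z = 0" for z using F0[of z] that by (auto simp: Dq)
  obtain \<mu> where mu: "\<And>z. z \<in> {v. a \<bullet> v = 0} \<Longrightarrow> bf F z z = \<mu> * bf E z z"
    by (rule form_multiple_on[OF sDE(2) sF subspace_hyperplane[of a], of xa ya]) (use xa z0 in auto)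
  obtain \<mu>' where mu': "\<And>z. z \<in> {v. b \<bullet> v = 0} \<Longrightarrow> bf F z z = \<mu>' * bf E z z"
    by (rule form_multiple_on[OF sDE(2) sF subspace_hyperplane[of b], of xb yb]) (use xb z0 in auto)
  \<comment> \<open>\<open>v0\<close> lies on both hyperplanes and \<open>E\<close> is nonzero
    there, so the two multipliers agree.\<close>
  have mm: "\<mu>' = \<mu>" using mu[of v0] mu'[of v0] v0 by simp
  define G where "G = F - \<mu> *\<^sub>R E"
  have sG: "sym_mat G" unfolding G_def by (intro sym_mat_diff sym_mat_scaleR sDE sF)
  have Ga: "bf G z z = 0" if "a \<bullet> z = 0 \<or> b \<bullet> z = 0" for z using mu[of z] mu'[of z] that by (auto simp: G_def bf_mat mm)
  obtain ea eb where e: "a \<bullet> ea = 1" "b \<bullet> ea = 0" "a \<bullet> eb = 0" "b \<bullet> eb = (1::real)" by (rule dual_vectors[OF ind]) blast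
  have Gp: "bf G u v = 0" if "a \<bullet> u = 0 \<and> a \<bullet> v = 0 \<or> b \<bullet> u = 0 \<and> b \<bullet> v = 0" for u v
    using bf_polar[OF sG, of u v] Ga[of u] Ga[of v] Ga[of "u + v"] that by (auto simp: inner_add_right)
  \<comment> \<open>A form that vanishes on \<open>a = 0\<close> and on \<open>b = 0\<close> keeps
    only the term with the product of the two linear forms, and that product is
    \<open>D\<close>.\<close>
  have "G = (2 * bf G ea eb) *\<^sub>R D"
  proof (rule bf_quad_ext[OF sG])
    show "sym_mat ((2 * bf G ea eb) *\<^sub>R D)" by (intro sym_mat_scaleR sDE)
    fix z
    define n where "n = z - (a \<bullet> z) *\<^sub>R ea - (b \<bullet> z) *\<^sub>R eb"
    have z: "z = n + (a \<bullet> z) *\<^sub>R ea + (b \<bullet> z) *\<^sub>R eb" by (simp add: n_def)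
    have n: "a \<bullet> n = 0" "b \<bullet> n = 0" by (simp_all add: n_def inner_diff_right e)
    have "bf G n n = 0" "bf G n ea = 0" "bf G ea n = 0" "bf G n eb = 0" "bf G eb n = 0" "bf G ea ea = 0" "bf G eb eb = 0"
      using n e by (auto intro!: Gp)
    then have "bf G z z = 2 * (a \<bullet> z) * (b \<bullet> z) * bf G ea eb"
      by (subst (1 2) z) (simp add: bf_lin bf_sym[OF sG, of eb ea])
    then show "bf G z z = bf ((2 * bf G ea eb) *\<^sub>R D) z z" by (simp add: bf_mat Dq)
  qed
  then have F: "F = (2 * bf G ea eb) *\<^sub>R D + \<mu> *\<^sub>R E" by (simp add: G_def algebra_simps)
  have "C = (4 / \<delta>) *\<^sub>R F" using det by (simp add: F_def)
  also have "\<dots> = (4 / \<delta> * (2 * bf G ea eb * p + \<mu> * e1)) *\<^sub>R A + (4 / \<delta> * (2 * bf G ea eb * q + \<mu> * e2)) *\<^sub>R B"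
    unfolding F D_def E_def by (simp add: algebra_simps)
  finally show ?thesis by blast
qed

subsection \<open>Zeros near a double characteristic\<close>

lemma partial_sum_fun:
  assumes "\<And>i. i \<in> I \<Longrightarrow> smooth_on UNIV (f i)"
  shows "partial j (\<lambda>x. \<Sum>i\<in>I. f i x) = (\<lambda>x. \<Sum>i\<in>I. partial j (f i) x)"
  using partials_sum[of I f "[j]", OF assms] by simp

text \<open>The right-hand side is symmetric in \<open>a\<close> and \<open>b\<close>, so Schwarz's
  theorem is contained in it. It also expresses the Hessian through the iterated Hadamard quotients
  that occur in the second order expansion.\<close>

lemma second_partial_decomposition:
  fixes f :: "real^'n::finite \<Rightarrow> complex"
  assumes f: "smooth_on UNIV f"
  shows "partial b (partial a f) y = partial b (hquot y a f) y + partial a (hquot y b f) y"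
proof -
  note sh = smooth_hquot[OF f, of y]
  note sc = smooth_coord_diff
  have e: "f = (\<lambda>x. f y + (\<Sum>i\<in>UNIV. of_real (x $ i - y $ i) * hquot y i f x))"
    by (rule ext, subst hadamard[OF f, of _ y]) (simp add: scaleR_conv_of_real[where 'a=complex])
  have st: "smooth_on UNIV (\<lambda>x. of_real (x $ i - y $ i) * g x)" if "smooth_on UNIV g" for i and g :: "real^'n \<Rightarrow> complex"
    by (rule smooth_on_mult[OF open_UNIV sc that])
  have sst: "smooth_on UNIV (\<lambda>x. \<Sum>i\<in>UNIV. of_real (x $ i - y $ i) * g i x)" if "\<And>i. smooth_on UNIV (g i)" for g :: "'n \<Rightarrow> real^'n \<Rightarrow> complex"
    by (rule smooth_on_sum[OF open_UNIV st[OF that]])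
  have ps: "partial a (\<lambda>x. \<Sum>i\<in>UNIV. of_real (x $ i - y $ i) * g i x) = (\<lambda>x. (\<Sum>i\<in>UNIV. of_real (x $ i - y $ i) * partial a (g i) x) + g a x)"
    if g: "\<And>i. smooth_on UNIV (g i)" for a and g :: "'n \<Rightarrow> real^'n \<Rightarrow> complex"
    unfolding partial_sum_fun[OF st[OF g]] partial_mult_fun[OF sc g] partial_coord_diff
    by (simp add: sum.distrib if_distrib[where f="\<lambda>z. z * _"] cong: if_cong)
  have "partial a f = partial a (\<lambda>x. f y + (\<Sum>i\<in>UNIV. of_real (x $ i - y $ i) * hquot y i f x))" by (rule arg_cong[OF e])
  also have "\<dots> = (\<lambda>x. (\<Sum>i\<in>UNIV. of_real (x $ i - y $ i) * partial a (hquot y i f) x) + hquot y a f x)"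
    unfolding partial_add_fun[OF smooth_on_const sst[OF sh]] ps[OF sh] by (simp add: partial_const)
  finally have "partial b (partial a f) y = partial b (\<lambda>x. (\<Sum>i\<in>UNIV. of_real (x $ i - y $ i) * partial a (hquot y i f) x) + hquot y a f x) y"
    by simp
  then show ?thesis unfolding partial_add_fun[OF sst[OF smooth_on_partial[OF sh]] sh] ps[OF smooth_on_partial[OF sh]] by simp
qed

lemma partial_partial_commute:
  fixes f :: "real^'n::finite \<Rightarrow> complex"
  assumes "smooth_on UNIV f"
  shows "partial b (partial a f) y = partial a (partial b f) y"
  using second_partial_decomposition[OF assms, of a b] second_partial_decomposition[OF assms, of b a] by (simp add: add.commute)

lemma hessian_sym_mat:
  assumes "smooth_on UNIV p"
  shows "sym_mat (\<chi> a b. Re (hessian p z $ a $ b))" "sym_mat (\<chi> a b. Im (hessian p z $ a $ b))"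
  using partial_partial_commute[OF assms] by (auto simp: sym_mat_def transpose_def hessian_def vec_eq_iff)

lemma bf_expand: "bf M x y = (\<Sum>i\<in>UNIV. \<Sum>j\<in>UNIV. x $ i * y $ j * M $ i $ j)"
  by (simp add: bf_def inner_vec_def matrix_vector_mult_def sum_distrib_left mult_ac)

lemma blowup_near:
  fixes P :: "real \<times> 'a::euclidean_space \<Rightarrow> 'b::real_normed_vector"
  assumes P: "continuous_on UNIV P" and K: "compact K" and e: "e > 0"
  shows "\<exists>d>0. \<forall>\<epsilon> w. 0 \<le> \<epsilon> \<longrightarrow> \<epsilon> < d \<longrightarrow> w \<in> K \<longrightarrow> norm (P (\<epsilon>, w) - P (0, w)) < e"
proof -
  have "uniformly_continuous_on ({0..1} \<times> K) P"
    by (rule compact_uniformly_continuous[OF continuous_on_subset[OF P] compact_Times[OF compact_Icc K]]) simp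
  then obtain d where d: "d > 0" "\<And>x x'. x \<in> {0..1} \<times> K \<Longrightarrow> x' \<in> {0..1} \<times> K \<Longrightarrow> dist x' x < d \<Longrightarrow> dist (P x') (P x) < e"
    unfolding uniformly_continuous_on_def using e by meson
  have "norm (P (\<epsilon>, w) - P (0, w)) < e" if "0 \<le> \<epsilon>" "\<epsilon> < min d 1" "w \<in> K" for \<epsilon> w
    using d(2)[of "(0, w)" "(\<epsilon>, w)"] that by (simp add: dist_norm dist_Pair_Pair)
  then show ?thesis using d(1) by (intro exI[of _ "min d 1"]) auto
qed

lemma continuous_on_symp[continuous_intros]:
  "continuous_on S f \<Longrightarrow> continuous_on S g \<Longrightarrow> continuous_on S (\<lambda>x. symp (f x) (g x))"
  unfolding symp_def by (intro continuous_intros)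

lemma symp_scaleR: "symp (a *\<^sub>R u) (b *\<^sub>R v) = a * b * symp u v"
  by (simp add: symp_def sum_distrib_left algebra_simps)

text \<open>\<open>P\<close> and \<open>G\<close> are the blowups of \<open>p\<close> and its
  gradient, divided by \<open>\<epsilon>\<^sup>2\<close> and \<open>\<epsilon>\<close>; Hadamard's
  formula extends them continuously to \<open>\<epsilon> = 0\<close>. There \<open>P\<close> is half
  the Hessian form, for which \<open>z\<close> is a nondegenerate zero, so the zero persists for
  small \<open>\<epsilon>\<close>; the bracket of the true gradient is
  \<open>\<epsilon>\<^sup>2\<close> times the nonzero \<open>\<Psi>\<close>.\<close>

lemma zero_near_double_zero:
  fixes p :: "real^('n::finite + 'n) \<Rightarrow> complex" and z0 :: "real^('n + 'n)"
  defines "A \<equiv> \<chi> a b. Re (hessian p z0 $ a $ b)" and "B \<equiv> \<chi> a b. Im (hessian p z0 $ a $ b)"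
  assumes p: "smooth_on UNIV p" and p0: "p z0 = 0" and dp: "\<And>j. partial j p z0 = 0"
    and z: "bf A z z = 0" "bf B z z = 0"
    and u: "bf A z u1 = 1" "bf B z u1 = 0" "bf A z u2 = 0" "bf B z u2 = 1"
    and sz: "symp (A *v z) (B *v z) \<noteq> 0" and r: "r > 0"
  shows "\<exists>w. norm (w - z0) < r \<and> p w = 0 \<and> symp (\<chi> j. Re (partial j p w)) (\<chi> j. Im (partial j p w)) \<noteq> 0"
proof -
  note s = hessian_sym_mat[OF p, of z0, folded A_def B_def]
  define h where "h i j = hquot z0 j (hquot z0 i p)" for i j
  define P where "P = (\<lambda>(\<epsilon>, w). \<Sum>i\<in>UNIV. \<Sum>j\<in>UNIV. of_real (w $ i * w $ j) * h i j (z0 + \<epsilon> *\<^sub>R w))"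
  define G where "G a = (\<lambda>(\<epsilon>, w). \<Sum>b\<in>UNIV. of_real (w $ b) * hquot z0 b (partial a p) (z0 + \<epsilon> *\<^sub>R w))" for a
  have ch: "continuous_on UNIV (\<lambda>x. f (z0 + fst x *\<^sub>R snd x))" if "smooth_on UNIV f" for f :: "real^('n + 'n) \<Rightarrow> complex"
    by (rule continuous_on_compose2[OF smooth_on_continuous[OF that]]) (auto intro!: continuous_intros)
  have cP: "continuous_on UNIV P" unfolding P_def h_def case_prod_beta
    by (intro continuous_on_sum continuous_on_mult continuous_on_of_real continuous_on_component continuous_on_snd continuous_on_id
      ch[OF smooth_hquot[OF smooth_hquot[OF p]]])
  have cG: "continuous_on UNIV (G a)" for a unfolding G_def case_prod_beta
    by (intro continuous_on_sum continuous_on_mult continuous_on_of_real continuous_on_component continuous_on_snd continuous_on_id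
      ch[OF smooth_hquot[OF smooth_on_partial[OF p]]])
  have Pe: "p (z0 + \<epsilon> *\<^sub>R w) = of_real (\<epsilon>\<^sup>2) * P (\<epsilon>, w)" for \<epsilon> w
    using hadamard2[OF p, of "z0 + \<epsilon> *\<^sub>R w" z0]
    by (simp add: p0 dp P_def h_def scaleR_conv_of_real[where 'a=complex] sum_distrib_left power2_eq_square mult_ac)
  have Ge: "partial a p (z0 + \<epsilon> *\<^sub>R w) = of_real \<epsilon> * G a (\<epsilon>, w)" for a \<epsilon> w
    using hadamard[OF smooth_on_partial[OF p], of a "z0 + \<epsilon> *\<^sub>R w" z0]
    by (simp add: dp G_def scaleR_conv_of_real[where 'a=complex] sum_distrib_left mult_ac)
  have hz: "h i j z0 = partial j (hquot z0 i p) z0" for i j by (simp add: h_def hquot_base)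
  have P0: "P (0, w) = 1/2 * Complex (bf A w w) (bf B w w)" for w
  proof -
    have "Complex (bf A w w) (bf B w w) = (\<Sum>i\<in>UNIV. \<Sum>j\<in>UNIV. of_real (w $ i * w $ j) * hessian p z0 $ i $ j)"
      by (rule complex_eqI) (simp_all add: bf_expand A_def B_def)
    also have "\<dots> = (\<Sum>i\<in>UNIV. \<Sum>j\<in>UNIV. of_real (w $ i * w $ j) * h i j z0) + (\<Sum>i\<in>UNIV. \<Sum>j\<in>UNIV. of_real (w $ i * w $ j) * h j i z0)"
      by (simp add: hessian_def second_partial_decomposition[OF p, of _ _ z0] hz algebra_simps flip: sum.distrib)
    also have "(\<Sum>i\<in>UNIV. \<Sum>j\<in>UNIV. of_real (w $ i * w $ j) * h j i z0) = (\<Sum>i\<in>UNIV. \<Sum>j\<in>UNIV. of_real (w $ i * w $ j) * h i j z0)"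
      by (subst sum.swap) (simp add: mult.commute)
    finally show ?thesis by (simp add: P_def)
  qed
  have G0: "G a (0, w) = Complex ((A *v w) $ a) ((B *v w) $ a)" for a w
    by (rule complex_eqI) (simp_all add: G_def hquot_base A_def B_def matrix_vector_mult_def hessian_def partial_partial_commute[OF p, of _ a] mult.commute)
  define \<Psi> where "\<Psi> x = symp (\<chi> a. Re (G a x)) (\<chi> a. Im (G a x))" for x
  have cPsi: "continuous_on UNIV \<Psi>" unfolding \<Psi>_def
    by (intro continuous_intros continuous_on_vec_lambda cG)
  have "\<Psi> (0, z) = symp (A *v z) (B *v z)" by (simp add: \<Psi>_def G0)
  then have "\<Psi> (0, z) \<noteq> 0" using sz by simp
  then have "\<forall>\<^sub>F x in at (0, z). \<Psi> x \<noteq> 0"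
    using cPsi by (intro tendsto_imp_eventually_ne[of \<Psi> "\<Psi> (0, z)"]) (simp_all add: continuous_on_def)
  then obtain d where d: "d > 0" "\<And>x. x \<noteq> (0, z) \<Longrightarrow> dist x (0, z) < d \<Longrightarrow> \<Psi> x \<noteq> 0"
    unfolding eventually_at by blast
  obtain KA where KA: "KA \<ge> 0" "\<And>x y. \<bar>bf A x y\<bar> \<le> norm x * norm y * KA" using bf_bound by blast
  obtain KB where KB: "KB \<ge> 0" "\<And>x y. \<bar>bf B x y\<bar> \<le> norm x * norm y * KB" using bf_bound by blast
  define U where "U = norm u1 + norm u2 + 1"
  define ww where "ww s = Re s *\<^sub>R u1 + Im s *\<^sub>R u2" for s
  have U1: "U \<ge> 1" by (simp add: U_def)
  have nww: "norm (ww s) \<le> norm s * U" for s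
  proof -
    have "norm (ww s) \<le> \<bar>Re s\<bar> * norm u1 + \<bar>Im s\<bar> * norm u2" unfolding ww_def by (rule order_trans[OF norm_triangle_ineq]) simp
    also have "\<dots> \<le> norm s * norm u1 + norm s * norm u2" by (intro add_mono mult_right_mono abs_Re_le_cmod abs_Im_le_cmod) simp_all
    finally show ?thesis unfolding U_def distrib_left using norm_ge_zero[of s] by linarith
  qed
  define L where "L = (KA + KB) * U\<^sup>2 + 1"
  have L1: "L \<ge> 1" using KA(1) KB(1) by (simp add: L_def)
  \<comment> \<open>\<open>1 / L\<close> makes the quadratic error at \<open>\<epsilon> = 0\<close>
    at most \<open>\<eta> / 2\<close>, which leaves the other half for positive
    \<open>\<epsilon>\<close>; \<open>d / (4 * U)\<close> keeps the correction where
    \<open>\<Psi>\<close> is nonzero.\<close>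
  define \<eta> where "\<eta> = min (1 / L) (d / (4 * U))"
  have \<eta>: "\<eta> > 0" "\<eta> * L \<le> 1" "\<eta> * U \<le> d / 4"
  proof -
    show "\<eta> > 0" using L1 U1 d(1) by (simp add: \<eta>_def)
    have "\<eta> \<le> 1 / L" "\<eta> \<le> d / (4 * U)" by (simp_all add: \<eta>_def)
    then show "\<eta> * L \<le> 1" "\<eta> * U \<le> d / 4" using L1 U1 by (simp_all add: field_simps)
  qed
  have q: "norm (s - P (0, z + ww s)) \<le> \<eta> / 2" if "norm s \<le> \<eta>" for s
  proof -
    have pol: "bf A (z + ww s) (z + ww s) = 2 * Re s + bf A (ww s) (ww s)" "bf B (z + ww s) (z + ww s) = 2 * Im s + bf B (ww s) (ww s)"
      using bf_polar[OF s(1), of z "ww s"] bf_polar[OF s(2), of z "ww s"] z u by (simp_all add: ww_def bf_lin)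
    have "s - P (0, z + ww s) = - (1/2) * Complex (bf A (ww s) (ww s)) (bf B (ww s) (ww s))"
      unfolding P0 pol by (rule complex_eqI) (simp_all add: field_simps)
    then have "norm (s - P (0, z + ww s)) \<le> 1/2 * (\<bar>bf A (ww s) (ww s)\<bar> + \<bar>bf B (ww s) (ww s)\<bar>)"
      using cmod_le[of "Complex (bf A (ww s) (ww s)) (bf B (ww s) (ww s))"] by (simp add: norm_mult)
    also have "\<dots> \<le> 1/2 * ((norm (ww s))\<^sup>2 * (KA + KB))"
      using KA(2)[of "ww s" "ww s"] KB(2)[of "ww s" "ww s"] by (simp add: power2_eq_square algebra_simps)
    also have "\<dots> \<le> 1/2 * ((\<eta> * U)\<^sup>2 * (KA + KB))"
      using order_trans[OF nww mult_right_mono[OF that, of U]] U1 KA(1) KB(1) by (intro mult_left_mono mult_right_mono power_mono) simp_all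
    also have "\<dots> \<le> 1/2 * (\<eta> * (\<eta> * L))" using \<eta>(1) by (simp add: L_def power2_eq_square algebra_simps)
    also have "\<dots> \<le> 1/2 * (\<eta> * 1)" using \<eta> by (intro mult_left_mono) simp_all
    finally show ?thesis by simp
  qed
  define K where "K = (\<lambda>s. z + ww s) ` cball 0 \<eta>"
  have cw: "continuous_on S (\<lambda>s. z + ww s)" for S unfolding ww_def by (intro continuous_intros)
  have "compact K" unfolding K_def by (intro compact_continuous_image cw compact_cball)
  from blowup_near[OF cP this, of "\<eta>/2"] \<eta>(1) obtain d1 where d1: "d1 > 0"
    "\<And>\<epsilon> w. 0 \<le> \<epsilon> \<Longrightarrow> \<epsilon> < d1 \<Longrightarrow> w \<in> K \<Longrightarrow> norm (P (\<epsilon>, w) - P (0, w)) < \<eta> / 2" by auto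
  define R where "R = norm z + d"
  have R: "R > 0" using d(1) by (simp add: R_def add_nonneg_pos)
  define \<epsilon> where "\<epsilon> = min (min (d1 / 2) (d / 2)) (r / (2 * R))"
  have \<epsilon>: "\<epsilon> > 0" "\<epsilon> < d1" "\<epsilon> \<le> d / 2" "\<epsilon> * R < r"
  proof -
    show "\<epsilon> > 0" using d1(1) d(1) r R by (simp add: \<epsilon>_def)
    show "\<epsilon> < d1" "\<epsilon> \<le> d / 2" using d1(1) by (auto simp: \<epsilon>_def min_def)
    have "\<epsilon> \<le> r / (2 * R)" by (simp add: \<epsilon>_def)
    then have "\<epsilon> * R \<le> r / 2" using R by (simp add: field_simps)
    then show "\<epsilon> * R < r" using r by simp
  qed
  \<comment> \<open>Fixed points of \<open>T\<close> are zeros of \<open>P\<close>. By the choice of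
    \<open>u1\<close> and \<open>u2\<close>, at \<open>\<epsilon> = 0\<close> the map
    \<open>s \<mapsto> P (0, z + ww s)\<close> is the identity up to quadratic terms, so
    \<open>T\<close> is small.\<close>
  define T where "T s = s - P (\<epsilon>, z + ww s)" for s
  have cT: "continuous_on (cball 0 \<eta>) T" unfolding T_def
    by (intro continuous_intros continuous_on_compose2[OF cP] cw) simp
  have "T s \<in> cball 0 \<eta>" if "s \<in> cball 0 \<eta>" for s
  proof -
    have "norm (P (\<epsilon>, z + ww s) - P (0, z + ww s)) < \<eta> / 2" using that \<epsilon> by (intro d1(2)) (auto simp: K_def)
    moreover have "T s = (s - P (0, z + ww s)) - (P (\<epsilon>, z + ww s) - P (0, z + ww s))" by (simp add: T_def)
    ultimately show ?thesis using q[of s] that norm_triangle_ineq4[of "s - P (0, z + ww s)" "P (\<epsilon>, z + ww s) - P (0, z + ww s)"] by simp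
  qed
  then obtain s' where s': "s' \<in> cball 0 \<eta>" "T s' = s'" using brouwer_ball[OF \<eta>(1) cT] by blast
  define w where "w = z + ww s'"
  have Pw: "P (\<epsilon>, w) = 0" using s'(2) by (simp add: T_def w_def)
  have nw: "norm (ww s') \<le> d / 4" using order_trans[OF nww[of s'] mult_right_mono[of "norm s'" \<eta> U]] s'(1) \<eta>(3) U1 by simp
  have "dist (\<epsilon>, w) (0, z) \<le> \<epsilon> + norm (ww s')" using \<epsilon>(1) norm_Pair_le[of \<epsilon> "ww s'"] by (simp add: dist_norm w_def)
  then have Psi: "\<Psi> (\<epsilon>, w) \<noteq> 0" using nw \<epsilon>(1,3) d(1) by (intro d(2)) (auto intro: le_less_trans)
  have "norm w \<le> R" using norm_triangle_ineq[of z "ww s'"] nw d(1) by (simp add: w_def R_def)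
  then have "\<epsilon> * norm w \<le> \<epsilon> * R" using \<epsilon>(1) by (intro mult_left_mono) simp_all
  from le_less_trans[OF this \<epsilon>(4)] have nr: "norm (z0 + \<epsilon> *\<^sub>R w - z0) < r" using \<epsilon>(1) by simp
  have "(\<chi> j. Re (partial j p (z0 + \<epsilon> *\<^sub>R w))) = \<epsilon> *\<^sub>R (\<chi> a. Re (G a (\<epsilon>, w)))"
    "(\<chi> j. Im (partial j p (z0 + \<epsilon> *\<^sub>R w))) = \<epsilon> *\<^sub>R (\<chi> a. Im (G a (\<epsilon>, w)))" by (simp_all add: vec_eq_iff Ge)
  then have "symp (\<chi> j. Re (partial j p (z0 + \<epsilon> *\<^sub>R w))) (\<chi> j. Im (partial j p (z0 + \<epsilon> *\<^sub>R w))) = \<epsilon> * \<epsilon> * \<Psi> (\<epsilon>, w)"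
    by (simp add: symp_scaleR \<Psi>_def)
  with nr Pe[of \<epsilon> w] Pw Psi \<epsilon>(1) show ?thesis by (intro exI[of _ "z0 + \<epsilon> *\<^sub>R w"]) auto
qed

subsection \<open>The principal symbol\<close>

lemma lmono_prod: "lmono \<zeta> xs = (\<Prod>i\<in>UNIV. \<zeta> i ^ count_list xs (i::'n::finite))"
proof (induction xs)
  case (Cons a xs)
  have "(\<Prod>i\<in>UNIV. \<zeta> i ^ count_list (a # xs) i) = (\<Prod>i\<in>UNIV. (if i = a then \<zeta> i else 1) * \<zeta> i ^ count_list xs i)"
    by (intro prod.cong) auto
  then show ?case using Cons by (simp add: prod.distrib)
qed simp

lemma mono_pow_lmono: "mono_pow \<xi> \<alpha> = lmono (rcx \<xi>) (mi_list \<alpha>)"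
  by (simp add: mono_pow_def lmono_prod mi_list_count rcx_def)

lemma lmono_euler: "(\<Sum>j\<in>UNIV. \<zeta> j * ldmono \<zeta> j xs) = of_nat (length xs) * lmono \<zeta> (xs :: 'n::finite list)"
proof (induction xs)
  case (Cons a xs)
  have "(\<Sum>j\<in>UNIV. \<zeta> j * ldmono \<zeta> j (a # xs)) = (\<Sum>j\<in>UNIV. if j = a then \<zeta> j * lmono \<zeta> xs else 0) + \<zeta> a * (\<Sum>j\<in>UNIV. \<zeta> j * ldmono \<zeta> j xs)"
    unfolding sum_distrib_left sum.distrib[symmetric] by (intro sum.cong) (auto simp: algebra_simps)
  then show ?case using Cons by (simp add: algebra_simps)
qed simp

lemma axis_parts:
  "xpart (z + t *\<^sub>R axis (Inl i) 1) = xpart z + t *\<^sub>R axis i 1" "xpart (z + t *\<^sub>R axis (Inr i) 1) = xpart z"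
  "xipart (z + t *\<^sub>R axis (Inr i) 1) = xipart z + t *\<^sub>R axis i 1" "xipart (z + t *\<^sub>R axis (Inl i) 1) = xipart z"
  by (auto simp: xpart_def xipart_def vec_eq_iff axis_def)

lemma partial_xpart:
  "partial (Inl m) (\<lambda>z. f (xpart z)) z = partial m f (xpart z)" "partial (Inr m) (\<lambda>z. f (xpart z)) z = 0"
  "has_partial (Inl m) (\<lambda>z. f (xpart z)) z \<longleftrightarrow> has_partial m f (xpart z)" "has_partial (Inr m) (\<lambda>z. f (xpart z)) z"
  by (simp_all add: partial_def has_partial_def axis_parts)

lemma partial_xipart:
  "partial (Inr m) (\<lambda>z. f (xipart z)) z = partial m f (xipart z)" "partial (Inl m) (\<lambda>z. f (xipart z)) z = 0"
  by (simp_all add: partial_def axis_parts)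

lemma continuous_on_xpart: "continuous_on S xpart"
  unfolding xpart_def by (intro continuous_intros)

lemma ck_xpart: "ck UNIV n f \<Longrightarrow> ck UNIV n (\<lambda>z. f (xpart z))"
proof (induction n arbitrary: f)
  case 0
  then show ?case using continuous_on_compose2[of UNIV f UNIV xpart] by (simp add: continuous_on_xpart)
next
  case (Suc n)
  have c: "continuous_on UNIV (\<lambda>z. f (xpart z))"
    using Suc.prems continuous_on_compose2[of UNIV f UNIV xpart] by (simp add: continuous_on_xpart)
  have "has_partial i (\<lambda>z. f (xpart z)) z \<and> ck UNIV n (partial i (\<lambda>z. f (xpart z)))" for i z
  proof (cases i)
    case (Inl m)
    have "partial i (\<lambda>z. f (xpart z)) = (\<lambda>z. partial m f (xpart z))" by (rule ext) (simp add: Inl partial_xpart)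
    then show ?thesis using Suc by (simp add: Inl partial_xpart)
  next
    case (Inr m)
    have "partial i (\<lambda>z. f (xpart z)) = (\<lambda>z. 0)" by (rule ext) (simp add: Inr partial_xpart)
    then show ?thesis by (simp add: Inr partial_xpart ck_const)
  qed
  with c show ?case by simp
qed

lemma smooth_on_xpart: "smooth_on UNIV f \<Longrightarrow> smooth_on UNIV (\<lambda>z. f (xpart z))"
  by (simp add: smooth_on_ck_iff ck_xpart)

lemma smooth_on_rcx: "smooth_on UNIV (\<lambda>\<xi>. rcx \<xi> i)"
  using smooth_coord_diff[of i 0] by (simp add: rcx_def)

lemma smooth_on_lmono: "smooth_on UNIV (\<lambda>\<xi>. lmono (rcx \<xi>) xs)"
  by (induction xs) (auto intro!: smooth_on_const smooth_on_mult smooth_on_rcx)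

lemma partial_lmono: "partial j (\<lambda>\<xi>. lmono (rcx \<xi>) xs) = (\<lambda>\<xi>. ldmono (rcx \<xi>) j xs)"
proof (induction xs)
  case (Cons i xs)
  have "partial j (\<lambda>\<xi>. rcx \<xi> i) = (\<lambda>\<xi>. if j = i then 1 else 0)" using partial_coord_diff[of j i 0] by (simp add: rcx_def)
  then show ?case using partial_mult_fun[OF smooth_on_rcx smooth_on_lmono, of j i xs] Cons by (auto simp: fun_eq_iff)
qed (simp add: partial_const fun_eq_iff)

lemma smooth_on_lmono_xipart: "smooth_on UNIV (\<lambda>z::real^('n::finite + 'n). lmono (rcx (xipart z)) xs)"
proof (induction xs)
  case (Cons i xs)
  have "smooth_on UNIV (\<lambda>z::real^('n + 'n). rcx (xipart z) i)"
    using smooth_coord_diff[of "Inr i" 0] by (simp add: rcx_def xipart_def)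
  then show ?case using Cons by (simp add: smooth_on_mult)
qed (simp add: smooth_on_const)

lemma principal_symbol_lmono:
  "principal_symbol k c = (\<lambda>z. \<Sum>\<alpha>\<in>{\<alpha>. mi_abs \<alpha> = k}. c \<alpha> (xpart z) * lmono (rcx (xipart z)) (mi_list \<alpha>))"
  by (simp add: fun_eq_iff principal_symbol_def mono_pow_lmono)

context
  fixes k :: nat and c :: "('n::finite \<Rightarrow> nat) \<Rightarrow> real^'n \<Rightarrow> complex"
  assumes c: "\<And>\<alpha>. mi_abs \<alpha> = k \<Longrightarrow> smooth_on UNIV (c \<alpha>)"
begin

lemma smooth_on_principal_symbol: "smooth_on UNIV (principal_symbol k c)"
  unfolding principal_symbol_lmono
  by (intro smooth_on_sum smooth_on_mult open_UNIV smooth_on_lmono_xipart smooth_on_xpart c) simp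

lemma partial_principal_symbol:
  "partial (Inl m) (principal_symbol k c) z = (\<Sum>\<alpha>\<in>{\<alpha>. mi_abs \<alpha> = k}. partial m (c \<alpha>) (xpart z) * lmono (rcx (xipart z)) (mi_list \<alpha>))"
  "partial (Inr j) (principal_symbol k c) z = (\<Sum>\<alpha>\<in>{\<alpha>. mi_abs \<alpha> = k}. c \<alpha> (xpart z) * ldmono (rcx (xipart z)) j (mi_list \<alpha>))"
proof -
  have "partial a (principal_symbol k c) z = (\<Sum>\<alpha>\<in>{\<alpha>. mi_abs \<alpha> = k}.
    c \<alpha> (xpart z) * partial a (\<lambda>z. lmono (rcx (xipart z)) (mi_list \<alpha>)) z + partial a (\<lambda>z. c \<alpha> (xpart z)) z * lmono (rcx (xipart z)) (mi_list \<alpha>))" for a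
    unfolding principal_symbol_lmono
    by (subst partial_sum_fun, intro smooth_on_mult open_UNIV smooth_on_lmono_xipart smooth_on_xpart c, simp)
      (intro sum.cong refl, subst partial_mult_fun, auto intro!: smooth_on_lmono_xipart smooth_on_xpart c)
  then show "partial (Inl m) (principal_symbol k c) z = (\<Sum>\<alpha>\<in>{\<alpha>. mi_abs \<alpha> = k}. partial m (c \<alpha>) (xpart z) * lmono (rcx (xipart z)) (mi_list \<alpha>))"
    "partial (Inr j) (principal_symbol k c) z = (\<Sum>\<alpha>\<in>{\<alpha>. mi_abs \<alpha> = k}. c \<alpha> (xpart z) * ldmono (rcx (xipart z)) j (mi_list \<alpha>))"
    by (simp_all add: partial_xpart partial_xipart(1)[of _ "\<lambda>\<xi>. lmono (rcx \<xi>) xs" for xs] partial_xipart(2)[of _ "\<lambda>\<xi>. lmono (rcx \<xi>) xs" for xs] partial_lmono)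
qed

text \<open>Euler's identity for the homogeneity in \<open>\<xi>\<close>. It supplies the vanishing
  of the symbol at a point where only its differential is assumed to vanish.\<close>

lemma principal_symbol_euler:
  "of_nat k * principal_symbol k c z = (\<Sum>j\<in>UNIV. rcx (xipart z) j * partial (Inr j) (principal_symbol k c) z)"
proof -
  have "(\<Sum>j\<in>UNIV. rcx (xipart z) j * partial (Inr j) (principal_symbol k c) z)
    = (\<Sum>\<alpha>\<in>{\<alpha>. mi_abs \<alpha> = k}. c \<alpha> (xpart z) * (\<Sum>j\<in>UNIV. rcx (xipart z) j * ldmono (rcx (xipart z)) j (mi_list \<alpha>)))"
    unfolding partial_principal_symbol sum_distrib_left by (subst sum.swap) (simp add: mult_ac)
  also have "\<dots> = (\<Sum>\<alpha>\<in>{\<alpha>. mi_abs \<alpha> = k}. of_nat k * (c \<alpha> (xpart z) * lmono (rcx (xipart z)) (mi_list \<alpha>)))"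
    by (intro sum.cong refl) (simp add: lmono_euler length_mi_list)
  finally show ?thesis by (simp add: principal_symbol_lmono sum_distrib_left)
qed

end

text \<open>Only one sign of the bracket is excluded directly. At \<open>- \<xi>\<close> the
  gradient in \<open>x\<close> is multiplied by \<open>(-1)^k\<close> and the gradient in
  \<open>\<xi>\<close> by \<open>- (-1)^k\<close>, so the bracket changes sign and the other case
  follows.\<close>

theorem hoermander:
  fixes c :: "('n::finite \<Rightarrow> nat) \<Rightarrow> real^'n \<Rightarrow> complex"
  assumes bs: "\<And>\<alpha>. mi_abs \<alpha> \<le> k \<Longrightarrow> bsmooth (c \<alpha>)"
    and U: "open U" "xpart w \<in> U"
    and solv: "\<And>f. test_fun U f \<Longrightarrow> \<exists>u. distribution U u \<and>
        (\<forall>\<phi>. test_fun U \<phi> \<longrightarrow> u (transpose_op k c \<phi>) = integral UNIV (\<lambda>x. f x * \<phi> x))"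
    and p0: "principal_symbol k c w = 0"
    and ne: "symp (\<chi> j. Re (partial j (principal_symbol k c) w)) (\<chi> j. Im (partial j (principal_symbol k c) w)) \<noteq> 0"
  shows False
proof -
  define p where "p = principal_symbol k c"
  have sc: "smooth_on UNIV (c \<alpha>)" if "mi_abs \<alpha> = k" for \<alpha> using bs[of \<alpha>] that by (simp add: bsmooth_def)
  note pp = partial_principal_symbol[of k c, OF sc, folded p_def]
  have p0': "(\<Sum>\<alpha>\<in>{\<alpha>. mi_abs \<alpha> = k}. c \<alpha> (xpart w) * lmono (rcx (xipart w)) (mi_list \<alpha>)) = 0"
    using p0 by (simp add: principal_symbol_lmono)
  define I where "I = Im (\<Sum>j\<in>UNIV. partial (Inl j) p w * cnj (partial (Inr j) p w))"
  have "I = symp (\<chi> j. Re (partial j p w)) (\<chi> j. Im (partial j p w))"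
    by (simp add: I_def symp_def) (intro sum.cong refl, simp add: algebra_simps)
  with ne have I: "I \<noteq> 0" by (simp add: p_def)
  show False
  proof (cases "I > 0")
    case True
    show False
      by (rule hoermander_positive[OF bs U solv, where \<xi> = "xipart w" and px = "\<lambda>m. partial (Inl m) p w" and pxi = "\<lambda>j. partial (Inr j) p w"])
        (use p0' True in \<open>simp_all add: pp I_def\<close>)
  next
    case False
    define e where "e = (-1 :: complex) ^ k"
    have ee: "e * cnj e = 1" by (simp add: e_def flip: power_mult_distrib)
    have sc: "lmono (rcx (- \<xi>)) xs = (-1) ^ length xs * lmono (rcx \<xi>) xs" 
      "ldmono (rcx (- \<xi>)) j xs = - ((-1) ^ length xs * ldmono (rcx \<xi>) j xs)" for \<xi> :: "real^'n" and j xs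
      using lmono_scale[of "-1" "rcx \<xi>" "rcx (- \<xi>)" xs] by (simp_all add: rcx_def)
    have "(\<Sum>j\<in>UNIV. (e * partial (Inl j) p w) * cnj (- e * partial (Inr j) p w)) = - (e * cnj e) * (\<Sum>j\<in>UNIV. partial (Inl j) p w * cnj (partial (Inr j) p w))"
      by (simp add: sum_distrib_left sum_negf mult_ac)
    then have "Im (\<Sum>j\<in>UNIV. (e * partial (Inl j) p w) * cnj (- e * partial (Inr j) p w)) > 0"
      using False I by (simp add: ee I_def)
    moreover have "(\<Sum>\<alpha>\<in>{\<alpha>. mi_abs \<alpha> = k}. g \<alpha> * lmono (rcx (- xipart w)) (mi_list \<alpha>)) = e * (\<Sum>\<alpha>\<in>{\<alpha>. mi_abs \<alpha> = k}. g \<alpha> * lmono (rcx (xipart w)) (mi_list \<alpha>))"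
      "(\<Sum>\<alpha>\<in>{\<alpha>. mi_abs \<alpha> = k}. g \<alpha> * ldmono (rcx (- xipart w)) j (mi_list \<alpha>)) = - e * (\<Sum>\<alpha>\<in>{\<alpha>. mi_abs \<alpha> = k}. g \<alpha> * ldmono (rcx (xipart w)) j (mi_list \<alpha>))" for g j
      by (simp_all add: sc length_mi_list e_def sum_distrib_left sum_negf mult_ac)
    ultimately show False
      by (intro hoermander_positive[OF bs U solv, where \<xi> = "- xipart w" and px = "\<lambda>m. e * partial (Inl m) p w" and pxi = "\<lambda>j. - e * partial (Inr j) p w"])
        (use p0' in \<open>simp_all add: pp\<close>)
  qed
qed

subsection \<open>Localization\<close>

lemma test_fun_mono: "test_fun V \<phi> \<Longrightarrow> V \<subseteq> U \<Longrightarrow> test_fun U \<phi>"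
  by (auto simp: test_fun_def)

lemma test_fun_zero: "test_fun U \<phi> \<Longrightarrow> x \<notin> U \<Longrightarrow> \<phi> x = 0"
  using closure_subset[of "{x. \<phi> x \<noteq> 0}"] by (auto simp: test_fun_def tsupport_def)

lemma distribution_mono:
  assumes "distribution U u" "V \<subseteq> U"
  shows "distribution V u"
  unfolding distribution_def
proof (intro conjI allI impI)
  show "u (\<lambda>x. a * \<phi> x + b * \<psi> x) = a * u \<phi> + b * u \<psi>" if "test_fun V \<phi>" "test_fun V \<psi>" for \<phi> \<psi> a b
    using assms(1) that[THEN test_fun_mono, OF assms(2)] unfolding distribution_def by blast
next
  fix K assume "compact K \<and> K \<subseteq> V"
  then have "compact K \<and> K \<subseteq> U" using assms(2) by auto
  then obtain C N where "\<forall>\<phi>. test_fun U \<phi> \<and> tsupport \<phi> \<subseteq> K \<longrightarrow>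
           norm (u \<phi>) \<le> C * (\<Sum>\<alpha>\<in>{\<alpha>. mi_abs \<alpha> \<le> N}. Sup ((\<lambda>x. norm (dpart \<alpha> \<phi> x)) ` UNIV))"
    using assms(1) unfolding distribution_def by blast
  then show "\<exists>C N. \<forall>\<phi>. test_fun V \<phi> \<and> tsupport \<phi> \<subseteq> K \<longrightarrow>
           norm (u \<phi>) \<le> C * (\<Sum>\<alpha>\<in>{\<alpha>. mi_abs \<alpha> \<le> N}. Sup ((\<lambda>x. norm (dpart \<alpha> \<phi> x)) ` UNIV))"
    using test_fun_mono[OF _ assms(2)] by blast
qed

text \<open>Multiplying the coefficients by a cutoff makes them smooth on the whole space with
  bounded derivatives. Inside the smaller ball nothing changes, and test functions supported there
  do not see the difference, so the same distributions still solve the equation.\<close>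

lemma localize_coefficients:
  fixes c :: "('n::finite \<Rightarrow> nat) \<Rightarrow> real^'n \<Rightarrow> complex"
  assumes \<Omega>: "open \<Omega>" "\<And>\<alpha>. mi_abs \<alpha> \<le> k \<Longrightarrow> smooth_on \<Omega> (c \<alpha>)" and ls: "locally_solvable_at \<Omega> k c x0"
  shows "\<exists>c' r. r > 0 \<and> (\<forall>\<alpha>. mi_abs \<alpha> \<le> k \<longrightarrow> bsmooth (c' \<alpha>)) \<and> (\<forall>\<alpha>. \<forall>x\<in>ball x0 r. c' \<alpha> x = c \<alpha> x) \<and>
    (\<forall>f. test_fun (ball x0 r) f \<longrightarrow> (\<exists>u. distribution (ball x0 r) u \<and>
        (\<forall>\<phi>. test_fun (ball x0 r) \<phi> \<longrightarrow> u (transpose_op k c' \<phi>) = integral UNIV (\<lambda>x. f x * \<phi> x))))"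
proof -
  obtain U where U: "open U" "x0 \<in> U" "U \<subseteq> \<Omega>" "\<And>f. test_fun U f \<Longrightarrow> \<exists>u. distribution U u \<and>
              (\<forall>\<phi>. test_fun U \<phi> \<longrightarrow> u (transpose_op k c \<phi>) = integral UNIV (\<lambda>x. f x * \<phi> x))"
    using ls unfolding locally_solvable_at_def by blast
  obtain R where R: "R > 0" "cball x0 R \<subseteq> U" using U(1,2) open_contains_cball by blast
  define r where "r = R / 2"
  have r: "r > 0" "cball x0 (2 * r) \<subseteq> U" using R by (simp_all add: r_def)
  obtain \<kappa> :: "real^'n \<Rightarrow> complex" where k: "smooth_on UNIV \<kappa>" "\<And>x. norm (x - x0) \<le> r \<Longrightarrow> \<kappa> x = 1"
    "\<And>x. norm (x - x0) \<ge> 2 * r \<Longrightarrow> \<kappa> x = 0" using cutoff_exists[OF r(1), of x0] by blast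
  define c' where "c' \<alpha> x = \<kappa> x * c \<alpha> x" for \<alpha> x
  have sub: "ball x0 r \<subseteq> U" using r by auto
  have eq: "c' \<alpha> x = c \<alpha> x" if "x \<in> ball x0 r" for \<alpha> x using k(2)[of x] that by (simp add: c'_def dist_norm norm_minus_commute)
  have "bsmooth (c' \<alpha>)" if \<alpha>: "mi_abs \<alpha> \<le> k" for \<alpha>
  proof (rule bsmooth_compact_support)
    show "c' \<alpha> x = 0" if "norm (x - x0) \<ge> 2 * r" for x using k(3)[OF that] by (simp add: c'_def)
    have "smooth_on \<Omega> (c' \<alpha>)" unfolding c'_def
      by (rule smooth_on_mult[OF \<Omega>(1) smooth_on_subset[OF k(1)] \<Omega>(2)[OF \<alpha>]]) simp
    moreover have "smooth_on (- cball x0 (2 * r)) (c' \<alpha>)"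
      by (rule smooth_on_cong[OF _ _ smooth_on_const[of _ 0]])
        (use k(3) in \<open>auto simp: c'_def dist_norm norm_minus_commute open_Compl\<close>)
    ultimately have "smooth_on (\<Omega> \<union> - cball x0 (2 * r)) (c' \<alpha>)" by (intro smooth_on_Un \<Omega>(1)) (simp_all add: open_Compl)
    moreover have "\<Omega> \<union> - cball x0 (2 * r) = UNIV" using r(2) U(3) by auto
    ultimately show "smooth_on UNIV (c' \<alpha>)" by simp
  qed
  moreover have "\<exists>u. distribution (ball x0 r) u \<and>
        (\<forall>\<phi>. test_fun (ball x0 r) \<phi> \<longrightarrow> u (transpose_op k c' \<phi>) = integral UNIV (\<lambda>x. f x * \<phi> x))" if f: "test_fun (ball x0 r) f" for f
  proof -
    obtain u where u: "distribution U u" "\<And>\<phi>. test_fun U \<phi> \<Longrightarrow> u (transpose_op k c \<phi>) = integral UNIV (\<lambda>x. f x * \<phi> x)"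
      using U(4)[OF test_fun_mono[OF f sub]] by blast
    have "transpose_op k c' \<phi> = transpose_op k c \<phi>" if "test_fun (ball x0 r) \<phi>" for \<phi>
    proof -
      have "(\<lambda>y. c' \<alpha> y * \<phi> y) = (\<lambda>y. c \<alpha> y * \<phi> y)" for \<alpha>
      proof
        show "c' \<alpha> y * \<phi> y = c \<alpha> y * \<phi> y" for y
          using eq[of y \<alpha>] test_fun_zero[OF that, of y] by (cases "y \<in> ball x0 r") auto
      qed
      then show ?thesis unfolding transpose_op_def[abs_def] by presburger
    qed
    then show ?thesis using u distribution_mono[OF u(1) sub] test_fun_mono[OF _ sub] by (intro exI[of _ u]) simp
  qed
  ultimately show ?thesis using r(1) eq by (intro exI[of _ c'] exI[of _ r] conjI allI impI ballI) blast+
qed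

lemma principal_symbol_local:
  fixes c c' :: "('n::finite \<Rightarrow> nat) \<Rightarrow> real^'n \<Rightarrow> complex"
  assumes eq: "\<And>\<alpha> x. x \<in> ball x0 r \<Longrightarrow> c' \<alpha> x = c \<alpha> x" and z: "xpart z \<in> ball x0 r"
  shows "principal_symbol k c' z = principal_symbol k c z"
    "partial a (principal_symbol k c') z = partial a (principal_symbol k c) z"
    "hessian (principal_symbol k c') z = hessian (principal_symbol k c) z"
proof -
  define V where "V = {z :: real^('n + 'n). xpart z \<in> ball x0 r}"
  have V: "open V" "z \<in> V" unfolding V_def using z open_vimage[OF open_ball continuous_on_xpart[of UNIV], of x0 r] by (simp_all add: vimage_def)
  have e: "principal_symbol k c' y = principal_symbol k c y" if "y \<in> V" for y
    using that eq by (simp add: principal_symbol_def V_def)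
  have e1: "partial b (principal_symbol k c') y = partial b (principal_symbol k c) y" if "y \<in> V" for y b
    by (rule partial_cong(1)[OF V(1) that e])
  show "principal_symbol k c' z = principal_symbol k c z" "partial a (principal_symbol k c') z = partial a (principal_symbol k c) z"
    using e e1 V(2) by auto
  have "partial a (partial b (principal_symbol k c')) z = partial a (partial b (principal_symbol k c)) z" for a b
    by (rule partial_cong(1)[OF V e1])
  then show "hessian (principal_symbol k c') z = hessian (principal_symbol k c) z" by (simp add: hessian_def)
qed

lemma finite_ranks: "finite (rank ` (X :: (real^'m::finite^'m) set))"
proof (rule finite_subset)
  show "rank ` X \<subseteq> {.. CARD('m)}" using rank_bound by fastforce
qed simp

lemma nondis_non_dissipative:
  assumes "sym_mat A" "sym_mat B" "non_dissipative A B" and ind: "\<And>a b. a *\<^sub>R A + b *\<^sub>R B = 0 \<Longrightarrow> a = 0 \<and> b = 0"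
  shows "nondis A B"
  unfolding nondis_def
proof (intro conjI allI impI assms)
  fix s t assume "\<forall>z. s * bf A z z + t * bf B z z \<ge> 0"
  then have "psd (s *\<^sub>R A + t *\<^sub>R B)" using assms by (simp add: psd_def qform_def bf_mat sym_mat_add sym_mat_scaleR flip: bf_def)
  then have "s *\<^sub>R A + t *\<^sub>R B = 0" using assms(3) by (auto simp: non_dissipative_def pencil_def)
  then show "s = 0" "t = 0" using ind by blast+
qed

lemma bracket_nonvanishing:
  fixes A B C :: "real^('n::finite + 'n)^('n + 'n)"
  assumes s: "sym_mat A" "sym_mat B" "sym_mat C" and C: "\<And>z. qform C z = poisson (qform A) (qform B) z"
    and nd: "non_dissipative A B" and ind: "\<And>a b d::real. a *\<^sub>R A + b *\<^sub>R B + d *\<^sub>R C = 0 \<Longrightarrow> a = 0 \<and> b = 0 \<and> d = 0"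
    and rk: "(minrank A B \<ge> 3 \<and> maxrank A B \<ge> 17) \<or>
         (minrank A B = 2 \<and> maxrank A B \<ge> 9 \<and>
          ({z. A *v z = 0 \<and> B *v z = 0} = {0} \<or> symplectic_subspace {z. A *v z = 0 \<and> B *v z = 0}))"
  shows "\<exists>z. bf A z z = 0 \<and> bf B z z = 0 \<and> symp (A *v z) (B *v z) \<noteq> 0"
proof (rule ccontr)
  assume n: "\<not> ?thesis"
  have ind2: "a = 0 \<and> b = 0" if "a *\<^sub>R A + b *\<^sub>R B = 0" for a b using ind[of a b 0] that by simp
  have ND: "nondis A B" by (rule nondis_non_dissipative[OF s(1,2) nd ind2])
  have Cq: "bf C z z = 4 * symp (A *v z) (B *v z)" for z
    using C[of z] poisson_qform[OF s(1,2), of z] by (simp add: qform_def bf_def)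
  have C0: "bf C z z = 0" if "bf A z z = 0" "bf B z z = 0" for z using n that Cq by auto
  have "A \<in> pencil A B" "A \<noteq> 0" using ind2[of 1 0] by (auto simp: pencil_def intro: exI[of _ 1] exI[of _ 0])
  then have "maxrank A B \<in> rank ` pencil A B" "minrank A B \<in> rank ` (pencil A B - {0})"
    unfolding maxrank_def minrank_def by (intro Max_in Min_in finite_ranks; blast)+
  then obtain s0 t0 p q where mx: "maxrank A B = rank (s0 *\<^sub>R A + t0 *\<^sub>R B)" and mn: "minrank A B = rank (p *\<^sub>R A + q *\<^sub>R B)"
    unfolding pencil_def by auto
  have "\<exists>c d. C = c *\<^sub>R A + d *\<^sub>R B"
    using rk
  proof
    assume r: "minrank A B \<ge> 3 \<and> maxrank A B \<ge> 17"
    have "rank (s *\<^sub>R A + t *\<^sub>R B) \<ge> 3" if "\<not> (s = 0 \<and> t = 0)" for s t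
    proof -
      have "s *\<^sub>R A + t *\<^sub>R B \<in> pencil A B - {0}" using ind2[of s t] that by (auto simp: pencil_def)
      then have "minrank A B \<le> rank (s *\<^sub>R A + t *\<^sub>R B)" unfolding minrank_def by (intro Min_le finite_ranks imageI)
      then show ?thesis using r by simp
    qed
    then show ?thesis using vanishing_form_in_span[OF ND s(3) C0] r mx by metis
  next
    assume r: "minrank A B = 2 \<and> maxrank A B \<ge> 9 \<and>
          ({z. A *v z = 0 \<and> B *v z = 0} = {0} \<or> symplectic_subspace {z. A *v z = 0 \<and> B *v z = 0})"
    show ?thesis
      by (rule vanishing_bracket_in_span[OF ND s(3) Cq C0, of p q s0 t0]) (use r mx mn in auto)
  qed
  then obtain c d where "C = c *\<^sub>R A + d *\<^sub>R B" by blast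
  then have "c *\<^sub>R A + d *\<^sub>R B + (-1) *\<^sub>R C = 0" by simp
  from ind[OF this] show False by simp
qed

theorem theorem1p2:
  fixes \<Omega> :: "(real^'n::finite) set"
    and k :: nat
    and c :: "('n \<Rightarrow> nat) \<Rightarrow> real^'n \<Rightarrow> complex"
    and x0 \<xi>0 :: "real^'n"
    and A B C :: "real^('n + 'n)^('n + 'n)"
  assumes "open \<Omega>"
    and "\<forall>\<alpha>. mi_abs \<alpha> \<le> k \<longrightarrow> smooth_on \<Omega> (c \<alpha>)"
    and "x0 \<in> \<Omega>" and "\<xi>0 \<noteq> 0"
    and "\<forall>j. partial j (principal_symbol k c) (pairvec x0 \<xi>0) = 0"
    and "A = (\<chi> a b. Re (hessian (principal_symbol k c) (pairvec x0 \<xi>0) $ a $ b))"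
    and "B = (\<chi> a b. Im (hessian (principal_symbol k c) (pairvec x0 \<xi>0) $ a $ b))"
    and "sym_mat C" and "\<forall>z. qform C z = poisson (qform A) (qform B) z"
    and "non_dissipative A B"
    and "\<forall>a b d::real. a *\<^sub>R A + b *\<^sub>R B + d *\<^sub>R C = 0 \<longrightarrow> a = 0 \<and> b = 0 \<and> d = 0"
    and "(minrank A B \<ge> 3 \<and> maxrank A B \<ge> 17) \<or>
         (minrank A B = 2 \<and> maxrank A B \<ge> 9 \<and>
          ({z. A *v z = 0 \<and> B *v z = 0} = {0} \<or>
           symplectic_subspace {z. A *v z = 0 \<and> B *v z = 0}))"
  shows "\<not> locally_solvable_at \<Omega> k c x0"
proof
  assume ls: "locally_solvable_at \<Omega> k c x0"
  have "\<And>\<alpha>. mi_abs \<alpha> \<le> k \<Longrightarrow> smooth_on \<Omega> (c \<alpha>)" using assms(2) by blast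
  from localize_coefficients[OF assms(1) this ls] obtain c' r where r: "r > 0"
    and c': "(\<forall>\<alpha>. mi_abs \<alpha> \<le> k \<longrightarrow> bsmooth (c' \<alpha>)) \<and> (\<forall>\<alpha>. \<forall>x\<in>ball x0 r. c' \<alpha> x = c \<alpha> x) \<and>
      (\<forall>f. test_fun (ball x0 r) f \<longrightarrow> (\<exists>u. distribution (ball x0 r) u \<and>
        (\<forall>\<phi>. test_fun (ball x0 r) \<phi> \<longrightarrow> u (transpose_op k c' \<phi>) = integral UNIV (\<lambda>x. f x * \<phi> x))))" by blast
  note bs = c'[THEN conjunct1, rule_format] and eq = c'[THEN conjunct2, THEN conjunct1, rule_format]
    and solv = c'[THEN conjunct2, THEN conjunct2, rule_format]
  have sc: "smooth_on UNIV (c' \<alpha>)" if "mi_abs \<alpha> = k" for \<alpha> using bs[of \<alpha>] that by (simp add: bsmooth_def)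
  define p where "p = principal_symbol k c'"
  define z0 where "z0 = pairvec x0 \<xi>0"
  have sp: "smooth_on UNIV p" unfolding p_def by (rule smooth_on_principal_symbol[OF sc])
  have xz: "xpart z0 = x0" by (simp add: z0_def xpart_def pairvec_def vec_eq_iff)
  then have xzb: "xpart z0 \<in> ball x0 r" using r by simp
  note loc = principal_symbol_local[where c = c and c' = c' and k = k, OF eq xzb, folded p_def]
  have dp: "partial j p z0 = 0" for j using assms(5)[folded z0_def] loc(2)[of j] by simp
  have A: "A = (\<chi> a b. Re (hessian p z0 $ a $ b))" and B: "B = (\<chi> a b. Im (hessian p z0 $ a $ b))"
    using assms(6,7)[folded z0_def] loc(3) by simp_all
  note s = hessian_sym_mat[OF sp, of z0, folded A B]
  have "\<exists>z. bf A z z = 0 \<and> bf B z z = 0 \<and> symp (A *v z) (B *v z) \<noteq> 0"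
    by (rule bracket_nonvanishing[OF s assms(8)]) (use assms(9-12) in blast)+
  then obtain z where z: "bf A z z = 0" "bf B z z = 0" "symp (A *v z) (B *v z) \<noteq> 0" by blast
  \<comment> \<open>Euler's identity yields \<open>p z0 = 0\<close> only after division by
    \<open>k\<close>. For \<open>k = 0\<close> the symbol does not depend on \<open>\<xi>\<close>,
    the rows of the Hessian with a \<open>\<xi>\<close> index vanish, and the bracket at
    \<open>z\<close> would be 0.\<close>
  have k0: "k \<noteq> 0"
  proof
    assume "k = 0"
    then have "mi_list \<alpha> = []" if "mi_abs \<alpha> = k" for \<alpha> :: "'n \<Rightarrow> nat" using length_mi_list[of \<alpha>] that by simp
    then have "partial (Inr j) p = (\<lambda>z. 0)" for j
      unfolding p_def by (intro ext) (simp add: partial_principal_symbol(2)[of k c', OF sc])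
    then have "hessian p z0 $ Inr j $ b = 0" for j b
      using partial_partial_commute[OF sp, of "Inr j" b z0] by (simp add: hessian_def partial_const)
    then have "(A *v z) $ Inr j = 0" "(B *v z) $ Inr j = 0" for j by (simp_all add: A B matrix_vector_mult_def)
    then show False using z(3) by (simp add: symp_def)
  qed
  have p0: "p z0 = 0" using principal_symbol_euler[of k c' z0, OF sc] k0 dp by (simp flip: p_def)
  \<comment> \<open>A nonzero bracket makes \<open>A *v z\<close> and \<open>B *v z\<close>
    independent, since \<open>symp\<close> is alternating.\<close>
  have "regular A B z"
    unfolding regular_def
  proof (intro conjI z allI impI)
    fix s t assume e: "s *\<^sub>R (A *v z) + t *\<^sub>R (B *v z) = 0"
    have "symp (A *v z) (s *\<^sub>R (A *v z) + t *\<^sub>R (B *v z)) = t * symp (A *v z) (B *v z)"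
      "symp (s *\<^sub>R (A *v z) + t *\<^sub>R (B *v z)) (B *v z) = s * symp (A *v z) (B *v z)"
      by (simp_all only: symp_lin symp_lin2 symp_self mult_zero_right add_0_left add_0_right)
    then show "s = 0" "t = 0" using z(3) unfolding e by (simp_all add: symp_def)
  qed
  then obtain u1 u2 where u: "bf A z u1 = 1" "bf B z u1 = 0" "bf A z u2 = 0" "bf B z u2 = 1" using regular_dual[OF s] by blast
  obtain w where w: "norm (w - z0) < r" "p w = 0" "symp (\<chi> j. Re (partial j p w)) (\<chi> j. Im (partial j p w)) \<noteq> 0"
    using zero_near_double_zero[OF sp p0 dp, folded A B, OF z(1,2) u z(3) r] by blast
  have "norm (xpart w - x0) \<le> norm (w - z0)"
  proof -
    have "(norm (xpart w - x0))\<^sup>2 \<le> (norm (w - z0))\<^sup>2"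
      unfolding power2_norm_eq_inner xz[symmetric] by (simp add: inner_vec_def sum_Plus_UNIV xpart_def sum_nonneg)
    then show ?thesis by (rule power2_le_imp_le) simp
  qed
  then have "xpart w \<in> ball x0 r" using w(1) by (simp add: dist_norm norm_minus_commute)
  from hoermander[OF bs open_ball this solv, folded p_def, OF _ _ w(2,3)] show False .
qed

end
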